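(* There exists a deterministic black-box polynomial identity testing algorithm, for non-SG $\Sigma\Pi\Sigma\Pi(k,r)$ circuits of degree at most $d$ in variables $X_1,\dots,X_n$ over an algebraically closed field $\mathbb{F}$, whose time complexity is polynomial in $d\cdot\binom{k(n+1+r^k)}{kr^k}\cdot\binom{k-1+d}{k-1}$ (and in $\log p$, if $\mathrm{char}(\mathbb{F})=p>0$); this quantity is at most $\mathrm{poly}(d^k, n^{r^k}, r^{k^2r^k})$.
   Context: A $\Sigma\Pi\Sigma\Pi(k,r)$ circuit over $\mathbb{F}$ is an expression $C=\sum_{i=1}^{k'}F_i=\sum_{i=1}^{k'}\prod_{j=1}^{d_i}Q_{i,j}$ with $k'\le k$, $d_i\in\mathbb{N}^+$, $F_i=\prod_j Q_{i,j}$, and each $Q_{i,j}\in\mathbb{F}[X_1,\dots,X_n]$ of degree at most $r$; its degree is $\max_i\deg F_i$, and $C$ also denotes the polynomial it computes. $C$ is minimal if $\sum_{i\in I}F_i\ne0$ for every nonempty proper subset $I\subseteq[k']$; homogeneous if all $F_i$ are homogeneous of the same degree; simple if $\gcd(F_1,\dots,F_{k'})=1$. In general $C=\gcd(C)\cdot\mathrm{simple}(C)$ where $\gcd(C)=\gcd(F_1,\dots,F_{k'})$ and $\mathrm{simple}(C)$ is the $\Sigma\Pi\Sigma\Pi(k,r)$ circuit $\sum_i F_i/\gcd(C)$ (simple part). For a homogeneous polynomial $F$, $\mathcal{V}(F)$ denotes its zero set in projective space. A minimal, simple, homogeneous $\Sigma\Pi\Sigma\Pi(k,r)$ circuit $\sum_{i=1}^{k'}F_i$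 is non-SG if there is $i\in[k']$ with $\bigcap_{j\in[k']\setminus\{i\}}\mathcal{V}(F_j)\not\subseteq\mathcal{V}(F_i)$. A minimal simple $\Sigma\Pi\Sigma\Pi(k,r)$ circuit $C=\sum_i F_i$ of degree $d$ is non-SG if its homogenization $\widetilde C(X_1,\dots,X_{n+1})=\sum_i F_i(X_1/X_{n+1},\dots,X_n/X_{n+1})X_{n+1}^d=\sum_i\prod_j\widetilde Q_{i,j}$ (each $\widetilde Q_{i,j}$ the homogenization of $Q_{i,j}$ or $X_{n+1}$) is non-SG; a minimal circuit $C$ is non-SG if $\mathrm{simple}(C)$ is non-SG; and an arbitrary $\Sigma\Pi\Sigma\Pi(k,r)$ circuit is non-SG if it computes the same polynomial as some minimal non-SG $\Sigma\Pi\Sigma\Pi(k,r)$ circuit. A deterministic black-box PIT algorithm for a class of polynomials only accesses the input polynomial through evaluations at points of its choosing (equivalently, it uses a hitting set: a finite set of points such that every nonzero polynomial in the class is nonzero at some point of the set), and decides whether the polynomial is identically zero.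
   Formalization: The closing bound "at most poly(d^k, n^{r^k}, r^{k^2r^k})" is proved with the constants of poly allowed to depend on k, since uniformly in k it is false (n=d=r=1 gives k·binom(3k,k)); n, d, k, r are taken to be at least 1. *)

theory Defs
  imports
    "HOL-Algebra.Algebraic_Closure"
    "HOL-Library.FuncSet"
    "HOL-Library.Log_Nat"
begin

section \<open>Multivariate polynomials\<close>

text \<open>
  As in \<^theory>\<open>HOL-Algebra.Indexed_Polynomials\<close>, a polynomial is a coefficient function on
  monomials, and monomials are multisets of indices. The variables \<open>X\<^sub>1, \<dots>, X\<^sub>n\<close> have the indices
  \<open>0, \<dots>, n - 1\<close>. The library provides the carrier and the addition, but no product of two
  polynomials.

  Fields are ring records rather than instances of a type class: this allows the final statement
  to quantify over all algebraically closed fields (on subsets of a given type), of all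
  characteristics, inside the scope of the algorithm and of the constants in its running time.
\<close>

type_synonym 'a mpoly = "nat multiset \<Rightarrow> 'a"

definition mpoly_mult :: "('a, 'm) ring_scheme \<Rightarrow> 'a mpoly \<Rightarrow> 'a mpoly \<Rightarrow> 'a mpoly" where
  "mpoly_mult F P Q = (\<lambda>m. \<Oplus>\<^bsub>F\<^esub>a\<in>{a. a \<subseteq># m}. P a \<otimes>\<^bsub>F\<^esub> Q (m - a))"

definition mpoly_ring :: "('a, 'm) ring_scheme \<Rightarrow> nat \<Rightarrow> 'a mpoly ring" where
  "mpoly_ring F n =
    \<lparr> carrier = ring.indexed_pset F {..<n} (carrier F),
      monoid.mult = mpoly_mult F,
      one = ring.indexed_const F \<one>\<^bsub>F\<^esub>,
      zero = ring.indexed_const F \<zero>\<^bsub>F\<^esub>,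
      add = ring.indexed_padd F \<rparr>"

definition mpoly_support :: "('a, 'm) ring_scheme \<Rightarrow> 'a mpoly \<Rightarrow> nat multiset set" where
  "mpoly_support F P = {m. P m \<noteq> \<zero>\<^bsub>F\<^esub>}"

definition mpoly_eval :: "('a, 'm) ring_scheme \<Rightarrow> 'a mpoly \<Rightarrow> (nat \<Rightarrow> 'a) \<Rightarrow> 'a" where
  "mpoly_eval F P x =
    (\<Oplus>\<^bsub>F\<^esub>m\<in>mpoly_support F P. P m \<otimes>\<^bsub>F\<^esub> (\<Otimes>\<^bsub>F\<^esub>i\<in>set_mset m. x i [^]\<^bsub>F\<^esub> count m i))"

text \<open>Total degree, with the convention that the zero polynomial has degree \<open>0\<close>.\<close>

definition mpoly_degree :: "('a, 'm) ring_scheme \<Rightarrow> 'a mpoly \<Rightarrow> nat" where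
  "mpoly_degree F P = Max (insert 0 (size ` mpoly_support F P))"

definition homogeneous_of_degree :: "('a, 'm) ring_scheme \<Rightarrow> nat \<Rightarrow> 'a mpoly \<Rightarrow> bool" where
  "homogeneous_of_degree F e P \<longleftrightarrow> (\<forall>m\<in>mpoly_support F P. size m = e)"

text \<open>
  \<open>P(X\<^sub>1/X\<^sub>n\<^sub>+\<^sub>1, \<dots>, X\<^sub>n/X\<^sub>n\<^sub>+\<^sub>1) X\<^sub>n\<^sub>+\<^sub>1\<^sup>e\<close> for \<open>e = deg P\<close>; the new variable has index \<open>n\<close>. The monomials of
  degree \<open>e\<close> in \<open>n + 1\<close> variables correspond to the monomials of degree at most \<open>e\<close> in \<open>n\<close>
  variables by erasing the new variable.
\<close>

definition homogenize :: "('a, 'm) ring_scheme \<Rightarrow> nat \<Rightarrow> 'a mpoly \<Rightarrow> 'a mpoly" where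
  "homogenize F n P =
    (\<lambda>m. if size m = mpoly_degree F P then P (filter_mset (\<lambda>i. i \<noteq> n) m) else \<zero>\<^bsub>F\<^esub>)"

definition is_gcd :: "('b, 'm) monoid_scheme \<Rightarrow> 'b set \<Rightarrow> 'b \<Rightarrow> bool" where
  "is_gcd R A g \<longleftrightarrow> g \<in> carrier R \<and> (\<forall>a\<in>A. g divides\<^bsub>R\<^esub> a) \<and>
     (\<forall>h\<in>carrier R. (\<forall>a\<in>A. h divides\<^bsub>R\<^esub> a) \<longrightarrow> h divides\<^bsub>R\<^esub> g)"


section \<open>Projective zero sets\<close>

text \<open>
  \<open>proj_space F m\<close> is the projective space with \<open>m\<close> homogeneous coordinates (so of dimension
  \<open>m - 1\<close>); its points are the classes of nonzero vectors modulo nonzero scalars.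
\<close>

definition proj_point :: "('a, 'm) ring_scheme \<Rightarrow> nat \<Rightarrow> (nat \<Rightarrow> 'a) \<Rightarrow> (nat \<Rightarrow> 'a) set" where
  "proj_point F m x = {(\<lambda>i\<in>{..<m}. c \<otimes>\<^bsub>F\<^esub> x i) | c. c \<in> carrier F - {\<zero>\<^bsub>F\<^esub>}}"

definition proj_space :: "('a, 'm) ring_scheme \<Rightarrow> nat \<Rightarrow> (nat \<Rightarrow> 'a) set set" where
  "proj_space F m =
    proj_point F m ` {x \<in> {..<m} \<rightarrow>\<^sub>E carrier F. \<exists>i<m. x i \<noteq> \<zero>\<^bsub>F\<^esub>}"

definition proj_zeros :: "('a, 'm) ring_scheme \<Rightarrow> nat \<Rightarrow> 'a mpoly \<Rightarrow> (nat \<Rightarrow> 'a) set set" where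
  "proj_zeros F m P = {L \<in> proj_space F m. \<forall>x\<in>L. mpoly_eval F P x = \<zero>\<^bsub>F\<^esub>}"


section \<open>Depth-4 circuits\<close>

text \<open>The circuit \<open>C\<close> has the factor \<open>Q\<^sub>i\<^sub>,\<^sub>j = C ! i ! j\<close>, with \<open>i\<close> and \<open>j\<close> counted from \<open>0\<close>.\<close>

type_synonym 'a circuit = "'a mpoly list list"

definition sps_circuit ::
  "('a, 'm) ring_scheme \<Rightarrow> nat \<Rightarrow> nat \<Rightarrow> nat \<Rightarrow> 'a circuit \<Rightarrow> bool" where
  "sps_circuit F n k r C \<longleftrightarrow> length C \<le> k \<and>
     (\<forall>Qs\<in>set C. Qs \<noteq> [] \<and>
        (\<forall>Q\<in>set Qs. Q \<in> carrier (mpoly_ring F n) \<and> mpoly_degree F Q \<le> r))"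

definition summand :: "('a, 'm) ring_scheme \<Rightarrow> nat \<Rightarrow> 'a circuit \<Rightarrow> nat \<Rightarrow> 'a mpoly" where
  "summand F n C i = (\<Otimes>\<^bsub>mpoly_ring F n\<^esub>j\<in>{..<length (C ! i)}. C ! i ! j)"

definition circuit_poly :: "('a, 'm) ring_scheme \<Rightarrow> nat \<Rightarrow> 'a circuit \<Rightarrow> 'a mpoly" where
  "circuit_poly F n C = (\<Oplus>\<^bsub>mpoly_ring F n\<^esub>i\<in>{..<length C}. summand F n C i)"

definition circuit_degree :: "('a, 'm) ring_scheme \<Rightarrow> nat \<Rightarrow> 'a circuit \<Rightarrow> nat" where
  "circuit_degree F n C =
    Max (insert 0 ((\<lambda>i. mpoly_degree F (summand F n C i)) ` {..<length C}))"

definition minimal_circuit :: "('a, 'm) ring_scheme \<Rightarrow> nat \<Rightarrow> 'a circuit \<Rightarrow> bool" where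
  "minimal_circuit F n C \<longleftrightarrow>
     (\<forall>I. I \<noteq> {} \<and> I \<subset> {..<length C} \<longrightarrow>
        (\<Oplus>\<^bsub>mpoly_ring F n\<^esub>i\<in>I. summand F n C i) \<noteq> \<zero>\<^bsub>mpoly_ring F n\<^esub>)"

definition homogeneous_circuit :: "('a, 'm) ring_scheme \<Rightarrow> nat \<Rightarrow> 'a circuit \<Rightarrow> bool" where
  "homogeneous_circuit F n C \<longleftrightarrow>
     (\<exists>e. \<forall>i<length C. homogeneous_of_degree F e (summand F n C i))"

definition circuit_gcd :: "('a, 'm) ring_scheme \<Rightarrow> nat \<Rightarrow> 'a circuit \<Rightarrow> 'a mpoly \<Rightarrow> bool" where
  "circuit_gcd F n C g \<longleftrightarrow> is_gcd (mpoly_ring F n) (summand F n C ` {..<length C}) g"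

definition simple_circuit :: "('a, 'm) ring_scheme \<Rightarrow> nat \<Rightarrow> 'a circuit \<Rightarrow> bool" where
  "simple_circuit F n C \<longleftrightarrow> circuit_gcd F n C \<one>\<^bsub>mpoly_ring F n\<^esub>"

text \<open>
  \<open>S\<close> is a simple part of \<open>C\<close>: its summands are the \<open>F\<^sub>i / gcd(C)\<close>. They are determined up to a
  common constant. The gcd has to be nonzero for the quotients to make sense.
\<close>

definition simple_part ::
  "('a, 'm) ring_scheme \<Rightarrow> nat \<Rightarrow> nat \<Rightarrow> nat \<Rightarrow> 'a circuit \<Rightarrow> 'a circuit \<Rightarrow> bool" where
  "simple_part F n k r C S \<longleftrightarrow> sps_circuit F n k r S \<and> length S = length C \<and>
     (\<exists>g. circuit_gcd F n C g \<and> g \<noteq> \<zero>\<^bsub>mpoly_ring F n\<^esub> \<and>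
        (\<forall>i<length C. summand F n C i = g \<otimes>\<^bsub>mpoly_ring F n\<^esub> summand F n S i))"

text \<open>
  The homogenization of a circuit of degree \<open>d\<close>. The \<open>i\<close>-th summand
  \<open>F\<^sub>i(X\<^sub>1/X\<^sub>n\<^sub>+\<^sub>1, \<dots>, X\<^sub>n/X\<^sub>n\<^sub>+\<^sub>1) X\<^sub>n\<^sub>+\<^sub>1\<^sup>d\<close> is the product of the homogenizations of the factors
  and of \<open>d - deg F\<^sub>i\<close> copies of \<open>X\<^sub>n\<^sub>+\<^sub>1\<close>.
\<close>

definition homogenize_circuit :: "('a, 'm) ring_scheme \<Rightarrow> nat \<Rightarrow> 'a circuit \<Rightarrow> 'a circuit" where
  "homogenize_circuit F n C =
    map (\<lambda>i. map (homogenize F n) (C ! i) @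
             replicate (circuit_degree F n C - mpoly_degree F (summand F n C i))
                       (ring.indexed_var F n))
        [0..<length C]"

text \<open>
  The intersection is taken inside projective space: for a single summand it is the whole space.
\<close>

definition non_SG_homogeneous :: "('a, 'm) ring_scheme \<Rightarrow> nat \<Rightarrow> 'a circuit \<Rightarrow> bool" where
  "non_SG_homogeneous F n C \<longleftrightarrow>
     minimal_circuit F n C \<and> simple_circuit F n C \<and> homogeneous_circuit F n C \<and>
     (\<exists>i<length C.
        \<not> proj_space F n \<inter> (\<Inter>j\<in>{..<length C} - {i}. proj_zeros F n (summand F n C j))
            \<subseteq> proj_zeros F n (summand F n C i))"

definition non_SG_simple :: "('a, 'm) ring_scheme \<Rightarrow> nat \<Rightarrow> 'a circuit \<Rightarrow> bool" where
  "non_SG_simple F n C \<longleftrightarrow> minimal_circuit F n C \<and> simple_circuit F n C \<and>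
     non_SG_homogeneous F (n + 1) (homogenize_circuit F n C)"

definition non_SG_minimal ::
  "('a, 'm) ring_scheme \<Rightarrow> nat \<Rightarrow> nat \<Rightarrow> nat \<Rightarrow> 'a circuit \<Rightarrow> bool" where
  "non_SG_minimal F n k r C \<longleftrightarrow> sps_circuit F n k r C \<and> minimal_circuit F n C \<and>
     (\<exists>S. simple_part F n k r C S \<and> non_SG_simple F n S)"

definition non_SG ::
  "('a, 'm) ring_scheme \<Rightarrow> nat \<Rightarrow> nat \<Rightarrow> nat \<Rightarrow> 'a circuit \<Rightarrow> bool" where
  "non_SG F n k r C \<longleftrightarrow> sps_circuit F n k r C \<and>
     (\<exists>C'. non_SG_minimal F n k r C' \<and> circuit_poly F n C' = circuit_poly F n C)"


section \<open>Deterministic algorithms with a black box\<close>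

text \<open>
  The machine model is a structured random access machine whose memory cells hold integers,
  with logarithmic cost: a step costs the total bit length of the data it reads. Up to polynomial
  factors this is the running time of a deterministic Turing machine.

  A point of \<open>F\<^sup>n\<close> is written down as in exact computations with algebraic elements: by an integer
  polynomial \<open>h\<close> and integer polynomials \<open>g\<^sub>1, \<dots>, g\<^sub>n\<close>, denoting \<open>(g\<^sub>1(\<alpha>), \<dots>, g\<^sub>n(\<alpha>))\<close> for
  a root \<open>\<alpha>\<close> of \<open>h\<close> in \<open>F\<close>. The machine has no influence on which root is meant. For instance
  \<open>\<alpha> = 1/D\<close> for \<open>h = D t - 1\<close>, and in characteristic \<open>p\<close> an \<open>h\<close> irreducible modulo \<open>p\<close> describes the
  elements of the finite field \<open>\<int>[t]/(p, h)\<close>.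

  The value of the input polynomial at a point is an element of the field \<open>F\<close>, which need not have
  a finite description; the machine learns whether it is zero.

  \<open>Query i h l g\<close>: cells \<open>h\<close> and \<open>g\<close> hold the addresses of the modulus and of the
  coordinates, and cell \<open>l\<close> holds a length \<open>len\<close>. The modulus occupies \<open>len + 1\<close> consecutive cells,
  each coordinate \<open>len\<close> cells, and the coordinates follow one another. The answer goes to cell \<open>i\<close>.
\<close>

datatype prog =
    Const nat int
  | Add nat nat nat
  | Sub nat nat nat
  | Mul nat nat nat
  | Div nat nat nat
  | Load nat nat
  | Store nat nat
  | Query nat nat nat nat
  | Seq prog prog
  | Cond nat prog prog
  | While nat prog

type_synonym memory = "nat \<Rightarrow> int"

text \<open>Modulus and coordinates are coefficient lists; the black box tells whether the value is nonzero.\<close>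

type_synonym blackbox = "int list \<Rightarrow> int list list \<Rightarrow> bool"

definition bits :: "int \<Rightarrow> nat" where
  "bits z = 1 + floorlog 2 (nat \<bar>z\<bar>)"

definition block :: "memory \<Rightarrow> nat \<Rightarrow> nat \<Rightarrow> int list" where
  "block s a m = map (\<lambda>t. s (a + t)) [0..<m]"

definition query_modulus :: "memory \<Rightarrow> nat \<Rightarrow> nat \<Rightarrow> int list" where
  "query_modulus s h l = block s (nat (s h)) (nat (s l) + 1)"

definition query_coords :: "nat \<Rightarrow> memory \<Rightarrow> nat \<Rightarrow> nat \<Rightarrow> int list list" where
  "query_coords n s l g =
    map (\<lambda>v. block s (nat (s g) + v * nat (s l)) (nat (s l))) [0..<n]"

text \<open>
  \<open>exec q n c s t s'\<close>: started in memory \<open>s\<close>, with the black box \<open>q\<close> for a polynomial in \<open>n\<close> variables,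
  the program \<open>c\<close> stops with memory \<open>s'\<close> after time \<open>t\<close>.
\<close>

inductive exec :: "blackbox \<Rightarrow> nat \<Rightarrow> prog \<Rightarrow> memory \<Rightarrow> nat \<Rightarrow> memory \<Rightarrow> bool"
  for q :: blackbox and n :: nat where
  Const: "exec q n (Const i z) s (bits z) (s(i := z))"
| Add: "exec q n (Add i a b) s (bits (s a) + bits (s b)) (s(i := s a + s b))"
| Sub: "exec q n (Sub i a b) s (bits (s a) + bits (s b)) (s(i := s a - s b))"
| Mul: "exec q n (Mul i a b) s (bits (s a) + bits (s b)) (s(i := s a * s b))"
| Div: "exec q n (Div i a b) s (bits (s a) + bits (s b)) (s(i := s a div s b))"
| Load: "exec q n (Load i a) s
           (bits (s a) + bits (s (nat (s a)))) (s(i := s (nat (s a))))"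
| Store: "exec q n (Store a b) s (bits (s a) + bits (s b)) (s(nat (s a) := s b))"
| Query: "exec q n (Query i h l g) s
            (bits (s h) + bits (s l) + bits (s g) +
             sum_list (map bits (query_modulus s h l)) +
             sum_list (map bits (concat (query_coords n s l g))))
            (s(i := of_bool (q (query_modulus s h l) (query_coords n s l g))))"
| Seq: "exec q n c1 s t1 s1 \<Longrightarrow> exec q n c2 s1 t2 s2 \<Longrightarrow>
          exec q n (Seq c1 c2) s (t1 + t2) s2"
| CondTrue: "s i > 0 \<Longrightarrow> exec q n c1 s t s1 \<Longrightarrow>
               exec q n (Cond i c1 c2) s (bits (s i) + t) s1"
| CondFalse: "\<not> s i > 0 \<Longrightarrow> exec q n c2 s t s1 \<Longrightarrow>
                exec q n (Cond i c1 c2) s (bits (s i) + t) s1"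
| WhileTrue: "s i > 0 \<Longrightarrow> exec q n c s t1 s1 \<Longrightarrow> exec q n (While i c) s1 t2 s2 \<Longrightarrow>
                exec q n (While i c) s (bits (s i) + t1 + t2) s2"
| WhileFalse: "\<not> s i > 0 \<Longrightarrow> exec q n (While i c) s (bits (s i)) s"

text \<open>
  Evaluation of an integer polynomial in \<open>F\<close>, using the library's convention for univariate
  polynomials: coefficient lists start with the coefficient of the highest power.
\<close>

definition int_poly_eval :: "('a, 'm) ring_scheme \<Rightarrow> int list \<Rightarrow> 'a \<Rightarrow> 'a" where
  "int_poly_eval F h a = ring.eval F (map (\<lambda>z. [z] \<cdot>\<^bsub>F\<^esub> \<one>\<^bsub>F\<^esub>) h) a"

text \<open>
  A choice of the roots denoted by the moduli. A modulus without roots denotes some arbitrary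
  element of \<open>F\<close>.
\<close>

definition root_choice :: "('a, 'm) ring_scheme \<Rightarrow> (int list \<Rightarrow> 'a) \<Rightarrow> bool" where
  "root_choice F \<rho> \<longleftrightarrow> (\<forall>h. \<rho> h \<in> carrier F \<and>
     ((\<exists>a\<in>carrier F. int_poly_eval F h a = \<zero>\<^bsub>F\<^esub>) \<longrightarrow> int_poly_eval F h (\<rho> h) = \<zero>\<^bsub>F\<^esub>))"

definition black_box :: "('a, 'm) ring_scheme \<Rightarrow> (int list \<Rightarrow> 'a) \<Rightarrow> 'a mpoly \<Rightarrow> blackbox" where
  "black_box F \<rho> f h gs \<longleftrightarrow>
     mpoly_eval F f (\<lambda>i. int_poly_eval F (gs ! i) (\<rho> h)) \<noteq> \<zero>\<^bsub>F\<^esub>"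

definition field_char :: "('a, 'm) ring_scheme \<Rightarrow> nat" where
  "field_char F = Gcd {m::nat. [m] \<cdot>\<^bsub>F\<^esub> \<one>\<^bsub>F\<^esub> = \<zero>\<^bsub>F\<^esub>}"

definition initial_memory :: "nat \<Rightarrow> nat \<Rightarrow> nat \<Rightarrow> nat \<Rightarrow> nat \<Rightarrow> memory" where
  "initial_memory n d k r p =
    (\<lambda>_. 0)(0 := int n, 1 := int d, 2 := int k, 3 := int r, 4 := int p)"

text \<open>
  The program \<open>M\<close> performs polynomial identity testing with time bound \<open>T\<close> for the class \<open>\<C>\<close> of
  polynomials in \<open>n\<close> variables: whatever roots the moduli denote, it leaves \<open>0\<close> in cell \<open>0\<close> if the
  black box is the zero polynomial and a nonzero value if it is a nonzero polynomial of the class.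
  The zero polynomial is always an admissible input; otherwise testing would be trivial for a class
  such as that of the non-SG circuits, none of which computes zero.
\<close>

definition black_box_PIT ::
  "prog \<Rightarrow> ('a, 'm) ring_scheme \<Rightarrow> nat \<Rightarrow> nat \<Rightarrow> nat \<Rightarrow> nat \<Rightarrow> 'a mpoly set \<Rightarrow> nat \<Rightarrow> bool" where
  "black_box_PIT M F n d k r \<C> T \<longleftrightarrow>
     (\<forall>\<rho> f. root_choice F \<rho> \<and> f \<in> insert \<zero>\<^bsub>mpoly_ring F n\<^esub> \<C> \<longrightarrow>
        (\<exists>t s. exec (black_box F \<rho> f) n M (initial_memory n d k r (field_char F)) t s \<and>
               t \<le> T \<and> (s 0 = 0 \<longleftrightarrow> f = \<zero>\<^bsub>mpoly_ring F n\<^esub>)))"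

definition non_SG_polys ::
  "('a, 'm) ring_scheme \<Rightarrow> nat \<Rightarrow> nat \<Rightarrow> nat \<Rightarrow> nat \<Rightarrow> 'a mpoly set" where
  "non_SG_polys F n d k r =
    {circuit_poly F n C | C. non_SG F n k r C \<and> circuit_degree F n C \<le> d}"

definition PIT_bound :: "nat \<Rightarrow> nat \<Rightarrow> nat \<Rightarrow> nat \<Rightarrow> nat" where
  "PIT_bound n d k r =
    d * ((k * (n + 1 + r ^ k)) choose (k * r ^ k)) * ((k - 1 + d) choose (k - 1))"

end

(*
  Let C be a minimal simple non-SG circuit, homogenized: forms F_1, ..., F_k' and a point x at which all F_j
  but one, say F_1, vanish.  Each F_j with j > 1 has a factor Q_j vanishing at x, so modulo Q_2, ..., Q_k' the
  circuit is F_1, a product of forms of degree at most r not vanishing at x.  The components through x of the common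
  zeros of the Q_j have codimension at most k' - 1.  So a sufficiently general linear space of dimension k' - 1 meets
  them, and at points where F_1 does not vanish: the circuit is not zero on this space.

  To make "sufficiently general" effective for an arbitrary number m of forms Q_1, ..., Q_m of degree r in
  variables w, the m coordinates y_1, ..., y_m of the linear space are adjoined and the Q_i are perturbed to
  s y_i^r + Q_i over the field of Laurent series in s: a complete intersection with an explicit monomial basis over
  the polynomials in w.  The norm with respect to this basis replaces Chow forms.  One direction b_i is chosen after
  the other so that a form of degree at most r^(m+1), the limit of a norm for s -> 0, does not vanish at b_i; this
  keeps the limit of the ideal finite over the remaining variables.  That the limit has no embedded components
  (again by multiplicativity of the norm) then gives the contradiction at x.

  So every set of points that is not covered by a hypersurface of degree r^k supplies the points b_i.  The
  monomial curve t -> (t^(w_v)), w_v = (r^k + 1)^v mod q, is such a set as soon as q separates the monomials of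
  degree at most r^k, and some q polynomial in their number does: otherwise all small q would divide the product of the
  differences of the exponents, and lcm(1, ..., 2 L + 1) >= 4^L.  For the chosen q the circuit stays nonzero on the
  span of min(k - 1, n) + 1 points of the curve, a family in 2 min(k - 1, n) + 1 parameters, into which Kronecker's
  substitution puts powers of one element of large order.  Such an element is a root of t^(2 M) - t^M + 1,
  M = 6^e, in every characteristic.  The common factor of a circuit is handled by the curve itself, being a factor
  of a product of polynomials of degree at most r.
*)
theory Submission
  imports
    Defs
    "HOL-Library.Poly_Mapping"
    "HOL-Library.Multiset_Order"
    "HOL-Computational_Algebra.Formal_Laurent_Series"
    "Jordan_Normal_Form.Char_Poly"
    "HOL-Number_Theory.Number_Theory"
begin

section \<open>Polynomials in countably many variables\<close>

text \<open>The obstacle is that the common zeros of the Q_i can have components of any dimension,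
  so no count of equations controls them. The fresh y_i remove it: with s y_i^r + Q_i the quotient
  is free of rank r^m over the polynomials in w for every choice of the Q_i, and determinants of
  multiplication matrices replace dimension theory. What can fail is the limit s -> 0, where
  finiteness over the polynomials in w may be lost; shearing w along b_i when y_i is adjoined
  restores it, and then norms of elements without poles have no poles. The limit ideal still
  vanishes at x, because x with y = 0 is a zero of all perturbed forms for all s. If the circuit
  vanished on the linear space, Cayley-Hamilton would give a nonzero \<alpha> in w alone with
  \<alpha> F_1^a in the limit ideal; by the absence of embedded components a power of F_1 would lie
  in it, although F_1 is not 0 at x. Each factor of F_1 yields its own polynomial that the base
  point of the space avoids, so the degree r^(m+1) does not grow with the number of factors. At most
  n + 1 points are needed, since n linear forms already single out x.\<close>

type_synonym 'k mp = "nat multiset \<Rightarrow>\<^sub>0 'k"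

abbreviation lookup :: "('a \<Rightarrow>\<^sub>0 'b::zero) \<Rightarrow> 'a \<Rightarrow> 'b" where "lookup \<equiv> Poly_Mapping.lookup"
abbreviation keys :: "('a \<Rightarrow>\<^sub>0 'b::zero) \<Rightarrow> 'a set" where "keys \<equiv> Poly_Mapping.keys"

text \<open>Monomials are multisets of variables, as in the definition of circuits.\<close>

abbreviation mvar :: "nat \<Rightarrow> 'k::comm_ring_1 mp" where
  "mvar v \<equiv> Poly_Mapping.single {#v#} 1"

abbreviation mcst :: "'k::comm_ring_1 \<Rightarrow> 'k mp" where
  "mcst \<equiv> Poly_Mapping.single {#}"

abbreviation mmon :: "nat multiset \<Rightarrow> 'k::comm_ring_1 mp" where
  "mmon m \<equiv> Poly_Mapping.single m 1"

definition mvars :: "'k::comm_ring_1 mp \<Rightarrow> nat set" where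
  "mvars p = (\<Union>m\<in>Poly_Mapping.keys p. set_mset m)"

lemma mcst_hom: "comm_ring_hom (mcst :: 'k::comm_ring_1 \<Rightarrow> 'k mp)"
  by unfold_locales (auto simp: single_add mult_single)

lemma mp_sum_monomials: "p = (\<Sum>m\<in>keys p. Poly_Mapping.single m (lookup p m))"
  by (rule poly_mapping_eqI)
     (auto simp: lookup_sum lookup_single when_def sum.delta in_keys_iff)

lemma mp_induct [case_names zero single add]:
  assumes "P 0" "\<And>m c. c \<noteq> 0 \<Longrightarrow> P (Poly_Mapping.single m c)" "\<And>p q. P p \<Longrightarrow> P q \<Longrightarrow> P (p + q)"
  shows "P (p :: 'k::comm_ring_1 mp)"
proof -
  have "P (\<Sum>m\<in>S. Poly_Mapping.single m (lookup p m))" if "finite S" "S \<subseteq> keys p" for S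
    using that by (induction S rule: finite_induct) (auto intro!: assms simp: in_keys_iff)
  from this[of "keys p"] show ?thesis using mp_sum_monomials[of p] by simp
qed

lemma mmon_add: "mmon (a + b) = (mmon a * mmon b :: 'k::comm_ring_1 mp)"
  by (simp add: mult_single)

lemma mmon_prod: "mmon m = (prod_mset (image_mset mvar m) :: 'k::comm_ring_1 mp)"
proof (induction m)
  case empty
  show ?case by (simp flip: single_one)
next
  case (add x m)
  have "mmon (add_mset x m) = (mmon {#x#} * mmon m :: 'k mp)" by (simp add: mult_single)
  then show ?case using add by simp
qed

lemma single_eq_cst_mult: "Poly_Mapping.single m c = mcst c * mmon m"
  by (simp add: mult_single)

lemma mvar_power: "mvar v ^ n = (mmon (replicate_mset n v) :: 'k::comm_ring_1 mp)"
  by (induction n) (auto simp: mult_single simp flip: single_one)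

lemma lookup_mcst_mult: "lookup (mcst c * p) m = c * lookup (p :: 'k::comm_ring_1 mp) m"
proof (induction p rule: mp_induct)
  case (add p q)
  then show ?case by (simp add: distrib_left lookup_add)
qed (auto simp: mult_single lookup_single when_def)

subsection \<open>Substitution\<close>

text \<open>One operator with a coefficient map \<open>h\<close> and an assignment \<open>x\<close>:
  substitution (\<open>msub\<close>), evaluation (\<open>meval\<close>), change of coefficients
  (\<open>mapc\<close>) and Kronecker's substitution (\<open>kr\<close>) are instances, so their
  composition laws come from \<open>hom_mev\<close>.\<close>

definition mev :: "('k::comm_ring_1 \<Rightarrow> 'b::comm_ring_1) \<Rightarrow> (nat \<Rightarrow> 'b) \<Rightarrow> 'k mp \<Rightarrow> 'b" where
  "mev h x p = (\<Sum>m\<in>keys p. h (lookup p m) * prod_mset (image_mset x m))"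

context
  fixes h :: "'k::comm_ring_1 \<Rightarrow> 'b::comm_ring_1"
  assumes h: "comm_ring_hom h"
begin

interpretation h: comm_ring_hom h by (rule h)

lemma mev_superset:
  assumes "finite S" "keys p \<subseteq> S"
  shows "mev h x p = (\<Sum>m\<in>S. h (lookup p m) * prod_mset (image_mset x m))"
  unfolding mev_def by (rule sum.mono_neutral_left) (use assms in \<open>auto simp: in_keys_iff\<close>)

lemma mev_single: "mev h x (Poly_Mapping.single m c) = h c * prod_mset (image_mset x m)"
  by (cases "c = 0") (auto simp: mev_def)

lemma mev_var [simp]: "mev h x (mvar v) = x v"
  by (simp add: mev_single)

lemma mev_cst [simp]: "mev h x (mcst c) = h c"
  by (simp add: mev_single)

lemma mev_add: "mev h x (p + q) = mev h x p + mev h x q"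
proof -
  let ?S = "keys p \<union> keys q"
  have "keys (p + q) \<subseteq> ?S" by (rule keys_add)
  then show ?thesis
    by (simp add: mev_superset[of ?S] lookup_add h.hom_add distrib_right sum.distrib)
qed

lemma mev_mult_single:
  "mev h x (Poly_Mapping.single m c * q) = mev h x (Poly_Mapping.single m c) * mev h x q"
proof (induction q rule: mp_induct)
  case zero
  then show ?case by (simp add: mev_def)
next
  case (single m' c')
  then show ?case by (simp add: mult_single mev_single h.hom_mult ac_simps)
next
  case (add p q)
  then show ?case by (simp add: distrib_left mev_add)
qed

lemma mev_mult: "mev h x (p * q) = mev h x p * mev h x q"
proof (induction p rule: mp_induct)
  case zero
  then show ?case by (simp add: mev_def)
next
  case (single m c)
  show ?case by (rule mev_mult_single)
next
  case (add p1 p2)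
  then show ?case by (simp add: distrib_right mev_add)
qed

lemma mev_hom: "comm_ring_hom (mev h x)"
proof
  show "mev h x 1 = 1" using mev_single[of x "{#}" 1] by simp
qed (simp_all add: mev_add mev_mult, simp add: mev_def)

end

lemma comm_ring_hom_compose: "comm_ring_hom f \<Longrightarrow> comm_ring_hom g \<Longrightarrow> comm_ring_hom (\<lambda>x. f (g x))"
proof -
  assume a: "comm_ring_hom f" "comm_ring_hom g"
  interpret f: comm_ring_hom f by fact
  interpret g: comm_ring_hom g by fact
  show ?thesis by unfold_locales (auto simp: f.hom_add f.hom_mult g.hom_add g.hom_mult)
qed

lemma hom_eq_mev:
  fixes \<phi> :: "'k::comm_ring_1 mp \<Rightarrow> 'b::comm_ring_1"
  assumes "comm_ring_hom \<phi>"
  shows "\<phi> p = mev (\<lambda>c. \<phi> (mcst c)) (\<lambda>v. \<phi> (mvar v)) p"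
proof -
  interpret comm_ring_hom \<phi> by fact
  have h: "comm_ring_hom (\<lambda>c. \<phi> (mcst c))"
    by (rule comm_ring_hom_compose[OF assms mcst_hom])
  show ?thesis
  proof (induction p rule: mp_induct)
    case (single m c)
    have "\<phi> (mmon m) = prod_mset (image_mset (\<lambda>v. \<phi> (mvar v)) m)"
      by (subst mmon_prod, induction m) (auto simp: hom_mult)
    then show ?case using mev_single[OF h, of _ m c] hom_mult[of "mcst c" "mmon m"] by (simp add: mult_single)
  qed (auto simp: hom_add mev_add[OF h], simp add: mev_def)
qed

text \<open>Both homomorphisms are evaluations by \<open>hom_eq_mev\<close>. Identities between
  composed substitutions are proved with this rule, one variable at a time; only the variables of
  \<open>p\<close> matter, so fresh variables never interfere.\<close>

lemma hom_ext_mp: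
  fixes \<phi> \<psi> :: "'k::comm_ring_1 mp \<Rightarrow> 'b::comm_ring_1"
  assumes "comm_ring_hom \<phi>" "comm_ring_hom \<psi>" "\<And>c. \<phi> (mcst c) = \<psi> (mcst c)"
    "\<And>v. v \<in> mvars p \<Longrightarrow> \<phi> (mvar v) = \<psi> (mvar v)"
  shows "\<phi> p = \<psi> p"
proof -
  have *: "image_mset (\<lambda>v. \<phi> (mvar v)) m = image_mset (\<lambda>v. \<psi> (mvar v)) m" if "m \<in> keys p" for m
    by (rule image_mset_cong) (use that assms(4) in \<open>auto simp: mvars_def\<close>)
  show ?thesis
    unfolding hom_eq_mev[OF assms(1), of p] hom_eq_mev[OF assms(2), of p] mev_def
    by (rule sum.cong) (use * assms(3) in auto)
qed

lemma comm_ring_hom_id: "comm_ring_hom (\<lambda>x. x)"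
  by unfold_locales auto

abbreviation msub :: "(nat \<Rightarrow> 'k::comm_ring_1 mp) \<Rightarrow> 'k mp \<Rightarrow> 'k mp" where
  "msub \<equiv> mev mcst"

abbreviation meval :: "(nat \<Rightarrow> 'k::comm_ring_1) \<Rightarrow> 'k mp \<Rightarrow> 'k" where
  "meval \<equiv> mev (\<lambda>c. c)"

lemmas msub_hom = mev_hom[OF mcst_hom]
lemmas meval_hom = mev_hom[OF comm_ring_hom_id]

definition mapc :: "('k::comm_ring_1 \<Rightarrow> 'b::comm_ring_1) \<Rightarrow> 'k mp \<Rightarrow> 'b mp" where
  "mapc h = mev (\<lambda>c. mcst (h c)) mvar"

lemma mcst_comp_hom: "comm_ring_hom h \<Longrightarrow> comm_ring_hom (\<lambda>c. mcst (h c))"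
  using comm_ring_hom_compose[OF mcst_hom] by blast

lemma mapc_hom: "comm_ring_hom h \<Longrightarrow> comm_ring_hom (mapc h)"
  unfolding mapc_def by (intro mev_hom mcst_comp_hom)

lemma mapc_single:
  assumes "comm_ring_hom h"
  shows "mapc h (Poly_Mapping.single m c) = Poly_Mapping.single m (h c)"
  unfolding mapc_def
  by (simp only: mev_single[OF mcst_comp_hom[OF assms]] mmon_prod[symmetric] single_eq_cst_mult[symmetric])

lemma mapc_var [simp]: "comm_ring_hom h \<Longrightarrow> mapc h (mvar v) = mvar v"
  unfolding mapc_def by (intro mev_var mcst_comp_hom)

lemma mapc_cst [simp]: "comm_ring_hom h \<Longrightarrow> mapc h (mcst c) = mcst (h c)"
  unfolding mapc_def by (intro mev_cst mcst_comp_hom)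

lemma lookup_mapc:
  assumes h: "comm_ring_hom h"
  shows "lookup (mapc h p) m = h (lookup p m)"
proof -
  interpret h: comm_ring_hom h by fact
  interpret m: comm_ring_hom "mapc h" by (rule mapc_hom[OF h])
  show ?thesis
    by (induction p rule: mp_induct)
       (auto simp: m.hom_add h.hom_add mapc_single[OF h] lookup_add lookup_single when_def)
qed

lemma keys_mapc: "comm_ring_hom h \<Longrightarrow> keys (mapc h p) \<subseteq> keys p"
  by (auto simp: in_keys_iff lookup_mapc comm_ring_hom_def ring_hom_def semiring_hom_def
      comm_monoid_add_hom_def monoid_add_hom_def zero_hom.hom_zero)

lemma hom_mev:
  assumes h: "comm_ring_hom h" and g: "comm_ring_hom g"
  shows "h (mev g x p) = mev (\<lambda>c. h (g c)) (\<lambda>v. h (x v)) p"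
proof -
  have hg: "comm_ring_hom (\<lambda>c. h (g c))" by (rule comm_ring_hom_compose[OF h g])
  show ?thesis
    by (rule hom_ext_mp[OF comm_ring_hom_compose[OF h mev_hom[OF g]] mev_hom[OF hg]])
       (simp_all add: mev_cst[OF g] mev_var[OF g] mev_cst[OF hg] mev_var[OF hg])
qed

lemma mapc_mev:
  assumes "comm_ring_hom h" "comm_ring_hom g"
  shows "mapc h (mev g x p) = mev (\<lambda>c. mapc h (g c)) (\<lambda>v. mapc h (x v)) p"
  by (rule hom_mev[OF mapc_hom[OF assms(1)] assms(2)])

lemma mev_mapc:
  assumes "comm_ring_hom h" "comm_ring_hom g"
  shows "mev g x (mapc h p) = mev (\<lambda>c. g (h c)) x p"
  unfolding mapc_def
  by (simp add: hom_mev[OF mev_hom[OF assms(2)] mcst_comp_hom[OF assms(1)]] mev_cst[OF assms(2)]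
      mev_var[OF assms(2)])

lemma mev_cong: "(\<And>v. v \<in> mvars p \<Longrightarrow> x v = y v) \<Longrightarrow> mev h x p = mev h y p"
  unfolding mev_def
  by (intro sum.cong refl arg_cong2[where f = "(*)"] arg_cong[where f = prod_mset] image_mset_cong)
     (auto simp: mvars_def)

subsection \<open>Variables and weighted degrees\<close>

lemma keys_mp_uminus: "keys (- p) = keys (p :: 'k::comm_ring_1 mp)"
  by (auto simp: in_keys_iff)

lemma mvars_simps [simp]:
  "mvars (0 :: 'k::comm_ring_1 mp) = {}" "mvars (1 :: 'k::comm_ring_1 mp) = {}"
  "mvars (mcst c) = {}" "mvars (- p) = mvars (p :: 'k::comm_ring_1 mp)"
  by (auto simp: mvars_def keys_mp_uminus)

lemma mvars_single: "mvars (Poly_Mapping.single m c) \<subseteq> set_mset m"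
  by (auto simp: mvars_def split: if_splits)

lemma mvars_add: "mvars (p + q) \<subseteq> mvars p \<union> mvars q"
  using keys_add[of p q] by (auto simp: mvars_def)

lemma mvars_diff: "mvars (p - q) \<subseteq> mvars p \<union> mvars q"
  using keys_diff[of p q] by (auto simp: mvars_def)

lemma mvars_mult: "mvars (p * q) \<subseteq> mvars p \<union> mvars q"
  using keys_mult[of p q] by (fastforce simp: mvars_def)

lemma finite_mvars [simp]: "finite (mvars p)"
  by (auto simp: mvars_def)

lemma mvars_sum: "(\<And>i. i \<in> A \<Longrightarrow> mvars (f i) \<subseteq> V) \<Longrightarrow> mvars (sum f A) \<subseteq> V"
  by (induction A rule: infinite_finite_induct) (use mvars_add in \<open>auto, blast\<close>)

lemma mvars_prod: "(\<And>i. i \<in> A \<Longrightarrow> mvars (f i) \<subseteq> V) \<Longrightarrow> mvars (prod f A) \<subseteq> V"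
  by (induction A rule: infinite_finite_induct) (use mvars_mult in \<open>auto, blast\<close>)

lemma mvars_prod_list: "(\<And>p. p \<in> set ps \<Longrightarrow> mvars p \<subseteq> V) \<Longrightarrow> mvars (prod_list ps) \<subseteq> V"
  by (induction ps) (use mvars_mult in \<open>auto, blast\<close>)

lemma mvars_power: "mvars (p ^ n) \<subseteq> mvars p"
  by (induction n) (simp, use mvars_mult in fastforce)

lemma mvars_prod_mset: "(\<And>i. i \<in># A \<Longrightarrow> mvars (f i) \<subseteq> V) \<Longrightarrow> mvars (prod_mset (image_mset f A)) \<subseteq> V"
  by (induction A) (use mvars_mult in \<open>auto, blast\<close>)

lemma mvars_mev:
  assumes "\<And>c. mvars (h c) \<subseteq> V" "\<And>v. v \<in> mvars p \<Longrightarrow> mvars (x v) \<subseteq> V"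
  shows "mvars (mev h x p) \<subseteq> V"
  unfolding mev_def
proof (rule mvars_sum)
  fix m assume m: "m \<in> keys p"
  have "mvars (prod_mset (image_mset x m)) \<subseteq> V"
    by (rule mvars_prod_mset, rule assms(2)) (use m in \<open>auto simp: mvars_def\<close>)
  then show "mvars (h (lookup p m) * prod_mset (image_mset x m)) \<subseteq> V"
    using mvars_mult assms(1) by blast
qed

lemma mvars_mapc: "comm_ring_hom h \<Longrightarrow> mvars (mapc h p) \<subseteq> mvars p"
  using keys_mapc[of h p] by (auto simp: mvars_def)

definition wdeg :: "(nat \<Rightarrow> nat) \<Rightarrow> nat multiset \<Rightarrow> nat" where
  "wdeg w m = sum_mset (image_mset w m)"

lemma wdeg_add [simp]: "wdeg w (a + b) = wdeg w a + wdeg w b"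
  by (simp add: wdeg_def)

lemma wdeg_simps [simp]: "wdeg w {#} = 0" "wdeg w (add_mset v m) = w v + wdeg w m"
  "wdeg w (replicate_mset n v) = n * w v"
  by (auto simp: wdeg_def)

lemma wdeg_one: "wdeg (\<lambda>_. 1) m = size m"
  by (simp add: wdeg_def)

text \<open>Weights other than 1 serve two purposes: an auxiliary variable that stands for a form of
  degree \<open>r\<close> gets weight \<open>r\<close>, and the indicator weight of a variable reads
  off its exponent.\<close>

definition whom :: "(nat \<Rightarrow> nat) \<Rightarrow> nat \<Rightarrow> 'k::comm_ring_1 mp \<Rightarrow> bool" where
  "whom w d p \<longleftrightarrow> (\<forall>m\<in>keys p. wdeg w m = d)"

lemma whom_zero [simp]: "whom w d 0"
  by (simp add: whom_def)

lemma whom_single: "whom w (wdeg w m) (Poly_Mapping.single m c)"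
  by (simp add: whom_def)

lemma whom_one: "whom w 0 1"
  by (metis single_one wdeg_simps(1) whom_single)

lemma whom_cst [simp]: "whom w 0 (mcst c)"
  by (metis wdeg_simps(1) whom_single)

lemma whom_var: "whom w (w v) (mvar v)"
  by (simp add: whom_def)

lemma whom_add: "whom w d p \<Longrightarrow> whom w d q \<Longrightarrow> whom w d (p + q)"
  using keys_add[of p q] by (auto simp: whom_def)

lemma whom_uminus: "whom w d p \<Longrightarrow> whom w d (- p)"
  by (auto simp: whom_def keys_mp_uminus)

lemma whom_diff: "whom w d p \<Longrightarrow> whom w d q \<Longrightarrow> whom w d (p - q)"
  using keys_diff[of p q] by (auto simp: whom_def)

lemma whom_mult: "whom w d p \<Longrightarrow> whom w e q \<Longrightarrow> whom w (d + e) (p * q)"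
  using keys_mult[of p q] by (fastforce simp: whom_def)

lemma whom_sum: "(\<And>i. i \<in> A \<Longrightarrow> whom w d (f i)) \<Longrightarrow> whom w d (sum f A)"
  by (induction A rule: infinite_finite_induct) (auto intro: whom_add)

lemma whom_prod: "(\<And>i. i \<in> A \<Longrightarrow> whom w (d i) (f i)) \<Longrightarrow> whom w (sum d A) (prod f A)"
  by (induction A rule: infinite_finite_induct) (auto intro: whom_mult whom_one)

lemma whom_power: "whom w d p \<Longrightarrow> whom w (n * d) (p ^ n)"
  by (induction n) (auto intro: whom_mult whom_one)

lemma whom_prod_mset:
  "(\<And>i. i \<in># A \<Longrightarrow> whom w (d i) (f i)) \<Longrightarrow> whom w (sum_mset (image_mset d A)) (prod_mset (image_mset f A))"
  by (induction A) (auto intro: whom_mult whom_one)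

lemma whom_mev:
  assumes "whom w d p" "\<And>c. whom w' 0 (h c)" "\<And>v. v \<in> mvars p \<Longrightarrow> whom w' (w v) (x v)"
  shows "whom w' d (mev h x p)"
  unfolding mev_def
proof (rule whom_sum)
  fix m assume m: "m \<in> keys p"
  have "whom w' (wdeg w m) (prod_mset (image_mset x m))"
    unfolding wdeg_def by (rule whom_prod_mset, rule assms(3)) (use m in \<open>auto simp: mvars_def\<close>)
  then show "whom w' d (h (lookup p m) * prod_mset (image_mset x m))"
    using whom_mult[OF assms(2)[of "lookup p m"], of "wdeg w m"] assms(1) m by (simp add: whom_def)
qed

lemma whom_mapc: "comm_ring_hom h \<Longrightarrow> whom w d p \<Longrightarrow> whom w d (mapc h p)"
  using keys_mapc[of h p] by (auto simp: whom_def)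

lemma whom_weights_cong:
  assumes "whom w d p" "\<And>v. v \<in> mvars p \<Longrightarrow> w v = w' v"
  shows "whom w' d p"
proof -
  have "wdeg w' m = wdeg w m" if "m \<in> keys p" for m
    unfolding wdeg_def using that
    by (intro arg_cong[where f = sum_mset] image_mset_cong assms(2)[symmetric]) (auto simp: mvars_def)
  with assms(1) show ?thesis by (auto simp: whom_def)
qed

section \<open>A free basis for a perturbed complete intersection\<close>

text \<open>The determinant of \<open>A\<close> is sent to 1 by \<epsilon>, so its image under
  \<theta> is not 0, and the adjugate divided by that image is a two-sided inverse. Below,
  \<epsilon> puts T = 0 and \<theta> puts T = s^-1.\<close>

lemma square_system:
  fixes A :: "'i \<Rightarrow> 'i \<Rightarrow> 'a::comm_ring_1" and \<theta> :: "'a \<Rightarrow> 'e::field" and \<epsilon> :: "'a \<Rightarrow> 'b::comm_ring_1"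
  assumes T: "finite T" and \<epsilon>: "comm_ring_hom \<epsilon>" and \<theta>: "comm_ring_hom \<theta>"
    and id: "\<And>\<mu> \<nu>. \<mu> \<in> T \<Longrightarrow> \<nu> \<in> T \<Longrightarrow> \<epsilon> (A \<mu> \<nu>) = (if \<mu> = \<nu> then 1 else 0)"
    and nz: "\<And>x. \<epsilon> x = 1 \<Longrightarrow> \<theta> x \<noteq> 0"
  shows "\<exists>c. \<forall>\<nu>\<in>T. (\<Sum>\<mu>\<in>T. c \<mu> * \<theta> (A \<mu> \<nu>)) = b \<nu>"
    and "(\<forall>\<nu>\<in>T. (\<Sum>\<mu>\<in>T. c \<mu> * \<theta> (A \<mu> \<nu>)) = 0) \<Longrightarrow> \<forall>\<mu>\<in>T. c \<mu> = 0"
proof -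
  obtain f where f: "bij_betw f {0..<card T} T"
    using ex_bij_betw_nat_finite[OF T] by blast
  define N where "N = card T"
  define M where "M = mat N N (\<lambda>(i, j). A (f i) (f j))"
  define B where "B = map_mat \<theta> M"
  have M: "M \<in> carrier_mat N N" and B: "B \<in> carrier_mat N N" by (auto simp: M_def B_def)
  have fT: "f i \<in> T" if "i < N" for i using f that by (auto simp: bij_betw_def N_def)
  have inj: "i < N \<Longrightarrow> j < N \<Longrightarrow> f i = f j \<longleftrightarrow> i = j" for i j
    using f by (auto simp: bij_betw_def inj_on_def N_def)
  have "map_mat \<epsilon> M = 1\<^sub>m N"
    by (rule eq_matI) (auto simp: M_def id fT inj)
  then have "\<epsilon> (det M) = 1"
    using comm_ring_hom.hom_det[OF \<epsilon>, of M] by simp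
  then have "det B \<noteq> 0"
    using nz comm_ring_hom.hom_det[OF \<theta>, of M] by (simp add: B_def)
  define d where "d = det B"
  define I where "I = inverse d \<cdot>\<^sub>m adj_mat B"
  have "d \<noteq> 0" by (simp add: d_def \<open>det B \<noteq> 0\<close>)
  have I: "I \<in> carrier_mat N N" using adj_mat(1)[OF B] by (simp add: I_def)
  have BI: "B * I = 1\<^sub>m N"
  proof -
    have "B * I = inverse d \<cdot>\<^sub>m (B * adj_mat B)"
      unfolding I_def by (rule mult_smult_distrib[OF B adj_mat(1)[OF B]])
    also have "\<dots> = 1\<^sub>m N" using \<open>d \<noteq> 0\<close>
      by (auto simp: adj_mat(2)[OF B] d_def[symmetric] intro!: eq_matI)
    finally show ?thesis .
  qed
  have IB: "I * B = 1\<^sub>m N"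
  proof -
    have "I * B = inverse d \<cdot>\<^sub>m (adj_mat B * B)"
      unfolding I_def by (rule mult_smult_assoc_mat[OF adj_mat(1)[OF B] B])
    also have "\<dots> = 1\<^sub>m N" using \<open>d \<noteq> 0\<close>
      by (auto simp: adj_mat(3)[OF B] d_def[symmetric] intro!: eq_matI)
    finally show ?thesis .
  qed
  have Bij: "B $$ (i, j) = \<theta> (A (f i) (f j))" if "i < N" "j < N" for i j
    using that by (simp add: B_def M_def)
  have sumT: "(\<Sum>\<mu>\<in>T. g \<mu>) = (\<Sum>i = 0..<N. g (f i))" for g :: "'i \<Rightarrow> 'e"
    by (rule sum.reindex_bij_betw[symmetric]) (use f N_def in simp)
  have sumBI: "(\<Sum>k = 0..<N. B $$ (i, k) * I $$ (k, j)) = (if i = j then 1 else 0)"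
    if "i < N" "j < N" for i j
  proof -
    have "(B * I) $$ (i, j) = 1\<^sub>m N $$ (i, j)" by (simp only: BI)
    then show ?thesis using that B I by (simp add: scalar_prod_def)
  qed
  have sumIB: "(\<Sum>k = 0..<N. I $$ (i, k) * B $$ (k, j)) = (if i = j then 1 else 0)"
    if "i < N" "j < N" for i j
  proof -
    have "(I * B) $$ (i, j) = 1\<^sub>m N $$ (i, j)" by (simp only: IB)
    then show ?thesis using that B I by (simp add: scalar_prod_def)
  qed
  show "\<exists>c. \<forall>\<nu>\<in>T. (\<Sum>\<mu>\<in>T. c \<mu> * \<theta> (A \<mu> \<nu>)) = b \<nu>"
  proof -
    define c where "c \<mu> = (\<Sum>l = 0..<N. b (f l) * I $$ (l, the_inv_into {0..<N} f \<mu>))" for \<mu>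
    have cf: "c (f i) = (\<Sum>l = 0..<N. b (f l) * I $$ (l, i))" if "i < N" for i
      using the_inv_into_f_f[of f "{0..<N}" i] f that by (simp add: c_def bij_betw_def N_def)
    have "(\<Sum>\<mu>\<in>T. c \<mu> * \<theta> (A \<mu> (f j))) = b (f j)" if j: "j < N" for j
    proof -
      have "(\<Sum>\<mu>\<in>T. c \<mu> * \<theta> (A \<mu> (f j))) = (\<Sum>i = 0..<N. \<Sum>l = 0..<N. b (f l) * (I $$ (l, i) * B $$ (i, j)))"
        unfolding sumT by (rule sum.cong) (use j in \<open>auto simp: cf Bij sum_distrib_right mult.assoc\<close>)
      also have "\<dots> = (\<Sum>l = 0..<N. b (f l) * (\<Sum>i = 0..<N. I $$ (l, i) * B $$ (i, j)))"
        by (subst sum.swap) (simp add: sum_distrib_left)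
      also have "\<dots> = (\<Sum>l = 0..<N. b (f l) * (if l = j then 1 else 0))"
        by (rule sum.cong) (use j sumIB in auto)
      also have "\<dots> = b (f j)" using j by (simp add: if_distrib sum.delta cong: if_cong)
      finally show ?thesis .
    qed
    moreover have "\<exists>j<N. \<nu> = f j" if "\<nu> \<in> T" for \<nu>
      using f that unfolding bij_betw_def N_def by (metis atLeastLessThan_iff imageE)
    ultimately show ?thesis by (intro exI[of _ c]) auto
  qed
  show "\<forall>\<mu>\<in>T. c \<mu> = 0" if z: "\<forall>\<nu>\<in>T. (\<Sum>\<mu>\<in>T. c \<mu> * \<theta> (A \<mu> \<nu>)) = 0"
  proof -
    have "c (f i) = 0" if i: "i < N" for i
    proof -
      have "c (f i) = (\<Sum>l = 0..<N. c (f l) * (if l = i then 1 else 0))"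
        using i by (simp add: if_distrib sum.delta cong: if_cong)
      also have "\<dots> = (\<Sum>l = 0..<N. c (f l) * (\<Sum>k = 0..<N. B $$ (l, k) * I $$ (k, i)))"
        by (rule sum.cong) (use i sumBI in auto)
      also have "\<dots> = (\<Sum>l = 0..<N. \<Sum>k = 0..<N. c (f l) * B $$ (l, k) * I $$ (k, i))"
        by (simp add: sum_distrib_left mult.assoc)
      also have "\<dots> = (\<Sum>k = 0..<N. (\<Sum>l = 0..<N. c (f l) * B $$ (l, k)) * I $$ (k, i))"
        by (subst sum.swap) (simp add: sum_distrib_right)
      also have "\<dots> = 0"
      proof (rule sum.neutral, rule)
        fix k assume "k \<in> {0..<N}"
        then have "(\<Sum>l = 0..<N. c (f l) * B $$ (l, k)) = (\<Sum>\<mu>\<in>T. c \<mu> * \<theta> (A \<mu> (f k)))"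
          unfolding sumT by (intro sum.cong) (auto simp: Bij)
        then show "(\<Sum>l = 0..<N. c (f l) * B $$ (l, k)) * I $$ (k, i) = 0"
          using z fT \<open>k \<in> {0..<N}\<close> by auto
      qed
      finally show ?thesis .
    qed
    moreover have "\<exists>j<N. \<nu> = f j" if "\<nu> \<in> T" for \<nu>
      using f that unfolding bij_betw_def N_def by (metis atLeastLessThan_iff imageE)
    ultimately show ?thesis by auto
  qed
qed

lemma fls_const_hom: "comm_ring_hom (fls_const :: 'k::field \<Rightarrow> 'k fls)"
  by unfold_locales (auto simp: fls_plus_const)

text \<open>The parameter \<open>T\<close> of a polynomial in \<open>T\<close> becomes \<open>s\<^sup>-\<^sup>1\<close>.\<close>

definition tau_ev :: "'k::field poly \<Rightarrow> 'k fls" where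
  "tau_ev p = poly (map_poly fls_const p) fls_X_inv"

lemma tau_ev_hom: "comm_ring_hom (tau_ev :: 'k::field poly \<Rightarrow> 'k fls)"
proof -
  interpret c: comm_ring_hom "fls_const :: 'k \<Rightarrow> 'k fls" by (rule fls_const_hom)
  interpret m: map_poly_comm_ring_hom "fls_const :: 'k \<Rightarrow> 'k fls" ..
  show ?thesis
    unfolding tau_ev_def by unfold_locales (auto simp: m.hom_add m.hom_mult)
qed

lemma tau_ev_pCons: "tau_ev (pCons a p) = fls_const a + fls_X_inv * tau_ev (p :: 'k::field poly)"
proof -
  interpret c: comm_ring_hom "fls_const :: 'k \<Rightarrow> 'k fls" by (rule fls_const_hom)
  interpret m: map_poly_comm_ring_hom "fls_const :: 'k \<Rightarrow> 'k fls" ..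
  show ?thesis unfolding tau_ev_def by (simp add: c.map_poly_pCons_hom)
qed

lemma nth_tau_ev: "fls_nth (tau_ev (p :: 'k::field poly)) (- int n) = coeff p n"
proof (induction p arbitrary: n)
  case 0
  then show ?case by (simp add: tau_ev_def)
next
  case (pCons a p)
  \<comment> \<open>A polynomial in s^-1 has no positive powers of s; otherwise the shifted summand
    would contribute to the constant coefficient.\<close>
  have pos: "fls_nth (tau_ev q) k = 0" if "k > 0" for q :: "'k poly" and k
    using that
  proof (induction q arbitrary: k)
    case (pCons a q)
    then show ?case by (simp add: tau_ev_pCons fls_X_inv_times_conv_shift)
  qed (simp add: tau_ev_def)
  show ?case
  proof (cases n)
    case 0
    then show ?thesis by (simp add: tau_ev_pCons fls_X_inv_times_conv_shift pos)
  next
    case (Suc n')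
    then show ?thesis using pCons.IH[of n']
      by (simp add: tau_ev_pCons fls_X_inv_times_conv_shift)
  qed
qed

lemma tau_ev_nonzero: "p \<noteq> 0 \<Longrightarrow> tau_ev (p :: 'k::field poly) \<noteq> 0"
  by (metis fls_zero_nth leading_coeff_0_iff nth_tau_ev)

lemma mapc_mapc:
  assumes "comm_ring_hom h" "comm_ring_hom g"
  shows "mapc h (mapc g p) = mapc (\<lambda>c. h (g c)) p"
proof -
  have "mapc h (mev (\<lambda>c. mcst (g c)) mvar p) = mev (\<lambda>c. mapc h (mcst (g c))) (\<lambda>v. mapc h (mvar v)) p"
    by (rule mapc_mev[OF assms(1) mcst_comp_hom[OF assms(2)]])
  then show ?thesis by (simp add: mapc_def[of g] mapc_def[of "\<lambda>c. h (g c)"] assms)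
qed

lemma pconst_hom: "comm_ring_hom (\<lambda>c. [:c:] :: 'k::field poly)"
  by unfold_locales (auto simp: one_pCons)

lemma poly0_hom: "comm_ring_hom (\<lambda>p. poly p (0 :: 'k::field))"
  by unfold_locales auto

lemma tau_ev_const: "tau_ev [:c:] = fls_const c"
  by (simp add: tau_ev_pCons) (simp add: tau_ev_def)

lemma tau_ev_X: "tau_ev [:0, 1:] = fls_X_inv"
  by (simp add: tau_ev_pCons) (simp add: tau_ev_def)

lemma finite_multisets_le: "finite V \<Longrightarrow> finite {m. set_mset m \<subseteq> V \<and> size m \<le> d}"
proof -
  assume V: "finite V"
  have "{m. set_mset m \<subseteq> V \<and> size m \<le> d} \<subseteq> mset ` {xs. set xs \<subseteq> V \<and> length xs \<le> d}"
  proof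
    fix m assume "m \<in> {m. set_mset m \<subseteq> V \<and> size m \<le> d}"
    moreover obtain xs where "m = mset xs" by (metis ex_mset)
    ultimately show "m \<in> mset ` {xs. set xs \<subseteq> V \<and> length xs \<le> d}" by auto
  qed
  then show ?thesis using finite_lists_length_le[OF V] finite_surj by blast
qed

section \<open>Ideals generated by a finite family\<close>

definition idl :: "('i \<Rightarrow> 'a::comm_ring_1) \<Rightarrow> 'i set \<Rightarrow> 'a set" where
  "idl g Y = {\<Sum>v\<in>Y. h v * g v | h. True}"

lemma idl_zero [simp]: "0 \<in> idl g Y"
  unfolding idl_def by (auto intro!: exI[of _ "\<lambda>_. 0"])

lemma idl_add: "a \<in> idl g Y \<Longrightarrow> b \<in> idl g Y \<Longrightarrow> a + b \<in> idl g Y"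
  unfolding idl_def by (auto, rule_tac x = "\<lambda>v. h v + ha v" in exI) (simp add: distrib_right sum.distrib)

lemma idl_mult: "a \<in> idl g Y \<Longrightarrow> c * a \<in> idl g Y"
  unfolding idl_def by (auto, rule_tac x = "\<lambda>v. c * h v" in exI) (simp add: sum_distrib_left mult.assoc)

lemma idl_uminus: "a \<in> idl g Y \<Longrightarrow> - a \<in> idl g Y"
  using idl_mult[of a g Y "- 1"] by simp

lemma idl_diff: "a \<in> idl g Y \<Longrightarrow> b \<in> idl g Y \<Longrightarrow> a - b \<in> idl g Y"
  using idl_add[of a g Y "- b"] idl_uminus[of b g Y] by simp

lemma idl_sum: "(\<And>i. i \<in> A \<Longrightarrow> f i \<in> idl g Y) \<Longrightarrow> sum f A \<in> idl g Y"
  by (induction A rule: infinite_finite_induct) (auto intro: idl_add)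

lemma idl_gen: "finite Y \<Longrightarrow> v \<in> Y \<Longrightarrow> g v \<in> idl g Y"
  unfolding idl_def
  by (auto intro!: exI[of _ "\<lambda>u. if u = v then 1 else 0"] simp: if_distrib[of "\<lambda>x. x * _"] cong: if_cong)

lemma idl_trans: "a - b \<in> idl g Y \<Longrightarrow> b - c \<in> idl g Y \<Longrightarrow> a - c \<in> idl g Y"
  using idl_add[of "a - b" g Y "b - c"] by simp

lemma idl_hom:
  assumes "comm_ring_hom \<phi>" "\<And>v. v \<in> Y \<Longrightarrow> \<phi> (g v) \<in> idl g' Y'" "a \<in> idl g Y"
  shows "\<phi> a \<in> idl g' Y'"
proof -
  interpret comm_ring_hom \<phi> by fact
  show ?thesis using assms(2,3) by (auto simp: idl_def[of g Y] hom_sum hom_mult intro!: idl_sum idl_mult)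
qed

text \<open>The ideal \<open>J\<close> is generated by the perturbed forms \<open>g v = s v\<^sup>r + q v\<close>, for \<open>v \<in> Y\<close>, over the Laurent series in \<open>s\<close>.
  Replacing \<open>v\<^sup>r\<close> by \<open>v\<^sup>r + s\<^sup>-\<^sup>1 q v\<close> in the monomials \<open>m\<close> gives \<open>Bs m\<close>. Over \<open>s\<^sup>-\<^sup>1 = 0\<close> this is the identity, so a
  determinant in \<open>s\<^sup>-\<^sup>1\<close> is nonzero and the \<open>Bs m\<close> form a basis; those divisible by no \<open>v\<^sup>r\<close> (\<open>stdm\<close>) are a
  basis modulo \<open>J\<close> over the polynomials in the remaining variables.\<close>

locale pert =
  fixes Y :: "nat set" and q :: "nat \<Rightarrow> 'k::field mp" and r :: nat
  assumes finY: "finite Y" and r: "r > 0" and q: "\<And>v. v \<in> Y \<Longrightarrow> whom (\<lambda>_. 1) r (q v)"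
begin

definition g :: "nat \<Rightarrow> 'k fls mp" where
  "g v = mcst fls_X * mvar v ^ r + mapc fls_const (q v)"

definition g' :: "nat \<Rightarrow> 'k fls mp" where
  "g' v = mvar v ^ r + mcst fls_X_inv * mapc fls_const (q v)"

abbreviation J :: "'k fls mp set" where "J \<equiv> idl g Y"

definition stp :: "nat multiset \<Rightarrow> nat multiset" where
  "stp m = m - (\<Sum>v\<in>Y. replicate_mset (r * (count m v div r)) v)"

text \<open>A version over the polynomials in T in place of s^-1: only there can T be specialized to
  0, where \<open>bs m\<close> becomes the monomial \<open>m\<close>.\<close>

definition bs :: "nat multiset \<Rightarrow> 'k poly mp" where
  "bs m = mmon (stp m) *
     (\<Prod>v\<in>Y. (mvar v ^ r + mcst [:0, 1:] * mapc (\<lambda>c. [:c:]) (q v)) ^ (count m v div r))"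

definition Bs :: "nat multiset \<Rightarrow> 'k fls mp" where
  "Bs m = mapc tau_ev (bs m)"

definition qvars :: "nat set" where
  "qvars = Y \<union> (\<Union>v\<in>Y. mvars (q v))"

definition stdm :: "nat multiset \<Rightarrow> bool" where
  "stdm m \<longleftrightarrow> (\<forall>v\<in>Y. count m v < r)"

definition std :: "'k fls mp \<Rightarrow> bool" where
  "std p \<longleftrightarrow> (\<forall>m\<in>keys p. stdm m)"

lemma fin_qvars: "finite qvars"
  using finY by (simp add: qvars_def)

lemma count_repl: "count (\<Sum>v\<in>Y. replicate_mset (r * (count m v div r)) v) u =
    (if u \<in> Y then r * (count m u div r) else 0)"
proof -
  have "count (\<Sum>v\<in>Y. replicate_mset (r * (count m v div r)) v) u =
      (\<Sum>v\<in>Y. if u = v then r * (count m v div r) else 0)"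
    unfolding count_sum by (rule sum.cong) auto
  then show ?thesis using finY by simp
qed

lemma count_stp: "count (stp m) u = (if u \<in> Y then count m u mod r else count m u)"
  by (simp add: stp_def count_repl minus_mult_div_eq_mod)

lemma stp_split: "m = stp m + (\<Sum>v\<in>Y. replicate_mset (r * (count m v div r)) v)"
  by (rule multiset_eqI) (simp add: count_stp count_repl mod_mult_div_eq)

lemma mmon_split: "(mmon m :: 'a::comm_ring_1 mp) = mmon (stp m) * (\<Prod>v\<in>Y. (mvar v ^ r) ^ (count m v div r))"
proof -
  have "(mmon (\<Sum>v\<in>Y. replicate_mset (r * (count m v div r)) v) :: 'a mp) =
      (\<Prod>v\<in>Y. mmon (replicate_mset (r * (count m v div r)) v))"
    using finY by (induction Y rule: finite_induct) (simp_all add: mmon_add)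
  then show ?thesis
    by (subst stp_split, subst mmon_add) (simp add: mvar_power[symmetric] power_mult[symmetric])
qed

lemma bs0: "mapc (\<lambda>p. poly p 0) (bs m) = mmon m"
proof -
  interpret m: comm_ring_hom "mapc (\<lambda>p. poly p (0::'k))" by (rule mapc_hom[OF poly0_hom])
  show ?thesis
    by (subst mmon_split) (simp add: bs_def m.hom_mult m.hom_prod m.hom_power m.hom_add
        mapc_single[OF poly0_hom] single_zero)
qed

lemma Bs_eq: "Bs m = mmon (stp m) * (\<Prod>v\<in>Y. g' v ^ (count m v div r))"
proof -
  interpret t: comm_ring_hom "tau_ev :: 'k poly \<Rightarrow> 'k fls" by (rule tau_ev_hom)
  interpret m: comm_ring_hom "mapc (tau_ev :: 'k poly \<Rightarrow> 'k fls)" by (rule mapc_hom[OF tau_ev_hom])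
  show ?thesis
    by (simp add: Bs_def bs_def m.hom_mult m.hom_prod m.hom_power m.hom_add g'_def
        mapc_single[OF tau_ev_hom] tau_ev_X mapc_mapc[OF tau_ev_hom pconst_hom] tau_ev_const)
qed

lemma g_g': "g v = mcst fls_X * g' v"
  by (simp add: g_def g'_def distrib_left mult.assoc[symmetric] mult_single fls_X_times_conv_shift
      fls_X_inv_conv_shift_1)

lemma Bs_std: "stdm m \<Longrightarrow> Bs m = mmon m"
proof -
  assume "stdm m"
  then have "stp m = m" "\<And>v. v \<in> Y \<Longrightarrow> count m v div r = 0"
    by (auto simp: stdm_def count_stp intro!: multiset_eqI)
  then show ?thesis by (simp add: Bs_eq)
qed

lemma Bs_g':
  assumes v: "v \<in> Y"
  shows "Bs m * g' v = Bs (m + replicate_mset r v)"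
proof -
  have s: "stp (m + replicate_mset r v) = stp m"
    by (rule multiset_eqI) (use v in \<open>auto simp: count_stp\<close>)
  have "(\<Prod>u\<in>Y. g' u ^ (count (m + replicate_mset r v) u div r)) =
      (\<Prod>u\<in>Y. g' u ^ (count m u div r) * (if u = v then g' v else 1))"
    by (rule prod.cong) (use r in auto)
  also have "\<dots> = (\<Prod>u\<in>Y. g' u ^ (count m u div r)) * g' v"
    using v finY by (simp add: prod.distrib)
  finally show ?thesis by (simp add: Bs_eq s mult.assoc)
qed

text \<open>Up to the unit s, multiplication by a generator only shifts the index of a basis
  element. This is why \<open>J\<close> is spanned by the \<open>Bs m\<close> whose \<open>m\<close>
  is not standard.\<close>

lemma Bs_g: "v \<in> Y \<Longrightarrow> Bs m * g v = mcst fls_X * Bs (m + replicate_mset r v)"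
  by (simp add: g_g' Bs_g'[symmetric] ac_simps)

lemma Bs_nonstd: "\<not> stdm m \<Longrightarrow> Bs m \<in> J"
proof -
  assume "\<not> stdm m"
  then obtain v where v: "v \<in> Y" "count m v \<ge> r" by (auto simp: stdm_def)
  then have "m = (m - replicate_mset r v) + replicate_mset r v"
    by (simp add: multiset_eq_iff)
  then have B: "Bs m = Bs (m - replicate_mset r v) * g' v"
    using Bs_g'[OF v(1)] by metis
  have "g' v = mcst fls_X_inv * g v"
    by (simp add: g_g' mult.assoc[symmetric] mult_single fls_X_inv_times_conv_shift fls_X_conv_shift_1)
  then have "Bs m = (Bs (m - replicate_mset r v) * mcst fls_X_inv) * g v"
    by (simp add: B mult.assoc)
  then show ?thesis using idl_mult[OF idl_gen[OF finY v(1), of g]] by simp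
qed

text \<open>The weights are prescribed on \<open>qvars\<close> only; outside they stay free, to be
  used for an auxiliary variable of weight \<open>r\<close>.\<close>

lemma whom_Bs:
  assumes "\<And>v. v \<in> qvars \<Longrightarrow> w v = 1"
  shows "whom w (wdeg w m) (Bs m)"
proof -
  have g': "whom w r (g' v)" if "v \<in> Y" for v
  proof -
    have "whom w r (q v)"
      by (rule whom_weights_cong[OF q[OF that]], rule assms[symmetric]) (use that in \<open>auto simp: qvars_def\<close>)
    then have "whom w (0 + r) (mcst fls_X_inv * mapc fls_const (q v))"
      by (intro whom_mult whom_cst whom_mapc fls_const_hom)
    moreover have "whom w (r * w v) (mvar v ^ r)" by (intro whom_power whom_var)
    moreover have "w v = 1" using assms that by (simp add: qvars_def)
    ultimately show ?thesis by (auto simp: g'_def intro: whom_add)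
  qed
  have "whom w (wdeg w (stp m) + (\<Sum>v\<in>Y. (count m v div r) * r)) (Bs m)"
    unfolding Bs_eq by (intro whom_mult whom_single whom_prod whom_power g')
  moreover have "wdeg w m = wdeg w (stp m) + (\<Sum>v\<in>Y. (count m v div r) * r)"
  proof -
    have "wdeg w (\<Sum>v\<in>Z. replicate_mset (r * (count m v div r)) v) = (\<Sum>v\<in>Z. (count m v div r) * r)"
      if "finite Z" "Z \<subseteq> Y" for Z
      using that by (induction Z rule: finite_induct) (auto simp: assms qvars_def)
    from this[OF finY] show ?thesis
      by (subst stp_split) simp
  qed
  ultimately show ?thesis by simp
qed

lemma mvars_Bs: "mvars (Bs m) \<subseteq> set_mset m \<union> qvars"
proof -
  have "mvars (g' v) \<subseteq> qvars" if "v \<in> Y" for v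
  proof -
    have "mvars (mvar v ^ r :: 'k fls mp) \<subseteq> qvars"
      using mvars_power[of "mvar v" r] mvars_single[of "{#v#}"] that by (fastforce simp: qvars_def)
    moreover have "mvars (mcst fls_X_inv * mapc fls_const (q v)) \<subseteq> qvars"
      using mvars_mult[of "mcst fls_X_inv" "mapc fls_const (q v)"] mvars_mapc[OF fls_const_hom, of "q v"] that
      by (auto simp: qvars_def)
    ultimately show ?thesis unfolding g'_def using mvars_add by blast
  qed
  then have "mvars (\<Prod>v\<in>Y. g' v ^ (count m v div r)) \<subseteq> qvars"
    using mvars_power by (intro mvars_prod) blast
  moreover have "mvars (mmon (stp m) :: 'k fls mp) \<subseteq> set_mset m"
    using mvars_single[of "stp m"] by (auto simp: stp_def dest: in_diffD)
  ultimately show ?thesis unfolding Bs_eq using mvars_mult by blast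
qed

definition box :: "nat set \<Rightarrow> nat \<Rightarrow> nat multiset set" where
  "box V d = {m. set_mset m \<subseteq> V \<and> size m \<le> d}"

text \<open>Since \<open>q v\<close> is homogeneous of degree \<open>r\<close>, \<open>Bs m\<close>
  involves only monomials of the size of \<open>m\<close>. So the monomials of a box and the
  \<open>Bs m\<close> with the same indices are linked by a square matrix over the polynomials in
  s^-1 that is the identity at s^-1 = 0.\<close>

lemma expand_box:
  assumes V: "finite V" "qvars \<subseteq> V"
  shows "keys p \<subseteq> box V d \<Longrightarrow> \<exists>c. p = (\<Sum>m\<in>box V d. mcst (c m) * Bs m)"
    and "(\<Sum>m\<in>box V d. mcst (c m) * Bs m) = 0 \<Longrightarrow> \<forall>m\<in>box V d. c m = 0"
proof -
  let ?T = "box V d"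
  have fin: "finite ?T" using finite_multisets_le[OF V(1)] by (simp add: box_def)
  have id: "poly (lookup (bs \<mu>) \<nu>) 0 = (if \<mu> = \<nu> then 1 else 0)" for \<mu> \<nu>
    using arg_cong[OF bs0[of \<mu>], of "\<lambda>x. lookup x \<nu>"]
    by (simp add: lookup_mapc[OF poly0_hom] lookup_single when_def)
  have nz: "tau_ev x \<noteq> 0" if "poly x 0 = 1" for x :: "'k poly"
    by (rule tau_ev_nonzero) (use that in auto)
  note sq = square_system[OF fin poly0_hom tau_ev_hom id nz]
  have L: "lookup (\<Sum>m\<in>?T. mcst (c m) * Bs m) \<nu> = (\<Sum>m\<in>?T. c m * tau_ev (lookup (bs m) \<nu>))" for c \<nu>
    by (simp add: lookup_sum lookup_mcst_mult Bs_def lookup_mapc[OF tau_ev_hom])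
  have B: "keys (Bs m) \<subseteq> ?T" if "m \<in> ?T" for m
  proof
    fix k assume k: "k \<in> keys (Bs m)"
    have "set_mset k \<subseteq> mvars (Bs m)" using k by (auto simp: mvars_def)
    moreover have "size k = size m" using whom_Bs[of "\<lambda>_. 1" m] k unfolding whom_def wdeg_one by simp
    ultimately show "k \<in> ?T" using mvars_Bs[of m] that V(2) by (auto simp: box_def)
  qed
  have out: "lookup (\<Sum>m\<in>?T. mcst (c m) * Bs m) \<nu> = 0" if "\<nu> \<notin> ?T" for c \<nu>
  proof -
    have "lookup (Bs m) \<nu> = 0" if "m \<in> ?T" for m using B[OF that] \<open>\<nu> \<notin> ?T\<close> by (auto simp: in_keys_iff)
    then show ?thesis by (simp add: lookup_sum lookup_mcst_mult)
  qed
  show "\<exists>c. p = (\<Sum>m\<in>?T. mcst (c m) * Bs m)" if "keys p \<subseteq> ?T"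
  proof -
    obtain c where c: "\<forall>\<nu>\<in>?T. (\<Sum>\<mu>\<in>?T. c \<mu> * tau_ev (lookup (bs \<mu>) \<nu>)) = lookup p \<nu>"
      using sq(1) by blast
    have "p = (\<Sum>m\<in>?T. mcst (c m) * Bs m)"
    proof (rule poly_mapping_eqI)
      fix \<nu>
      show "lookup p \<nu> = lookup (\<Sum>m\<in>?T. mcst (c m) * Bs m) \<nu>"
        using c L[of c \<nu>] out[of \<nu> c] that by (cases "\<nu> \<in> ?T") (auto simp: in_keys_iff)
    qed
    then show ?thesis by blast
  qed
  show "\<forall>m\<in>?T. c m = 0" if "(\<Sum>m\<in>?T. mcst (c m) * Bs m) = 0"
    by (rule sq(2)) (use L[of c] that in simp_all)
qed

lemma Bs_independent:
  assumes S: "finite S" and z: "(\<Sum>m\<in>S. mcst (c m) * Bs m) = 0"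
  shows "\<forall>m\<in>S. c m = 0"
proof -
  define V where "V = qvars \<union> (\<Union>m\<in>S. set_mset m)"
  define d where "d = (\<Sum>m\<in>S. size m)"
  have V: "finite V" "qvars \<subseteq> V" using S fin_qvars by (auto simp: V_def)
  have SB: "S \<subseteq> box V d" using S by (auto simp: box_def V_def d_def intro: member_le_sum)
  have "finite (box V d)" using finite_multisets_le[OF V(1)] by (simp add: box_def)
  then have "(\<Sum>m\<in>box V d. mcst (if m \<in> S then c m else 0) * Bs m) = (\<Sum>m\<in>S. mcst (c m) * Bs m)"
    by (intro sum.mono_neutral_cong_right) (use SB in auto)
  then have "\<forall>m\<in>box V d. (if m \<in> S then c m else 0) = 0"
    using expand_box(2)[OF V, of "\<lambda>m. if m \<in> S then c m else 0"] z by simp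
  then show ?thesis using SB by (metis subset_iff)
qed

lemma expand_hom:
  assumes w: "\<And>v. v \<in> qvars \<Longrightarrow> w v = 1" and p: "whom w d p"
  shows "\<exists>S c. finite S \<and> p = (\<Sum>m\<in>S. mcst (c m) * Bs m) \<and>
      (\<forall>m\<in>S. wdeg w m = d \<and> set_mset m \<subseteq> mvars p \<union> qvars)"
proof -
  define V where "V = qvars \<union> mvars p"
  define e where "e = (\<Sum>m\<in>keys p. size m)"
  have V: "finite V" "qvars \<subseteq> V" using fin_qvars by (auto simp: V_def)
  have "keys p \<subseteq> box V e" by (auto simp: box_def V_def e_def mvars_def intro: member_le_sum)
  then obtain c where c: "p = (\<Sum>m\<in>box V e. mcst (c m) * Bs m)"
    using expand_box(1)[OF V] by blast
  define S where "S = {m\<in>box V e. wdeg w m = d}"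
  have fin: "finite (box V e)" using finite_multisets_le[OF V(1)] by (simp add: box_def)
  have "p = (\<Sum>m\<in>S. mcst (c m) * Bs m)"
  proof (rule poly_mapping_eqI)
    fix \<nu>
    have zero: "lookup (Bs m) \<nu> = 0" if "wdeg w m \<noteq> wdeg w \<nu>" for m
    proof -
      have "whom w (wdeg w m) (Bs m)" by (rule whom_Bs) (rule w)
      then show ?thesis using that unfolding whom_def by (metis in_keys_iff)
    qed
    show "lookup p \<nu> = lookup (\<Sum>m\<in>S. mcst (c m) * Bs m) \<nu>"
    proof (cases "wdeg w \<nu> = d")
      case True
      have "lookup p \<nu> = (\<Sum>m\<in>box V e. c m * lookup (Bs m) \<nu>)"
        by (subst c) (simp add: lookup_sum lookup_mcst_mult)
      also have "\<dots> = (\<Sum>m\<in>S. c m * lookup (Bs m) \<nu>)"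
        by (rule sum.mono_neutral_right) (use fin zero True in \<open>auto simp: S_def\<close>)
      finally show ?thesis by (simp add: lookup_sum lookup_mcst_mult)
    next
      case False
      then have "lookup p \<nu> = 0" using p by (auto simp: whom_def in_keys_iff)
      moreover have "lookup (\<Sum>m\<in>S. mcst (c m) * Bs m) \<nu> = 0"
        using zero False by (auto simp: lookup_sum lookup_mcst_mult S_def intro!: sum.neutral)
      ultimately show ?thesis by simp
    qed
  qed
  moreover have "finite S" using fin by (simp add: S_def)
  ultimately show ?thesis
    by (intro exI[of _ S] exI[of _ c]) (auto simp: S_def box_def V_def)
qed

lemma expand:
  "\<exists>S c. finite S \<and> p = (\<Sum>m\<in>S. mcst (c m) * Bs m) \<and> (\<forall>m\<in>S. set_mset m \<subseteq> mvars p \<union> qvars)"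
proof -
  define V where "V = qvars \<union> mvars p"
  define e where "e = (\<Sum>m\<in>keys p. size m)"
  have V: "finite V" "qvars \<subseteq> V" using fin_qvars by (auto simp: V_def)
  have "keys p \<subseteq> box V e" by (auto simp: box_def V_def e_def mvars_def intro: member_le_sum)
  then obtain c where c: "p = (\<Sum>m\<in>box V e. mcst (c m) * Bs m)"
    using expand_box(1)[OF V] by blast
  then show ?thesis using finite_multisets_le[OF V(1)]
    by (intro exI[of _ "box V e"] exI[of _ c]) (auto simp: box_def V_def)
qed

lemma std_part:
  assumes "finite S"
  shows "(\<Sum>m\<in>S. mcst (c m) * Bs m) - (\<Sum>m\<in>{m\<in>S. stdm m}. mcst (c m) * mmon m) \<in> J"
    and "std (\<Sum>m\<in>{m\<in>S. stdm m}. mcst (c m) * mmon m)"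
proof -
  have "(\<Sum>m\<in>S. mcst (c m) * Bs m) = (\<Sum>m\<in>{m\<in>S. stdm m}. mcst (c m) * Bs m) + (\<Sum>m\<in>{m\<in>S. \<not> stdm m}. mcst (c m) * Bs m)"
    using assms by (subst sum.union_disjoint[symmetric]) (auto intro!: sum.cong)
  moreover have "(\<Sum>m\<in>{m\<in>S. stdm m}. mcst (c m) * Bs m) = (\<Sum>m\<in>{m\<in>S. stdm m}. mcst (c m) * mmon m)"
    by (rule sum.cong) (auto simp: Bs_std)
  moreover have "(\<Sum>m\<in>{m\<in>S. \<not> stdm m}. mcst (c m) * Bs m) \<in> J"
    by (intro idl_sum idl_mult Bs_nonstd) auto
  ultimately show "(\<Sum>m\<in>S. mcst (c m) * Bs m) - (\<Sum>m\<in>{m\<in>S. stdm m}. mcst (c m) * mmon m) \<in> J" by simp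
  show "std (\<Sum>m\<in>{m\<in>S. stdm m}. mcst (c m) * mmon m)"
  proof -
    have "keys (\<Sum>m\<in>{m\<in>S. stdm m}. mcst (c m) * mmon m) \<subseteq> {m\<in>S. stdm m}"
      by (rule order_trans[OF keys_sum]) (auto simp: mult_single split: if_splits)
    then show ?thesis by (auto simp: std_def)
  qed
qed

text \<open>The multiples of the generators lie in the span \<open>N\<close> of the nonstandard
  \<open>Bs m\<close>, whereas a standard polynomial is a combination of standard
  \<open>Bs m\<close>, these being monomials. Independence of the \<open>Bs m\<close> separates the
  two.\<close>

lemma std_zero: assumes z: "std z" "z \<in> J" shows "z = 0"
proof -
  define N where "N = {(\<Sum>m\<in>S. mcst (c m) * Bs m) | S c. finite S \<and> (\<forall>m\<in>S. \<not> stdm m)}"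
  have NI: "(\<Sum>m\<in>S. mcst (c m) * Bs m) \<in> N" if "finite S" "\<forall>m\<in>S. \<not> stdm m" for S c
    using that unfolding N_def by blast
  have N0: "0 \<in> N" using NI[of "{}"] by simp
  have Nadd: "a + b \<in> N" if "a \<in> N" "b \<in> N" for a b
  proof -
    from that obtain S1 c1 S2 c2 where 1: "finite S1" "\<forall>m\<in>S1. \<not> stdm m" "a = (\<Sum>m\<in>S1. mcst (c1 m) * Bs m)"
      and 2: "finite S2" "\<forall>m\<in>S2. \<not> stdm m" "b = (\<Sum>m\<in>S2. mcst (c2 m) * Bs m)"
      unfolding N_def mem_Collect_eq by (elim exE conjE) (rule that)
    have "a = (\<Sum>m\<in>S1\<union>S2. mcst (if m \<in> S1 then c1 m else 0) * Bs m)"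
      unfolding 1(3) by (rule sum.mono_neutral_cong_left) (use 1(1) 2(1) in auto)
    moreover have "b = (\<Sum>m\<in>S1\<union>S2. mcst (if m \<in> S2 then c2 m else 0) * Bs m)"
      unfolding 2(3) by (rule sum.mono_neutral_cong_left) (use 1(1) 2(1) in auto)
    ultimately have "a + b = (\<Sum>m\<in>S1\<union>S2. mcst ((if m \<in> S1 then c1 m else 0) + (if m \<in> S2 then c2 m else 0)) * Bs m)"
      by (simp only: single_add distrib_right sum.distrib)
    moreover have "(\<Sum>m\<in>S1\<union>S2. mcst ((if m \<in> S1 then c1 m else 0) + (if m \<in> S2 then c2 m else 0)) * Bs m) \<in> N"
      by (rule NI) (use 1(1,2) 2(1,2) in blast)+
    ultimately show ?thesis by (simp only:)
  qed
  have Nsum: "sum f A \<in> N" if "\<And>i. i \<in> A \<Longrightarrow> f i \<in> N" for f :: "'i \<Rightarrow> _" and A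
    using that by (induction A rule: infinite_finite_induct) (auto intro: N0 Nadd)
  have Nb: "mcst c * Bs m \<in> N" if "\<not> stdm m" for c m
    using NI[of "{m}" "\<lambda>_. c"] that by simp
  have Ng: "h * g v \<in> N" if v: "v \<in> Y" for h v
  proof -
    obtain S c where "finite S" and h: "h = (\<Sum>m\<in>S. mcst (c m) * Bs m)" using expand[of h] by blast
    have eq: "h * g v = (\<Sum>m\<in>S. mcst (c m * fls_X) * Bs (m + replicate_mset r v))"
      unfolding h sum_distrib_right
    proof (rule sum.cong[OF refl])
      fix m
      have "mcst (c m) * Bs m * g v = mcst (c m) * (Bs m * g v)" by (simp only: mult.assoc)
      also have "\<dots> = (mcst (c m) * mcst fls_X) * Bs (m + replicate_mset r v)"
        by (simp only: Bs_g[OF v] mult.assoc)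
      finally show "mcst (c m) * Bs m * g v = mcst (c m * fls_X) * Bs (m + replicate_mset r v)"
        by (simp add: mult_single)
    qed
    show ?thesis unfolding eq
      by (rule Nsum, rule Nb) (use v in \<open>auto simp: stdm_def\<close>)
  qed
  obtain h where zh: "z = (\<Sum>v\<in>Y. h v * g v)" using z(2) unfolding idl_def by auto
  have "z \<in> N" unfolding zh by (rule Nsum, rule Ng)
  then obtain S c where S: "finite S" "\<forall>m\<in>S. \<not> stdm m" "z = (\<Sum>m\<in>S. mcst (c m) * Bs m)"
    unfolding N_def mem_Collect_eq by (elim exE conjE) (rule that)
  have zk: "z = (\<Sum>m\<in>keys z. mcst (lookup z m) * Bs m)"
  proof -
    have "mcst (lookup z m) * Bs m = Poly_Mapping.single m (lookup z m)" if "m \<in> keys z" for m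
    proof -
      have "stdm m" using z(1) that unfolding std_def by blast
      then show ?thesis by (simp only: Bs_std single_eq_cst_mult[of m "lookup z m"])
    qed
    then have "(\<Sum>m\<in>keys z. mcst (lookup z m) * Bs m) = (\<Sum>m\<in>keys z. Poly_Mapping.single m (lookup z m))"
      by (intro sum.cong) auto
    then show ?thesis using mp_sum_monomials[of z] by (simp only:)
  qed
  have disj: "S \<inter> keys z = {}" using S(2) z(1) by (auto simp: std_def)
  define C where "C m = (if m \<in> keys z then lookup z m else - c m)" for m
  have neg: "mcst (- x) = - mcst (x :: 'k fls)" for x by (simp add: single_uminus)
  have "(\<Sum>m\<in>S \<union> keys z. mcst (C m) * Bs m) = (\<Sum>m\<in>S. mcst (C m) * Bs m) + (\<Sum>m\<in>keys z. mcst (C m) * Bs m)"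
    using disj S(1) by (intro sum.union_disjoint) auto
  also have "(\<Sum>m\<in>S. mcst (C m) * Bs m) = - z"
    using disj by (auto simp: S(3) C_def neg sum_negf[symmetric] intro!: sum.cong)
  also have "(\<Sum>m\<in>keys z. mcst (C m) * Bs m) = (\<Sum>m\<in>keys z. mcst (lookup z m) * Bs m)"
    by (rule sum.cong) (simp_all add: C_def)
  also have "\<dots> = z" by (rule zk[symmetric])
  finally have "(\<Sum>m\<in>S \<union> keys z. mcst (C m) * Bs m) = 0" by simp
  then have "\<forall>m\<in>S \<union> keys z. C m = 0" by (intro Bs_independent) (use S(1) in simp_all)
  then have "C m = 0" if "m \<in> keys z" for m using that by blast
  moreover have "C m = lookup z m" "lookup z m \<noteq> 0" if "m \<in> keys z" for m
    using that by (simp_all add: C_def in_keys_iff)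
  ultimately have "lookup z m = 0" for m by (metis in_keys_iff)
  then show "z = 0" by (intro poly_mapping_eqI) simp
qed

end

text \<open>The coefficient of the \<open>Y\<close>-monomial \<open>a\<close>, a polynomial in the other variables.\<close>

definition cfy :: "nat set \<Rightarrow> nat multiset \<Rightarrow> 'k::comm_ring_1 mp \<Rightarrow> 'k mp" where
  "cfy Y a z = (\<Sum>m\<in>keys z. if filter_mset (\<lambda>v. v \<in> Y) m = a
      then Poly_Mapping.single (filter_mset (\<lambda>v. v \<notin> Y) m) (lookup z m) else 0)"

lemma cfy_superset:
  assumes "finite S" "keys z \<subseteq> S"
  shows "cfy Y a z = (\<Sum>m\<in>S. if filter_mset (\<lambda>v. v \<in> Y) m = a
      then Poly_Mapping.single (filter_mset (\<lambda>v. v \<notin> Y) m) (lookup z m) else 0)"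
  unfolding cfy_def by (rule sum.mono_neutral_left) (use assms in \<open>auto simp: in_keys_iff\<close>)

lemma cfy_add: "cfy Y a (p + q) = cfy Y a p + cfy Y a q"
proof -
  let ?S = "keys p \<union> keys q"
  have "keys (p + q) \<subseteq> ?S" by (rule keys_add)
  then show ?thesis
    by (simp add: cfy_superset[of ?S] lookup_add single_add sum.distrib[symmetric])
       (rule sum.cong, auto simp: lookup_add single_add)
qed

lemma cfy_zero [simp]: "cfy Y a 0 = 0"
  by (simp add: cfy_def)

lemma cfy_sum: "cfy Y a (sum f A) = (\<Sum>i\<in>A. cfy Y a (f i))"
  by (induction A rule: infinite_finite_induct) (simp_all add: cfy_add)

lemma cfy_single: "cfy Y a (Poly_Mapping.single m c) =
    (if filter_mset (\<lambda>v. v \<in> Y) m = a then Poly_Mapping.single (filter_mset (\<lambda>v. v \<notin> Y) m) c else 0)"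
  by (cases "c = 0") (simp_all add: cfy_def)

definition yfree :: "nat set \<Rightarrow> 'k::comm_ring_1 mp \<Rightarrow> bool" where
  "yfree Y p \<longleftrightarrow> mvars p \<inter> Y = {}"

lemma yfree_keys: "yfree Y p \<Longrightarrow> m \<in> keys p \<Longrightarrow> set_mset m \<inter> Y = {}"
  unfolding yfree_def mvars_def by blast

lemma yfree_intros:
  "yfree Y 0" "yfree Y 1" "yfree Y (mcst c)" "yfree Y p \<Longrightarrow> yfree Y p' \<Longrightarrow> yfree Y (p + p')"
  "yfree Y p \<Longrightarrow> yfree Y p' \<Longrightarrow> yfree Y (p * p')" "yfree Y p \<Longrightarrow> yfree Y (- p)"
  "yfree Y p \<Longrightarrow> yfree Y p' \<Longrightarrow> yfree Y (p - p')"
  using mvars_add[of p p'] mvars_mult[of p p'] mvars_diff[of p p'] by (auto simp: yfree_def)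

lemma yfree_sum: "(\<And>i. i \<in> A \<Longrightarrow> yfree Y (f i)) \<Longrightarrow> yfree Y (sum f A)"
  by (induction A rule: infinite_finite_induct) (simp_all add: yfree_intros)

lemma filter_disjoint:
  assumes "set_mset m \<inter> Y = {}"
  shows "filter_mset (\<lambda>v. v \<in> Y) m = {#}" "filter_mset (\<lambda>v. v \<notin> Y) m = m"
  using assms by (auto simp: count_eq_zero_iff intro!: multiset_eqI)

lemma filter_subset:
  assumes "set_mset m \<subseteq> Y"
  shows "filter_mset (\<lambda>v. v \<in> Y) m = m" "filter_mset (\<lambda>v. v \<notin> Y) m = {#}"
  using assms by (auto simp: count_eq_zero_iff intro!: multiset_eqI)

lemma cfy_mult_single:
  assumes "set_mset m \<inter> Y = {}"
  shows "cfy Y a (Poly_Mapping.single m c * z) = Poly_Mapping.single m c * cfy Y a z"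
proof (induction z rule: mp_induct)
  case (single m' c')
  show ?case by (simp add: mult_single cfy_single filter_disjoint[OF assms])
next
  case (add p q)
  then show ?case by (simp add: distrib_left cfy_add)
qed simp

lemma cfy_mult:
  assumes "yfree Y c"
  shows "cfy Y a (c * z) = c * cfy Y a z"
proof -
  have "c * z = (\<Sum>m\<in>keys c. Poly_Mapping.single m (lookup c m) * z)"
    unfolding sum_distrib_right[symmetric] mp_sum_monomials[of c, symmetric] ..
  then have "cfy Y a (c * z) = (\<Sum>m\<in>keys c. Poly_Mapping.single m (lookup c m) * cfy Y a z)"
    unfolding cfy_sum[symmetric]
    by (simp only: cfy_sum) (intro sum.cong refl cfy_mult_single yfree_keys[OF assms])
  also have "\<dots> = c * cfy Y a z"
    unfolding sum_distrib_right[symmetric] mp_sum_monomials[of c, symmetric] ..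
  finally show ?thesis .
qed

lemma mvars_cfy: "mvars (cfy Y a z) \<subseteq> mvars z - Y"
  unfolding cfy_def
proof (rule mvars_sum)
  fix m assume m: "m \<in> keys z"
  have "mvars (Poly_Mapping.single (filter_mset (\<lambda>v. v \<notin> Y) m) (lookup z m)) \<subseteq> mvars z - Y"
    by (rule order_trans[OF mvars_single]) (use m in \<open>auto simp: mvars_def\<close>)
  then show "mvars (if filter_mset (\<lambda>v. v \<in> Y) m = a
      then Poly_Mapping.single (filter_mset (\<lambda>v. v \<notin> Y) m) (lookup z m) else 0) \<subseteq> mvars z - Y"
    by simp
qed

lemma yfree_cfy: "yfree Y (cfy Y a z)"
  using mvars_cfy[of Y a z] by (auto simp: yfree_def)

lemma cfy_decomp:
  assumes A: "finite A" "\<And>m. m \<in> keys z \<Longrightarrow> filter_mset (\<lambda>v. v \<in> Y) m \<in> A"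
  shows "z = (\<Sum>a\<in>A. cfy Y a z * mmon a)"
proof -
  have "(\<Sum>a\<in>A. cfy Y a z * mmon a) = (\<Sum>a\<in>A. \<Sum>m\<in>keys z. if filter_mset (\<lambda>v. v \<in> Y) m = a
      then Poly_Mapping.single m (lookup z m) else 0)"
  proof (rule sum.cong[OF refl])
    fix a
    have "(if filter_mset (\<lambda>v. v \<in> Y) m = a
      then Poly_Mapping.single (filter_mset (\<lambda>v. v \<notin> Y) m) (lookup z m) else 0) * mmon a
      = (if filter_mset (\<lambda>v. v \<in> Y) m = a then Poly_Mapping.single m (lookup z m) else 0)" for m
      using multiset_partition[of m "\<lambda>v. v \<in> Y"] by (auto simp: mult_single add.commute)
    then show "cfy Y a z * mmon a = (\<Sum>m\<in>keys z. if filter_mset (\<lambda>v. v \<in> Y) m = a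
      then Poly_Mapping.single m (lookup z m) else 0)"
      unfolding cfy_def sum_distrib_right by (rule sum.cong[OF refl])
  qed
  also have "\<dots> = (\<Sum>m\<in>keys z. \<Sum>a\<in>A. if filter_mset (\<lambda>v. v \<in> Y) m = a
      then Poly_Mapping.single m (lookup z m) else 0)"
    by (rule sum.swap)
  also have "\<dots> = (\<Sum>m\<in>keys z. Poly_Mapping.single m (lookup z m))"
    by (rule sum.cong[OF refl]) (use A in simp)
  finally show ?thesis using mp_sum_monomials[of z] by simp
qed

lemma cfy_basis:
  assumes "yfree Y c" "set_mset b \<subseteq> Y"
  shows "cfy Y a (c * mmon b) = (if a = b then c else 0)"
  by (simp add: cfy_mult[OF assms(1)] cfy_single filter_subset[OF assms(2)] single_one)

lemma keys_cfy:
  assumes "m \<in> keys (cfy Y a z)"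
  shows "m + a \<in> keys z"
proof -
  have "lookup (cfy Y a z) m \<noteq> 0" using assms by (simp add: in_keys_iff)
  then obtain m' where m': "m' \<in> keys z" "lookup (if filter_mset (\<lambda>v. v \<in> Y) m' = a
      then Poly_Mapping.single (filter_mset (\<lambda>v. v \<notin> Y) m') (lookup z m') else 0) m \<noteq> 0"
    unfolding cfy_def lookup_sum by (meson sum.neutral)
  then have "a = filter_mset (\<lambda>v. v \<in> Y) m'" "m = filter_mset (\<lambda>v. v \<notin> Y) m'"
    by (auto simp: lookup_single when_def split: if_splits)
  then have "m + a = m'" using multiset_partition[of m' "\<lambda>v. v \<in> Y"] by (simp add: add.commute)
  then show ?thesis using m' by simp
qed

text \<open>Multiplication by a monomial shifts all weights by the same amount; this replaces a
  subtraction of degrees in \<open>whom_N\<close>.\<close>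

lemma whom_cancel:
  assumes "whom w (d + wdeg w a) (p * mmon a)"
  shows "whom w d p"
proof -
  have "p * mmon a = (\<Sum>m\<in>keys p. Poly_Mapping.single (m + a) (lookup p m))"
    by (subst mp_sum_monomials[of p]) (simp add: sum_distrib_right mult_single)
  then have "lookup (p * mmon a) (m + a) = lookup p m" for m
    by (simp add: lookup_sum lookup_single when_def in_keys_iff)
  then have "m + a \<in> keys (p * mmon a)" if "m \<in> keys p" for m
    using that by (simp add: in_keys_iff)
  then show ?thesis using assms unfolding whom_def by fastforce
qed

section \<open>Normal forms, multiplication matrices and the norm\<close>

context pert
begin

definition nf :: "'k fls mp \<Rightarrow> 'k fls mp" where
  "nf p = (THE z. std z \<and> p - z \<in> J)"

lemma std_diff: "std a \<Longrightarrow> std b \<Longrightarrow> std (a - b)"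
  using keys_diff[of a b] unfolding std_def by blast

lemma nf_unique:
  assumes "std z" "p - z \<in> J"
  shows "nf p = z"
  unfolding nf_def
proof (rule the_equality)
  show "std z \<and> p - z \<in> J" using assms by blast
next
  fix z' assume z': "std z' \<and> p - z' \<in> J"
  have "z' - z \<in> J" using idl_diff[OF assms(2) conjunct2[OF z']] by simp
  then have "z' - z = 0" using std_zero std_diff z' assms(1) by blast
  then show "z' = z" by simp
qed

lemma nf_ex: "\<exists>z. std z \<and> p - z \<in> J \<and> mvars z \<subseteq> mvars p \<union> qvars"
proof -
  obtain S c where S: "finite S" "p = (\<Sum>m\<in>S. mcst (c m) * Bs m)" "\<forall>m\<in>S. set_mset m \<subseteq> mvars p \<union> qvars"
    using expand[of p] by blast
  have "mvars (\<Sum>m\<in>{m\<in>S. stdm m}. mcst (c m) * mmon m) \<subseteq> mvars p \<union> qvars"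
  proof (rule mvars_sum)
    fix m assume "m \<in> {m\<in>S. stdm m}"
    then show "mvars (mcst (c m) * mmon m) \<subseteq> mvars p \<union> qvars"
      using S(3) mvars_single[of m "c m"] by (auto simp: mult_single)
  qed
  then show ?thesis using std_part[OF S(1), of c] unfolding S(2)[symmetric] by blast
qed

lemma std_nf: "std (nf p)" and nf_cong: "p - nf p \<in> J" and mvars_nf: "mvars (nf p) \<subseteq> mvars p \<union> qvars"
  using nf_ex[of p] nf_unique by metis+

lemma whom_nf:
  assumes w: "\<And>v. v \<in> qvars \<Longrightarrow> w v = 1" and p: "whom w d p"
  shows "whom w d (nf p)"
proof -
  obtain S c where S: "finite S" "p = (\<Sum>m\<in>S. mcst (c m) * Bs m)" "\<forall>m\<in>S. wdeg w m = d \<and> set_mset m \<subseteq> mvars p \<union> qvars"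
    using expand_hom[OF w p] by blast
  have eq: "nf p = (\<Sum>m\<in>{m\<in>S. stdm m}. mcst (c m) * mmon m)"
    by (rule nf_unique) (use std_part[OF S(1), of c] S(2) in simp_all)
  show ?thesis unfolding eq
  proof (rule whom_sum)
    fix m assume "m \<in> {m\<in>S. stdm m}"
    then show "whom w d (mcst (c m) * mmon m)"
      using S(3) whom_single[of w m "c m"] by (simp add: mult_single)
  qed
qed

definition stdY :: "nat multiset set" where
  "stdY = {a. set_mset a \<subseteq> Y \<and> stdm a}"

text \<open>Standard monomials in \<open>Y\<close> are exponent vectors with entries below
  \<open>r\<close>. Their number is the rank of the quotient by \<open>J\<close>, and the degree
  bounds r^m come from it.\<close>

lemma stdY_card: "finite stdY" "card stdY = r ^ card Y"
proof -
  have "bij_betw (\<lambda>f. \<Sum>v\<in>Y. replicate_mset (f v) v) (Y \<rightarrow>\<^sub>E {..<r}) stdY"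
  proof (rule bij_betw_byWitness[where f' = "\<lambda>a. \<lambda>v\<in>Y. count a v"])
    have c: "count (\<Sum>v\<in>Y. replicate_mset (f v) v) u = (if u \<in> Y then f u else 0)" for f u
    proof -
      have "count (\<Sum>v\<in>Y. replicate_mset (f v) v) u = (\<Sum>v\<in>Y. if u = v then f u else 0)"
        unfolding count_sum by (rule sum.cong) auto
      then show ?thesis using finY by simp
    qed
    show "\<forall>f\<in>Y \<rightarrow>\<^sub>E {..<r}. (\<lambda>v\<in>Y. count (\<Sum>v\<in>Y. replicate_mset (f v) v) v) = f"
      unfolding c by (auto simp: PiE_iff extensional_def fun_eq_iff)
    show "\<forall>a\<in>stdY. (\<Sum>v\<in>Y. replicate_mset ((\<lambda>v\<in>Y. count a v) v) v) = a"
      by (auto simp: c stdY_def not_in_iff intro!: multiset_eqI)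
    show "(\<lambda>f. \<Sum>v\<in>Y. replicate_mset (f v) v) ` (Y \<rightarrow>\<^sub>E {..<r}) \<subseteq> stdY"
      by (auto simp: stdY_def stdm_def c PiE_iff simp flip: count_greater_zero_iff split: if_splits)
    show "(\<lambda>a. \<lambda>v\<in>Y. count a v) ` stdY \<subseteq> Y \<rightarrow>\<^sub>E {..<r}"
      by (auto simp: stdY_def stdm_def)
  qed
  note bij = this
  have fc: "finite (Y \<rightarrow>\<^sub>E {..<r})" "card (Y \<rightarrow>\<^sub>E {..<r}) = r ^ card Y"
    using finY by (auto intro: finite_PiE simp: card_PiE)
  show "finite stdY" using bij_betw_finite[OF bij] fc(1) by simp
  show "card stdY = r ^ card Y" using bij_betw_same_card[OF bij] fc(2) by simp
qed

definition al :: "nat multiset list" where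
  "al = (SOME xs. distinct xs \<and> set xs = stdY)"

lemma al: "distinct al" "set al = stdY" "length al = r ^ card Y"
proof -
  have "\<exists>xs. distinct xs \<and> set xs = stdY" using finite_distinct_list[OF stdY_card(1)] by blast
  then have *: "distinct al \<and> set al = stdY" unfolding al_def by (rule someI_ex)
  then show "distinct al" "set al = stdY" by blast+
  show "length al = r ^ card Y" using * distinct_card stdY_card(2) by metis
qed

abbreviation D :: nat where "D \<equiv> r ^ card Y"

lemma al_nth: "i < D \<Longrightarrow> al ! i \<in> stdY"
  using al by (metis nth_mem)

lemma al_inj: "i < D \<Longrightarrow> j < D \<Longrightarrow> al ! i = al ! j \<longleftrightarrow> i = j"
  using al by (simp add: nth_eq_iff_index_eq)

lemma sum_al: "(\<Sum>a\<in>stdY. f a) = (\<Sum>i<D. f (al ! i))"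
proof -
  have "bij_betw ((!) al) {..<D} stdY"
    by (rule bij_betw_nth[OF al(1)]) (simp_all add: al)
  then show ?thesis by (rule sum.reindex_bij_betw[symmetric])
qed

text \<open>Multiplication by \<open>p\<close> modulo \<open>J\<close>; its determinant \<open>N p\<close> is the norm.\<close>

definition M :: "'k fls mp \<Rightarrow> 'k fls mp mat" where
  "M p = mat D D (\<lambda>(i, j). cfy Y (al ! i) (nf (p * mmon (al ! j))))"

lemma M_carrier [simp]: "M p \<in> carrier_mat D D" "dim_row (M p) = D" "dim_col (M p) = D"
  by (simp_all add: M_def)

lemma nf_decomp: "nf p = (\<Sum>i<D. cfy Y (al ! i) (nf p) * mmon (al ! i))"
proof -
  have "filter_mset (\<lambda>v. v \<in> Y) m \<in> stdY" if "m \<in> keys (nf p)" for m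
    using std_nf[of p] that by (auto simp: std_def stdY_def stdm_def)
  from cfy_decomp[OF stdY_card(1) this] show ?thesis unfolding sum_al .
qed

lemma yfree_M: "i < D \<Longrightarrow> j < D \<Longrightarrow> yfree Y (M p $$ (i, j))"
  by (simp add: M_def yfree_cfy)

lemma M_cong:
  assumes "j < D"
  shows "p * mmon (al ! j) - (\<Sum>i<D. M p $$ (i, j) * mmon (al ! i)) \<in> J"
proof -
  have "(\<Sum>i<D. M p $$ (i, j) * mmon (al ! i)) = nf (p * mmon (al ! j))"
    using assms by (subst nf_decomp) (simp add: M_def)
  then show ?thesis using nf_cong by simp
qed

lemma std_comb:
  assumes "\<And>i. i < D \<Longrightarrow> yfree Y (c i)"
  shows "std (\<Sum>i<D. c i * mmon (al ! i))"
proof -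
  have "stdm m" if m: "m \<in> keys (\<Sum>i<D. c i * mmon (al ! i))" for m
  proof -
    have "m \<in> (\<Union>i<D. keys (c i * mmon (al ! i)))" using keys_sum m by fast
    then obtain i where i: "i < D" "m \<in> keys (c i * mmon (al ! i))" by blast
    then obtain b where b: "b \<in> keys (c i)" "m = b + al ! i"
      using keys_mult[of "c i" "mmon (al ! i)"] by auto
    have "count b v = 0" if "v \<in> Y" for v
      using yfree_keys[OF assms[OF i(1)] b(1)] that by (meson disjoint_iff count_inI)
    then show ?thesis using al_nth[OF i(1)] b(2) by (simp add: stdm_def stdY_def)
  qed
  then show ?thesis unfolding std_def by blast
qed

text \<open>By uniqueness of normal forms, any \<open>Y\<close>-free coordinates modulo
  \<open>J\<close> are the column of the matrix. The rules for sums, scalars, products and congruent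
  arguments are obtained by exhibiting such a column.\<close>

lemma M_eqI:
  assumes "\<And>i. i < D \<Longrightarrow> yfree Y (c i)" "j < D" "p * mmon (al ! j) - (\<Sum>i<D. c i * mmon (al ! i)) \<in> J"
    and "i < D"
  shows "M p $$ (i, j) = c i"
proof -
  have "nf (p * mmon (al ! j)) = (\<Sum>i<D. c i * mmon (al ! i))"
    by (rule nf_unique[OF std_comb[OF assms(1)] assms(3)])
  then have "M p $$ (i, j) = (\<Sum>k<D. cfy Y (al ! i) (c k * mmon (al ! k)))"
    using assms(2,4) by (simp add: M_def cfy_sum)
  also have "\<dots> = (\<Sum>k<D. if k = i then c k else 0)"
  proof (rule sum.cong[OF refl])
    fix k assume "k \<in> {..<D}"
    then show "cfy Y (al ! i) (c k * mmon (al ! k)) = (if k = i then c k else 0)"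
      using cfy_basis[OF assms(1), of k "al ! k" "al ! i"] al_nth[of k] al_inj[of i k] assms(4)
      by (auto simp: stdY_def)
  qed
  also have "\<dots> = c i" using assms(4) by simp
  finally show ?thesis .
qed

lemma M_congruent: "p - p' \<in> J \<Longrightarrow> M p = M p'"
proof (rule eq_matI)
  fix i j assume J: "p - p' \<in> J" and "i < dim_row (M p')" "j < dim_col (M p')"
  then have ij: "i < D" "j < D" by simp_all
  show "M p $$ (i, j) = M p' $$ (i, j)"
  proof (rule M_eqI[OF yfree_M ij(2) _ ij(1)])
    have "p * mmon (al ! j) - p' * mmon (al ! j) \<in> J"
      using idl_mult[OF J, of "mmon (al ! j)"] by (simp add: algebra_simps)
    then show "p * mmon (al ! j) - (\<Sum>i<D. M p' $$ (i, j) * mmon (al ! i)) \<in> J"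
      using idl_trans M_cong[OF ij(2)] by blast
  qed (use ij in simp_all)
qed simp_all

lemma M_add: "M (p + p') = M p + M p'"
proof (rule eq_matI)
  fix i j assume "i < dim_row (M p + M p')" "j < dim_col (M p + M p')"
  then have ij: "i < D" "j < D" by simp_all
  have "M (p + p') $$ (i, j) = M p $$ (i, j) + M p' $$ (i, j)"
  proof (rule M_eqI[where c = "\<lambda>i. M p $$ (i, j) + M p' $$ (i, j)", OF _ ij(2) _ ij(1)])
    show "(p + p') * mmon (al ! j) - (\<Sum>i<D. (M p $$ (i, j) + M p' $$ (i, j)) * mmon (al ! i)) \<in> J"
      using idl_add[OF M_cong[OF ij(2), of p] M_cong[OF ij(2), of p']]
      by (simp add: distrib_right sum.distrib algebra_simps)
  qed (use ij in \<open>simp add: yfree_intros yfree_M\<close>)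
  then show "M (p + p') $$ (i, j) = (M p + M p') $$ (i, j)" using ij by simp
qed simp_all

lemma M_scal: "yfree Y c \<Longrightarrow> M (c * p) = c \<cdot>\<^sub>m M p"
proof (rule eq_matI)
  fix i j assume c: "yfree Y c" and "i < dim_row (c \<cdot>\<^sub>m M p)" "j < dim_col (c \<cdot>\<^sub>m M p)"
  then have ij: "i < D" "j < D" by simp_all
  have "M (c * p) $$ (i, j) = c * M p $$ (i, j)"
  proof (rule M_eqI[where c = "\<lambda>i. c * M p $$ (i, j)", OF _ ij(2) _ ij(1)])
    show "c * p * mmon (al ! j) - (\<Sum>i<D. c * M p $$ (i, j) * mmon (al ! i)) \<in> J"
      using idl_mult[OF M_cong[OF ij(2), of p], of c]
      by (simp add: right_diff_distrib sum_distrib_left mult.assoc)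
  qed (use ij c in \<open>simp add: yfree_intros yfree_M\<close>)
  then show "M (c * p) $$ (i, j) = (c \<cdot>\<^sub>m M p) $$ (i, j)" using ij by simp
qed simp_all

lemma M_one: "M 1 = 1\<^sub>m D"
proof (rule eq_matI)
  fix i j assume "i < dim_row (1\<^sub>m D :: 'k fls mp mat)" "j < dim_col (1\<^sub>m D :: 'k fls mp mat)"
  then have ij: "i < D" "j < D" by simp_all
  have "M 1 $$ (i, j) = (if i = j then 1 else 0)"
  proof (rule M_eqI[where c = "\<lambda>i. if i = j then 1 else 0", OF _ ij(2) _ ij(1)])
    have "(\<Sum>i<D. (if i = j then 1 else 0) * mmon (al ! i)) = (\<Sum>i<D. if i = j then mmon (al ! i) else (0 :: 'k fls mp))"
      by (rule sum.cong) simp_all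
    also have "\<dots> = mmon (al ! j)" using ij by simp
    finally show "1 * mmon (al ! j) - (\<Sum>i<D. (if i = j then 1 else 0) * mmon (al ! i)) \<in> J" by simp
  qed (simp add: yfree_intros)
  then show "M 1 $$ (i, j) = 1\<^sub>m D $$ (i, j)" using ij by simp
qed simp_all

lemma M_yfree: "yfree Y c \<Longrightarrow> M c = c \<cdot>\<^sub>m 1\<^sub>m D"
  using M_scal[of c 1] by (simp add: M_one)

lemma M_mult: "M (p * p') = M p * M p'"
proof (rule eq_matI)
  fix i j assume "i < dim_row (M p * M p')" "j < dim_col (M p * M p')"
  then have ij: "i < D" "j < D" by simp_all
  have "M (p * p') $$ (i, j) = (\<Sum>k<D. M p $$ (i, k) * M p' $$ (k, j))"
  proof (rule M_eqI[where c = "\<lambda>i. (\<Sum>k<D. M p $$ (i, k) * M p' $$ (k, j))", OF _ ij(2) _ ij(1)])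
    have 1: "p * (p' * mmon (al ! j)) - p * (\<Sum>k<D. M p' $$ (k, j) * mmon (al ! k)) \<in> J"
      using idl_mult[OF M_cong[OF ij(2), of p'], of p] by (simp only: right_diff_distrib)
    have "(\<Sum>k<D. M p' $$ (k, j) * (p * mmon (al ! k) - (\<Sum>i<D. M p $$ (i, k) * mmon (al ! i)))) \<in> J"
      by (intro idl_sum idl_mult M_cong) simp
    also have "(\<Sum>k<D. M p' $$ (k, j) * (p * mmon (al ! k) - (\<Sum>i<D. M p $$ (i, k) * mmon (al ! i)))) =
        p * (\<Sum>k<D. M p' $$ (k, j) * mmon (al ! k)) -
        (\<Sum>k<D. \<Sum>i<D. M p $$ (i, k) * M p' $$ (k, j) * mmon (al ! i))"
      by (simp add: right_diff_distrib sum_subtractf sum_distrib_left ac_simps)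
    also have "(\<Sum>k<D. \<Sum>i<D. M p $$ (i, k) * M p' $$ (k, j) * mmon (al ! i)) =
        (\<Sum>i<D. (\<Sum>k<D. M p $$ (i, k) * M p' $$ (k, j)) * mmon (al ! i))"
      by (subst sum.swap) (simp only: sum_distrib_right)
    finally show "p * p' * mmon (al ! j) - (\<Sum>i<D. (\<Sum>k<D. M p $$ (i, k) * M p' $$ (k, j)) * mmon (al ! i)) \<in> J"
      using idl_trans[OF 1] by (simp only: mult.assoc)
  qed (use ij in \<open>intro yfree_sum yfree_intros yfree_M, simp_all\<close>)
  then show "M (p * p') $$ (i, j) = (M p * M p') $$ (i, j)"
    using ij by (simp add: scalar_prod_def atLeast0LessThan)
qed simp_all

definition N :: "'k fls mp \<Rightarrow> 'k fls mp" where
  "N p = det (M p)"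

lemma N_mult: "N (p * p') = N p * N p'"
  by (simp add: N_def M_mult det_mult[of _ D])

lemma N_one: "N 1 = 1"
  by (simp add: N_def M_one)

lemma N_power: "N (p ^ n) = N p ^ n"
  by (induction n) (simp_all add: N_one N_mult)

lemma N_cong: "p - p' \<in> J \<Longrightarrow> N p = N p'"
  by (simp add: N_def M_congruent)

lemma N_yfree: "yfree Y c \<Longrightarrow> N c = c ^ D"
  by (simp add: N_def M_yfree det_smult)

lemma mvars_M: "i < D \<Longrightarrow> j < D \<Longrightarrow> mvars (M p $$ (i, j)) \<subseteq> (mvars p \<union> qvars) - Y"
proof -
  assume ij: "i < D" "j < D"
  have "mvars (mmon (al ! j) :: 'k fls mp) \<subseteq> qvars"
    using mvars_single[of "al ! j"] al_nth[OF ij(2)] by (fastforce simp: stdY_def qvars_def)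
  then have "mvars (nf (p * mmon (al ! j))) \<subseteq> mvars p \<union> qvars"
    using mvars_nf[of "p * mmon (al ! j)"] mvars_mult[of p "mmon (al ! j)"] by blast
  then show ?thesis using mvars_cfy[of Y "al ! i" "nf (p * mmon (al ! j))"] ij by (auto simp: M_def)
qed

lemma mvars_N: "mvars (N p) \<subseteq> (mvars p \<union> qvars) - Y"
proof -
  have "mvars (signof \<pi> * (\<Prod>i = 0..<D. M p $$ (i, \<pi> i))) \<subseteq> (mvars p \<union> qvars) - Y"
    if "\<pi> permutes {0..<D}" for \<pi>
  proof -
    have "mvars (\<Prod>i = 0..<D. M p $$ (i, \<pi> i)) \<subseteq> (mvars p \<union> qvars) - Y"
      by (rule mvars_prod, rule mvars_M) (use permutes_in_image[OF that] in auto)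
    moreover have "mvars (signof \<pi> :: 'k fls mp) = {}" by (simp add: sign_def)
    ultimately show ?thesis using mvars_mult by fastforce
  qed
  then show ?thesis unfolding N_def det_def M_carrier if_P[OF refl] by (intro mvars_sum) simp
qed

text \<open>The entry (i, j) has degree d + deg a_j - deg a_i for the basis monomials a_i. To avoid
  the difference each row is multiplied by its a_i; in the determinant this multiplies every term by
  the product of all basis monomials, the monomial of \<open>A\<close>, which is cancelled at the
  end.\<close>

lemma whom_N:
  assumes w: "\<And>v. v \<in> qvars \<Longrightarrow> w v = 1" and p: "whom w d p"
  shows "whom w (D * d) (N p)"
proof -
  have entry: "whom w (d + wdeg w (al ! j)) (M p $$ (i, j) * mmon (al ! i))" if "i < D" "j < D" for i j
  proof -
    have h: "whom w (d + wdeg w (al ! j)) (nf (p * mmon (al ! j)))"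
      by (intro whom_nf w whom_mult p whom_single)
    have "m \<in> keys (nf (p * mmon (al ! j)))" if m: "m \<in> keys (M p $$ (i, j) * mmon (al ! i))" for m
    proof -
      obtain b where "b \<in> keys (M p $$ (i, j))" "m = b + al ! i"
        using keys_mult[of "M p $$ (i, j)" "mmon (al ! i)"] m by (auto split: if_splits)
      then show ?thesis using keys_cfy \<open>i < D\<close> \<open>j < D\<close> by (simp add: M_def)
    qed
    then show ?thesis using h unfolding whom_def by blast
  qed
  define A where "A = (\<Sum>i = 0..<D. al ! i)"
  have A: "mmon A = (\<Prod>i = 0..<D. mmon (al ! i) :: 'k fls mp)"
  proof -
    have "mmon (\<Sum>i\<in>S. al ! i) = (\<Prod>i\<in>S. mmon (al ! i) :: 'k fls mp)" if "finite S" for S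
      using that
    proof (induction S rule: finite_induct)
      case (insert x F)
      then show ?case by (simp add: mmon_add)
    qed simp
    then show ?thesis unfolding A_def by simp
  qed
  have wA: "wdeg w A = (\<Sum>i = 0..<D. wdeg w (al ! i))"
  proof -
    have "wdeg w (\<Sum>i\<in>S. al ! i) = (\<Sum>i\<in>S. wdeg w (al ! i))" if "finite S" for S
      using that by (induction S rule: finite_induct) simp_all
    then show ?thesis unfolding A_def by simp
  qed
  have "whom w (D * d + wdeg w A) (signof \<pi> * (\<Prod>i = 0..<D. M p $$ (i, \<pi> i)) * mmon A)"
    if \<pi>: "\<pi> permutes {0..<D}" for \<pi>
  proof -
    have "whom w (\<Sum>i = 0..<D. d + wdeg w (al ! \<pi> i)) (\<Prod>i = 0..<D. M p $$ (i, \<pi> i) * mmon (al ! i))"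
      by (rule whom_prod, rule entry) (use permutes_in_image[OF \<pi>] in auto)
    moreover have "(\<Sum>i = 0..<D. wdeg w (al ! \<pi> i)) = wdeg w A"
      unfolding wA using sum.permute[OF \<pi>, of "\<lambda>i. wdeg w (al ! i)"] by (simp add: o_def)
    ultimately have "whom w (D * d + wdeg w A) ((\<Prod>i = 0..<D. M p $$ (i, \<pi> i)) * mmon A)"
      by (simp add: sum.distrib prod.distrib A)
    then show ?thesis by (auto simp: sign_def mult.assoc intro: whom_uminus)
  qed
  then have "whom w (D * d + wdeg w A) (N p * mmon A)"
    unfolding N_def det_def M_carrier if_P[OF refl] sum_distrib_right by (intro whom_sum) simp
  then show ?thesis by (rule whom_cancel)
qed

text \<open>Cramer's rule: the column of the adjugate that belongs to the basis element 1 contains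
  the coordinates of a cofactor \<open>v\<close>.\<close>

lemma N_mem: "\<exists>v. N p - p * v \<in> J"
proof -
  have "{#} \<in> stdY" using r by (simp add: stdY_def stdm_def)
  then obtain i0 where i0: "i0 < D" "al ! i0 = {#}" using al by (metis in_set_conv_nth)
  define B where "B = adj_mat (M p)"
  have B: "B \<in> carrier_mat D D" "M p * B = N p \<cdot>\<^sub>m 1\<^sub>m D"
    unfolding B_def N_def using adj_mat(1,2)[of "M p" D] by simp_all
  have sumB: "(\<Sum>k<D. M p $$ (i, k) * B $$ (k, i0)) = (if i = i0 then N p else 0)" if "i < D" for i
  proof -
    have "(M p * B) $$ (i, i0) = (N p \<cdot>\<^sub>m 1\<^sub>m D) $$ (i, i0)" by (simp only: B(2))
    then show ?thesis using that i0 B(1) by (simp add: scalar_prod_def atLeast0LessThan)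
  qed
  define v where "v = (\<Sum>k<D. B $$ (k, i0) * mmon (al ! k))"
  have "(\<Sum>k<D. B $$ (k, i0) * (p * mmon (al ! k) - (\<Sum>i<D. M p $$ (i, k) * mmon (al ! i)))) \<in> J"
    by (intro idl_sum idl_mult M_cong) simp
  also have "(\<Sum>k<D. B $$ (k, i0) * (p * mmon (al ! k) - (\<Sum>i<D. M p $$ (i, k) * mmon (al ! i)))) =
      p * v - (\<Sum>k<D. \<Sum>i<D. M p $$ (i, k) * B $$ (k, i0) * mmon (al ! i))"
    by (simp add: v_def right_diff_distrib sum_subtractf sum_distrib_left ac_simps)
  also have "(\<Sum>k<D. \<Sum>i<D. M p $$ (i, k) * B $$ (k, i0) * mmon (al ! i)) =
      (\<Sum>i<D. (\<Sum>k<D. M p $$ (i, k) * B $$ (k, i0)) * mmon (al ! i))"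
    by (subst sum.swap) (simp only: sum_distrib_right)
  also have "\<dots> = (\<Sum>i<D. if i = i0 then N p else 0)"
    by (rule sum.cong[OF refl]) (simp add: sumB i0(2) single_one)
  also have "\<dots> = N p" using i0 by simp
  finally have "- (p * v - N p) \<in> J" by (rule idl_uminus)
  then show ?thesis by (intro exI[of _ v]) simp
qed

end

section \<open>Integral elements and their reduction\<close>

lemma mcst_mult: "mcst (a * b) = (mcst a * mcst b :: 'k::comm_ring_1 mp)"
  by (simp add: mult_single)

lemma fps_to_fls_hom: "comm_ring_hom (fps_to_fls :: 'k::field fps \<Rightarrow> 'k fls)"
  by unfold_locales (simp_all add: fls_times_fps_to_fls)

lemma fps_nth0_hom: "comm_ring_hom (\<lambda>f. fps_nth f 0 :: 'k::field)"
  by unfold_locales simp_all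

lemma fps_const_hom: "comm_ring_hom (fps_const :: 'k::field \<Rightarrow> 'k fps)"
  by unfold_locales simp_all

abbreviation emb :: "'k::field fps mp \<Rightarrow> 'k fls mp" where "emb \<equiv> mapc fps_to_fls"
abbreviation rd :: "'k::field fps mp \<Rightarrow> 'k mp" where "rd \<equiv> mapc (\<lambda>f. fps_nth f 0)"
abbreviation lft :: "'k::field mp \<Rightarrow> 'k fps mp" where "lft \<equiv> mapc fps_const"
abbreviation inc :: "'k::field mp \<Rightarrow> 'k fls mp" where "inc \<equiv> mapc fls_const"

global_interpretation emb_hom: comm_ring_hom "emb :: 'k::field fps mp \<Rightarrow> 'k fls mp"
  by (rule mapc_hom[OF fps_to_fls_hom])
global_interpretation rd_hom: comm_ring_hom "rd :: 'k::field fps mp \<Rightarrow> 'k mp"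
  by (rule mapc_hom[OF fps_nth0_hom])
global_interpretation lft_hom: comm_ring_hom "lft :: 'k::field mp \<Rightarrow> 'k fps mp"
  by (rule mapc_hom[OF fps_const_hom])
global_interpretation inc_hom: comm_ring_hom "inc :: 'k::field mp \<Rightarrow> 'k fls mp"
  by (rule mapc_hom[OF fls_const_hom])

lemma emb_lft: "emb (lft p) = inc p"
  by (simp add: mapc_mapc[OF fps_to_fls_hom fps_const_hom])

lemma rd_lft: "rd (lft p) = p"
  by (rule poly_mapping_eqI) (simp add: lookup_mapc fps_nth0_hom fps_const_hom)

lemma emb_eq_iff: "emb p = emb p' \<longleftrightarrow> p = p'"
proof
  assume e: "emb p = emb p'"
  show "p = p'"
  proof (rule poly_mapping_eqI)
    fix m
    have "lookup (emb p) m = lookup (emb p') m" by (simp only: e)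
    then show "lookup p m = lookup p' m" by (simp add: lookup_mapc fps_to_fls_hom)
  qed
qed simp

lemma keys_emb: "keys (emb p) = keys p"
  by (auto simp: in_keys_iff lookup_mapc fps_to_fls_hom)

lemma mvars_emb: "mvars (emb p) = mvars p"
  by (simp add: mvars_def keys_emb)

lemma emb_X_power: "emb (mcst (fps_X ^ n)) = mcst (fls_X ^ n)"
  by (simp add: fps_to_fls_hom fps_to_fls_power)

lemma rd_zero_dvd:
  assumes "rd p = 0"
  shows "\<exists>p'. p = mcst fps_X * p'"
proof -
  define p' where "p' = (\<Sum>m\<in>keys p. Poly_Mapping.single m (fps_shift 1 (lookup p m)))"
  have "mcst fps_X * Poly_Mapping.single m (fps_shift 1 (lookup p m)) = Poly_Mapping.single m (lookup p m)" for m
  proof -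
    have "fps_nth (lookup p m) 0 = lookup (rd p) m" by (simp add: lookup_mapc fps_nth0_hom)
    then have "fps_nth (lookup p m) 0 = 0" by (simp add: assms)
    then have "fps_X * fps_shift 1 (lookup p m) = lookup p m"
      by (simp add: fps_eq_iff)
    then show ?thesis by (simp add: mult_single)
  qed
  then have "mcst fps_X * p' = p"
    unfolding p'_def sum_distrib_left using mp_sum_monomials[of p] by simp
  then show ?thesis by metis
qed

lemma rd_X_mult: "rd (mcst (fps_X ^ n) * p) = (if n = 0 then rd p else 0)"
  by (cases n) (simp_all add: rd_hom.hom_mult fps_nth0_hom single_one)

text \<open>s is divided out as long as the reduction vanishes; the order of one fixed nonzero
  coefficient drops each time.\<close>

lemma primitive_part:
  "p \<noteq> 0 \<Longrightarrow> \<exists>a p'. p = mcst (fps_X ^ a) * p' \<and> rd p' \<noteq> (0 :: 'k::field mp)"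
proof -
  assume "p \<noteq> 0"
  then obtain m where "lookup p m \<noteq> 0" by (metis lookup_zero poly_mapping_eqI)
  then show ?thesis
  proof (induction "subdegree (lookup p m)" arbitrary: p)
    case 0
    then have "fps_nth (lookup p m) 0 \<noteq> 0" by (metis nth_subdegree_nonzero)
    moreover have "fps_nth (lookup p m) 0 = lookup (rd p) m" by (simp add: lookup_mapc fps_nth0_hom)
    ultimately have "rd p \<noteq> 0" by auto
    then show ?case by (intro exI[of _ 0] exI[of _ p]) (simp add: single_one)
  next
    case (Suc n)
    have "rd p \<noteq> 0 \<or> rd p = 0" by blast
    then show ?case
    proof
      assume "rd p \<noteq> 0"
      then show ?thesis by (intro exI[of _ 0] exI[of _ p]) (simp add: single_one)
    next
      assume "rd p = 0"
      then obtain p1 where p1: "p = mcst fps_X * p1" using rd_zero_dvd by blast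
      have l: "lookup p m = fps_X * lookup p1 m" by (simp add: p1 lookup_mcst_mult)
      then have nz: "lookup p1 m \<noteq> 0" using Suc.prems by auto
      then have "n = subdegree (lookup p1 m)" using Suc.hyps(2) by (simp add: l)
      from Suc.hyps(1)[OF this nz] obtain a p' where "p1 = mcst (fps_X ^ a) * p'" "rd p' \<noteq> 0" by blast
      then show ?thesis unfolding p1
        by (intro exI[of _ "Suc a"] exI[of _ p']) (simp add: mult.assoc[symmetric] mult_single)
    qed
  qed
qed

text \<open>The poles at \<open>s = 0\<close> of the coefficients have order at most \<open>e\<close>.\<close>

definition ebd :: "nat \<Rightarrow> 'k::field fls mp \<Rightarrow> bool" where
  "ebd e p \<longleftrightarrow> (\<exists>z. mcst (fls_X ^ e) * p = emb z)"

lemma ebd_emb: "ebd 0 (emb z)"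
  unfolding ebd_def by (auto simp: single_one)

lemma ebd_mono: "ebd e p \<Longrightarrow> e \<le> e' \<Longrightarrow> ebd e' p"
proof -
  assume "ebd e p" "e \<le> e'"
  then obtain z where z: "mcst (fls_X ^ e) * p = emb z" by (auto simp: ebd_def)
  have "mcst (fls_X ^ e') * p = mcst (fls_X ^ (e' - e)) * (mcst (fls_X ^ e) * p)"
    using \<open>e \<le> e'\<close> by (simp add: mult.assoc[symmetric] mult_single power_add[symmetric])
  also have "\<dots> = emb (mcst (fps_X ^ (e' - e)) * z)"
    by (simp only: z emb_hom.hom_mult emb_X_power)
  finally show ?thesis unfolding ebd_def by blast
qed

lemma ebd_add: "ebd e p \<Longrightarrow> ebd e p' \<Longrightarrow> ebd e (p + p')"
  unfolding ebd_def by (metis distrib_left emb_hom.hom_add)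

lemma ebd_zero: "ebd e 0"
  unfolding ebd_def by (metis emb_hom.hom_zero mult_zero_right)

lemma ebd_sum: "(\<And>i. i \<in> A \<Longrightarrow> ebd e (f i)) \<Longrightarrow> ebd e (sum f A)"
  by (induction A rule: infinite_finite_induct) (simp_all add: ebd_zero ebd_add)

lemma ebd_mult: "ebd e p \<Longrightarrow> ebd e' p' \<Longrightarrow> ebd (e + e') (p * p')"
proof -
  assume "ebd e p" "ebd e' p'"
  then obtain z z' where z: "mcst (fls_X ^ e) * p = emb z" "mcst (fls_X ^ e') * p' = emb z'"
    by (auto simp: ebd_def)
  have "mcst (fls_X ^ (e + e')) * (p * p') = (mcst (fls_X ^ e) * p) * (mcst (fls_X ^ e') * p')"
    by (simp add: power_add mcst_mult ac_simps)
  also have "\<dots> = emb (z * z')" by (simp only: z emb_hom.hom_mult)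
  finally show ?thesis unfolding ebd_def by blast
qed

lemma ebd_prod: "finite A \<Longrightarrow> (\<And>i. i \<in> A \<Longrightarrow> ebd e (f i)) \<Longrightarrow> ebd (card A * e) (prod f A)"
proof (induction A rule: finite_induct)
  case empty
  show ?case using ebd_emb[of 1] by (simp add: emb_hom.hom_one)
next
  case (insert x F)
  then show ?case using ebd_mult[of e "f x" "card F * e" "prod f F"] by simp
qed

lemma ebd_ex: "\<exists>e. ebd e p"
proof (induction p rule: mp_induct)
  case zero
  show ?case using ebd_zero by blast
next
  case (single m c)
  define e where "e = nat (- fls_subdegree c)"
  have "fls_subdegree (fls_X ^ e * c) = int e + fls_subdegree c"
    using single by (simp add: fls_subdegree_mult)
  then have "fls_subdegree (fls_X ^ e * c) \<ge> 0" by (simp add: e_def)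
  then have "fps_to_fls (fls_regpart (fls_X ^ e * c)) = fls_X ^ e * c"
    by (rule fls_regpart_to_fls_trivial)
  then have "mcst (fls_X ^ e) * Poly_Mapping.single m c = emb (Poly_Mapping.single m (fls_regpart (fls_X ^ e * c)))"
    by (simp add: mult_single mapc_single[OF fps_to_fls_hom])
  then show ?case unfolding ebd_def by blast
next
  case (add p q)
  then obtain e e' where "ebd e p" "ebd e' q" by blast
  then have "ebd (e + e') (p + q)" by (intro ebd_add) (auto intro: ebd_mono)
  then show ?case by blast
qed

lemma mcst_power: "mcst (c ^ n) = (mcst c ^ n :: 'k::comm_ring_1 mp)"
  by (induction n) (simp_all add: mcst_mult single_one)

lemma mcst_flsX_cancel: "mcst (fls_X ^ n) * p = mcst (fls_X ^ n) * p' \<Longrightarrow> p = (p' :: 'k::field fls mp)"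
proof -
  assume e: "mcst (fls_X ^ n) * p = mcst (fls_X ^ n) * p'"
  have i: "(mcst (inverse (fls_X ^ n)) * mcst (fls_X ^ n) :: 'k fls mp) = 1"
    by (simp add: mult_single single_one)
  have "mcst (inverse (fls_X ^ n)) * (mcst (fls_X ^ n) * p) = mcst (inverse (fls_X ^ n)) * (mcst (fls_X ^ n) * p')"
    by (simp only: e)
  then show ?thesis by (simp only: mult.assoc[symmetric] i mult_1)
qed

lemma primitive_fls:
  fixes p :: "'k::field fls mp"
  assumes "p \<noteq> 0"
  shows "\<exists>n a p'. mcst (fls_X ^ n) * p = mcst (fls_X ^ a) * emb p' \<and> rd p' \<noteq> 0"
proof -
  obtain n z where z: "mcst (fls_X ^ n) * p = emb z" using ebd_ex[of p] by (auto simp: ebd_def)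
  have "z \<noteq> 0"
  proof
    assume "z = 0"
    then have "mcst (fls_X ^ n) * p = mcst (fls_X ^ n) * 0" by (simp add: z)
    then show False using mcst_flsX_cancel assms by blast
  qed
  then obtain a p' where p': "z = mcst (fps_X ^ a) * p'" "rd p' \<noteq> 0" using primitive_part by blast
  have "mcst (fls_X ^ n) * p = mcst (fls_X ^ a) * emb p'"
    by (simp only: z p'(1) emb_hom.hom_mult emb_X_power)
  then show ?thesis using p'(2) by blast
qed

text \<open>Valuations are multiplicative, so bounded denominators of all powers mean no denominator.\<close>

lemma integral_of_powers:
  fixes P :: "'k::field fls mp"
  assumes bd: "\<And>l. ebd n (P ^ l)"
  shows "\<exists>z. P = emb z"
proof (cases "P = 0")
  case True
  then show ?thesis by (metis emb_hom.hom_zero)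
next
  case False
  then obtain k a p' where e: "mcst (fls_X ^ k) * P = mcst (fls_X ^ a) * emb p'" and p': "rd p' \<noteq> 0"
    using primitive_fls by blast
  show ?thesis
  proof (cases "k \<le> a")
    case True
    then have "mcst (fls_X ^ k) * P = mcst (fls_X ^ k) * emb (mcst (fps_X ^ (a - k)) * p')"
      by (simp only: e emb_hom.hom_mult emb_X_power)
         (simp add: mult.assoc[symmetric] mult_single power_add[symmetric])
    then show ?thesis using mcst_flsX_cancel by blast
  next
    case False
    define j where "j = k - a"
    have j: "j \<ge> 1" "k = a + j" using False by (auto simp: j_def)
    have "mcst (fls_X ^ a) * (mcst (fls_X ^ j) * P) = mcst (fls_X ^ a) * emb p'"
      unfolding e[symmetric] j(2) by (simp add: mult.assoc[symmetric] mult_single power_add)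
    then have jP: "mcst (fls_X ^ j) * P = emb p'" by (rule mcst_flsX_cancel)
    \<comment> \<open>P is s^-j times a polynomial with nonzero reduction, and reductions multiply
      without zero divisors, so P^l has a pole of order j l. With l = n + 1 this exceeds the allowed
      n.\<close>
    define l where "l = n + 1"
    obtain z where z: "mcst (fls_X ^ n) * P ^ l = emb z" using bd[of l] by (auto simp: ebd_def)
    have "j * l \<ge> n + 1" using mult_le_mono1[OF j(1), of l] by (simp add: l_def)
    then have jl: "j * l = (j * l - n) + n" by simp
    have "emb (p' ^ l) = (mcst (fls_X ^ j) * P) ^ l" by (simp add: emb_hom.hom_power jP)
    also have "\<dots> = mcst (fls_X ^ (j * l)) * P ^ l"
      by (simp add: power_mult_distrib power_mult mcst_power)
    also have "\<dots> = mcst (fls_X ^ (j * l - n)) * (mcst (fls_X ^ n) * P ^ l)"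
      by (subst jl, subst power_add) (simp add: mcst_mult mult.assoc)
    also have "\<dots> = emb (mcst (fps_X ^ (j * l - n)) * z)"
      by (simp only: z emb_hom.hom_mult emb_X_power)
    finally have "p' ^ l = mcst (fps_X ^ (j * l - n)) * z" by (simp only: emb_eq_iff)
    then have "rd (p' ^ l) = 0" using \<open>j * l \<ge> n + 1\<close> by (simp add: rd_X_mult)
    then have "rd p' ^ l = 0" by (simp add: rd_hom.hom_power)
    then show ?thesis using p' by simp
  qed
qed

context pert
begin

text \<open>The reduction at \<open>s = 0\<close> of the quotient by \<open>J\<close> is finite over the polynomials without the variables in \<open>Y\<close>.\<close>

definition Sp :: "nat \<Rightarrow> bool" where
  "Sp n \<longleftrightarrow> (\<forall>p. \<exists>z. emb p - emb z \<in> J \<and> (\<forall>m\<in>keys z. \<forall>v\<in>Y. count m v < n))"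

text \<open>An entry of column j is the coordinate \<open>L i\<close> of a product with the j-th
  basis monomial, and \<open>L i\<close> is linear over the \<open>Y\<close>-free polynomials. Under
  \<open>Sp n\<close> an element without poles is congruent to a combination of the finitely many
  monomials in \<open>A\<close> with coefficients without poles, so the poles of \<open>L i\<close>
  at these monomials bound all others.\<close>

lemma entries_bounded:
  assumes "Sp n"
  shows "\<exists>e. \<forall>p i j. i < D \<longrightarrow> j < D \<longrightarrow> ebd e (M (emb p) $$ (i, j))"
proof -
  have "{#} \<in> stdY" using r by (simp add: stdY_def stdm_def)
  then obtain i0 where i0: "i0 < D" "al ! i0 = {#}" using al by (metis in_set_conv_nth)
  define L where "L i p = M p $$ (i, i0)" for i p
  have L_add: "L i (p + p') = L i p + L i p'" if "i < D" for i p p'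
    using that i0 by (simp add: L_def M_add)
  have L_scal: "L i (c * p) = c * L i p" if "i < D" "yfree Y c" for i c p
    using that i0 by (simp add: L_def M_scal)
  have L0: "L i 0 = 0" if "i < D" for i using L_scal[OF that, of 0 0] by (simp add: yfree_intros)
  have L_sum: "L i (sum f A) = (\<Sum>a\<in>A. L i (f a))" if "i < D" for i and f :: "nat multiset \<Rightarrow> _" and A
    by (induction A rule: infinite_finite_induct) (simp_all add: L_add L0 that)
  define A where "A = {\<alpha>. set_mset \<alpha> \<subseteq> Y \<and> (\<forall>v\<in>Y. count \<alpha> v < n)}"
  have finA: "finite A"
  proof (rule finite_subset[OF _ finite_multisets_le[OF finY, of "card Y * n"]])
    show "A \<subseteq> {m. set_mset m \<subseteq> Y \<and> size m \<le> card Y * n}"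
    proof
      fix m assume m: "m \<in> A"
      have "size m = (\<Sum>v\<in>set_mset m. count m v)" by (simp add: size_multiset_overloaded_eq)
      also have "\<dots> \<le> (\<Sum>v\<in>Y. count m v)" by (rule sum_mono2) (use m finY in \<open>auto simp: A_def\<close>)
      also have "\<dots> \<le> (\<Sum>v\<in>Y. n)" by (rule sum_mono) (use m in \<open>auto simp: A_def less_imp_le\<close>)
      finally show "m \<in> {m. set_mset m \<subseteq> Y \<and> size m \<le> card Y * n}" using m by (simp add: A_def)
    qed
  qed
  define ex where "ex i \<alpha> = (SOME e. ebd e (L i (mmon \<alpha>)))" for i \<alpha>
  have ex: "ebd (ex i \<alpha>) (L i (mmon \<alpha>))" for i \<alpha>
    unfolding ex_def by (rule someI_ex[OF ebd_ex])
  define e where "e = (\<Sum>i<D. \<Sum>\<alpha>\<in>A. ex i \<alpha>)"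
  have exe: "ex i \<alpha> \<le> e" if "i < D" "\<alpha> \<in> A" for i \<alpha>
  proof -
    have "ex i \<alpha> \<le> (\<Sum>\<alpha>\<in>A. ex i \<alpha>)" by (rule member_le_sum) (use that finA in auto)
    also have "\<dots> \<le> e" unfolding e_def by (rule member_le_sum) (use that in auto)
    finally show ?thesis .
  qed
  have "ebd e (M (emb p) $$ (i, j))" if ij: "i < D" "j < D" for p i j
  proof -
    have eq: "M (emb p) $$ (i, j) = L i (emb (p * mmon (al ! j)))"
      using ij i0 by (simp add: L_def M_def single_one emb_hom.hom_mult mapc_single[OF fps_to_fls_hom])
    obtain z where z: "emb (p * mmon (al ! j)) - emb z \<in> J" "\<forall>m\<in>keys z. \<forall>v\<in>Y. count m v < n"
      using assms unfolding Sp_def by blast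
    have "filter_mset (\<lambda>v. v \<in> Y) m \<in> A" if "m \<in> keys z" for m
      using z(2) that by (auto simp: A_def)
    from cfy_decomp[OF finA this] have zd: "z = (\<Sum>a\<in>A. cfy Y a z * mmon a)" .
    have "L i (emb (p * mmon (al ! j))) = L i (emb z)"
      using M_congruent[OF z(1)] by (simp add: L_def)
    also have "\<dots> = L i (\<Sum>a\<in>A. emb (cfy Y a z) * mmon a)"
      by (subst zd) (simp add: emb_hom.hom_sum emb_hom.hom_mult mapc_single[OF fps_to_fls_hom])
    also have "\<dots> = (\<Sum>a\<in>A. emb (cfy Y a z) * L i (mmon a))"
    proof -
      have "yfree Y (emb (cfy Y a z))" for a
        using yfree_cfy[of Y a z] by (simp add: yfree_def mvars_emb)
      then show ?thesis using ij by (simp add: L_sum L_scal)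
    qed
    also have "ebd e \<dots>"
    proof (rule ebd_sum)
      fix a assume "a \<in> A"
      then show "ebd e (emb (cfy Y a z) * L i (mmon a))"
        using ebd_mult[OF ebd_emb ebd_mono[OF ex exe[OF ij(1)]]] by simp
    qed
    finally show ?thesis by (simp only: eq)
  qed
  then show ?thesis by blast
qed

text \<open>One bound on the poles holds for all powers of \<open>p\<close> at once, and the norm of
  a power is the power of the norm.\<close>

lemma N_integral:
  assumes "Sp n"
  shows "\<exists>z. N (emb p) = emb z"
proof -
  obtain e where e: "\<And>p i j. i < D \<Longrightarrow> j < D \<Longrightarrow> ebd e (M (emb p) $$ (i, j))"
    using entries_bounded[OF assms] by blast
  have bd: "ebd (D * e) (N (emb p))" for p
  proof -
    have "ebd (D * e) (signof \<pi> * (\<Prod>i = 0..<D. M (emb p) $$ (i, \<pi> i)))"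
      if \<pi>: "\<pi> permutes {0..<D}" for \<pi>
    proof -
      have "ebd (card {0..<D} * e) (\<Prod>i = 0..<D. M (emb p) $$ (i, \<pi> i))"
        by (intro ebd_prod e) (use permutes_in_image[OF \<pi>] in auto)
      moreover have "ebd 0 (signof \<pi> :: 'k fls mp)"
        using ebd_emb[of "1 :: 'k fps mp"] ebd_emb[of "- 1 :: 'k fps mp"] by (simp add: sign_def emb_hom.hom_uminus emb_hom.hom_one)
      ultimately show ?thesis using ebd_mult by fastforce
    qed
    then show ?thesis unfolding N_def det_def M_carrier if_P[OF refl] by (intro ebd_sum) simp
  qed
  have "ebd (D * e) (N (emb p) ^ l)" for l
    using bd[of "p ^ l"] by (simp add: emb_hom.hom_power N_power)
  then show ?thesis by (rule integral_of_powers)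
qed

end

section \<open>Generic projection, one direction at a time\<close>

text \<open>The shear w -> w + y b of the coordinates in \<open>W\<close>: invertible, degree
  preserving, and making \<open>y\<close> the coordinate along \<open>b\<close>.\<close>

definition shf :: "nat set \<Rightarrow> nat \<Rightarrow> (nat \<Rightarrow> 'a::comm_ring_1) \<Rightarrow> 'a mp \<Rightarrow> 'a mp" where
  "shf W y b = msub (\<lambda>v. if v \<in> W then mvar v + mcst (b v) * mvar y else mvar v)"

lemma shf_hom: "comm_ring_hom (shf W y b)"
  unfolding shf_def by (rule msub_hom)

lemma shf_var: "shf W y b (mvar v) = (if v \<in> W then mvar v + mcst (b v) * mvar y else mvar v)"
  unfolding shf_def by (rule mev_var[OF mcst_hom])

lemma shf_cst: "shf W y b (mcst c) = mcst c"
  unfolding shf_def by (rule mev_cst[OF mcst_hom])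

lemma mapc_shf:
  assumes h: "comm_ring_hom h"
  shows "mapc h (shf W y b p) = shf W y (\<lambda>v. h (b v)) (mapc h p)"
proof -
  interpret h: comm_ring_hom "mapc h" by (rule mapc_hom[OF h])
  have "(\<lambda>v. mapc h (if v \<in> W then mvar v + mcst (b v) * mvar y else mvar v)) =
      (\<lambda>v. if v \<in> W then mvar v + mcst (h (b v)) * mvar y else mvar v)"
    by (auto simp: fun_eq_iff h.hom_add h.hom_mult h)
  then show ?thesis
    unfolding shf_def by (simp add: mapc_mev[OF h mcst_hom] mev_mapc[OF h mcst_hom] h)
qed

lemma shf_inverse: "y \<notin> W \<Longrightarrow> shf W y b (shf W y (\<lambda>v. - b v) p) = p"
proof (rule hom_ext_mp[where \<psi> = "\<lambda>p. p"])
  assume y: "y \<notin> W"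
  interpret s: comm_ring_hom "shf W y b" by (rule shf_hom)
  show "comm_ring_hom (\<lambda>p. shf W y b (shf W y (\<lambda>v. - b v) p))"
    by (rule comm_ring_hom_compose[OF shf_hom shf_hom])
  show "shf W y b (shf W y (\<lambda>v. - b v) (mvar v)) = mvar v" for v
    using y by (simp add: shf_var s.hom_add s.hom_minus s.hom_mult shf_cst single_uminus)
qed (simp_all add: shf_cst comm_ring_hom_id)

lemma whom_shf:
  assumes "whom w d p" "\<And>v. v \<in> W \<Longrightarrow> w v = w y"
  shows "whom w d (shf W y b p)"
  unfolding shf_def
proof (rule whom_mev[OF assms(1)])
  fix v
  have "whom w (0 + w y) (mcst (b v) * mvar y)" by (intro whom_mult whom_cst whom_var)
  then show "whom w (w v) (if v \<in> W then mvar v + mcst (b v) * mvar y else mvar v)"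
    using assms(2)[of v] whom_var[of w v] by (auto intro: whom_add)
qed simp

lemma mvars_shf: "mvars (shf W y b p) \<subseteq> insert y (mvars p)"
  unfolding shf_def
proof (rule mvars_mev)
  fix v assume v: "v \<in> mvars p"
  have "mvars (mcst (b v) * mvar y) \<subseteq> {y}"
    using mvars_mult[of "mcst (b v)" "mvar y"] mvars_single[of "{#y#}"] by fastforce
  then show "mvars (if v \<in> W then mvar v + mcst (b v) * mvar y else mvar v) \<subseteq> insert y (mvars p)"
    using v mvars_single[of "{#v#}" "1::'a"] mvars_add[of "mvar v" "mcst (b v) * mvar y"]
    by (auto split: if_splits)
qed simp

text \<open>For the weight that is 1 at \<open>u\<close> and 0 elsewhere the shear is homogeneous,
  because \<open>u\<close> is neither sheared nor the direction variable.\<close>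

lemma count_shf:
  assumes "u \<notin> W" "u \<noteq> y" "\<And>m. m \<in> keys p \<Longrightarrow> count m u < n" "m \<in> keys (shf W y b p)"
  shows "count m u < n"
proof -
  interpret s: comm_ring_hom "shf W y b" by (rule shf_hom)
  define w :: "nat \<Rightarrow> nat" where "w v = (if v = u then 1 else 0)" for v
  have wd: "wdeg w m = count m u" for m
    by (induction m) (simp_all add: w_def)
  have "shf W y b p = (\<Sum>k\<in>keys p. shf W y b (Poly_Mapping.single k (lookup p k)))"
    by (subst mp_sum_monomials) (simp add: s.hom_sum)
  then have "m \<in> (\<Union>k\<in>keys p. keys (shf W y b (Poly_Mapping.single k (lookup p k))))"
    using assms(4) keys_sum by fastforce
  then obtain k where k: "k \<in> keys p" "m \<in> keys (shf W y b (Poly_Mapping.single k (lookup p k)))" by blast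
  have "whom w (wdeg w k) (shf W y b (Poly_Mapping.single k (lookup p k)))"
    by (rule whom_shf[OF whom_single]) (use assms(1,2) in \<open>auto simp: w_def\<close>)
  then show ?thesis using k assms(3) by (simp add: whom_def wd)
qed

lemma lookup_unit_eval:
  assumes "whom (\<lambda>_. 1) d p"
  shows "meval (\<lambda>v. if v = y then 1 else 0) p = lookup p (replicate_mset d y)"
proof -
  have pm: "prod_mset (image_mset (\<lambda>v. if v = y then 1 else (0 :: 'a)) m) =
      (if set_mset m \<subseteq> {y} then 1 else 0)" for m
    by (induction m) auto
  have eq: "set_mset m \<subseteq> {y} \<longleftrightarrow> m = replicate_mset d y" if "m \<in> keys p" for m
  proof -
    have "size m = d" using assms that unfolding whom_def wdeg_one by blast
    then show ?thesis by (metis set_mset_subset_singletonD size_replicate_mset set_mset_replicate_mset_subset subset_insertI empty_subsetI order_refl)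
  qed
  have "meval (\<lambda>v. if v = y then 1 else 0) p = (\<Sum>m\<in>keys p. if m = replicate_mset d y then lookup p m else 0)"
    unfolding mev_def by (rule sum.cong[OF refl]) (simp add: pm eq)
  also have "\<dots> = lookup p (replicate_mset d y)" by (simp add: in_keys_iff)
  finally show ?thesis .
qed

text \<open>Division by a polynomial monic in \<open>y\<close>, by induction on the exponent of
  \<open>y\<close>. As the lower terms of \<open>h\<close> are free of \<open>Y\<close>, the bound
  on the exponents of \<open>Y\<close> survives.\<close>

lemma monic_division:
  fixes h' :: "'a::comm_ring_1 mp"
  assumes h: "h = mvar y ^ n + h'" and h': "\<And>m. m \<in> keys h' \<Longrightarrow> count m y < n"
    and Y: "y \<notin> Y" "\<And>m v. m \<in> keys h' \<Longrightarrow> v \<in> Y \<Longrightarrow> count m v = 0"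
  shows "(\<And>m v. m \<in> keys p \<Longrightarrow> v \<in> Y \<Longrightarrow> count m v < b) \<Longrightarrow>
     \<exists>z c. p - z = c * h \<and> (\<forall>m\<in>keys z. count m y < n \<and> (\<forall>v\<in>Y. count m v < b))"
proof -
  define R where "R = {p. \<exists>z c. p - z = c * h \<and> (\<forall>m\<in>keys z. count m y < n \<and> (\<forall>v\<in>Y. count m v < b))}"
  have R0: "0 \<in> R" unfolding R_def by (auto intro!: exI[of _ 0])
  have Radd: "p + p' \<in> R" if "p \<in> R" "p' \<in> R" for p p'
  proof -
    from that obtain z c z' c' where 1: "p - z = c * h" "\<forall>m\<in>keys z. count m y < n \<and> (\<forall>v\<in>Y. count m v < b)"
      and 2: "p' - z' = c' * h" "\<forall>m\<in>keys z'. count m y < n \<and> (\<forall>v\<in>Y. count m v < b)"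
      unfolding R_def by blast
    have "(p + p') - (z + z') = (c + c') * h" using 1(1) 2(1) by (simp add: algebra_simps)
    moreover have "\<forall>m\<in>keys (z + z'). count m y < n \<and> (\<forall>v\<in>Y. count m v < b)"
      using 1(2) 2(2) keys_add[of z z'] by blast
    ultimately show ?thesis unfolding R_def by blast
  qed
  have Rsum: "sum f A \<in> R" if "\<And>i. i \<in> A \<Longrightarrow> f i \<in> R" for f :: "nat multiset \<Rightarrow> 'a mp" and A
    using that by (induction A rule: infinite_finite_induct) (simp_all add: R0 Radd)
  have mono: "Poly_Mapping.single m c \<in> R" if "\<forall>v\<in>Y. count m v < b" for m c
    using that
  proof (induction "count m y" arbitrary: m c rule: less_induct)
    case less
    show ?case
    proof (cases "count m y < n")
      case True
      have "Poly_Mapping.single m c - Poly_Mapping.single m c = 0 * h" by simp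
      moreover have "\<forall>k\<in>keys (Poly_Mapping.single m c). count k y < n \<and> (\<forall>v\<in>Y. count k v < b)"
        using True less.prems by simp
      ultimately show ?thesis unfolding R_def by blast
    next
      case False
      define m' where "m' = m - replicate_mset n y"
      have m: "m = m' + replicate_mset n y"
        using False by (simp add: m'_def multiset_eq_iff)
      define t where "t = - (Poly_Mapping.single m' c * h')"
      have eq: "Poly_Mapping.single m c = t + Poly_Mapping.single m' c * h"
        by (simp add: t_def h distrib_left m mult_single mvar_power)
      have "t = (\<Sum>k\<in>keys h'. Poly_Mapping.single (m' + k) (- (c * lookup h' k)))"
        unfolding t_def by (subst mp_sum_monomials[of h']) (simp add: sum_distrib_left mult_single sum_negf single_uminus)
      also have "\<dots> \<in> R"
      proof (rule Rsum)
        fix k assume k: "k \<in> keys h'"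
        show "Poly_Mapping.single (m' + k) (- (c * lookup h' k)) \<in> R"
        proof (rule less.hyps)
          show "count (m' + k) y < count m y" using h'[OF k] by (simp add: m)
          show "\<forall>v\<in>Y. count (m' + k) v < b" using less.prems Y k by (auto simp: m)
        qed
      qed
      finally have "t \<in> R" .
      moreover have "Poly_Mapping.single m' c * h - 0 = Poly_Mapping.single m' c * h" by simp
      then have "Poly_Mapping.single m' c * h \<in> R"
        unfolding R_def mem_Collect_eq by (intro exI[of _ 0] exI[of _ "Poly_Mapping.single m' c"]) simp
      ultimately show ?thesis unfolding eq by (rule Radd)
    qed
  qed
  assume "\<And>m v. m \<in> keys p \<Longrightarrow> v \<in> Y \<Longrightarrow> count m v < b"
  then have "p \<in> R"
    by (subst mp_sum_monomials) (intro Rsum mono ballI)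
  then show ?thesis unfolding R_def by blast
qed

text \<open>Monomials of equal degree that agree outside \<open>y\<close> are equal, so no two terms
  merge.\<close>

lemma dehomogenize_nonzero:
  assumes p: "whom (\<lambda>_. 1) d p" "p \<noteq> (0 :: 'a::comm_ring_1 mp)" "mvars p \<subseteq> insert y W" and y: "y \<notin> W"
  defines "H \<equiv> msub (\<lambda>v. if v = y then 1 else mvar v) p"
  shows "H \<noteq> 0" "mvars H \<subseteq> W" "\<And>m. m \<in> keys H \<Longrightarrow> size m \<le> d"
proof -
  let ?f = "filter_mset (\<lambda>v. v \<noteq> y)"
  have pm: "prod_mset (image_mset (\<lambda>v. if v = y then 1 else mvar v) m) = (mmon (?f m) :: 'a mp)" for m
  proof (induction m)
    case (add v m)
    have "(mmon (add_mset v (?f m)) :: 'a mp) = mvar v * mmon (?f m)" by (simp add: mult_single)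
    with add show ?case by simp
  qed (simp add: single_one)
  have H: "H = (\<Sum>m\<in>keys p. Poly_Mapping.single (?f m) (lookup p m))"
    unfolding H_def mev_def pm by (simp add: mult_single)
  have sz: "size m = d" if "m \<in> keys p" for m using p(1) that unfolding whom_def wdeg_one by blast
  have szf: "size m = size (?f m) + count m y" for m
  proof -
    have "m = ?f m + filter_mset (\<lambda>v. v = y) m" using multiset_partition[of m "\<lambda>v. v \<noteq> y"] by simp
    then have "size m = size (?f m) + size (filter_mset (\<lambda>v. v = y) m)" by (metis size_union)
    then show ?thesis by (simp add: filter_eq_replicate_mset)
  qed
  have inj: "m = m'" if "m \<in> keys p" "m' \<in> keys p" "?f m = ?f m'" for m m'
  proof (rule multiset_eqI)
    fix v
    have cy: "count m y = count m' y" using sz[OF that(1)] sz[OF that(2)] szf[of m] szf[of m'] that(3) by simp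
    show "count m v = count m' v"
      using cy arg_cong[OF that(3), of "\<lambda>k. count k v"] by (cases "v = y") simp_all
  qed
  obtain m0 where m0: "m0 \<in> keys p" using p(2) by (metis keys_eq_empty equals0I)
  have "lookup H (?f m0) = (\<Sum>m\<in>keys p. if m = m0 then lookup p m else 0)"
    unfolding H lookup_sum
    by (rule sum.cong[OF refl]) (use inj[OF _ m0] in \<open>auto simp: lookup_single when_def\<close>)
  also have "\<dots> = lookup p m0" using m0 by simp
  finally have "lookup H (?f m0) \<noteq> 0" using m0 by (simp add: in_keys_iff)
  then show "H \<noteq> 0" by auto
  have keysH: "\<exists>m'\<in>keys p. m = ?f m'" if "m \<in> keys H" for m
    using that keys_sum[of "\<lambda>m. Poly_Mapping.single (?f m) (lookup p m)" "keys p"]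
    unfolding H[symmetric] by (fastforce split: if_splits)
  show "size m \<le> d" if "m \<in> keys H" for m
    using keysH[OF that] sz szf by (metis le_add1)
  show "mvars H \<subseteq> W"
    unfolding mvars_def using keysH p(3) by (fastforce simp: mvars_def)
qed

context pert
begin

text \<open>Seen as a polynomial in \<open>y\<close>, the norm is the characteristic polynomial of
  \<open>- M p\<close> at s y^r. It is monic, and composition with a nonconstant polynomial cannot
  kill it.\<close>

lemma N_perturbed_nonzero:
  assumes y: "y \<notin> Y" "y \<notin> qvars" and p: "y \<notin> mvars p"
  shows "N (mcst fls_X * mvar y ^ r + p) \<noteq> 0"
proof -
  let ?h = "\<lambda>c. [:mcst c:] :: 'k fls mp poly"
  have c1: "comm_ring_hom (\<lambda>p. [:p:] :: 'k fls mp poly)"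
    by unfold_locales (auto simp: one_pCons)
  have h: "comm_ring_hom ?h" by (rule comm_ring_hom_compose[OF c1 mcst_hom])
  define \<phi> where "\<phi> = mev ?h (\<lambda>v. if v = y then [:0, 1:] else [:mvar v:])"
  interpret \<phi>: comm_ring_hom \<phi> unfolding \<phi>_def by (rule mev_hom[OF h])
  have free: "\<phi> x = [:x:]" if "y \<notin> mvars x" for x
    unfolding \<phi>_def
    by (rule hom_ext_mp[OF mev_hom[OF h] c1]) (use that in \<open>auto simp: mev_cst[OF h] mev_var[OF h]\<close>)
  define t :: "'k fls mp poly" where "t = [:mcst fls_X:] * [:0, 1:] ^ r"
  have ph: "comm_ring_hom (\<lambda>q. pcompose q t)" by unfold_locales (simp_all add: pcompose_add pcompose_mult)
  define A where "A = M p"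
  have A: "A \<in> carrier_mat D D" by (simp add: A_def)
  have yf: "yfree Y (mcst fls_X * mvar y ^ r :: 'k fls mp)"
  proof -
    have "mvars (mcst fls_X * mvar y ^ r :: 'k fls mp) \<subseteq> {y}"
      using mvars_mult[of "mcst fls_X" "mvar y ^ r"] mvars_power[of "mvar y" r] mvars_single[of "{#y#}"]
      by fastforce
    then show ?thesis using y(1) by (auto simp: yfree_def)
  qed
  have Mu: "M (mcst fls_X * mvar y ^ r + p) = (mcst fls_X * mvar y ^ r) \<cdot>\<^sub>m 1\<^sub>m D + A"
    by (simp add: M_add M_yfree[OF yf] A_def)
  have "\<phi> (mcst fls_X * mvar y ^ r) = t"
    unfolding t_def \<phi>.hom_mult \<phi>.hom_power by (simp add: \<phi>_def mev_cst[OF h] mev_var[OF h])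
  moreover have "\<phi> (A $$ (i, j)) = [:A $$ (i, j):]" if "i < D" "j < D" for i j
    by (rule free) (use mvars_M[OF that, of p] y p in \<open>auto simp: A_def\<close>)
  ultimately have "map_mat \<phi> (M (mcst fls_X * mvar y ^ r + p)) = map_mat (\<lambda>q. pcompose q t) (char_poly_matrix (- A))"
    using A by (intro eq_matI) (auto simp: Mu char_poly_matrix_def \<phi>.hom_add \<phi>.hom_zero pcompose_pCons)
  then have "\<phi> (N (mcst fls_X * mvar y ^ r + p)) = pcompose (char_poly (- A)) t"
    unfolding N_def char_poly_def \<phi>.hom_det[symmetric] comm_ring_hom.hom_det[OF ph, symmetric] by simp
  moreover have "pcompose (char_poly (- A)) t \<noteq> 0"
  proof
    assume z: "pcompose (char_poly (- A)) t = 0"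
    have "monic (char_poly (- A))" using degree_monic_char_poly[of "- A" D] A by simp
    then have "char_poly (- A) \<noteq> 0" by auto
    moreover have "degree t > 0"
    proof -
      have "t = monom (mcst fls_X) r" by (simp add: t_def monom_altdef)
      moreover have "(mcst fls_X :: 'k fls mp) \<noteq> 0" 
        using mcst_flsX_cancel[of 1 1 0] by (auto simp: power_one_right)
      ultimately show ?thesis using r by (simp add: degree_monom_eq)
    qed
    ultimately show False using z pcompose_eq_0 by blast
  qed
  ultimately show ?thesis by auto
qed

end

lemma fps_unit: "fps_nth \<eta> 0 \<noteq> 0 \<Longrightarrow> inverse \<eta> * \<eta> = (1 :: 'k::field fps)"
  by (rule inverse_mult_eq_1)

text \<open>The form \<open>H\<close> is the limit of the norm of the new generator; where it does not vanish, the
  projection from the new direction keeps the limit finite over the remaining coordinates.\<close>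

lemma projection_step:
  fixes q :: "nat \<Rightarrow> 'k::field mp"
  assumes P: "pert Y q r" and Sp: "pert.Sp Y q r n" and Qn: "whom (\<lambda>_. 1) r Qn"
    and vars: "\<And>v. v \<in> Y \<Longrightarrow> mvars (q v) \<subseteq> W \<union> Y" "mvars Qn \<subseteq> W \<union> Y"
    and disj: "W \<inter> Y = {}" "y \<notin> W" "y \<notin> Y"
  shows "\<exists>H. H \<noteq> 0 \<and> mvars H \<subseteq> W \<and> (\<forall>m\<in>keys H. size m \<le> r ^ (card Y + 1)) \<and>
     (\<forall>b. meval b H \<noteq> 0 \<longrightarrow>
        (\<exists>n'. pert.Sp (insert y Y) (\<lambda>v. shf W y b (if v = y then Qn else q v)) r n'))"
proof -
  interpret pert Y q r by (rule P)
  have qv: "qvars \<subseteq> W \<union> Y" using vars(1) by (auto simp: qvars_def)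
  then have y: "y \<notin> qvars" using disj by blast
  have yQ: "y \<notin> mvars (inc Qn)" using mvars_mapc[OF fls_const_hom, of Qn] vars(2) disj by blast
  \<comment> \<open>The new generator before the shear. Its norm, rescaled by a power of s, is
    \<open>C\<close>; the reduction of \<open>C\<close> is a nonzero form of degree r^(card Y + 1),
    and \<open>H\<close> is this form at y = 1.\<close>
  define u where "u = mcst fls_X * mvar y ^ r + inc Qn"
  have "N u \<noteq> 0" unfolding u_def by (rule N_perturbed_nonzero[OF disj(3) y yQ])
  then obtain k a C where C: "mcst (fls_X ^ k) * N u = mcst (fls_X ^ a) * emb C" "rd C \<noteq> 0"
    using primitive_fls by blast
  have keysC: "keys C \<subseteq> keys (N u)"
  proof
    fix m assume "m \<in> keys C"
    then have "lookup (mcst (fls_X ^ a) * emb C) m \<noteq> 0"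
      by (simp add: lookup_mcst_mult in_keys_iff lookup_mapc[OF fps_to_fls_hom])
    then have "lookup (mcst (fls_X ^ k) * N u) m \<noteq> 0" unfolding C(1) .
    then show "m \<in> keys (N u)" by (auto simp: lookup_mcst_mult in_keys_iff)
  qed
  have keysrC: "keys (rd C) \<subseteq> keys (N u)" using keysC keys_mapc[OF fps_nth0_hom, of C] by blast
  let ?d = "r ^ (card Y + 1)"
  have "whom (\<lambda>_. 1) (0 + r * 1) (mcst fls_X * mvar y ^ r :: 'k fls mp)"
    by (intro whom_mult whom_cst whom_power whom_var)
  then have "whom (\<lambda>_. 1) r u"
    unfolding u_def by (intro whom_add whom_mapc fls_const_hom Qn) simp
  then have "whom (\<lambda>_. 1) (D * r) (N u)" by (rule whom_N[OF refl])
  then have wNu: "whom (\<lambda>_. 1) ?d (N u)" by (simp add: mult.commute)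
  have wC: "whom (\<lambda>_. 1) ?d C" using wNu keysC unfolding whom_def by blast
  have wrC: "whom (\<lambda>_. 1) ?d (rd C)" using wNu keysrC unfolding whom_def by blast
  have mu: "mvars u \<subseteq> insert y (W \<union> Y)"
  proof -
    have "mvars (mcst fls_X * mvar y ^ r :: 'k fls mp) \<subseteq> {y}"
      using mvars_mult[of "mcst fls_X" "mvar y ^ r"] mvars_power[of "mvar y" r] mvars_single[of "{#y#}"]
      by fastforce
    then show ?thesis
      using mvars_add[of "mcst fls_X * mvar y ^ r" "inc Qn"] mvars_mapc[OF fls_const_hom, of Qn] vars(2)
      unfolding u_def by blast
  qed
  have mN: "mvars (N u) \<subseteq> insert y W" using mvars_N[of u] mu qv by blast
  then have mC: "mvars C \<subseteq> insert y W" and mrC: "mvars (rd C) \<subseteq> insert y W"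
    using keysC keysrC unfolding mvars_def by blast+
  define H where "H = msub (\<lambda>v. if v = y then 1 else mvar v) (rd C)"
  note Hp = dehomogenize_nonzero[OF wrC C(2) mrC disj(2), folded H_def]
  have main: "\<exists>n'. pert.Sp (insert y Y) (\<lambda>v. shf W y b (if v = y then Qn else q v)) r n'"
    if b: "meval b H \<noteq> 0" for b
  proof -
    define q' where "q' v = shf W y b (if v = y then Qn else q v)" for v
    interpret P': pert "insert y Y" q' r
    proof
      show "finite (insert y Y)" using finY by simp
      show "whom (\<lambda>_. 1) r (q' v)" if "v \<in> insert y Y" for v
        unfolding q'_def by (rule whom_shf) (use that q Qn in auto)
    qed (rule r)
    define \<sigma> where "\<sigma> = shf W y (\<lambda>v. fls_const (b v))"
    interpret \<sigma>: comm_ring_hom \<sigma> unfolding \<sigma>_def by (rule shf_hom)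
    define \<sigma>O where "\<sigma>O = shf W y (\<lambda>v. fps_const (b v))"
    have emb\<sigma>: "emb (\<sigma>O p) = \<sigma> (emb p)" for p
      by (simp add: \<sigma>O_def \<sigma>_def mapc_shf[OF fps_to_fls_hom])
    have \<sigma>inc: "\<sigma> (inc p) = inc (shf W y b p)" for p
      by (simp add: \<sigma>_def mapc_shf[OF fls_const_hom])
    have \<sigma>g: "\<sigma> (g v) = P'.g v" if "v \<in> Y" for v
    proof -
      have "v \<notin> W" "v \<noteq> y" using that disj by auto
      then show ?thesis
        by (simp add: g_def P'.g_def \<sigma>.hom_add \<sigma>.hom_mult \<sigma>.hom_power \<sigma>inc q'_def)
           (simp add: \<sigma>_def shf_cst shf_var)
    qed
    have \<sigma>u: "\<sigma> u = P'.g y"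
      by (simp add: u_def P'.g_def \<sigma>.hom_add \<sigma>.hom_mult \<sigma>.hom_power \<sigma>inc q'_def)
         (simp add: \<sigma>_def shf_cst shf_var disj)
    have gen: "P'.g v \<in> P'.J" if "v \<in> insert y Y" for v
      by (rule idl_gen) (use that finY in auto)
    have \<sigma>J: "\<sigma> p \<in> P'.J" if "p \<in> J" for p
      by (rule idl_hom[OF \<sigma>.comm_ring_hom_axioms _ that]) (simp add: \<sigma>g gen)
    \<comment> \<open>The norm of \<open>u\<close> lies in the ideal of \<open>u\<close> and
      \<open>J\<close>, so the shear takes it into the new ideal; s being a unit among the Laurent
      series, the sheared \<open>C\<close> is there too.\<close>
    obtain v0 where v0: "N u - u * v0 \<in> J" using N_mem by blast
    have "\<sigma> (N u) \<in> P'.J"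
    proof -
      have "\<sigma> (N u) - \<sigma> u * \<sigma> v0 \<in> P'.J" using \<sigma>J[OF v0] by (simp add: \<sigma>.hom_minus \<sigma>.hom_mult)
      moreover have "\<sigma> v0 * \<sigma> u \<in> P'.J" unfolding \<sigma>u by (intro idl_mult gen) simp
      ultimately show ?thesis using idl_add by (metis diff_add_cancel mult.commute)
    qed
    then have "\<sigma> (mcst (fls_X ^ k) * N u) \<in> P'.J" by (simp add: \<sigma>.hom_mult idl_mult)
    then have XC: "mcst (fls_X ^ a) * \<sigma> (emb C) \<in> P'.J"
      by (simp only: C(1) \<sigma>.hom_mult) (simp add: \<sigma>_def shf_cst)
    have Xinv: "mcst (inverse (fls_X ^ a)) * (mcst (fls_X ^ a) * \<sigma> (emb C)) = \<sigma> (emb C)"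
      by (simp add: mult.assoc[symmetric] mult_single single_one)
    then have hJ: "emb (\<sigma>O C) \<in> P'.J" using idl_mult[OF XC, of "mcst (inverse (fls_X ^ a))"] by (simp only: Xinv emb\<sigma>)
    define h0 where "h0 = \<sigma>O C"
    have wh0: "whom (\<lambda>_. 1) ?d h0" unfolding h0_def \<sigma>O_def by (rule whom_shf[OF wC refl])
    have mh0: "mvars h0 \<subseteq> insert y W"
      using mvars_shf[of W y "\<lambda>v. fps_const (b v)" C] mC unfolding h0_def \<sigma>O_def by blast
    \<comment> \<open>The coefficient of the pure power of \<open>y\<close> in the sheared
      \<open>C\<close>. Its constant term is the value of the reduced form at y = 1, w = b, that is,
      \<open>H\<close> at \<open>b\<close>; so \<eta> is a unit among the power series and
      \<open>h\<close> is monic in \<open>y\<close>.\<close>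
    define \<eta> where "\<eta> = lookup h0 (replicate_mset ?d y)"
    have "fps_nth \<eta> 0 = lookup (rd h0) (replicate_mset ?d y)"
      by (simp add: \<eta>_def lookup_mapc[OF fps_nth0_hom])
    also have "\<dots> = meval (\<lambda>v. if v = y then 1 else 0) (rd h0)"
      by (rule lookup_unit_eval[symmetric]) (intro whom_mapc fps_nth0_hom wh0)
    also have "rd h0 = shf W y b (rd C)"
      by (simp add: h0_def \<sigma>O_def mapc_shf[OF fps_nth0_hom])
    also have "meval (\<lambda>v. if v = y then 1 else 0) (shf W y b (rd C)) = meval b H"
    proof -
      have e1: "meval (\<lambda>v. if v = y then 1 else 0) (shf W y b (rd C)) =
        meval (\<lambda>v. meval (\<lambda>v. if v = y then 1 else 0) (if v \<in> W then mvar v + mcst (b v) * mvar y else mvar v)) (rd C)"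
        unfolding shf_def by (simp add: hom_mev[OF meval_hom mcst_hom] mev_cst[OF comm_ring_hom_id])
      have e2: "meval b H = meval (\<lambda>v. meval b (if v = y then 1 else mvar v)) (rd C)"
        unfolding H_def by (simp add: hom_mev[OF meval_hom mcst_hom] mev_cst[OF comm_ring_hom_id])
      interpret m: comm_ring_hom "meval (\<lambda>v. if v = y then 1 else (0::'k))" by (rule meval_hom)
      interpret mb: comm_ring_hom "meval b" by (rule meval_hom)
      show ?thesis unfolding e1 e2
      proof (rule mev_cong)
        fix v assume "v \<in> mvars (rd C)"
        then have "v = y \<or> v \<in> W" using mrC by blast
        then show "meval (\<lambda>v. if v = y then 1 else 0) (if v \<in> W then mvar v + mcst (b v) * mvar y else mvar v) =
          meval b (if v = y then 1 else mvar v)"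
          using disj(2) by (auto simp: m.hom_add m.hom_mult mev_var[OF comm_ring_hom_id] mev_cst[OF comm_ring_hom_id])
      qed
    qed
    finally have "fps_nth \<eta> 0 \<noteq> 0" using b by simp
    then have \<eta>: "inverse \<eta> * \<eta> = 1" by (rule fps_unit)
    define h where "h = mcst (inverse \<eta>) * h0"
    define h' where "h' = h - mvar y ^ ?d"
    have lh': "lookup h' m = (if m = replicate_mset ?d y then 0 else inverse \<eta> * lookup h0 m)" for m
      using \<eta> by (auto simp: h'_def h_def lookup_minus lookup_mcst_mult mvar_power lookup_single when_def \<eta>_def)
    have kh': "m \<in> keys h0 \<and> m \<noteq> replicate_mset ?d y" if "m \<in> keys h'" for m
      using that by (auto simp: in_keys_iff lh' split: if_splits)
    have cnt: "count m y < ?d" if m: "m \<in> keys h'" for m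
    proof -
      have sz: "size m = ?d" using kh'[OF m] wh0 unfolding whom_def wdeg_one by blast
      have le: "replicate_mset (count m y) y \<subseteq># m" by (simp add: count_le_replicate_mset_subset_eq[symmetric])
      have "count m y \<noteq> ?d"
      proof
        assume c: "count m y = ?d"
        then have "m = replicate_mset ?d y"
          using le sz by (metis mset_subset_size nat_less_le size_replicate_mset subset_mset.le_imp_less_or_eq)
        then show False using kh'[OF m] by blast
      qed
      moreover have "count m y \<le> ?d" using size_mset_mono[OF le] sz by simp
      ultimately show ?thesis by simp
    qed
    have cY: "count m v = 0" if "m \<in> keys h'" "v \<in> Y" for m v
    proof -
      have "set_mset m \<subseteq> insert y W" using kh'[OF that(1)] mh0 by (auto simp: mvars_def)
      then show ?thesis using that(2) disj by (auto simp: count_eq_zero_iff)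
    qed
    have hJ': "emb h \<in> P'.J" using idl_mult[OF hJ] by (simp add: h_def h0_def emb_hom.hom_mult)
    have "P'.Sp (max n ?d)"
      unfolding P'.Sp_def
    proof
      fix p :: "'k fps mp"
      \<comment> \<open>The shear is undone, the old finiteness bounds the exponents of
        \<open>Y\<close>, and after shearing again division by the monic \<open>h\<close> bounds
        that of \<open>y\<close>.\<close>
      define p' where "p' = shf W y (\<lambda>v. - fps_const (b v)) p"
      have pp': "\<sigma>O p' = p" unfolding \<sigma>O_def p'_def by (rule shf_inverse[OF disj(2)])
      obtain z where z: "emb p' - emb z \<in> J" "\<forall>m\<in>keys z. \<forall>v\<in>Y. count m v < n"
        using Sp unfolding Sp_def by blast
      have 1: "emb p - emb (\<sigma>O z) \<in> P'.J"
        using \<sigma>J[OF z(1)] by (simp add: \<sigma>.hom_minus emb\<sigma>[symmetric] pp')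
      have cz: "count m v < n" if "m \<in> keys (\<sigma>O z)" "v \<in> Y" for m v
        by (rule count_shf[of v W y z n m "\<lambda>v. fps_const (b v)"])
           (use that z(2) disj in \<open>auto simp: \<sigma>O_def\<close>)
      have hh: "h = mvar y ^ ?d + h'" by (simp add: h'_def)
      obtain z' c where z': "\<sigma>O z - z' = c * h" "\<forall>m\<in>keys z'. count m y < ?d \<and> (\<forall>v\<in>Y. count m v < n)"
        using monic_division[OF hh cnt disj(3) cY cz] by blast
      have "emb (\<sigma>O z) - emb z' \<in> P'.J"
        using arg_cong[OF z'(1), of emb] idl_mult[OF hJ', of "emb c"] by (simp add: emb_hom.hom_minus emb_hom.hom_mult)
      with 1 have "emb p - emb z' \<in> P'.J" by (rule idl_trans)
      then show "\<exists>z. emb p - emb z \<in> P'.J \<and> (\<forall>m\<in>keys z. \<forall>v\<in>insert y Y. count m v < max n ?d)"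
        using z'(2) by (intro exI[of _ z']) (auto simp: less_max_iff_disj)
    qed
    then show ?thesis unfolding q'_def by blast
  qed
  show ?thesis
    by (rule exI[of _ H]) (use Hp main in blast)
qed

section \<open>The limit ideal\<close>

definition upol :: "nat \<Rightarrow> 'a::comm_ring_1 mp \<Rightarrow> 'a mp poly" where
  "upol y = mev (\<lambda>c. [:mcst c:]) (\<lambda>v. if v = y then [:0, 1:] else [:mvar v:])"

lemma const_poly_hom: "comm_ring_hom (\<lambda>p. [:p:] :: 'a::comm_ring_1 poly)"
  by unfold_locales (auto simp: one_pCons)

lemma const_mcst_hom: "comm_ring_hom (\<lambda>c. [:mcst c:] :: 'a::comm_ring_1 mp poly)"
  by (rule comm_ring_hom_compose[OF const_poly_hom mcst_hom])

lemma upol_hom: "comm_ring_hom (upol y)"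
  unfolding upol_def by (rule mev_hom[OF const_mcst_hom])

lemma upol_var: "upol y (mvar v) = (if v = y then [:0, 1:] else [:mvar v:])"
  unfolding upol_def by (rule mev_var[OF const_mcst_hom])

lemma upol_cst: "upol y (mcst c) = [:mcst c:]"
  unfolding upol_def by (rule mev_cst[OF const_mcst_hom])

lemma upol_free: "y \<notin> mvars x \<Longrightarrow> upol y x = [:x:]"
  by (rule hom_ext_mp[OF upol_hom const_poly_hom]) (auto simp: upol_var upol_cst)

lemma upol_mapc:
  assumes h: "comm_ring_hom h"
  shows "map_poly (mapc h) (upol y p) = upol y (mapc h p)"
proof -
  interpret h: comm_ring_hom "mapc h" by (rule mapc_hom[OF h])
  interpret mh: map_poly_comm_ring_hom "mapc h" ..
  show ?thesis
  proof (rule hom_ext_mp[where \<phi> = "\<lambda>p. map_poly (mapc h) (upol y p)" and \<psi> = "\<lambda>p. upol y (mapc h p)"])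
    show "comm_ring_hom (\<lambda>p. map_poly (mapc h) (upol y p))"
      by (rule comm_ring_hom_compose[OF mh.comm_ring_hom_axioms upol_hom])
    show "comm_ring_hom (\<lambda>p. upol y (mapc h p))"
      by (rule comm_ring_hom_compose[OF upol_hom mapc_hom[OF h]])
    show "map_poly (mapc h) (upol y (mvar v)) = upol y (mapc h (mvar v))" for v
      by (simp add: upol_var h h.map_poly_pCons_hom)
  qed (simp add: upol_cst h h.map_poly_pCons_hom)
qed

text \<open>\<open>a\<close> is the least exponent of \<open>t\<close>. Applied to a reduced
  characteristic polynomial, the lowest coefficient \<open>g\<close> is the polynomial that the base
  point of the linear space has to avoid.\<close>

lemma split_lowest:
  fixes p :: "'a::comm_ring_1 mp"
  assumes "p \<noteq> 0"
  shows "\<exists>a g h. p = mvar t ^ a * (g + mvar t * h) \<and> g \<noteq> 0 \<and> t \<notin> mvars g \<and>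
    (\<forall>m\<in>keys g. m + replicate_mset a t \<in> keys p)"
proof -
  define a where "a = Min ((\<lambda>m. count m t) ` keys p)"
  have ne: "keys p \<noteq> {}" using assms by simp
  have amin: "a \<le> count m t" if "m \<in> keys p" for m
    unfolding a_def by (rule Min_le) (use that in auto)
  have "a \<in> (\<lambda>m. count m t) ` keys p" unfolding a_def by (rule Min_in) (use ne in auto)
  then obtain m0 where m0: "m0 \<in> keys p" "count m0 t = a" by auto
  define K0 where "K0 = {m\<in>keys p. count m t = a}"
  define K1 where "K1 = {m\<in>keys p. count m t > a}"
  have K: "keys p = K0 \<union> K1" "K0 \<inter> K1 = {}" "finite K0" "finite K1"
    using amin by (auto simp: K0_def K1_def le_less)
  define g where "g = (\<Sum>m\<in>K0. Poly_Mapping.single (m - replicate_mset a t) (lookup p m))"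
  define h where "h = (\<Sum>m\<in>K1. Poly_Mapping.single (m - replicate_mset (Suc a) t) (lookup p m))"
  have r0: "m - replicate_mset a t + replicate_mset a t = m" if "m \<in> K0" for m
    using that by (simp add: K0_def multiset_eq_iff)
  have r1: "m - replicate_mset (Suc a) t + replicate_mset (Suc a) t = m" if "m \<in> K1" for m
    using that by (auto simp: K1_def multiset_eq_iff)
  have p: "p = mvar t ^ a * g + mvar t ^ Suc a * h"
  proof -
    have "mvar t ^ a * g = (\<Sum>m\<in>K0. Poly_Mapping.single m (lookup p m))"
      unfolding g_def sum_distrib_left
      by (rule sum.cong[OF refl]) (simp add: mvar_power mult_single add.commute[of "replicate_mset _ _"] r0)
    moreover have "mvar t ^ Suc a * h = (\<Sum>m\<in>K1. Poly_Mapping.single m (lookup p m))"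
      unfolding h_def sum_distrib_left
      by (rule sum.cong[OF refl]) (simp only: mvar_power mult_single add.commute[of "replicate_mset _ _"] r1 mult_1)
    moreover have "p = (\<Sum>m\<in>K0 \<union> K1. Poly_Mapping.single m (lookup p m))"
      using mp_sum_monomials[of p] K(1) by simp
    ultimately show ?thesis using K by (simp only: sum.union_disjoint)
  qed
  have inj: "m = m'" if "m \<in> K0" "m' \<in> K0" "m - replicate_mset a t = m' - replicate_mset a t" for m m'
    using r0 that by metis
  have m0K: "m0 \<in> K0" using m0 by (simp add: K0_def)
  have "lookup g (m0 - replicate_mset a t) = (\<Sum>m\<in>K0. if m = m0 then lookup p m else 0)"
    unfolding g_def lookup_sum
    by (rule sum.cong[OF refl]) (use inj[OF _ m0K] in \<open>auto simp: lookup_single when_def\<close>)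
  also have "\<dots> = lookup p m0" using m0K K(3) by simp
  finally have g0: "g \<noteq> 0" using m0(1) by (auto simp: in_keys_iff)
  have kg: "\<exists>m'\<in>K0. m = m' - replicate_mset a t" if "m \<in> keys g" for m
    using that keys_sum[of "\<lambda>m. Poly_Mapping.single (m - replicate_mset a t) (lookup p m)" K0]
    unfolding g_def[symmetric] by (fastforce split: if_splits)
  have "t \<notin> mvars g"
  proof
    assume "t \<in> mvars g"
    then obtain m where m: "m \<in> keys g" "t \<in># m" by (auto simp: mvars_def)
    then obtain m' where "m' \<in> K0" "m = m' - replicate_mset a t" using kg by blast
    then have "count m t = 0" by (simp add: K0_def)
    then show False using m(2) by (simp add: count_eq_zero_iff)
  qed
  moreover have "m + replicate_mset a t \<in> keys p" if m: "m \<in> keys g" for m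
  proof -
    obtain m' where m': "m' \<in> K0" "m = m' - replicate_mset a t" using kg[OF m] by blast
    then have "m + replicate_mset a t = m'" using r0 by simp
    then show ?thesis using m'(1) by (simp add: K0_def)
  qed
  moreover have "p = mvar t ^ a * (g + mvar t * h)" using p by (simp add: algebra_simps)
  ultimately show ?thesis using g0 by blast
qed

lemma sub_var_free:
  assumes "t \<notin> mvars x"
  shows "msub (\<lambda>v. if v = t then p else mvar v) x = x"
  by (rule hom_ext_mp[where \<psi> = "\<lambda>x. x"])
     (use assms in \<open>auto simp: msub_hom comm_ring_hom_id mev_cst[OF mcst_hom] mev_var[OF mcst_hom]\<close>)

lemma mapc_sub_var:
  assumes h: "comm_ring_hom h"
  shows "mapc h (msub (\<lambda>v. if v = t then p else mvar v) x) =
    msub (\<lambda>v. if v = t then mapc h p else mvar v) (mapc h x)"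
proof -
  have "(\<lambda>v. mapc h (if v = t then p else mvar v)) = (\<lambda>v. if v = t then mapc h p else mvar v)"
    by (auto simp: fun_eq_iff h)
  then show ?thesis by (simp add: mapc_mev[OF h mcst_hom] mev_mapc[OF h mcst_hom] h)
qed

context pert
begin

text \<open>The special fibre of the family \<open>J\<close>: its elements without poles, taken at s
  = 0. It can be larger than the ideal of the \<open>q v\<close>: if u and v in \<open>Y\<close>
  have q u = q v, then u^r - v^r belongs to it.\<close>

definition lim :: "'k mp set" where
  "lim = {rd p | p. emb p \<in> J}"

lemma limI: "emb p \<in> J \<Longrightarrow> rd p \<in> lim"
  unfolding lim_def by blast

lemma lim_add: "a \<in> lim \<Longrightarrow> b \<in> lim \<Longrightarrow> a + b \<in> lim"
proof -
  assume "a \<in> lim" "b \<in> lim"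
  then obtain p p' where "a = rd p" "emb p \<in> J" "b = rd p'" "emb p' \<in> J" by (auto simp: lim_def)
  then show ?thesis using limI[of "p + p'"] by (simp add: emb_hom.hom_add rd_hom.hom_add idl_add)
qed

lemma lim_mult: "a \<in> lim \<Longrightarrow> c * a \<in> lim"
proof -
  assume "a \<in> lim"
  then obtain p where p: "a = rd p" "emb p \<in> J" by (auto simp: lim_def)
  have "rd (lft c * p) \<in> lim" by (rule limI) (simp add: emb_hom.hom_mult idl_mult p(2))
  then show ?thesis by (simp add: rd_hom.hom_mult rd_lft p(1))
qed

lemma lim_zero: "0 \<in> lim"
  using limI[of 0] by (simp add: emb_hom.hom_zero rd_hom.hom_zero)

lemma lim_sum: "(\<And>i. i \<in> A \<Longrightarrow> f i \<in> lim) \<Longrightarrow> sum f A \<in> lim"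
  by (induction A rule: infinite_finite_induct) (simp_all add: lim_zero lim_add)

lemma lim_diff: "a \<in> lim \<Longrightarrow> b \<in> lim \<Longrightarrow> a - b \<in> lim"
  using lim_add[of a "- b"] lim_mult[of b "- 1"] by simp

lemma q_lim: "v \<in> Y \<Longrightarrow> q v \<in> lim"
proof -
  assume v: "v \<in> Y"
  have "rd (mcst fps_X * mvar v ^ r + lft (q v)) \<in> lim"
  proof (rule limI)
    have "emb (mcst fps_X * mvar v ^ r + lft (q v)) = g v"
      by (simp add: g_def emb_hom.hom_add emb_hom.hom_mult emb_hom.hom_power fps_to_fls_hom emb_lft)
    then show "emb (mcst fps_X * mvar v ^ r + lft (q v)) \<in> J" by (simp add: idl_gen finY v)
  qed
  then show ?thesis
    by (simp add: rd_hom.hom_add rd_hom.hom_mult rd_hom.hom_power fps_nth0_hom rd_lft)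
qed

text \<open>Where the variables in \<open>Y\<close> and all \<open>q v\<close> vanish, so do the
  perturbed generators for every s, hence all of \<open>J\<close> and its limit. This keeps the
  point of the circuit in the limit.\<close>

lemma lim_vanish:
  assumes x: "\<And>v. v \<in> Y \<Longrightarrow> x v = 0" "\<And>v. v \<in> Y \<Longrightarrow> meval x (q v) = 0" and p: "p \<in> lim"
  shows "meval x p = 0"
proof -
  obtain p0 where p0: "p = rd p0" "emb p0 \<in> J" using p by (auto simp: lim_def)
  let ?e = "meval (\<lambda>v. fls_const (x v))"
  interpret e: comm_ring_hom ?e by (rule meval_hom)
  have "?e (g v) = 0" if v: "v \<in> Y" for v
  proof -
    have "?e (inc (q v)) = fls_const (meval x (q v))"
      by (simp add: mev_mapc[OF fls_const_hom comm_ring_hom_id] hom_mev[OF fls_const_hom comm_ring_hom_id])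
    then show ?thesis
      using v r by (simp add: g_def e.hom_add e.hom_mult e.hom_power mev_var[OF comm_ring_hom_id] x)
  qed
  then have "?e p' = 0" if "p' \<in> J" for p' using that
    by (auto simp: idl_def e.hom_sum e.hom_mult)
  then have "?e (emb p0) = 0" using p0(2) by blast
  moreover have "?e (emb p0) = fps_to_fls (meval (\<lambda>v. fps_const (x v)) p0)"
    by (simp add: mev_mapc[OF fps_to_fls_hom comm_ring_hom_id] hom_mev[OF fps_to_fls_hom comm_ring_hom_id])
  ultimately have z: "meval (\<lambda>v. fps_const (x v)) p0 = 0" by simp
  have "meval x p = fps_nth (meval (\<lambda>v. fps_const (x v)) p0) 0"
    unfolding p0(1) by (simp add: mev_mapc[OF fps_nth0_hom comm_ring_hom_id] hom_mev[OF fps_nth0_hom comm_ring_hom_id])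
  then show ?thesis by (simp add: z)
qed

lemma yfree_var: "t \<notin> Y \<Longrightarrow> yfree Y (mvar t)"
  using mvars_single[of "{#t#}"] by (fastforce simp: yfree_def)

lemma M_T_minus:
  assumes "t \<notin> Y"
  shows "M (mvar t - p) = mvar t \<cdot>\<^sub>m 1\<^sub>m D - M p"
proof -
  have "M (- p) = - M p" using M_scal[of "- 1" p] by (auto simp: yfree_intros intro!: eq_matI)
  then have "M (mvar t + - p) = mvar t \<cdot>\<^sub>m 1\<^sub>m D + - M p"
    by (simp only: M_add M_yfree[OF yfree_var[OF assms]])
  then show ?thesis by (auto intro!: eq_matI)
qed

lemma upol_N:
  assumes t: "t \<notin> Y" "t \<notin> qvars" "t \<notin> mvars p"
  shows "upol t (N (mvar t - p)) = char_poly (M p)"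
proof -
  interpret u: comm_ring_hom "upol t :: 'k fls mp \<Rightarrow> _" by (rule upol_hom)
  have "upol t (M p $$ (i, j)) = [:M p $$ (i, j):]" if "i < D" "j < D" for i j
    by (rule upol_free) (use mvars_M[OF that, of p] t in auto)
  then have "map_mat (upol t) (M (mvar t - p)) = char_poly_matrix (M p)"
    by (intro eq_matI) (auto simp: M_T_minus[OF t(1)] char_poly_matrix_def u.hom_minus u.hom_zero upol_var)
  then show ?thesis unfolding N_def char_poly_def u.hom_det[symmetric] by simp
qed

text \<open>The norm of t - p is the characteristic polynomial of \<open>M p\<close>; its leading
  coefficient 1 survives the reduction.\<close>

lemma chi_nonzero:
  assumes t: "t \<notin> Y" "t \<notin> qvars" "t \<notin> mvars p" and Z: "N (mvar t - p) = emb Z"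
  shows "rd Z \<noteq> 0"
proof -
  interpret e: map_poly_comm_ring_hom "emb :: 'k fps mp \<Rightarrow> 'k fls mp" ..
  have "coeff (char_poly (M p)) D = 1" using degree_monic_char_poly[of "M p" D] by simp
  then have "coeff (map_poly emb (upol t Z)) D = 1"
    by (simp add: upol_mapc[OF fps_to_fls_hom] Z[symmetric] upol_N[OF t])
  then have "emb (coeff (upol t Z) D) = emb 1" by (simp add: coeff_map_poly emb_hom.hom_zero emb_hom.hom_one)
  then have "coeff (upol t Z) D = 1" by (simp only: emb_eq_iff)
  then have "coeff (map_poly rd (upol t Z)) D = 1" by (simp add: coeff_map_poly rd_hom.hom_zero rd_hom.hom_one)
  then have "coeff (upol t (rd Z)) D = 1" by (simp add: upol_mapc[OF fps_nth0_hom])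
  moreover have "upol t 0 = (0 :: 'k mp poly)" by (simp add: upol_def mev_def)
  ultimately show ?thesis by auto
qed

text \<open>Cayley-Hamilton: N (t - p) is a multiple of t - p modulo \<open>J\<close>, and putting t
  = p removes the multiple.\<close>

lemma chi_in_lim:
  assumes t: "t \<notin> Y" "t \<notin> qvars" "t \<notin> mvars p" and Z: "N (mvar t - inc p) = emb Z"
  shows "msub (\<lambda>v. if v = t then p else mvar v) (rd Z) \<in> lim"
proof -
  let ?\<rho> = "msub (\<lambda>v. if v = t then inc p else mvar v)"
  interpret \<rho>: comm_ring_hom ?\<rho> by (rule msub_hom)
  have ti: "t \<notin> mvars (inc x)" if "t \<notin> mvars x" for x :: "'k mp"
    using that mvars_mapc[OF fls_const_hom, of x] by blast
  have "?\<rho> (g v) = g v" if v: "v \<in> Y" for v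
  proof -
    have "t \<notin> mvars (inc (q v))" by (rule ti) (use t(2) v in \<open>auto simp: qvars_def\<close>)
    moreover have "v \<noteq> t" using t(1) v by blast
    ultimately show ?thesis
      by (simp add: g_def \<rho>.hom_add \<rho>.hom_mult \<rho>.hom_power sub_var_free mev_cst[OF mcst_hom] mev_var[OF mcst_hom])
  qed
  then have \<rho>J: "?\<rho> x \<in> J" if "x \<in> J" for x
    by (intro idl_hom[OF \<rho>.comm_ring_hom_axioms _ that]) (simp add: idl_gen finY)
  have z: "?\<rho> (mvar t - inc p) = 0"
    by (simp add: \<rho>.hom_minus mev_var[OF mcst_hom] sub_var_free[OF ti[OF t(3)]])
  obtain v0 where "N (mvar t - inc p) - (mvar t - inc p) * v0 \<in> J" using N_mem by blast
  from \<rho>J[OF this] have "?\<rho> (emb Z - (mvar t - inc p) * v0) \<in> J" by (simp only: Z)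
  moreover have "?\<rho> (emb Z - (mvar t - inc p) * v0) = ?\<rho> (emb Z)"
    by (simp only: \<rho>.hom_minus[of "emb Z"] \<rho>.hom_mult z) simp
  ultimately have "?\<rho> (emb Z) \<in> J" by simp
  moreover have "?\<rho> (emb Z) = emb (msub (\<lambda>v. if v = t then lft p else mvar v) Z)"
    by (simp add: mapc_sub_var[OF fps_to_fls_hom] emb_lft cong: if_cong)
  ultimately have "rd (msub (\<lambda>v. if v = t then lft p else mvar v) Z) \<in> lim" by (intro limI) simp
  then show ?thesis by (simp add: mapc_sub_var[OF fps_nth0_hom] rd_lft cong: if_cong)
qed

text \<open>The reduced characteristic polynomial of \<open>P\<close> is t^a (gg + t h), and
  Cayley-Hamilton puts t = P. With weight \<open>r\<close> for \<open>t\<close> it is homogeneous of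
  weight D r, which bounds the degree of \<open>gg\<close>.\<close>

lemma low_coefficient:
  assumes Sp: "Sp n" and P: "whom (\<lambda>_. 1) r P" "mvars P \<subseteq> W \<union> Y" and qv: "qvars \<subseteq> W \<union> Y"
    and W: "finite W"
  shows "\<exists>a gg h. P ^ a * (gg + P * h) \<in> lim \<and> gg \<noteq> 0 \<and> mvars gg \<subseteq> W \<and>
    (\<forall>m\<in>keys gg. size m \<le> D * r)"
proof -
  obtain t where t: "t \<notin> W \<union> Y" using W finY by (meson ex_new_if_finite finite_UnI infinite_UNIV_nat)
  then have t': "t \<notin> Y" "t \<notin> qvars" "t \<notin> mvars P" "t \<notin> mvars (inc P)"
    using P(2) qv mvars_mapc[OF fls_const_hom, of P] by blast+
  have "mvar t - inc P = emb (mvar t - lft P)" by (simp add: emb_hom.hom_minus fps_to_fls_hom emb_lft)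
  then obtain Z where Z: "N (mvar t - inc P) = emb Z" using N_integral[OF Sp] by metis
  have nz: "rd Z \<noteq> 0" by (rule chi_nonzero[OF t'(1,2,4) Z])
  then obtain a gg h where s: "rd Z = mvar t ^ a * (gg + mvar t * h)" "gg \<noteq> 0" "t \<notin> mvars gg"
    "\<forall>m\<in>keys gg. m + replicate_mset a t \<in> keys (rd Z)" using split_lowest by blast
  let ?\<rho> = "msub (\<lambda>v. if v = t then P else mvar v)"
  interpret \<rho>: comm_ring_hom ?\<rho> by (rule msub_hom)
  have "?\<rho> (rd Z) = P ^ a * (gg + P * ?\<rho> h)"
    by (simp add: s(1) \<rho>.hom_mult \<rho>.hom_add \<rho>.hom_power mev_var[OF mcst_hom] sub_var_free[OF s(3)])
  then have 1: "P ^ a * (gg + P * ?\<rho> h) \<in> lim" using chi_in_lim[OF t'(1-3) Z] by simp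
  define w where "w v = (if v = t then r else 1)" for v
  have wq: "w v = 1" if "v \<in> qvars" for v using that t' by (auto simp: w_def)
  have "whom w r (mvar t - inc P)"
  proof (rule whom_diff)
    show "whom w r (mvar t :: 'k fls mp)" using whom_var[of w t] by (simp add: w_def)
    show "whom w r (inc P)"
      by (rule whom_weights_cong[OF whom_mapc[OF fls_const_hom P(1)]]) (use t'(4) in \<open>auto simp: w_def\<close>)
  qed
  then have "whom w (D * r) (emb Z)" unfolding Z[symmetric]
    using whom_N[of w r "mvar t - inc P"] wq by blast
  then have wX: "whom w (D * r) (rd Z)"
    using keys_mapc[OF fps_nth0_hom, of Z] unfolding whom_def keys_emb by blast
  have "mvars (emb Z) \<subseteq> insert t W"
  proof -
    have "mvars (mvar t :: 'k fls mp) \<subseteq> {t}" by (rule order_trans[OF mvars_single]) simp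
    then have "mvars (mvar t - inc P) \<subseteq> insert t (W \<union> Y)"
      using mvars_diff[of "mvar t" "inc P"] mvars_mapc[OF fls_const_hom, of P] P(2) by blast
    then show ?thesis using mvars_N[of "mvar t - inc P"] qv unfolding Z[symmetric] by blast
  qed
  then have mX: "mvars (rd Z) \<subseteq> insert t W" using mvars_mapc[OF fps_nth0_hom, of Z] by (simp add: mvars_emb)
  have 2: "mvars gg \<subseteq> W"
  proof
    fix v assume v: "v \<in> mvars gg"
    then obtain m where m: "m \<in> keys gg" "v \<in># m" by (auto simp: mvars_def)
    then have "v \<in># m + replicate_mset a t" by simp
    then have "v \<in> mvars (rd Z)" using s(4) m(1) unfolding mvars_def by blast
    then show "v \<in> W" using mX v s(3) by blast
  qed
  have 3: "size m \<le> D * r" if m: "m \<in> keys gg" for m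
  proof -
    have "wdeg w (m + replicate_mset a t) = D * r" using wX s(4) m unfolding whom_def by blast
    moreover have "size k \<le> wdeg w k" for k
      using r by (induction k) (auto simp: w_def Suc_le_eq intro: le_trans)
    ultimately show ?thesis by (metis le_add1 le_trans wdeg_add)
  qed
  show ?thesis using 1 2 3 s(2) by blast
qed

end

context pert
begin

text \<open>If \<open>p\<close> vanishes on the fibre over \<open>w0\<close>, then its coefficients
  with respect to the \<open>Y\<close>-monomials vanish at \<open>w0\<close>, and by linearity so do
  all entries of its matrix. What remains of det (t - M p) is t^D.\<close>

lemma chi_at_point:
  assumes t: "t \<notin> Y" and tp: "t \<notin> mvars p"
    and zero: "msub (\<lambda>v. if v \<in> Y then mvar v else mcst (w0 v)) p = 0"
    and Z: "N (mvar t - inc p) = emb Z"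
  shows "msub (\<lambda>v. if v = t then mvar t else mcst (w0 v)) (rd Z) = mvar t ^ D"
proof -
  let ?s = "msub (\<lambda>v. if v \<in> Y then mvar v else mcst (w0 v)) :: 'k mp \<Rightarrow> 'k mp"
  let ?A = "filter_mset (\<lambda>v. v \<in> Y) ` keys p"
  interpret s: comm_ring_hom ?s by (rule msub_hom)
  interpret ev: comm_ring_hom "meval w0" by (rule meval_hom)
  have pd: "p = (\<Sum>a\<in>?A. cfy Y a p * mmon a)" by (rule cfy_decomp) auto
  have s_free: "?s x = mcst (meval w0 x)" if "yfree Y x" for x
  proof (rule hom_ext_mp[where \<phi> = ?s and \<psi> = "\<lambda>x. mcst (meval w0 x)"])
    show "comm_ring_hom (\<lambda>x. mcst (meval w0 x) :: 'k mp)"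
      by (rule comm_ring_hom_compose[OF mcst_hom meval_hom])
    show "?s (mvar v) = mcst (meval w0 (mvar v))" if "v \<in> mvars x" for v
      using that \<open>yfree Y x\<close> by (auto simp: yfree_def mev_var[OF mcst_hom] mev_var[OF comm_ring_hom_id])
  qed (simp_all add: msub_hom mev_cst[OF mcst_hom] mev_cst[OF comm_ring_hom_id])
  have s_mon: "?s (mmon a) = mmon a" if "set_mset a \<subseteq> Y" for a
  proof -
    have "image_mset (\<lambda>v. if v \<in> Y then mvar v else mcst (w0 v)) a = image_mset mvar a"
      by (rule image_mset_cong) (use that in auto)
    then have "?s (mmon a) = prod_mset (image_mset mvar a)"
      by (simp add: mev_single[OF mcst_hom] single_one)
    then show ?thesis by (simp only: mmon_prod[of a, symmetric])
  qed
  have Asub: "set_mset a \<subseteq> Y" if "a \<in> ?A" for a using that by auto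
  have "0 = (\<Sum>a\<in>?A. mcst (meval w0 (cfy Y a p)) * mmon a)"
  proof -
    have "?s p = (\<Sum>a\<in>?A. ?s (cfy Y a p) * ?s (mmon a))"
      by (subst pd) (simp only: s.hom_sum s.hom_mult)
    also have "\<dots> = (\<Sum>a\<in>?A. mcst (meval w0 (cfy Y a p)) * mmon a)"
      by (rule sum.cong[OF refl]) (simp only: s_free[OF yfree_cfy] s_mon[OF Asub])
    finally show ?thesis using zero by simp
  qed
  then have z: "(\<Sum>a\<in>?A. mcst (meval w0 (cfy Y a p)) * mmon a) = 0" by simp
  have c0: "meval w0 (cfy Y b p) = 0" if b: "b \<in> ?A" for b
  proof -
    have "cfy Y b (\<Sum>a\<in>?A. mcst (meval w0 (cfy Y a p)) * mmon a) =
        (\<Sum>a\<in>?A. if b = a then mcst (meval w0 (cfy Y a p)) else 0)"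
      unfolding cfy_sum by (intro sum.cong refl cfy_basis yfree_intros Asub)
    also have "\<dots> = mcst (meval w0 (cfy Y b p))" using b by simp
    finally have "mcst (meval w0 (cfy Y b p)) = (0 :: 'k mp)" unfolding z by simp
    then show ?thesis by (metis lookup_single_eq lookup_zero)
  qed
  let ?e = "msub (\<lambda>v. if v = t then mvar t else mcst (fls_const (w0 v))) :: 'k fls mp \<Rightarrow> _"
  interpret e: comm_ring_hom ?e by (rule msub_hom)
  have e0: "?e (inc (cfy Y b p)) = 0" if b: "b \<in> ?A" "t \<notin> mvars p" for b
  proof -
    have "?e (inc (cfy Y b p)) = mev (\<lambda>c. mcst (fls_const c)) (\<lambda>v. mcst (fls_const (w0 v))) (cfy Y b p)"
      unfolding mev_mapc[OF fls_const_hom mcst_hom]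
      by (rule mev_cong) (use mvars_cfy[of Y b p] b in auto)
    also have "\<dots> = mcst (fls_const (meval w0 (cfy Y b p)))"
      by (simp add: hom_mev[OF mcst_comp_hom[OF fls_const_hom] comm_ring_hom_id])
    finally show ?thesis by (simp add: c0[OF b(1)])
  qed
  show ?thesis
  proof -
    have yfi: "yfree Y (inc x)" if "yfree Y x" for x
      using that mvars_mapc[OF fls_const_hom, of x] by (auto simp: yfree_def)
    have ip: "inc p = (\<Sum>a\<in>?A. inc (cfy Y a p) * mmon a)"
      by (subst pd) (simp add: inc_hom.hom_sum inc_hom.hom_mult mapc_single[OF fls_const_hom])
    have Msum: "M (\<Sum>a\<in>S. inc (cfy Y a p) * mmon a) $$ (i, j) = (\<Sum>a\<in>S. inc (cfy Y a p) * M (mmon a) $$ (i, j))"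
      if "i < D" "j < D" for S i j
    proof (induction S rule: infinite_finite_induct)
      case empty
      have "M 0 = 0 \<cdot>\<^sub>m M 0" using M_scal[of 0 0] by (simp add: yfree_intros)
      then have "M 0 $$ (i, j) = (0 \<cdot>\<^sub>m M 0) $$ (i, j)" by simp
      then show ?case using that by simp
    next
      case (infinite S)
      have "M 0 = 0 \<cdot>\<^sub>m M 0" using M_scal[of 0 0] by (simp add: yfree_intros)
      then have "M 0 $$ (i, j) = (0 \<cdot>\<^sub>m M 0) $$ (i, j)" by simp
      then show ?case using that infinite by simp
    next
      case (insert a S)
      then show ?case using that by (simp add: M_add M_scal[OF yfi[OF yfree_cfy]])
    qed
    have "?e (M (inc p) $$ (i, j)) = 0" if ij: "i < D" "j < D" for i j
    proof -
      have "M (inc p) $$ (i, j) = (\<Sum>a\<in>?A. inc (cfy Y a p) * M (mmon a) $$ (i, j))"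
        unfolding Msum[OF ij, symmetric] ip[symmetric] ..
      then have "?e (M (inc p) $$ (i, j)) = (\<Sum>a\<in>?A. ?e (inc (cfy Y a p)) * ?e (M (mmon a) $$ (i, j)))"
        by (simp only: e.hom_sum e.hom_mult)
      also have "\<dots> = 0" by (rule sum.neutral) (use e0 tp in simp)
      finally show ?thesis .
    qed
    then have "map_mat ?e (M (mvar t - inc p)) = mvar t \<cdot>\<^sub>m 1\<^sub>m D"
      by (intro eq_matI) (auto simp: M_T_minus[OF t] e.hom_minus e.hom_zero mev_var[OF mcst_hom])
    then have e1: "?e (emb Z) = mvar t ^ D"
      unfolding Z[symmetric] N_def e.hom_det[symmetric] by (simp add: det_smult)
    have e2: "?e (emb Z) = emb (msub (\<lambda>v. if v = t then mvar t else mcst (fps_const (w0 v))) Z)"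
      by (simp add: mapc_mev[OF fps_to_fls_hom mcst_hom] mev_mapc[OF fps_to_fls_hom mcst_hom]
          fps_to_fls_hom if_distrib[of emb] cong: if_cong)
    have e3: "mvar t ^ D = emb (mvar t ^ D :: 'k fps mp)" by (simp add: emb_hom.hom_power fps_to_fls_hom)
    have "emb (msub (\<lambda>v. if v = t then mvar t else mcst (fps_const (w0 v))) Z) = emb (mvar t ^ D :: 'k fps mp)"
      by (rule trans[OF e2[symmetric] trans[OF e1 e3]])
    then have "msub (\<lambda>v. if v = t then mvar t else mcst (fps_const (w0 v))) Z = mvar t ^ D"
      by (simp only: emb_eq_iff)
    then have "rd (msub (\<lambda>v. if v = t then mvar t else mcst (fps_const (w0 v))) Z) = rd (mvar t ^ D)" by (simp only:)
    then show ?thesis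
      by (simp add: mapc_mev[OF fps_nth0_hom mcst_hom] mev_mapc[OF fps_nth0_hom mcst_hom]
          fps_nth0_hom if_distrib[of rd] rd_hom.hom_power cong: if_cong)
  qed
qed

text \<open>Lets \<open>eliminate\<close> exchange the argument of a characteristic polynomial at
  the cost of a multiple of the difference.\<close>

lemma lim_congruence:
  fixes c :: "'k mp"
  shows "msub (\<lambda>v. if v = t then a else mvar v) c - msub (\<lambda>v. if v = t then b else mvar v) c \<in> {d * (a - b) | d. True}"
proof -
  let ?a = "msub (\<lambda>v. if v = t then a else mvar v) :: 'k mp \<Rightarrow> _"
  let ?b = "msub (\<lambda>v. if v = t then b else mvar v) :: 'k mp \<Rightarrow> _"
  interpret a: comm_ring_hom ?a by (rule msub_hom)
  interpret b: comm_ring_hom ?b by (rule msub_hom)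
  have "\<exists>d. ?a (mmon m) - ?b (mmon m) = d * (a - b)" for m
  proof (induction m)
    case empty
    have "?a (mmon {#}) - ?b (mmon {#}) = 0 * (a - b)" by (simp add: mev_cst[OF mcst_hom])
    then show ?case by blast
  next
    case (add v m)
    have s: "mmon (add_mset v m) = (mvar v * mmon m :: 'k mp)" by (simp add: mult_single)
    obtain d where d: "?a (mmon m) - ?b (mmon m) = d * (a - b)" using add by blast
    have "?a (mmon (add_mset v m)) - ?b (mmon (add_mset v m)) =
        ?a (mvar v) * (?a (mmon m) - ?b (mmon m)) + (?a (mvar v) - ?b (mvar v)) * ?b (mmon m)"
      unfolding s a.hom_mult b.hom_mult by (simp add: algebra_simps)
    also have "\<dots> = (?a (mvar v) * d + (if v = t then ?b (mmon m) else 0)) * (a - b)"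
      unfolding d by (simp add: mev_var[OF mcst_hom] algebra_simps)
    finally show ?case by blast
  qed
  then obtain d where d: "\<And>m. ?a (mmon m) - ?b (mmon m) = d m * (a - b)" by metis
  have "?a x - ?b x \<in> {d * (a - b) | d. True}" for x
  proof (induction x rule: mp_induct)
    case zero
    show ?case by (auto simp: a.hom_zero b.hom_zero intro!: exI[of _ 0])
  next
    case (single m c)
    have "?a (Poly_Mapping.single m c) - ?b (Poly_Mapping.single m c) = (mcst c * d m) * (a - b)"
      unfolding single_eq_cst_mult[of m c] a.hom_mult b.hom_mult
      using d[of m] by (simp add: mev_cst[OF mcst_hom] right_diff_distrib[symmetric] mult.assoc)
    then show ?case by blast
  next
    case (add x y)
    then obtain d1 d2 where ds: "?a x - ?b x = d1 * (a - b)" "?a y - ?b y = d2 * (a - b)" by blast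
    have "?a (x + y) - ?b (x + y) = (?a x - ?b x) + (?a y - ?b y)"
      by (simp add: a.hom_add b.hom_add)
    also have "\<dots> = (d1 + d2) * (a - b)" unfolding ds by (simp add: distrib_right)
    finally have "?a (x + y) - ?b (x + y) = (d1 + d2) * (a - b)" .
    then show ?case by blast
  qed
  then show ?thesis .
qed

text \<open>Let F be the reduced characteristic polynomial of \<open>u\<close>. Then F(u) is in the
  limit and F(gg) - F(u) is a multiple of gg - u, so \<alpha> = F(gg) works; it is free of
  \<open>Y\<close>, as \<open>gg\<close> and the coefficients of F are. At \<open>w0\<close> the
  polynomial F is t^D, so \<alpha> takes the nonzero value gg(w0)^D there.\<close>

lemma eliminate:
  assumes Sp: "Sp n" and u: "msub (\<lambda>v. if v \<in> Y then mvar v else mcst (w0 v)) u = 0"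
    and gg: "yfree Y gg" "meval w0 gg \<noteq> 0" and mem: "P * (gg - u) \<in> lim"
  shows "\<exists>\<alpha>. \<alpha> \<noteq> 0 \<and> yfree Y \<alpha> \<and> \<alpha> * P \<in> lim"
proof -
  obtain t where t: "t \<notin> qvars \<union> Y \<union> mvars u \<union> mvars gg"
    by (meson ex_new_if_finite finite_UnI infinite_UNIV_nat finite_mvars finY fin_qvars)
  then have t': "t \<notin> Y" "t \<notin> qvars" "t \<notin> mvars u" by blast+
  have "mvar t - inc u = emb (mvar t - lft u)" by (simp add: emb_hom.hom_minus fps_to_fls_hom emb_lft)
  then obtain Z where Z: "N (mvar t - inc u) = emb Z" using N_integral[OF Sp] by metis
  let ?s = "\<lambda>a. msub (\<lambda>v. if v = t then a else mvar v) (rd Z)"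
  define \<alpha> where "\<alpha> = ?s gg"
  obtain d where d: "\<alpha> - ?s u = d * (gg - u)"
    using lim_congruence[of t gg "rd Z" u] unfolding \<alpha>_def by blast
  have "\<alpha> * P = P * ?s u + P * (\<alpha> - ?s u)"
    by (simp add: algebra_simps)
  also have "\<dots> = P * ?s u + d * (P * (gg - u))" unfolding d by (simp add: ac_simps)
  also have "\<dots> \<in> lim" by (intro lim_add lim_mult mem chi_in_lim[OF t' Z])
  finally have 1: "\<alpha> * P \<in> lim" .
  have "mvars (emb Z) \<inter> Y = {}" using mvars_N[of "mvar t - inc u"] unfolding Z[symmetric] by blast
  then have "mvars (rd Z) \<inter> Y = {}" using mvars_mapc[OF fps_nth0_hom, of Z] by (auto simp: mvars_emb)
  moreover have "mvars \<alpha> \<subseteq> mvars (rd Z) \<union> mvars gg"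
    unfolding \<alpha>_def by (rule mvars_mev) (auto split: if_splits dest: subsetD[OF mvars_single])
  ultimately have 2: "yfree Y \<alpha>" using gg(1) by (auto simp: yfree_def)
  have "meval w0 \<alpha> = meval (\<lambda>v. if v = t then meval w0 gg else w0 v) (rd Z)"
    unfolding \<alpha>_def
    by (simp add: hom_mev[OF meval_hom mcst_hom] mev_cst[OF comm_ring_hom_id] mev_var[OF comm_ring_hom_id]
        if_distrib[of "meval w0"] cong: if_cong)
  also have "\<dots> = meval (\<lambda>v. meval w0 gg) (msub (\<lambda>v. if v = t then mvar t else mcst (w0 v)) (rd Z))"
    by (simp add: hom_mev[OF meval_hom mcst_hom] mev_cst[OF comm_ring_hom_id] mev_var[OF comm_ring_hom_id]
        if_distrib[of "meval (\<lambda>v. meval w0 gg)"] cong: if_cong)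
  also have "\<dots> = meval w0 gg ^ D"
    unfolding chi_at_point[OF t'(1,3) u Z]
    by (simp add: mvar_power mev_single[OF comm_ring_hom_id])
  finally have "meval w0 \<alpha> \<noteq> 0" using gg(2) by simp
  then have "\<alpha> \<noteq> 0" by (auto simp: mev_def)
  with 1 2 show ?thesis by blast
qed

text \<open>The limit has no embedded or lower-dimensional part: it is torsion free, up to nilpotents,
  over the remaining coordinates.\<close>

lemma purity:
  assumes Sp: "Sp n" and \<alpha>: "\<alpha> \<noteq> 0" "yfree Y \<alpha>" and mem: "\<alpha> * P \<in> lim"
  shows "P ^ D \<in> lim"
proof -
  obtain q0 where q0: "\<alpha> * P = rd q0" "emb q0 \<in> J" using mem by (auto simp: lim_def)
  have "rd (q0 - lft (\<alpha> * P)) = 0" by (simp add: rd_hom.hom_minus rd_lft q0(1))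
  then obtain g0 where "q0 - lft (\<alpha> * P) = mcst fps_X * g0" using rd_zero_dvd by blast
  then have g0: "q0 = lft (\<alpha> * P) + mcst fps_X * g0" by (simp add: algebra_simps)
  have "infinite (UNIV :: nat set)" by simp
  then obtain t where t: "t \<notin> qvars \<union> Y \<union> mvars P \<union> mvars (emb g0) \<union> mvars \<alpha>"
    by (meson ex_new_if_finite finite_UnI finite_mvars finY fin_qvars)
  then obtain s where s: "s \<notin> insert t (qvars \<union> Y \<union> mvars P \<union> mvars (emb g0) \<union> mvars \<alpha>)"
    using ex_new_if_finite[OF infinite_UNIV_nat, of "insert t (qvars \<union> Y \<union> mvars P \<union> mvars (emb g0) \<union> mvars \<alpha>)"]
      finY fin_qvars by auto
  have ts: "t \<notin> Y" "s \<notin> Y" "s \<noteq> t" "t \<notin> qvars" "s \<notin> qvars" "t \<notin> mvars P" "t \<notin> mvars (emb g0)" "s \<notin> mvars (emb g0)"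
    using t s by blast+
  have "mvar t - inc P = emb (mvar t - lft P)" by (simp add: emb_hom.hom_minus fps_to_fls_hom emb_lft)
  then obtain Z where Z: "N (mvar t - inc P) = emb Z" using N_integral[OF Sp] by metis
  \<comment> \<open>A lift of \<alpha> P to an element of \<open>J\<close> is \<alpha> P + s g0 with
    the series parameter s. The norm \<open>V\<close> of t + z g0, with a variable z in place of
    that parameter (the index \<open>s\<close> of the code), has no poles as a polynomial in t and
    z. Hence its specializations at z = s and at z = 0, with t replaced by \<alpha> t, have the same
    reduction.\<close>
  have "mvar t + mvar s * emb g0 = emb (mvar t + mvar s * g0)"
    by (simp add: emb_hom.hom_add emb_hom.hom_mult fps_to_fls_hom)
  then obtain V where V: "N (mvar t + mvar s * emb g0) = emb V" using N_integral[OF Sp] by metis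
  define \<alpha>E where "\<alpha>E = inc \<alpha>"
  have yE: "yfree Y \<alpha>E" using \<alpha>(2) mvars_mapc[OF fls_const_hom, of \<alpha>] by (auto simp: yfree_def \<alpha>E_def)
  have MV: "M (mvar t + mvar s * emb g0) = mvar t \<cdot>\<^sub>m 1\<^sub>m D + mvar s \<cdot>\<^sub>m M (emb g0)"
    by (simp add: M_add M_yfree[OF yfree_var[OF ts(1)]] M_scal[OF yfree_var[OF ts(2)]])
  have free: "t \<notin> mvars (M (emb g0) $$ (i, j))" "s \<notin> mvars (M (emb g0) $$ (i, j))" if "i < D" "j < D" for i j
    using mvars_M[OF that, of "emb g0"] ts by blast+
  define sb where "sb \<xi> = (\<lambda>v. if v = t then \<alpha>E * mvar t else if v = s then mcst \<xi> else mvar v)" for \<xi> :: "'k fls"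
  have sb_hom: "comm_ring_hom (msub (sb \<xi>))" for \<xi> by (rule msub_hom)
  have sb_free: "msub (sb \<xi>) x = x" if "t \<notin> mvars x" "s \<notin> mvars x" for \<xi> x
  proof (rule hom_ext_mp[where \<psi> = "\<lambda>x. x", OF sb_hom comm_ring_hom_id])
    show "msub (sb \<xi>) (mvar v) = mvar v" if "v \<in> mvars x" for v
      using that \<open>t \<notin> mvars x\<close> \<open>s \<notin> mvars x\<close> by (auto simp: mev_var[OF mcst_hom] sb_def)
  qed (simp add: mev_cst[OF mcst_hom])
  have sbV: "msub (sb \<xi>) (emb V) = N (\<alpha>E * mvar t + mcst \<xi> * emb g0)" for \<xi>
  proof -
    interpret sb: comm_ring_hom "msub (sb \<xi>)" by (rule sb_hom)
    have yt: "yfree Y (\<alpha>E * mvar t)" by (intro yfree_intros yE yfree_var ts)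
    have MR: "M (\<alpha>E * mvar t + mcst \<xi> * emb g0) = (\<alpha>E * mvar t) \<cdot>\<^sub>m 1\<^sub>m D + mcst \<xi> \<cdot>\<^sub>m M (emb g0)"
      by (simp add: M_add M_yfree[OF yt] M_scal[OF yfree_intros(3)])
    have sbv: "msub (sb \<xi>) (mvar t) = \<alpha>E * mvar t" "msub (sb \<xi>) (mvar s) = mcst \<xi>"
      using ts(3) by (simp_all add: mev_var[OF mcst_hom] sb_def)
    have "map_mat (msub (sb \<xi>)) (M (mvar t + mvar s * emb g0)) = M (\<alpha>E * mvar t + mcst \<xi> * emb g0)"
    proof (rule eq_matI)
      fix i j assume "i < dim_row (M (\<alpha>E * mvar t + mcst \<xi> * emb g0))" "j < dim_col (M (\<alpha>E * mvar t + mcst \<xi> * emb g0))"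
      then have ij: "i < D" "j < D" by simp_all
      show "map_mat (msub (sb \<xi>)) (M (mvar t + mvar s * emb g0)) $$ (i, j) = M (\<alpha>E * mvar t + mcst \<xi> * emb g0) $$ (i, j)"
        unfolding MR MV using ij
        by (simp add: sb.hom_add sb.hom_mult sb.hom_zero sb_free[OF free[OF ij]] sbv)
    qed simp_all
    then show ?thesis unfolding V[symmetric] N_def sb.hom_det[symmetric] by simp
  qed
  define sO where "sO \<xi> = (\<lambda>v. if v = t then lft \<alpha> * mvar t else if v = s then mcst \<xi> else mvar v)" for \<xi> :: "'k fps"
  have embs: "emb (msub (sO \<xi>) V) = msub (sb (fps_to_fls \<xi>)) (emb V)" for \<xi>
  proof -
    have "(\<lambda>v. emb (sO \<xi> v)) = sb (fps_to_fls \<xi>)"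
      by (auto simp: fun_eq_iff sO_def sb_def emb_hom.hom_mult emb_lft \<alpha>E_def fps_to_fls_hom)
    then show ?thesis
      by (simp add: mapc_mev[OF fps_to_fls_hom mcst_hom] mev_mapc[OF fps_to_fls_hom mcst_hom] fps_to_fls_hom)
  qed
  have rds: "rd (msub (sO \<xi>) V) = msub (\<lambda>v. if v = t then \<alpha> * mvar t else if v = s then mcst (fps_nth \<xi> 0) else mvar v) (rd V)" for \<xi>
  proof -
    have "(\<lambda>v. rd (sO \<xi> v)) = (\<lambda>v. if v = t then \<alpha> * mvar t else if v = s then mcst (fps_nth \<xi> 0) else mvar v)"
      by (auto simp: fun_eq_iff sO_def rd_hom.hom_mult rd_lft fps_nth0_hom)
    then show ?thesis
      by (simp add: mapc_mev[OF fps_nth0_hom mcst_hom] mev_mapc[OF fps_nth0_hom mcst_hom] fps_nth0_hom)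
  qed
  \<comment> \<open>Modulo \<open>J\<close> the element \<alpha> t + s g0 is \<alpha> (t - P), whose
    norm is \<alpha>^D times the characteristic polynomial of P; at z = 0 the norm is (\<alpha>
    t)^D. So the reduced characteristic polynomial of P is t^D.\<close>
  have a: "emb (msub (sO fps_X) V) = emb (lft \<alpha> ^ D * Z)"
  proof -
    have "(\<alpha>E * mvar t + mcst fls_X * emb g0) - \<alpha>E * (mvar t - inc P) = emb q0"
      by (simp add: g0 emb_hom.hom_add emb_hom.hom_mult emb_lft inc_hom.hom_mult \<alpha>E_def fps_to_fls_hom lft_hom.hom_mult algebra_simps)
    then have "N (\<alpha>E * mvar t + mcst fls_X * emb g0) = N (\<alpha>E * (mvar t - inc P))"
      using q0(2) by (intro N_cong) simp
    also have "\<dots> = emb (lft \<alpha> ^ D * Z)"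
      by (simp add: N_mult N_yfree[OF yE[unfolded \<alpha>E_def]] Z emb_hom.hom_mult emb_hom.hom_power emb_lft \<alpha>E_def)
    finally show ?thesis by (simp add: embs sbV)
  qed
  have b: "emb (msub (sO 0) V) = emb (lft \<alpha> ^ D * mvar t ^ D)"
  proof -
    have "N (\<alpha>E * mvar t) = (\<alpha>E * mvar t) ^ D" by (intro N_yfree yfree_intros yE yfree_var ts)
    then show ?thesis
      by (simp add: embs sbV emb_hom.hom_mult emb_hom.hom_power emb_lft \<alpha>E_def power_mult_distrib fps_to_fls_hom)
  qed
  have "\<alpha> ^ D * rd Z = rd (msub (sO fps_X) V)"
    using a unfolding emb_eq_iff by (simp add: rd_hom.hom_mult rd_hom.hom_power rd_lft)
  also have "\<dots> = rd (msub (sO 0) V)" by (simp add: rds cong: if_cong)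
  also have "\<dots> = \<alpha> ^ D * mvar t ^ D"
    using b unfolding emb_eq_iff by (simp add: rd_hom.hom_mult rd_hom.hom_power rd_lft fps_nth0_hom)
  finally have "rd Z = mvar t ^ D" using \<alpha>(1) by simp
  moreover have "msub (\<lambda>v. if v = t then P else mvar v) (rd Z) \<in> lim"
    by (rule chi_in_lim[OF ts(1,4,6) Z])
  moreover have "msub (\<lambda>v. if v = t then P else mvar v) (mvar t ^ D) = P ^ D"
  proof -
    interpret s: comm_ring_hom "msub (\<lambda>v. if v = t then P else mvar v)" by (rule msub_hom)
    show ?thesis by (simp add: s.hom_power mev_var[OF mcst_hom])
  qed
  ultimately show ?thesis by simp
qed

end

section \<open>Points of evasive linear spaces\<close>

text \<open>\<open>w \<mapsto> w + y\<^sub>0 b\<^sub>0 + \<dots>\<close> with the variable \<open>nn + i\<close> as \<open>y\<^sub>i\<close>.\<close>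

definition tau :: "nat \<Rightarrow> (nat \<Rightarrow> nat \<Rightarrow> 'k::comm_ring_1) \<Rightarrow> nat \<Rightarrow> 'k mp \<Rightarrow> 'k mp" where
  "tau nn b j = msub (\<lambda>v. if v < nn then mvar v + (\<Sum>i<j. mcst (b i v) * mvar (nn + i)) else mvar v)"

lemma tau_hom: "comm_ring_hom (tau nn b j)"
  unfolding tau_def by (rule msub_hom)

lemma tau_var: "tau nn b j (mvar v) = (if v < nn then mvar v + (\<Sum>i<j. mcst (b i v) * mvar (nn + i)) else mvar v)"
  unfolding tau_def by (rule mev_var[OF mcst_hom])

lemma tau_cst: "tau nn b j (mcst c) = mcst c"
  unfolding tau_def by (rule mev_cst[OF mcst_hom])

lemma shf_tau: "shf {..<nn} (nn + j) (b j) (tau nn b j p) = tau nn b (Suc j) p"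
proof (rule hom_ext_mp[where \<phi> = "\<lambda>p. shf {..<nn} (nn + j) (b j) (tau nn b j p)" and \<psi> = "tau nn b (Suc j)"])
  interpret s: comm_ring_hom "shf {..<nn} (nn + j) (b j)" by (rule shf_hom)
  show "comm_ring_hom (\<lambda>p. shf {..<nn} (nn + j) (b j) (tau nn b j p))"
    by (rule comm_ring_hom_compose[OF shf_hom tau_hom])
  show "shf {..<nn} (nn + j) (b j) (tau nn b j (mvar v)) = tau nn b (Suc j) (mvar v)" for v
    by (simp add: tau_var s.hom_add s.hom_sum s.hom_mult shf_var shf_cst)
qed (simp_all add: tau_hom tau_cst shf_cst)

lemma tau_cong: "(\<And>i. i < j \<Longrightarrow> b i = b' i) \<Longrightarrow> tau nn b j = tau nn b' j"
  unfolding tau_def by (intro arg_cong[where f = msub] ext) (auto intro!: sum.cong)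

lemma whom_tau:
  assumes "whom (\<lambda>_. 1) d p"
  shows "whom (\<lambda>_. 1) d (tau nn b j p)"
  unfolding tau_def
proof (rule whom_mev[OF assms])
  fix v
  have "whom (\<lambda>_. 1) (0 + 1) (mcst (b i v) * mvar (nn + i))" for i
    by (rule whom_mult[OF whom_cst]) (simp add: whom_def)
  then have "whom (\<lambda>_. 1) 1 (mvar v + (\<Sum>i<j. mcst (b i v) * mvar (nn + i)))"
    by (intro whom_add whom_sum) (simp_all add: whom_def)
  then show "whom (\<lambda>_. 1) 1 (if v < nn then mvar v + (\<Sum>i<j. mcst (b i v) * mvar (nn + i)) else mvar v)"
    by (simp add: whom_def)
qed simp

lemma mvars_tau:
  assumes "mvars p \<subseteq> {..<nn}"
  shows "mvars (tau nn b j p) \<subseteq> {..<nn} \<union> {nn..<nn + j}"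
  unfolding tau_def
proof (rule mvars_mev)
  fix v assume "v \<in> mvars p"
  then have v: "v < nn" using assms by auto
  have "mvars (mcst (b i v) * mvar (nn + i)) \<subseteq> {nn + i}" for i
    using mvars_mult[of "mcst (b i v)" "mvar (nn + i)"] mvars_single[of "{#nn + i#}" "1::'a"] by fastforce
  then have "mvars (mcst (b i v) * mvar (nn + i)) \<subseteq> {..<nn} \<union> {nn..<nn + j}" if "i < j" for i
    using that by fastforce
  then have "mvars (\<Sum>i<j. mcst (b i v) * mvar (nn + i)) \<subseteq> {..<nn} \<union> {nn..<nn + j}"
    by (intro mvars_sum) simp
  moreover have "mvars (mvar v :: 'a mp) \<subseteq> {..<nn} \<union> {nn..<nn + j}"
    by (rule order_trans[OF mvars_single]) (use v in simp)
  ultimately show "mvars (if v < nn then mvar v + (\<Sum>i<j. mcst (b i v) * mvar (nn + i)) else mvar v)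
      \<subseteq> {..<nn} \<union> {nn..<nn + j}"
    using mvars_add[of "mvar v" "\<Sum>i<j. mcst (b i v) * mvar (nn + i)"] v by auto
qed simp

text \<open>Several polynomials must be avoided at once, one for each factor of a product of unknown
  length. Their degrees are bounded one by one; the degree of their product is not.\<close>

definition evasive :: "nat \<Rightarrow> nat \<Rightarrow> (nat \<Rightarrow> 'k::comm_ring_1) set \<Rightarrow> bool" where
  "evasive nn e B \<longleftrightarrow> (\<forall>\<G>. finite \<G> \<and>
     (\<forall>G\<in>\<G>. G \<noteq> 0 \<and> mvars G \<subseteq> {..<nn} \<and> (\<forall>m\<in>keys G. size m \<le> e)) \<longrightarrow>
     (\<exists>b\<in>B. \<forall>G\<in>\<G>. meval b G \<noteq> 0))"

text \<open>The form to be avoided when y_j is adjoined has degree at most r^(j+1), hence at most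
  r^m, so each direction can be chosen in \<open>B\<close>.\<close>

lemma projection_chain:
  fixes Q :: "nat \<Rightarrow> 'k::field mp"
  assumes r: "r > 0" and ev: "evasive nn e B" and e: "r ^ m \<le> e"
    and Q: "\<And>i. i < m \<Longrightarrow> whom (\<lambda>_. 1) r (Q i)" "\<And>i. i < m \<Longrightarrow> mvars (Q i) \<subseteq> {..<nn}"
  shows "j \<le> m \<Longrightarrow> \<exists>b n. (\<forall>i<j. b i \<in> B) \<and> pert {nn..<nn + j} (\<lambda>v. tau nn b j (Q (v - nn))) r \<and>
     pert.Sp {nn..<nn + j} (\<lambda>v. tau nn b j (Q (v - nn))) r n"
proof (induction j)
  case 0
  have P: "pert {nn..<nn + 0} (\<lambda>v. tau nn b 0 (Q (v - nn))) r" for b by unfold_locales (use r in auto)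
  interpret pert "{nn..<nn + 0}" "\<lambda>v. tau nn undefined 0 (Q (v - nn))" r by (rule P)
  \<comment> \<open>With no variable in \<open>Y\<close> yet, the condition on the exponents is
    vacuous.\<close>
  have "Sp 0"
    unfolding Sp_def
  proof
    fix p :: "'k fps mp"
    have "emb p - emb p \<in> J" by simp
    then show "\<exists>z. emb p - emb z \<in> J \<and> (\<forall>m\<in>keys z. \<forall>v\<in>{nn..<nn + 0}. count m v < 0)"
      by (intro exI[of _ p]) simp
  qed
  then show ?case using P by blast
next
  case (Suc j)
  then obtain b n where b: "\<forall>i<j. b i \<in> B" and P: "pert {nn..<nn + j} (\<lambda>v. tau nn b j (Q (v - nn))) r"
    and Sp: "pert.Sp {nn..<nn + j} (\<lambda>v. tau nn b j (Q (v - nn))) r n" by auto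
  have jm: "j < m" using Suc.prems by simp
  have "\<exists>H. H \<noteq> 0 \<and> mvars H \<subseteq> {..<nn} \<and> (\<forall>m\<in>keys H. size m \<le> r ^ (card {nn..<nn + j} + 1)) \<and>
     (\<forall>\<beta>. meval \<beta> H \<noteq> 0 \<longrightarrow> (\<exists>n'. pert.Sp (insert (nn + j) {nn..<nn + j})
        (\<lambda>v. shf {..<nn} (nn + j) \<beta> (if v = nn + j then tau nn b j (Q j) else tau nn b j (Q (v - nn)))) r n'))"
  proof (rule projection_step[OF P Sp])
    show "whom (\<lambda>_. 1) r (tau nn b j (Q j))" by (intro whom_tau Q jm)
    show "mvars (tau nn b j (Q (v - nn))) \<subseteq> {..<nn} \<union> {nn..<nn + j}" if "v \<in> {nn..<nn + j}" for v
      by (intro mvars_tau Q) (use that jm in auto)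
    show "mvars (tau nn b j (Q j)) \<subseteq> {..<nn} \<union> {nn..<nn + j}" by (intro mvars_tau Q jm)
  qed auto
  then obtain H where H: "H \<noteq> 0" "mvars H \<subseteq> {..<nn}" "\<forall>m\<in>keys H. size m \<le> r ^ (j + 1)"
    "\<And>\<beta>. meval \<beta> H \<noteq> 0 \<Longrightarrow> \<exists>n'. pert.Sp (insert (nn + j) {nn..<nn + j})
        (\<lambda>v. shf {..<nn} (nn + j) \<beta> (if v = nn + j then tau nn b j (Q j) else tau nn b j (Q (v - nn)))) r n'"
    by auto
  have "r ^ (j + 1) \<le> e" using power_increasing[of "j + 1" m r] r e jm by simp
  then have "\<forall>G\<in>{H}. G \<noteq> 0 \<and> mvars G \<subseteq> {..<nn} \<and> (\<forall>m\<in>keys G. size m \<le> e)"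
    using H(1-3) le_trans by blast
  then obtain \<beta> where \<beta>: "\<beta> \<in> B" "meval \<beta> H \<noteq> 0"
    using ev unfolding evasive_def by (metis finite.emptyI finite_insert insertI1)
  obtain n' where n': "pert.Sp (insert (nn + j) {nn..<nn + j})
        (\<lambda>v. shf {..<nn} (nn + j) \<beta> (if v = nn + j then tau nn b j (Q j) else tau nn b j (Q (v - nn)))) r n'"
    using H(4)[OF \<beta>(2)] by blast
  define b' where "b' = b(j := \<beta>)"
  have tb: "tau nn b' j = tau nn b j" by (rule tau_cong) (simp add: b'_def)
  have "(if v = nn + j then tau nn b j (Q j) else tau nn b j (Q (v - nn))) = tau nn b' j (Q (v - nn))" for v
    unfolding tb by simp
  moreover have "\<beta> = b' j" by (simp add: b'_def)
  ultimately have eq: "(\<lambda>v. shf {..<nn} (nn + j) \<beta> (if v = nn + j then tau nn b j (Q j) else tau nn b j (Q (v - nn))))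
     = (\<lambda>v. tau nn b' (Suc j) (Q (v - nn)))"
    by (simp only: shf_tau)
  have ins: "insert (nn + j) {nn..<nn + j} = {nn..<nn + Suc j}" by auto
  have "pert {nn..<nn + Suc j} (\<lambda>v. tau nn b' (Suc j) (Q (v - nn))) r"
  proof
    show "whom (\<lambda>_. 1) r (tau nn b' (Suc j) (Q (v - nn)))" if "v \<in> {nn..<nn + Suc j}" for v
      by (intro whom_tau Q) (use that Suc.prems in auto)
  qed (use r in auto)
  moreover have "pert.Sp {nn..<nn + Suc j} (\<lambda>v. tau nn b' (Suc j) (Q (v - nn))) r n'"
    using n' unfolding eq ins .
  moreover have "\<forall>i<Suc j. b' i \<in> B" using b \<beta>(1) by (auto simp: b'_def less_Suc_eq)
  ultimately show ?case by blast
qed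

context pert
begin

text \<open>The relations of the factors are multiplied: modulo the limit P^a gg is - P^(a+1) h, and
  the exponent A + a supplies the powers missing on either side. The new cofactor is - h k.\<close>

lemma product_low_coefficient:
  assumes "\<And>P. P \<in> set Ps \<Longrightarrow> \<exists>a gg h. P ^ a * (gg + P * h) \<in> lim \<and> gg \<in> \<G>"
  shows "\<exists>a gs h. prod_list Ps ^ a * (prod_list gs - prod_list Ps * h) \<in> lim \<and> set gs \<subseteq> \<G>"
  using assms
proof (induction Ps)
  case Nil
  have "prod_list [] ^ 0 * (prod_list [] - prod_list [] * 1) \<in> lim" by (simp add: lim_zero)
  then show ?case by (metis empty_subsetI list.set(1))
next
  case (Cons P Ps)
  obtain a gg h where 1: "P ^ a * (gg + P * h) \<in> lim" "gg \<in> \<G>" using Cons.prems[of P] by auto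
  obtain A gs k where 2: "prod_list Ps ^ A * (prod_list gs - prod_list Ps * k) \<in> lim" "set gs \<subseteq> \<G>"
    using Cons.IH Cons.prems by (metis list.set_intros(2))
  let ?R = "prod_list Ps"
  have "(P * ?R) ^ (A + a) * (gg * prod_list gs - (P * ?R) * (- (h * k))) =
     (P ^ (A + a) * ?R ^ a * gg) * (?R ^ A * (prod_list gs - ?R * k)) +
     (?R ^ (A + a) * P ^ A * ?R * k) * (P ^ a * (gg + P * h))"
    by (simp add: power_mult_distrib power_add algebra_simps)
  also have "\<dots> \<in> lim" by (intro lim_add lim_mult 1 2)
  finally have "prod_list (P # Ps) ^ (A + a) * (prod_list (gg # gs) - prod_list (P # Ps) * (- (h * k))) \<in> lim"
    by simp
  moreover have "set (gg # gs) \<subseteq> \<G>" using 1 2 by simp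
  ultimately show ?case by blast
qed

end

text \<open>The last point \<open>b m\<close> is the base point of the linear space and has to avoid
  the lowest coefficients of all factors; the other points are its directions.\<close>

theorem secant_nonvanishing:
  fixes Q :: "nat \<Rightarrow> 'k::field mp"
  assumes r: "r > 0" and ev: "evasive nn (r ^ (m + 1)) B"
    and Q: "\<And>i. i < m \<Longrightarrow> whom (\<lambda>_. 1) r (Q i)" "\<And>i. i < m \<Longrightarrow> mvars (Q i) \<subseteq> {..<nn}"
    and Ps: "\<And>P. P \<in> set Ps \<Longrightarrow> whom (\<lambda>_. 1) r P" "\<And>P. P \<in> set Ps \<Longrightarrow> mvars P \<subseteq> {..<nn}"
    and x: "\<And>i. i < m \<Longrightarrow> meval x (Q i) = 0" "\<And>P. P \<in> set Ps \<Longrightarrow> meval x P \<noteq> 0"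
    and f: "f = prod_list Ps + (\<Sum>i<m. A i * Q i)"
  shows "\<exists>b. (\<forall>i\<le>m. b i \<in> B) \<and>
     msub (\<lambda>v. if v \<in> {nn..<nn + m} then mvar v else mcst (b m v)) (tau nn b m f) \<noteq> 0"
proof -
  have e: "r ^ m \<le> r ^ (m + 1)" using r by simp
  obtain b n where b: "\<forall>i<m. b i \<in> B" and P: "pert {nn..<nn + m} (\<lambda>v. tau nn b m (Q (v - nn))) r"
    and Sp: "pert.Sp {nn..<nn + m} (\<lambda>v. tau nn b m (Q (v - nn))) r n"
    using projection_chain[OF r ev e, where Q = Q and j = m] Q by blast
  define Y where "Y = {nn..<nn + m}"
  define q where "q v = tau nn b m (Q (v - nn))" for v
  interpret pert Y q r using P unfolding Y_def q_def .
  have Sp: "Sp n" using Sp unfolding Y_def q_def .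
  interpret t: comm_ring_hom "tau nn b m" by (rule tau_hom)
  have cY: "card Y = m" by (simp add: Y_def)
  have qv: "qvars \<subseteq> {..<nn} \<union> Y"
  proof -
    have "mvars (q v) \<subseteq> {..<nn} \<union> Y" if "v \<in> Y" for v
      unfolding q_def Y_def by (intro mvars_tau Q) (use that in \<open>auto simp: Y_def\<close>)
    then show ?thesis by (auto simp: qvars_def)
  qed
  \<comment> \<open>The point with y = 0: there the shears are trivial, so the sheared forms take
    the values of the original ones at \<open>x\<close>.\<close>
  define x' where "x' v = (if v < nn then x v else 0)" for v
  have tx: "meval x' (tau nn b m p) = meval x p" if "mvars p \<subseteq> {..<nn}" for p
  proof -
    interpret x': comm_ring_hom "meval x'" by (rule meval_hom)
    show ?thesis
      by (rule hom_ext_mp[OF comm_ring_hom_compose[OF meval_hom tau_hom] meval_hom])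
         (use that in \<open>auto simp: tau_var tau_cst mev_cst[OF comm_ring_hom_id] mev_var[OF comm_ring_hom_id]
            x'.hom_add x'.hom_sum x'.hom_mult x'_def\<close>)
  qed
  have qx: "meval x' (q v) = 0" if "v \<in> Y" for v
    unfolding q_def using that by (subst tx) (auto simp: Y_def intro!: x Q)
  define Ts where "Ts = map (tau nn b m) Ps"
  define \<G> :: "'k mp set" where "\<G> = {gg. gg \<noteq> 0 \<and> mvars gg \<subseteq> {..<nn} \<and> (\<forall>k\<in>keys gg. size k \<le> r ^ (m + 1))}"
  have "\<exists>a gg h. T ^ a * (gg + T * h) \<in> lim \<and> gg \<in> \<G>" if T: "T \<in> set Ts" for T
  proof -
    obtain P where P: "P \<in> set Ps" "T = tau nn b m P" using T by (auto simp: Ts_def)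
    have "whom (\<lambda>_. 1) r T" "mvars T \<subseteq> {..<nn} \<union> Y"
      unfolding P(2) Y_def by (intro whom_tau mvars_tau Ps P(1))+
    from low_coefficient[OF Sp this qv finite_lessThan] show ?thesis
      unfolding \<G>_def cY by (simp add: mult.commute)
  qed
  then obtain a gs h where gs: "prod_list Ts ^ a * (prod_list gs - prod_list Ts * h) \<in> lim" "set gs \<subseteq> \<G>"
    using product_low_coefficient[of Ts \<G>] by blast
  have "\<exists>w0\<in>B. \<forall>G\<in>set gs. meval w0 G \<noteq> 0"
    using ev gs(2) unfolding evasive_def \<G>_def by blast
  then obtain w0 where w0: "w0 \<in> B" "\<And>G. G \<in> set gs \<Longrightarrow> meval w0 G \<noteq> 0" by blast
  define b' where "b' = b(m := w0)"
  have tb: "tau nn b' m = tau nn b m" by (rule tau_cong) (simp add: b'_def)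
  let ?s = "msub (\<lambda>v. if v \<in> Y then mvar v else mcst (w0 v)) :: 'k mp \<Rightarrow> _"
  have "?s (tau nn b m f) \<noteq> 0"
  proof
    assume z: "?s (tau nn b m f) = 0"
    interpret s: comm_ring_hom ?s by (rule msub_hom)
    interpret x': comm_ring_hom "meval x'" by (rule meval_hom)
    interpret w0: comm_ring_hom "meval w0" by (rule meval_hom)
    have "tau nn b m f = prod_list Ts + (\<Sum>i<m. tau nn b m (A i) * q (nn + i))"
    proof -
      have "tau nn b m (prod_list Ps) = prod_list (map (tau nn b m) Ps)"
        by (induction Ps) (simp_all add: t.hom_mult t.hom_one)
      then have "tau nn b m f = prod_list Ts + (\<Sum>i<m. tau nn b m (A i) * tau nn b m (Q i))"
        unfolding f t.hom_add t.hom_sum t.hom_mult Ts_def by (simp only:)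
      then show ?thesis by (simp only: q_def add_diff_cancel_left')
    qed
    moreover have "(\<Sum>i<m. tau nn b m (A i) * q (nn + i)) \<in> lim"
      by (intro lim_sum lim_mult q_lim) (simp add: Y_def)
    ultimately have fl: "tau nn b m f - prod_list Ts \<in> lim" by simp
    \<comment> \<open>Modulo the limit the circuit is the product of the sheared factors, so
      \<open>u\<close> may replace that product times \<open>h\<close> in the relation; and
      \<open>u\<close> vanishes on the fibre over \<open>w0\<close> because the circuit was assumed
      to.\<close>
    define u where "u = tau nn b m f * h"
    have ring: "S * (G - F * k) = S * (G - T * k) - (S * k) * (F - T)" for S G F k T :: "'k mp"
      by (simp add: algebra_simps)
    have "prod_list Ts ^ a * (prod_list gs - u) = prod_list Ts ^ a * (prod_list gs - prod_list Ts * h)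
        - (prod_list Ts ^ a * h) * (tau nn b m f - prod_list Ts)"
      unfolding u_def by (rule ring)
    also have "\<dots> \<in> lim" by (intro lim_diff lim_mult gs fl)
    finally have mem: "prod_list Ts ^ a * (prod_list gs - u) \<in> lim" .
    have u0: "?s u = 0" by (simp add: u_def s.hom_mult z)
    have "mvars (prod_list gs) \<subseteq> {..<nn}" by (rule mvars_prod_list) (use gs(2) in \<open>auto simp: \<G>_def\<close>)
    then have yg: "yfree Y (prod_list gs)" by (auto simp: yfree_def Y_def)
    have "meval w0 (prod_list gs) \<noteq> 0"
      using w0(2) by (induction gs) (simp_all add: w0.hom_mult w0.hom_one)
    from eliminate[OF Sp u0 yg this mem] obtain \<alpha> where
      "\<alpha> \<noteq> 0" "yfree Y \<alpha>" "\<alpha> * prod_list Ts ^ a \<in> lim" by blast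
    then have "(prod_list Ts ^ a) ^ D \<in> lim" by (rule purity[OF Sp])
    then have "meval x' ((prod_list Ts ^ a) ^ D) = 0"
      by (rule lim_vanish[rotated 2]) (use qx in \<open>auto simp: x'_def Y_def\<close>)
    then have "meval x' (prod_list Ts) = 0" by (simp add: x'.hom_power)
    moreover have "meval x' (prod_list Ts) \<noteq> 0"
      unfolding Ts_def using x(2) Ps(2)
      by (induction Ps) (auto simp: x'.hom_mult x'.hom_one tx)
    ultimately show False by simp
  qed
  then have "msub (\<lambda>v. if v \<in> {nn..<nn + m} then mvar v else mcst (b' m v)) (tau nn b' m f) \<noteq> 0"
    unfolding tb by (simp add: b'_def Y_def cong: if_cong)
  moreover have "\<forall>i\<le>m. b' i \<in> B" using b w0(1) by (auto simp: b'_def le_less)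
  ultimately show ?thesis by blast
qed

section \<open>Kronecker substitution and an evasive curve\<close>

definition kr :: "nat \<Rightarrow> 'k::comm_ring_1 mp \<Rightarrow> 'k poly" where
  "kr B = mev (\<lambda>c. [:c:]) (\<lambda>v. monom 1 (B ^ v))"

definition krdeg :: "nat \<Rightarrow> nat multiset \<Rightarrow> nat" where
  "krdeg B m = wdeg (\<lambda>v. B ^ v) m"

lemma kr_sum: "kr B p = (\<Sum>m\<in>keys p. monom (lookup p m) (krdeg B m))"
proof -
  have "prod_mset (image_mset (\<lambda>v. monom 1 (B ^ v)) m) = (monom 1 (krdeg B m) :: 'a poly)" for m
    by (induction m) (simp_all add: krdeg_def mult_monom)
  then show ?thesis unfolding kr_def mev_def by (simp add: smult_monom)
qed

lemma wdeg_sum: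
  assumes "finite V" "set_mset m \<subseteq> V"
  shows "wdeg w m = (\<Sum>v\<in>V. count m v * w v)"
  using assms(2)
proof (induction m)
  case (add x m)
  have "(\<Sum>v\<in>V. count (add_mset x m) v * w v) = (\<Sum>v\<in>V. (if v = x then w x else 0) + count m v * w v)"
    by (rule sum.cong) auto
  also have "\<dots> = w x + (\<Sum>v\<in>V. count m v * w v)"
    using add.prems assms(1) by (simp add: sum.distrib)
  finally show ?case using add by simp
qed simp

lemma digits_less: "(\<And>v. v < N \<Longrightarrow> a v < B) \<Longrightarrow> (\<Sum>v<N. a v * B ^ v) < (B::nat) ^ N"
proof (induction N)
  case (Suc N)
  then have "(\<Sum>v<N. a v * B ^ v) < B ^ N" by simp
  moreover have "a N * B ^ N \<le> (B - 1) * B ^ N" using Suc.prems[of N] by (intro mult_right_mono) auto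
  moreover have "B ^ Suc N = (B - 1) * B ^ N + B ^ N"
    using Suc.prems[of N] by (cases B) (auto simp: algebra_simps)
  ultimately show ?case unfolding sum.lessThan_Suc by linarith
qed simp

lemma digits_inj:
  "(\<And>v. v < N \<Longrightarrow> a v < B) \<Longrightarrow> (\<And>v. v < N \<Longrightarrow> b v < B) \<Longrightarrow>
   (\<Sum>v<N. a v * B ^ v) = (\<Sum>v<N. b v * (B::nat) ^ v) \<Longrightarrow> v < N \<Longrightarrow> a v = b v"
proof (induction N)
  case (Suc N)
  have l: "(\<Sum>v<N. a v * B ^ v) < B ^ N" "(\<Sum>v<N. b v * B ^ v) < B ^ N"
    using Suc.prems by (auto intro!: digits_less)
  have B0: "B ^ N > 0" by (rule le_less_trans[OF _ l(1)]) simp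
  have e: "(\<Sum>v<N. a v * B ^ v) + a N * B ^ N = (\<Sum>v<N. b v * B ^ v) + b N * B ^ N"
    using Suc.prems(3) by simp
  have "a N = ((\<Sum>v<N. a v * B ^ v) + a N * B ^ N) div B ^ N" using l(1) B0 by simp
  also have "\<dots> = ((\<Sum>v<N. b v * B ^ v) + b N * B ^ N) div B ^ N" by (simp only: e)
  also have "\<dots> = b N" using l(2) B0 by simp
  finally have N: "a N = b N" .
  then have "(\<Sum>v<N. a v * B ^ v) = (\<Sum>v<N. b v * B ^ v)" using e by simp
  then have "v < N \<Longrightarrow> a v = b v" using Suc.IH Suc.prems(1,2) by simp
  then show ?case using N Suc.prems(4) by (auto simp: less_Suc_eq)
qed simp

lemma kronecker:
  assumes p: "p \<noteq> 0" "mvars p \<subseteq> {..<N}" and B: "\<And>m v. m \<in> keys p \<Longrightarrow> count m v < B"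
  shows "kr B p \<noteq> 0" "degree (kr B p) < B ^ N"
proof -
  have sub: "set_mset m \<subseteq> {..<N}" if "m \<in> keys p" for m using p(2) that by (auto simp: mvars_def)
  have kd: "krdeg B m = (\<Sum>v<N. count m v * B ^ v)" if "m \<in> keys p" for m
    unfolding krdeg_def by (rule wdeg_sum[OF finite_lessThan sub[OF that]])
  have inj: "m = m'" if "m \<in> keys p" "m' \<in> keys p" "krdeg B m = krdeg B m'" for m m'
  proof (rule multiset_eqI)
    fix v
    show "count m v = count m' v"
    proof (cases "v < N")
      case True
      show ?thesis
        by (rule digits_inj[of N "count m" B "count m'"])
           (use B that kd True in auto)
    next
      case False
      then have "v \<notin># m" "v \<notin># m'" using sub[OF that(1)] sub[OF that(2)] by auto
      then show ?thesis by (simp add: count_eq_zero_iff[symmetric] del: count_eq_zero_iff)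
    qed
  qed
  obtain m0 where m0: "m0 \<in> keys p" using p(1) by (metis keys_eq_empty equals0I)
  have "coeff (kr B p) (krdeg B m0) = (\<Sum>m\<in>keys p. if m = m0 then lookup p m else 0)"
    unfolding kr_sum coeff_sum by (rule sum.cong[OF refl]) (use inj[OF _ m0] in auto)
  also have "\<dots> = lookup p m0" using m0 by simp
  finally have "coeff (kr B p) (krdeg B m0) \<noteq> 0" using m0 by (simp add: in_keys_iff)
  then show nz: "kr B p \<noteq> 0" by auto
  have lt: "krdeg B m < B ^ N" if "m \<in> keys p" for m
    unfolding kd[OF that] by (rule digits_less) (rule B[OF that])
  have "degree (kr B p) \<le> B ^ N - 1"
    unfolding kr_sum
  proof (rule degree_sum_le)
    fix m assume "m \<in> keys p"
    then have "krdeg B m \<le> B ^ N - 1" using lt[of m] by simp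
    then show "degree (monom (lookup p m) (krdeg B m)) \<le> B ^ N - 1" using degree_monom_le le_trans by blast
  qed simp
  moreover have "B ^ N > 0" by (rule le_less_trans[OF _ lt[OF m0]]) simp
  ultimately show "degree (kr B p) < B ^ N" by linarith
qed

lemma poly_kr: "poly (kr B p) x = meval (\<lambda>v. x ^ (B ^ v)) p"
proof -
  have h: "comm_ring_hom (\<lambda>p. poly p x)" by unfold_locales simp_all
  show ?thesis unfolding kr_def
    by (simp add: hom_mev[OF h const_poly_hom] poly_monom)
qed

lemma nonzero_value:
  fixes p :: "'k::field mp"
  assumes "infinite (UNIV :: 'k set)" "p \<noteq> 0"
  shows "\<exists>x. meval x p \<noteq> 0"
proof -
  define N where "N = Suc (Max (insert 0 (mvars p)))"
  define B where "B = Suc (Max (insert 0 (size ` keys p)))"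
  have "mvars p \<subseteq> {..<N}" by (auto simp: N_def less_Suc_eq_le intro: Max_ge)
  moreover have "count m v < B" if "m \<in> keys p" for m v
  proof -
    have "count m v \<le> size m" by (rule count_le_size)
    also have "\<dots> \<le> Max (insert 0 (size ` keys p))" by (rule Max_ge) (use that in auto)
    finally show ?thesis by (simp add: B_def)
  qed
  ultimately have "kr B p \<noteq> 0" using kronecker(1)[OF assms(2)] by blast
  then have "finite {x. poly (kr B p) x = 0}" by (rule poly_roots_finite)
  then obtain x where "poly (kr B p) x \<noteq> 0" using assms(1) by (metis (mono_tags) ex_new_if_finite mem_Collect_eq)
  then show ?thesis unfolding poly_kr by blast
qed

text \<open>The substitution of \<open>t\<close> to the power \<open>wgt R q v\<close> for the variable \<open>v\<close> separates the monomials of degree at most \<open>R\<close>.\<close>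

definition goodq :: "nat \<Rightarrow> nat \<Rightarrow> nat \<Rightarrow> bool" where
  "goodq n R q \<longleftrightarrow> (\<forall>m m'. set_mset m \<subseteq> {..<n} \<and> set_mset m' \<subseteq> {..<n} \<and> size m \<le> R \<and> size m' \<le> R \<and>
     krdeg (R + 1) m mod q = krdeg (R + 1) m' mod q \<longrightarrow> m = m')"

definition wgt :: "nat \<Rightarrow> nat \<Rightarrow> nat \<Rightarrow> nat" where
  "wgt R q v = (R + 1) ^ v mod q"

lemma wdeg_wgt_cong: "wdeg (wgt R q) m mod q = krdeg (R + 1) m mod q"
proof (induction m)
  case (add v m)
  have "wdeg (wgt R q) (add_mset v m) mod q = (wgt R q v mod q + wdeg (wgt R q) m mod q) mod q"
    by (simp add: mod_add_eq)
  also have "\<dots> = ((R + 1) ^ v mod q + krdeg (R + 1) m mod q) mod q" by (simp add: add wgt_def)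
  finally show ?case by (simp add: krdeg_def mod_add_eq)
qed (simp add: krdeg_def)

text \<open>The coordinate \<open>n\<close> is the homogenizing one.\<close>

definition curve :: "nat \<Rightarrow> nat \<Rightarrow> nat \<Rightarrow> 'k::comm_ring_1 \<Rightarrow> 'k \<Rightarrow> nat \<Rightarrow> 'k" where
  "curve n R q l t v = l * (if v < n then t ^ wgt R q v else 1)"

text \<open>As polynomials in l and t, the points send a monomial of degree e to some l^e t^j. A
  good \<open>q\<close> recovers the part without the coordinate \<open>n\<close> from j, and e then
  gives the exponent of that coordinate, so no two monomials of degree at most \<open>R\<close>
  collide.\<close>

lemma curve_evasive:
  assumes inf: "infinite (UNIV :: 'k::field set)" and q: "goodq n R q"
  shows "evasive (n + 1) R {curve n R q l t | l t. l \<noteq> (0 :: 'k)}"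
  unfolding evasive_def
proof (intro allI impI)
  fix \<G> :: "'k mp set"
  assume G: "finite \<G> \<and> (\<forall>G\<in>\<G>. G \<noteq> 0 \<and> mvars G \<subseteq> {..<n + 1} \<and> (\<forall>m\<in>keys G. size m \<le> R))"
  let ?x = "\<lambda>v. mvar 0 * (if v < n then mvar 1 ^ wgt R q v else 1) :: 'k mp"
  define im where "im m = replicate_mset (size m) 0 + replicate_mset (wdeg (wgt R q) (filter_mset (\<lambda>v. v < n) m)) (1::nat)" for m
  have im: "prod_mset (image_mset ?x m) = mmon (im m)" for m
  proof (induction m)
    case empty
    then show ?case by (simp add: im_def single_one)
  next
    case (add v m)
    have "?x v = mmon (add_mset 0 (if v < n then replicate_mset (wgt R q v) 1 else {#}))"
      by (simp add: mvar_power mult_single)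
    then have "prod_mset (image_mset ?x (add_mset v m)) = mmon (add_mset 0 (if v < n then replicate_mset (wgt R q v) 1 else {#}) + im m)"
      using add by (simp add: mult_single)
    also have "add_mset 0 (if v < n then replicate_mset (wgt R q v) 1 else {#}) + im m = im (add_mset v m)"
      by (rule multiset_eqI) (simp add: im_def)
    finally show ?case .
  qed
  have nz: "msub ?x G \<noteq> 0" if "G \<in> \<G>" for G
  proof -
    have G': "G \<noteq> 0" "mvars G \<subseteq> {..<n + 1}" "\<And>m. m \<in> keys G \<Longrightarrow> size m \<le> R" using G that by blast+
    have inj: "m = m'" if m: "m \<in> keys G" "m' \<in> keys G" "im m = im m'" for m m'
    proof -
      have c0: "count (im k) 0 = size k" "count (im k) 1 = wdeg (wgt R q) (filter_mset (\<lambda>v. v < n) k)" for k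
        by (simp_all add: im_def)
      have sz: "size m = size m'" using m(3) c0(1) by metis
      have wd: "wdeg (wgt R q) (filter_mset (\<lambda>v. v < n) m) = wdeg (wgt R q) (filter_mset (\<lambda>v. v < n) m')"
        using m(3) c0(2) by metis
      have "filter_mset (\<lambda>v. v < n) m = filter_mset (\<lambda>v. v < n) m'"
      proof -
        have "krdeg (R + 1) (filter_mset (\<lambda>v. v < n) m) mod q = krdeg (R + 1) (filter_mset (\<lambda>v. v < n) m') mod q"
          unfolding wdeg_wgt_cong[symmetric] wd ..
        moreover have "size (filter_mset (\<lambda>v. v < n) k) \<le> R" if "k \<in> keys G" for k
          using G'(3)[OF that] size_filter_mset_lesseq le_trans by blast
        moreover have "set_mset (filter_mset (\<lambda>v. v < n) k) \<subseteq> {..<n}" for k by auto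
        ultimately show ?thesis using q m(1,2) unfolding goodq_def by blast
      qed
      moreover have "filter_mset (\<lambda>v. \<not> v < n) k = replicate_mset (size k - size (filter_mset (\<lambda>v. v < n) k)) n"
        if "k \<in> keys G" for k
      proof -
        have "filter_mset (\<lambda>v. \<not> v < n) k = filter_mset (\<lambda>v. v = n) k"
          using G'(2) that by (intro filter_mset_cong) (force simp: mvars_def)+
        then have f: "filter_mset (\<lambda>v. \<not> v < n) k = replicate_mset (count k n) n"
          by (simp add: filter_eq_replicate_mset)
        moreover have "size k = size (filter_mset (\<lambda>v. v < n) k) + size (filter_mset (\<lambda>v. \<not> v < n) k)"
          by (metis multiset_partition size_union)
        ultimately show ?thesis by simp
      qed
      ultimately show "m = m'" using sz m(1,2) multiset_partition by metis
    qed
    obtain m0 where m0: "m0 \<in> keys G" using G'(1) by (metis keys_eq_empty equals0I)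
    have "msub ?x G = (\<Sum>m\<in>keys G. Poly_Mapping.single (im m) (lookup G m))"
      unfolding mev_def im by (simp add: mult_single)
    then have "lookup (msub ?x G) (im m0) = (\<Sum>m\<in>keys G. if m = m0 then lookup G m else 0)"
      unfolding lookup_sum
      by (simp only: lookup_sum, intro sum.cong[OF refl]) (use inj[OF _ m0] in \<open>auto simp: lookup_single when_def\<close>)
    also have "\<dots> = lookup G m0" using m0 by simp
    finally have "lookup (msub ?x G) (im m0) \<noteq> 0" using m0 by (simp add: in_keys_iff)
    then show ?thesis by auto
  qed
  \<comment> \<open>The factor \<open>mvar 0\<close> forces l to be nonzero at the point where
    \<open>p\<close> does not vanish.\<close>
  define p where "p = mvar 0 * (\<Prod>G\<in>\<G>. msub ?x G)"
  have "(mvar 0 :: 'k mp) \<noteq> 0" by (metis lookup_single_eq lookup_zero one_neq_zero)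
  then have "p \<noteq> 0" using nz G by (simp add: p_def)
  then obtain x where x: "meval x p \<noteq> 0" using nonzero_value[OF inf] by blast
  interpret x: comm_ring_hom "meval x" by (rule meval_hom)
  have x0: "x 0 \<noteq> 0" and xG: "meval x (msub ?x G) \<noteq> 0" if "G \<in> \<G>" for G
    using x that G by (auto simp: p_def x.hom_mult x.hom_prod mev_var[OF comm_ring_hom_id])
  have x0: "x 0 \<noteq> 0" using x by (auto simp: p_def x.hom_mult mev_var[OF comm_ring_hom_id])
  have "meval x (msub ?x G) = meval (curve n R q (x 0) (x 1)) G" for G
  proof -
    have "(\<lambda>v. meval x (?x v)) = curve n R q (x 0) (x 1)"
      by (auto simp: fun_eq_iff curve_def x.hom_mult x.hom_power x.hom_one mev_var[OF comm_ring_hom_id])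
    then show ?thesis by (simp add: hom_mev[OF meval_hom mcst_hom] mev_cst[OF comm_ring_hom_id])
  qed
  then show "\<exists>b\<in>{curve n R q l t | l t. l \<noteq> 0}. \<forall>G\<in>\<G>. meval b G \<noteq> 0"
    using x0 xG by (intro bexI[of _ "curve n R q (x 0) (x 1)"]) auto
qed

subsection \<open>A small modulus separating the monomials\<close>

text \<open>Both sides are the integral of x^(a-1) (1-x)^M over [0, 1]; the induction on M uses
  Pascal's rule instead.\<close>

lemma partial_fractions:
  "a > 0 \<Longrightarrow> (\<Sum>j\<le>M. (- 1) ^ j * of_nat (M choose j) / (of_nat (a + j) :: rat)) = fact M / pochhammer (of_nat a) (M + 1)"
proof (induction M arbitrary: a)
  case (Suc M)
  have p0: "pochhammer (of_nat b :: rat) l \<noteq> 0" if "b > 0" for b l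
    using pochhammer_pos[of "of_nat b :: rat" l] that by simp
  have e1: "(\<Sum>j\<le>Suc M. (- 1) ^ j * of_nat (Suc M choose j) / (of_nat (a + j) :: rat)) =
     1 / of_nat a + (\<Sum>j\<le>M. (- 1) ^ Suc j * of_nat (Suc M choose Suc j) / (of_nat (a + Suc j) :: rat))"
    by (subst sum.atMost_Suc_shift) simp
  have e2: "(\<Sum>j\<le>M. (- 1) ^ Suc j * of_nat (Suc M choose Suc j) / (of_nat (a + Suc j) :: rat)) =
     (\<Sum>j\<le>M. (- 1) ^ Suc j * of_nat (M choose Suc j) / (of_nat (a + Suc j) :: rat)) -
     (\<Sum>j\<le>M. (- 1) ^ j * of_nat (M choose j) / (of_nat (Suc a + j) :: rat))"
    unfolding sum_subtractf[symmetric]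
    by (rule sum.cong) (simp_all add: add_divide_distrib diff_divide_distrib algebra_simps)
  have e3: "1 / of_nat a + (\<Sum>j\<le>M. (- 1) ^ Suc j * of_nat (M choose Suc j) / (of_nat (a + Suc j) :: rat)) =
     (\<Sum>j\<le>Suc M. (- 1) ^ j * of_nat (M choose j) / (of_nat (a + j) :: rat))"
    by (subst sum.atMost_Suc_shift) simp
  have e4: "(\<Sum>j\<le>Suc M. (- 1) ^ j * of_nat (M choose j) / (of_nat (a + j) :: rat)) =
     (\<Sum>j\<le>M. (- 1) ^ j * of_nat (M choose j) / (of_nat (a + j) :: rat))" by simp
  have i1: "(\<Sum>j\<le>M. (- 1) ^ j * of_nat (M choose j) / (of_nat (a + j) :: rat)) = fact M / pochhammer (of_nat a) (M + 1)"
    by (rule Suc.IH) (rule Suc.prems)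
  have i2: "(\<Sum>j\<le>M. (- 1) ^ j * of_nat (M choose j) / (of_nat (Suc a + j) :: rat)) = fact M / pochhammer (of_nat (Suc a)) (M + 1)"
    by (rule Suc.IH) simp
  have "(\<Sum>j\<le>Suc M. (- 1) ^ j * of_nat (Suc M choose j) / (of_nat (a + j) :: rat)) =
     fact M / pochhammer (of_nat a) (M + 1) - fact M / pochhammer (of_nat (Suc a)) (M + 1)"
    using e1 e2 e3 e4 i1 i2 by linarith
  also have "\<dots> = fact (Suc M) / pochhammer (of_nat a) (Suc M + 1)"
  proof -
    have r1: "pochhammer (of_nat a :: rat) (Suc M + 1) = pochhammer (of_nat a) (M + 1) * (of_nat a + of_nat (M + 1))"
      using pochhammer_Suc[of "of_nat a :: rat" "M + 1"] by simp
    have r2: "pochhammer (of_nat a :: rat) (Suc M + 1) = of_nat a * pochhammer (of_nat (Suc a)) (M + 1)"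
      using pochhammer_rec[of "of_nat a :: rat" "M + 1"] by (simp add: add.commute)
    have nz: "pochhammer (of_nat a :: rat) (M + 1) \<noteq> 0" "pochhammer (of_nat (Suc a) :: rat) (M + 1) \<noteq> 0"
      "(of_nat a :: rat) \<noteq> 0" "of_nat a + of_nat (M + 1) \<noteq> (0 :: rat)"
      using p0[of a "M + 1"] p0[of "Suc a" "M + 1"] Suc.prems by (simp_all flip: of_nat_add)
    have "fact M / pochhammer (of_nat a) (M + 1) = fact M * (of_nat a + of_nat (M + 1)) / pochhammer (of_nat a :: rat) (Suc M + 1)"
      unfolding r1 by (rule nonzero_mult_divide_mult_cancel_right[OF nz(4), symmetric])
    moreover have "fact M / pochhammer (of_nat (Suc a)) (M + 1) = of_nat a * fact M / pochhammer (of_nat a :: rat) (Suc M + 1)"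
      unfolding r2 by (rule nonzero_mult_divide_mult_cancel_left[OF nz(3), symmetric])
    ultimately show ?thesis by (simp add: diff_divide_distrib[symmetric] algebra_simps)
  qed
  finally show ?case .
qed (simp add: pochhammer_Suc0)

text \<open>Nair's argument for lcm(1, ..., 2 M + 1): for a = M + 1 the alternating sum above has
  denominators up to 2 M + 1, so Z times the sum is an integer, and it equals Z / ((2 M + 1) binom(2
  M, M)) > 0. Hence Z is at least (2 M + 1) binom(2 M, M), which is at least 4^M.\<close>

lemma divisible_by_all_large:
  assumes "\<And>i. 1 \<le> i \<Longrightarrow> i \<le> 2 * M + 1 \<Longrightarrow> i dvd Z" "Z > (0::nat)"
  shows "Z \<ge> 4 ^ M"
proof -
  define P where "P = (pochhammer (of_nat (M + 1)) (M + 1) :: rat) / fact M"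
  have P: "P = of_nat ((2 * M + 1) * ((2 * M) choose M))"
  proof -
    have "(fact (2 * M + 1) :: rat) = fact M * pochhammer (of_nat (M + 1)) (M + 1)"
      using pochhammer_product[of M "2 * M + 1" "1 :: rat"] by (simp add: pochhammer_fact add.commute)
    moreover have "(of_nat ((2 * M) choose M) :: rat) = fact (2 * M) / (fact M * fact M)"
      using binomial_fact[of M "2 * M"] by simp
    ultimately have "fact M * pochhammer (of_nat (M + 1)) (M + 1) =
        fact M * (fact M * (of_nat (2 * M + 1) * of_nat ((2 * M) choose M)) :: rat)"
      by (simp add: fact_Suc algebra_simps)
    then have "pochhammer (of_nat (M + 1)) (M + 1) =
        fact M * (of_nat (2 * M + 1) * of_nat ((2 * M) choose M) :: rat)"
      by (subst (asm) mult_cancel_left) simp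
    then show ?thesis by (simp only: P_def nonzero_mult_div_cancel_left[OF fact_nonzero] of_nat_mult)
  qed
  have "\<exists>z. (\<Sum>j\<in>A. (- 1) ^ j * of_nat (M choose j) * (of_nat Z / (of_nat (M + 1 + j) :: rat))) = of_int z"
    if "A \<subseteq> {..M}" for A
  proof -
    have "finite A" using that finite_subset by blast
    then show ?thesis using that
    proof (induction A rule: finite_induct)
      case empty
      show ?case by (intro exI[of _ 0]) simp
    next
      case (insert j A)
      then obtain z where z: "(\<Sum>j\<in>A. (- 1) ^ j * of_nat (M choose j) * (of_nat Z / (of_nat (M + 1 + j) :: rat))) = of_int z" by auto
      obtain y where y: "Z = (M + 1 + j) * y" using assms(1)[of "M + 1 + j"] insert.prems by (auto elim: dvdE)
      have "(of_nat Z :: rat) = of_nat (M + 1 + j) * of_nat y" by (simp only: y of_nat_mult)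
      note Zy = this
      have nz: "(of_nat (M + 1 + j) :: rat) \<noteq> 0" unfolding of_nat_eq_0_iff by simp
      have d: "(of_nat Z / of_nat (M + 1 + j) :: rat) = of_nat y"
        unfolding Zy by (rule nonzero_mult_div_cancel_left[OF nz])
      have "(- 1) ^ j * of_nat (M choose j) * (of_nat Z / (of_nat (M + 1 + j) :: rat)) =
          of_int ((- 1) ^ j * int (M choose j) * int y)" unfolding d by simp
      then have "(\<Sum>j\<in>insert j A. (- 1) ^ j * of_nat (M choose j) * (of_nat Z / (of_nat (M + 1 + j) :: rat))) =
          of_int ((- 1) ^ j * int (M choose j) * int y + z)"
        unfolding sum.insert[OF insert(1,2)] z by (simp only: of_int_add)
      then show ?case by blast
    qed
  qed
  from this[of "{..M}"] obtain z where
    z: "(\<Sum>j\<le>M. (- 1) ^ j * of_nat (M choose j) * (of_nat Z / (of_nat (M + 1 + j) :: rat))) = of_int z" by auto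
  have "(\<Sum>j\<le>M. (- 1) ^ j * of_nat (M choose j) * (of_nat Z / (of_nat (M + 1 + j) :: rat))) =
     of_nat Z * (\<Sum>j\<le>M. (- 1) ^ j * of_nat (M choose j) / (of_nat (M + 1 + j) :: rat))"
    by (simp add: sum_distrib_left ac_simps)
  also have "\<dots> = of_nat Z * (fact M / pochhammer (of_nat (M + 1)) (M + 1))"
    by (subst partial_fractions) simp_all
  finally have zz: "of_int z = of_nat Z / P" using z by (simp add: P_def field_simps)
  have Ppos: "P > 0" unfolding P by (simp only: of_nat_0_less_iff) simp
  have "of_nat Z / P > 0" using assms(2) Ppos by simp
  then have "(of_int z :: rat) > 0" by (simp add: zz)
  then have "z \<ge> 1" by simp
  then have "(of_int z :: rat) \<ge> 1" by simp
  then have "of_nat Z \<ge> P" using Ppos by (simp add: zz field_simps)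
  then have "Z \<ge> (2 * M + 1) * ((2 * M) choose M)" unfolding P of_nat_le_iff .
  moreover have "4 ^ M \<le> (2 * M + 1) * ((2 * M) choose M)"
  proof -
    have "(\<Sum>i\<le>2 * M. (2 * M) choose i) \<le> (\<Sum>i\<le>2 * M. (2 * M) choose M)"
      by (rule sum_mono) (use binomial_maximum'[of M] in simp)
    then have "2 ^ (2 * M) \<le> (2 * M + 1) * ((2 * M) choose M)"
      unfolding choose_row_sum by simp
    then show ?thesis by (simp add: power_mult)
  qed
  ultimately show ?thesis by simp
qed

lemma binomial_mono_left: "m \<le> n \<Longrightarrow> m choose k \<le> n choose k"
proof (induction rule: inc_induct)
  case (step j)
  have "j choose k \<le> Suc j choose k" by (cases k) simp_all
  then show ?case using step by simp
qed simp

text \<open>The number of monomials of degree at most \<open>R\<close> in \<open>n\<close>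
  variables.\<close>

definition ssz :: "nat \<Rightarrow> nat \<Rightarrow> nat" where
  "ssz n R = (n + R) choose R"

lemma ssz_ge:
  assumes "n \<ge> 1" "R \<ge> 1"
  shows "R + 1 \<le> ssz n R" "n \<le> ssz n R"
proof -
  have "(R + 1) = (1 + R) choose R" by simp
  also have "\<dots> \<le> (n + R) choose R" by (rule binomial_mono_left) (use assms in simp)
  finally show "R + 1 \<le> ssz n R" by (simp add: ssz_def)
  have "n + 1 = (n + 1) choose n" using binomial_symmetric[of 1 "n + 1"] by simp
  also have "\<dots> \<le> (n + R) choose n" by (rule binomial_mono_left) (use assms in simp)
  also have "\<dots> = (n + R) choose R" using binomial_symmetric[of n "n + R"] by simp
  finally show "n \<le> ssz n R" by (simp add: ssz_def)
qed

text \<open>Padding with one more variable \<open>n\<close> makes all degrees equal to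
  \<open>R\<close>; the count is then Pascal's rule, according to whether the last variable
  occurs.\<close>

lemma card_multisets_le: "finite {m. set_mset m \<subseteq> {..<n} \<and> size m \<le> R} \<and>
    card {m. set_mset m \<subseteq> {..<n} \<and> size m \<le> R} \<le> ssz n R"
proof
  let ?A = "{m. set_mset m \<subseteq> {..<n} \<and> size m \<le> R}"
  show fin: "finite ?A" by (rule finite_multisets_le) simp
  let ?f = "\<lambda>m. m + replicate_mset (R - size m) n"
  have eq: "filter_mset (\<lambda>v. v < n) (?f m) = m" if "m \<in> ?A" for m
  proof -
    have "filter_mset (\<lambda>v. v < n) m = m" using that by (auto simp: filter_mset_eq_conv)
    moreover have "filter_mset (\<lambda>v. v < n) (replicate_mset (R - size m) n) = {#}" by simp
    ultimately show ?thesis by simp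
  qed
  have inj: "inj_on ?f ?A" by (rule inj_on_inverseI[where g = "filter_mset (\<lambda>v. v < n)"]) (rule eq)
  have "card ?A = card (?f ` ?A)" by (rule card_image[OF inj, symmetric])
  also have "\<dots> \<le> card {m. size m = R \<and> set_mset m \<subseteq> {..<n + 1}}"
  proof (rule card_mono)
    show "finite {m. size m = R \<and> set_mset m \<subseteq> {..<n + 1}}"
      by (rule finite_subset[OF _ finite_multisets_le[of "{..<n + 1}" R]]) auto
    show "?f ` ?A \<subseteq> {m. size m = R \<and> set_mset m \<subseteq> {..<n + 1}}" by (auto split: if_splits)
  qed
  also have "\<dots> \<le> ssz n R"
  proof -
    have "card {m. size m = R \<and> set_mset m \<subseteq> {..<n + 1}} \<le> (n + R) choose R" for n R
    proof (induction "n + R" arbitrary: n R rule: less_induct)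
      case less
      show ?case
      proof (cases "R = 0")
        case True
        then have "{m. size m = R \<and> set_mset m \<subseteq> {..<n + 1}} = {{#}}" by auto
        then show ?thesis using True by simp
      next
        case R: False
        show ?thesis
        proof (cases "n = 0")
          case True
          have "{m. size m = R \<and> set_mset m \<subseteq> {..<n + 1}} \<subseteq> {replicate_mset R 0}"
          proof
            fix m :: "nat multiset"
            assume "m \<in> {m. size m = R \<and> set_mset m \<subseteq> {..<n + 1}}"
            then have "size m = R" "set_mset m \<subseteq> {0}" using True by auto
            then show "m \<in> {replicate_mset R 0}" by (metis insertCI set_mset_subset_singletonD size_replicate_mset)
          qed
          then have "card {m. size m = R \<and> set_mset m \<subseteq> {..<n + 1}} \<le> card {replicate_mset R (0::nat)}"
            by (rule card_mono[rotated]) simp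
          then show ?thesis using True by simp
        next
          case n: False
          let ?X = "\<lambda>n R. {m. size m = R \<and> set_mset m \<subseteq> {..<n + 1}}"
          have fX: "finite (?X n R)" for n R :: nat
            by (rule finite_subset[OF _ finite_multisets_le[of "{..<n + 1}" R]]) auto
          have "?X n R \<subseteq> ?X (n - 1) R \<union> add_mset n ` ?X n (R - 1)"
          proof
            fix m assume m: "m \<in> ?X n R"
            show "m \<in> ?X (n - 1) R \<union> add_mset n ` ?X n (R - 1)"
            proof (cases "n \<in># m")
              case True
              then obtain m' where "m = add_mset n m'" by (metis insert_DiffM)
              then show ?thesis using m by auto
            next
              case False
              then have "set_mset m \<subseteq> {..<n}" using m by (auto simp: less_Suc_eq)
              then show ?thesis using m n by auto
            qed
          qed
          then have "card (?X n R) \<le> card (?X (n - 1) R \<union> add_mset n ` ?X n (R - 1))"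
            by (rule card_mono[rotated]) (intro finite_UnI finite_imageI fX)
          also have "\<dots> \<le> card (?X (n - 1) R) + card (add_mset n ` ?X n (R - 1))" by (rule card_Un_le)
          also have "card (add_mset n ` ?X n (R - 1)) \<le> card (?X n (R - 1))" by (rule card_image_le[OF fX])
          also have "card (?X (n - 1) R) + card (?X n (R - 1)) \<le> ((n - 1 + R) choose R) + ((n + (R - 1)) choose (R - 1))"
            by (rule add_mono; rule less) (use n R in auto)
          also have "\<dots> = (n + R) choose R"
            using n R by (cases n; cases R) (simp_all add: add.commute)
          finally show ?thesis by simp
        qed
      qed
    qed
    then show ?thesis unfolding ssz_def .
  qed
  finally show "card ?A \<le> ssz n R" .
qed

text \<open>There are at most S^2 pairs of monomials, and their Kronecker exponents differ by at
  most (R + 1)^n, which is at most 2^(S^2). So the product \<open>Z\<close> of the differences is at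
  most 2^(S^4). If no q up to 2 S^4 + 1 were good, all of them would divide \<open>Z\<close>, which
  would then be at least 4^(S^4).\<close>

lemma good_modulus:
  assumes "n \<ge> 1" "R \<ge> 1"
  shows "\<exists>q. 1 \<le> q \<and> q \<le> 2 * ssz n R ^ 4 + 1 \<and> goodq n R q"
proof (rule ccontr)
  assume neg: "\<nexists>q. 1 \<le> q \<and> q \<le> 2 * ssz n R ^ 4 + 1 \<and> goodq n R q"
  define A where "A = {m. set_mset m \<subseteq> {..<n} \<and> size m \<le> R}"
  define S where "S = ssz n R"
  have A: "finite A" "card A \<le> S" using card_multisets_le[of n R] by (simp_all add: A_def S_def)
  define dif where "dif = (\<lambda>(m, m'). krdeg (R + 1) m - krdeg (R + 1) m')"
  define PP where "PP = {(m, m') \<in> A \<times> A. krdeg (R + 1) m > krdeg (R + 1) m'}"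
  define Z where "Z = (\<Prod>p\<in>PP. dif p)"
  have finPP: "finite PP" unfolding PP_def by (rule finite_subset[of _ "A \<times> A"]) (use A in auto)
  have Zpos: "Z > 0" unfolding Z_def by (rule prod_pos) (auto simp: PP_def dif_def)
  have kinj: "m = m'" if "m \<in> A" "m' \<in> A" "krdeg (R + 1) m = krdeg (R + 1) m'" for m m'
  proof (rule multiset_eqI)
    fix v
    have cl: "count k v < R + 1" if "k \<in> A" for k v
      using that count_le_size[of k v] by (simp add: A_def)
    show "count m v = count m' v"
    proof (cases "v < n")
      case True
      show ?thesis
        by (rule digits_inj[of n "count m" "R + 1" "count m'"])
           (use that cl True in \<open>auto simp: krdeg_def wdeg_sum[of "{..<n}"] A_def\<close>)
    next
      case False
      then have "v \<notin># m" "v \<notin># m'" using that by (auto simp: A_def)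
      then show ?thesis by (simp add: count_eq_zero_iff[symmetric] del: count_eq_zero_iff)
    qed
  qed
  have "q dvd Z" if "1 \<le> q" "q \<le> 2 * S ^ 4 + 1" for q
  proof -
    have "\<not> goodq n R q" using neg that unfolding S_def by blast
    then obtain m m' where m: "m \<in> A" "m' \<in> A" "krdeg (R + 1) m mod q = krdeg (R + 1) m' mod q" "m \<noteq> m'"
      unfolding goodq_def A_def by blast
    have "krdeg (R + 1) m \<noteq> krdeg (R + 1) m'" using kinj m by blast
    then have "\<exists>p\<in>PP. q dvd dif p"
    proof (cases "krdeg (R + 1) m > krdeg (R + 1) m'")
      case True
      then have "(m, m') \<in> PP" using m by (simp add: PP_def)
      moreover have "q dvd krdeg (R + 1) m - krdeg (R + 1) m'"
        using m(3) True by (simp add: mod_eq_dvd_iff_nat[symmetric])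
      ultimately show ?thesis by (intro bexI[of _ "(m, m')"]) (simp_all add: dif_def)
    next
      case False
      then have "(m', m) \<in> PP" using m \<open>krdeg (R + 1) m \<noteq> krdeg (R + 1) m'\<close> by (simp add: PP_def)
      moreover have "q dvd krdeg (R + 1) m' - krdeg (R + 1) m"
        using m(3) False by (simp add: mod_eq_dvd_iff_nat[symmetric])
      ultimately show ?thesis by (intro bexI[of _ "(m', m)"]) (simp_all add: dif_def)
    qed
    then obtain p where "p \<in> PP" "q dvd dif p" by blast
    then show ?thesis unfolding Z_def using finPP dvd_prod_eqI dvd_trans dvd_prodI by metis
  qed
  then have Z4: "Z \<ge> 4 ^ (S ^ 4)" by (intro divisible_by_all_large Zpos) auto
  have kb: "krdeg (R + 1) m \<le> (R + 1) ^ n" if "m \<in> A" for m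
  proof -
    have "count m v < R + 1" for v using that count_le_size[of m v] by (simp add: A_def)
    then have "(\<Sum>v<n. count m v * (R + 1) ^ v) < (R + 1) ^ n" by (intro digits_less) simp
    then show ?thesis using that by (simp add: krdeg_def wdeg_sum[of "{..<n}"] A_def)
  qed
  have RS: "R + 1 \<le> S" and nS: "n \<le> S" using ssz_ge[OF assms] by (simp_all add: S_def)
  have "Z \<le> (\<Prod>p\<in>PP. (R + 1) ^ n)"
    unfolding Z_def
  proof (rule prod_mono)
    fix p assume "p \<in> PP"
    then obtain m m' where "p = (m, m')" "m \<in> A" by (auto simp: PP_def)
    then have "dif p \<le> krdeg (R + 1) m" by (simp add: dif_def)
    then show "0 \<le> dif p \<and> dif p \<le> (R + 1) ^ n" using kb[OF \<open>m \<in> A\<close>] by simp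
  qed
  also have "\<dots> = (R + 1) ^ (n * card PP)" by (simp add: power_mult)
  also have "\<dots> \<le> (2 ^ (R + 1)) ^ (n * card PP)" by (rule power_mono[OF less_imp_le[OF less_exp]]) simp
  also have "\<dots> = 2 ^ ((R + 1) * (n * card PP))" by (rule power_mult[symmetric])
  also have "\<dots> \<le> 2 ^ (S * (S * (S * S)))"
  proof (rule power_increasing)
    have "card PP \<le> card (A \<times> A)" by (rule card_mono) (use A in \<open>auto simp: PP_def\<close>)
    also have "\<dots> \<le> S * S" using A by (simp add: card_cartesian_product mult_le_mono)
    finally show "(R + 1) * (n * card PP) \<le> S * (S * (S * S))" using RS nS by (intro mult_le_mono) auto
  qed simp
  also have "\<dots> = 2 ^ (S ^ 4)" by (simp add: power4_eq_xxxx mult.assoc)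
  also have "\<dots> < 4 ^ (S ^ 4)"
  proof (rule power_strict_mono)
    show "0 < S ^ 4" using RS by simp
  qed simp_all
  finally show False using Z4 by simp
qed

subsection \<open>The hitting property over a field\<close>

text \<open>The generic point of the span of \<open>mu + 1\<close> points of the curve, in affine coordinates: the points have the parameters
  \<open>0, \<dots>, mu\<close>, and \<open>mu + j\<close> is the coefficient of the point with parameter \<open>j\<close>.\<close>

definition theta :: "nat \<Rightarrow> nat \<Rightarrow> nat \<Rightarrow> nat \<Rightarrow> nat \<Rightarrow> 'k::comm_ring_1 mp" where
  "theta n R q mu v = mvar 0 ^ wgt R q v +
     (\<Sum>j\<in>{1..mu}. mvar (mu + j) * (mvar j ^ wgt R q v - mvar 0 ^ wgt R q v))"

text \<open>A point of the span is normalized by its last coordinate c, by homogeneity at the cost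
  of c^d. The coefficients u_i = y_i l_i / c then sum to 1, so one of them can be eliminated; this
  gives \<open>theta\<close> its form.\<close>

lemma theta_secant:
  fixes f :: "'k::field mp"
  assumes inf: "infinite (UNIV :: 'k set)" and b: "\<And>i. i \<le> m \<Longrightarrow> b i \<in> {curve n R q l t | l t. l \<noteq> 0}"
    and hom: "whom (\<lambda>_. 1) d f" "mvars f \<subseteq> {..<n + 1}"
    and nz: "msub (\<lambda>v. if v \<in> {n + 1..<n + 1 + m} then mvar v else mcst (b m v)) (tau (n + 1) b m f) \<noteq> 0"
  shows "msub (theta n R q m) (msub (\<lambda>v. if v = n then 1 else mvar v) f) \<noteq> 0"
proof -
  obtain l t where lt: "\<And>i. i \<le> m \<Longrightarrow> b i = curve n R q (l i) (t i) \<and> l i \<noteq> 0"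
    using b by (simp only: mem_Collect_eq) metis
  let ?s = "msub (\<lambda>v. if v \<in> {n + 1..<n + 1 + m} then mvar v else mcst (b m v)) :: 'k mp \<Rightarrow> _"
  \<comment> \<open>\<open>L\<close> is the last coordinate of the generic point. It joins the
    product so that both factors are nonzero at \<open>z\<close>.\<close>
  define L where "L = mcst (l m) + (\<Sum>i<m. mcst (l i) * mvar (n + 1 + i))"
  have "L \<noteq> 0"
  proof -
    have "lookup L {#} = l m"
      by (simp add: L_def lookup_add lookup_sum lookup_mcst_mult lookup_single when_def)
    then show ?thesis using lt[of m] by auto
  qed
  then have "?s (tau (n + 1) b m f) * L \<noteq> 0" using nz by simp
  then obtain z where z: "meval z (?s (tau (n + 1) b m f) * L) \<noteq> 0" using nonzero_value[OF inf] by blast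
  interpret z: comm_ring_hom "meval z" by (rule meval_hom)
  interpret s: comm_ring_hom ?s by (rule msub_hom)
  define y where "y i = (if i < m then z (n + 1 + i) else 1)" for i
  define c where "c = (\<Sum>i\<le>m. y i * l i)"
  have splitm: "(\<Sum>i\<le>m. F i) = F m + (\<Sum>i<m. F i)" for F :: "nat \<Rightarrow> 'k"
    by (simp add: lessThan_Suc_atMost[symmetric] add.commute)
  have "meval z L = c"
    unfolding c_def splitm L_def
    by (simp add: y_def z.hom_add z.hom_sum z.hom_mult mev_cst[OF comm_ring_hom_id] mev_var[OF comm_ring_hom_id] mult.commute)
  then have c0: "c \<noteq> 0" using z by (auto simp: z.hom_mult)
  define pt where "pt v = (\<Sum>i\<le>m. y i * b i v)" for v
  have "meval z (?s (tau (n + 1) b m f)) = meval pt f"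
  proof (rule hom_ext_mp)
    show "comm_ring_hom (\<lambda>f. meval z (?s (tau (n + 1) b m f)))"
      by (intro comm_ring_hom_compose[OF meval_hom] comm_ring_hom_compose[OF msub_hom] tau_hom)
    show "meval z (?s (tau (n + 1) b m (mvar v))) = meval pt (mvar v)" if "v \<in> mvars f" for v
    proof -
      have v: "v < n + 1" using that hom(2) by auto
      have 1: "tau (n + 1) b m (mvar v) = mvar v + (\<Sum>i<m. mcst (b i v) * mvar (n + 1 + i))"
        using v by (simp add: tau_var)
      have 2: "?s (mvar v) = mcst (b m v)" by (subst mev_var[OF mcst_hom]) (use v in simp)
      have 3: "?s (mvar (n + 1 + i)) = mvar (n + 1 + i)" if "i < m" for i
        by (subst mev_var[OF mcst_hom]) (use that in simp)
      have "?s (tau (n + 1) b m (mvar v)) = mcst (b m v) + (\<Sum>i<m. mcst (b i v) * mvar (n + 1 + i))"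
        unfolding 1 s.hom_add s.hom_sum s.hom_mult 2 mev_cst[OF mcst_hom]
        by (intro arg_cong2[where f = "(+)"] refl sum.cong) (simp only: 3 lessThan_iff)
      then show ?thesis
        unfolding mev_var[OF comm_ring_hom_id] pt_def splitm
        by (simp add: z.hom_add z.hom_sum z.hom_mult y_def mult.commute
            mev_cst[OF comm_ring_hom_id] mev_var[OF comm_ring_hom_id])
    qed
  qed (simp_all add: meval_hom tau_cst mev_cst[OF mcst_hom] mev_cst[OF comm_ring_hom_id])
  then have ptnz: "meval pt f \<noteq> 0" using z by (auto simp: z.hom_mult)
  have ptn: "pt n = c" unfolding pt_def c_def by (rule sum.cong) (simp_all add: lt curve_def)
  define u where "u i = y i * l i / c" for i
  have usum: "(\<Sum>i\<le>m. u i) = 1" unfolding u_def sum_divide_distrib[symmetric] c_def[symmetric] using c0 by simp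
  have ptv: "pt v = c * (\<Sum>i\<le>m. u i * t i ^ wgt R q v)" if "v < n" for v
    unfolding pt_def sum_distrib_left
    by (rule sum.cong) (use c0 that in \<open>simp_all add: lt curve_def u_def\<close>)
  define pt' where "pt' v = (if v = n then 1 else (\<Sum>i\<le>m. u i * t i ^ wgt R q v))" for v
  have "meval pt f = c ^ d * meval pt' f"
  proof -
    have pm: "prod_mset (image_mset pt k) = c ^ size k * prod_mset (image_mset pt' k)" if "set_mset k \<subseteq> {..<n + 1}" for k
      using that
    proof (induction k)
      case (add v k)
      have "pt v = c * pt' v" using add.prems ptv[of v] ptn by (auto simp: pt'_def)
      then show ?case using add by simp
    qed simp
    have "meval pt f = (\<Sum>k\<in>keys f. c ^ d * (lookup f k * prod_mset (image_mset pt' k)))"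
      unfolding mev_def
    proof (rule sum.cong[OF refl])
      fix k assume k: "k \<in> keys f"
      have "set_mset k \<subseteq> {..<n + 1}" using hom(2) k by (auto simp: mvars_def)
      moreover have "size k = d" using hom(1) k unfolding whom_def wdeg_one by blast
      ultimately show "lookup f k * prod_mset (image_mset pt k) = c ^ d * (lookup f k * prod_mset (image_mset pt' k))"
        by (simp add: pm)
    qed
    then show ?thesis by (simp add: mev_def sum_distrib_left)
  qed
  then have nz': "meval pt' f \<noteq> 0" using ptnz by auto
  \<comment> \<open>Shift of indices: variable 0 of \<open>theta\<close> is the curve parameter of
    the base point \<open>b m\<close>, variable j + 1 that of \<open>b j\<close>, and variable m + j
    + 1 the coefficient of \<open>b j\<close>.\<close>
  define x where "x i = (if i = 0 then t m else if i \<le> m then t (i - 1) else u (i - m - 1))" for i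
  have xth: "meval x (theta n R q m v) = (\<Sum>i\<le>m. u i * t i ^ wgt R q v)" for v
  proof -
    interpret x: comm_ring_hom "meval x" by (rule meval_hom)
    have "meval x (theta n R q m v) = t m ^ wgt R q v + (\<Sum>j\<in>{1..m}. u (j - 1) * (t (j - 1) ^ wgt R q v - t m ^ wgt R q v))"
      unfolding theta_def
      by (simp add: x.hom_add x.hom_sum x.hom_mult x.hom_minus x.hom_power mev_var[OF comm_ring_hom_id] x_def)
    also have "(\<Sum>j\<in>{1..m}. u (j - 1) * (t (j - 1) ^ wgt R q v - t m ^ wgt R q v)) =
        (\<Sum>i<m. u i * (t i ^ wgt R q v - t m ^ wgt R q v))"
      by (rule sum.reindex_bij_witness[where i = "\<lambda>i. i + 1" and j = "\<lambda>j. j - 1"]) auto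
    also have "\<dots> = (\<Sum>i<m. u i * t i ^ wgt R q v) - (\<Sum>i<m. u i) * t m ^ wgt R q v"
      by (simp add: right_diff_distrib sum_subtractf sum_distrib_right)
    also have "(\<Sum>i<m. u i) = 1 - u m" using usum unfolding splitm by (simp add: algebra_simps)
    finally show ?thesis unfolding splitm by (simp add: algebra_simps)
  qed
  have "meval x (msub (theta n R q m) (msub (\<lambda>v. if v = n then 1 else mvar v) f)) = meval pt' f"
  proof (rule hom_ext_mp)
    interpret x: comm_ring_hom "meval x" by (rule meval_hom)
    interpret th: comm_ring_hom "msub (theta n R q m)" by (rule msub_hom)
    show "comm_ring_hom (\<lambda>f. meval x (msub (theta n R q m) (msub (\<lambda>v. if v = n then 1 else mvar v) f)))"
      by (intro comm_ring_hom_compose[OF meval_hom] comm_ring_hom_compose[OF msub_hom] msub_hom)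
    show "meval x (msub (theta n R q m) (msub (\<lambda>v. if v = n then 1 else mvar v) (mvar v))) = meval pt' (mvar v)" for v
      by (simp add: mev_var[OF mcst_hom] mev_var[OF comm_ring_hom_id] pt'_def th.hom_one x.hom_one xth)
  qed (simp_all add: meval_hom mev_cst[OF mcst_hom] mev_cst[OF comm_ring_hom_id])
  then show ?thesis using nz' by (auto simp: mev_def)
qed

text \<open>The hitting set consists of the points for \<open>q \<le> qmax\<close> and the exponents \<open>i \<le> emax\<close>; \<open>kbase\<close> is the base of
  Kronecker's substitution.\<close>

definition mu_of :: "nat \<Rightarrow> nat \<Rightarrow> nat" where "mu_of n k = min (k - 1) n"
definition qmax :: "nat \<Rightarrow> nat \<Rightarrow> nat" where "qmax n R = 2 * ssz n R ^ 4 + 1"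
definition kbase :: "nat \<Rightarrow> nat \<Rightarrow> nat \<Rightarrow> nat" where "kbase n d R = d * qmax n R + 1"
definition emax :: "nat \<Rightarrow> nat \<Rightarrow> nat \<Rightarrow> nat \<Rightarrow> nat" where
  "emax n d R mu = kbase n d R ^ (2 * mu + 1)"

text \<open>Substituting \<open>t\<^bsup>i B\<^sup>u\<^esup>\<close> for the variable \<open>u\<close> in \<open>theta n R q mu v\<close> gives the univariate polynomial \<open>gpoly R q mu B i v\<close>;
  the sum is cut at \<open>l\<close> to describe the intermediate states of the program.\<close>

definition gpart :: "nat \<Rightarrow> nat \<Rightarrow> nat \<Rightarrow> nat \<Rightarrow> nat \<Rightarrow> nat \<Rightarrow> nat \<Rightarrow> int poly" where
  "gpart R q mu B i v l = monom 1 (i * wgt R q v) +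
     (\<Sum>j\<in>{1..l}. monom 1 (i * (B ^ (mu + j) + wgt R q v * B ^ j)) - monom 1 (i * (B ^ (mu + j) + wgt R q v)))"

definition gpoly :: "nat \<Rightarrow> nat \<Rightarrow> nat \<Rightarrow> nat \<Rightarrow> nat \<Rightarrow> nat \<Rightarrow> int poly" where
  "gpoly R q mu B i v = gpart R q mu B i v mu"

definition ipev :: "'k::comm_ring_1 \<Rightarrow> int poly \<Rightarrow> 'k" where
  "ipev a p = poly (map_poly of_int p) a"

lemma of_int_comm_hom: "comm_ring_hom (of_int :: int \<Rightarrow> 'k::comm_ring_1)"
  by unfold_locales simp_all

lemma ipev_hom: "comm_ring_hom (ipev a)"
proof -
  interpret i: comm_ring_hom "of_int :: int \<Rightarrow> 'a" by (rule of_int_comm_hom)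
  interpret m: map_poly_comm_ring_hom "of_int :: int \<Rightarrow> 'a" ..
  show ?thesis unfolding ipev_def by unfold_locales (simp_all add: of_int_poly_hom.hom_add of_int_poly_hom.hom_mult)
qed

lemma ipev_monom: "ipev a (monom c e) = of_int c * a ^ e"
  unfolding ipev_def by (simp add: map_poly_monom poly_monom)

lemma ipev_gpoly:
  "ipev a (gpoly R q mu B i v) = meval (\<lambda>u. (a ^ i) ^ (B ^ u)) (theta 0 R q mu v)"
proof -
  interpret e: comm_ring_hom "ipev a" by (rule ipev_hom)
  interpret x: comm_ring_hom "meval (\<lambda>u. (a ^ i) ^ (B ^ u))" by (rule meval_hom)
  have p: "a ^ (i * (x + y * z)) = (a ^ i) ^ x * ((a ^ i) ^ z) ^ y" for x y z
    by (simp add: power_add power_mult[symmetric] distrib_left ac_simps)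
  have p': "a ^ (i * (x + y)) = (a ^ i) ^ x * (a ^ i) ^ y" for x y
    by (simp add: power_add power_mult[symmetric] distrib_left)
  show ?thesis
    unfolding gpoly_def gpart_def theta_def
    by (simp add: e.hom_add e.hom_sum e.hom_minus ipev_monom x.hom_add x.hom_sum x.hom_mult x.hom_minus x.hom_power
        mev_var[OF comm_ring_hom_id] p p' right_diff_distrib power_mult)
       (rule sum.cong, simp_all add: power_add power_mult[symmetric] ac_simps)
qed

lemma theta_n: "theta n R q mu = theta n' R q mu"
  by (simp add: theta_def fun_eq_iff)

definition point :: "'k::comm_ring_1 \<Rightarrow> nat \<Rightarrow> nat \<Rightarrow> nat \<Rightarrow> nat \<Rightarrow> nat \<Rightarrow> nat \<Rightarrow> 'k" where
  "point a R q mu B i v = ipev a (gpoly R q mu B i v)"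

text \<open>Each exponent in the composed polynomial is at most d q, below the base, and there are 2
  mu + 1 variables; so its univariate Kronecker image has degree less than \<open>emax\<close>. It
  cannot vanish at \<open>emax\<close> different powers of \<open>a\<close>.\<close>

lemma hitting_exponent:
  fixes f :: "'k::field mp"
  assumes nz: "msub (theta n R q mu) f \<noteq> 0" and deg: "\<And>m. m \<in> keys f \<Longrightarrow> size m \<le> d"
    and q: "1 \<le> q" "q \<le> qmax n R" and d: "d \<ge> 1"
    and a: "\<And>c. 1 \<le> c \<Longrightarrow> c \<le> emax n d R mu \<Longrightarrow> a ^ c \<noteq> 1" "a \<noteq> 0"
  shows "\<exists>i. 1 \<le> i \<and> i \<le> emax n d R mu \<and> meval (point a R q mu (kbase n d R) i) f \<noteq> 0"
proof -
  let ?B = "kbase n d R"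
  let ?E = "emax n d R mu"
  let ?p = "msub (theta n R q mu) f"
  have mth: "mvars (theta n R q mu v :: 'k mp) \<subseteq> {..<2 * mu + 1}" for v
  proof -
    have mv: "mvars (mvar u :: 'k mp) \<subseteq> {..<2 * mu + 1}" if "u < 2 * mu + 1" for u
      by (rule order_trans[OF mvars_single]) (use that in simp)
    have mp: "mvars (mvar u ^ w :: 'k mp) \<subseteq> {..<2 * mu + 1}" if "u < 2 * mu + 1" for u w
      by (rule order_trans[OF mvars_power mv[OF that]])
    have "mvars (mvar (mu + j) * (mvar j ^ wgt R q v - mvar 0 ^ wgt R q v) :: 'k mp) \<subseteq> {..<2 * mu + 1}"
      if "j \<in> {1..mu}" for j
      by (rule order_trans[OF mvars_mult Un_least[OF mv order_trans[OF mvars_diff Un_least[OF mp mp]]]])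
         (use that in auto)
    then show ?thesis unfolding theta_def
      by (intro order_trans[OF mvars_add Un_least] mp mvars_sum) auto
  qed
  have mvp: "mvars ?p \<subseteq> {..<2 * mu + 1}" by (rule mvars_mev) (use mth in simp_all)
  have wq: "wgt R q v \<le> q" for v unfolding wgt_def using q by (simp add: less_imp_le)
  have cdeg: "count m u \<le> d * q" if m: "m \<in> keys ?p" for m u
  proof -
    define bd where "bd e p \<longleftrightarrow> (\<forall>m\<in>keys p. count m u \<le> e)" for e and p :: "'k mp"
    have bd_add: "bd e (x + y)" if "bd e x" "bd e y" for e x y
      using that keys_add[of x y] unfolding bd_def by blast
    have bd_diff: "bd e (x - y)" if "bd e x" "bd e y" for e x y
      using that keys_diff[of x y] unfolding bd_def by blast
    have bd_sum: "bd e (sum F A)" if "\<And>i. i \<in> A \<Longrightarrow> bd e (F i)" for e A and F :: "'i \<Rightarrow> 'k mp"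
      using that by (induction A rule: infinite_finite_induct) (simp_all add: bd_add, simp_all add: bd_def)
    have bd_mult: "bd (e + e') (x * y)" if "bd e x" "bd e' y" for e e' x y
      unfolding bd_def
    proof
      fix k assume "k \<in> keys (x * y)"
      then obtain k1 k2 where "k1 \<in> keys x" "k2 \<in> keys y" "k = k1 + k2" using keys_mult[of x y] by blast
      then show "count k u \<le> e + e'" using that by (simp add: bd_def add_mono)
    qed
    have bd_mono: "bd e' x" if "bd e x" "e \<le> e'" for e e' x using that unfolding bd_def by (meson le_trans)
    have bdv: "bd w (mvar z ^ w)" for z w
      by (simp add: bd_def mvar_power)
    have bd1: "bd (if z = u then w else 0) (mvar z ^ w)" for z w
      by (simp add: bd_def mvar_power)
    have bdth: "bd q (theta n R q mu v)" for v
      unfolding theta_def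
    proof (intro bd_add bd_sum)
      show "bd q (mvar 0 ^ wgt R q v)" by (rule bd_mono[OF bdv wq])
      fix j assume j: "j \<in> {1..mu}"
      show "bd q (mvar (mu + j) * (mvar j ^ wgt R q v - mvar 0 ^ wgt R q v))"
      proof (cases "u = mu + j")
        case True
        have "bd 1 (mvar (mu + j) ^ 1)" by (rule bdv)
        moreover have "bd 0 (mvar j ^ wgt R q v - mvar 0 ^ wgt R q v)"
          using bd1[of j "wgt R q v"] bd1[of 0 "wgt R q v"] True j by (intro bd_diff) auto
        ultimately have "bd (1 + 0) (mvar (mu + j) ^ 1 * (mvar j ^ wgt R q v - mvar 0 ^ wgt R q v))" by (rule bd_mult)
        then show ?thesis using q(1) by (auto intro: bd_mono)
      next
        case False
        have "bd 0 (mvar (mu + j) ^ 1)" using bd1[of "mu + j" 1] False by simp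
        moreover have "bd q (mvar j ^ wgt R q v - mvar 0 ^ wgt R q v)"
          by (intro bd_diff bd_mono[OF bdv wq])
        ultimately have "bd (0 + q) (mvar (mu + j) ^ 1 * (mvar j ^ wgt R q v - mvar 0 ^ wgt R q v))" by (rule bd_mult)
        then show ?thesis by simp
      qed
    qed
    have bdp: "bd (size k * q) (prod_mset (image_mset (theta n R q mu) k))" for k
    proof (induction k)
      case empty
      show ?case by (simp add: bd_def)
    next
      case (add v k)
      then show ?case using bd_mult[OF bdth add] by simp
    qed
    have "bd (d * q) ?p"
      unfolding mev_def
    proof (rule bd_sum)
      fix k assume k: "k \<in> keys f"
      have "bd (0 + size k * q) (mcst (lookup f k) * prod_mset (image_mset (theta n R q mu) k))"
        by (rule bd_mult[OF _ bdp]) (simp add: bd_def)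
      then show "bd (d * q) (mcst (lookup f k) * prod_mset (image_mset (theta n R q mu) k))"
        by (rule bd_mono) (use deg[OF k] in simp)
    qed
    then show ?thesis using m by (simp add: bd_def)
  qed
  have "count m u < ?B" if "m \<in> keys ?p" for m u
    using cdeg[OF that, of u] mult_le_mono2[OF q(2), of d] unfolding kbase_def by linarith
  from kronecker[OF nz mvp this] have k: "kr ?B ?p \<noteq> 0" "degree (kr ?B ?p) < ?E"
    by (simp_all add: emax_def)
  have "\<exists>i\<in>{1..?E}. poly (kr ?B ?p) (a ^ i) \<noteq> 0"
  proof (rule ccontr)
    assume "\<not> ?thesis"
    then have sub: "(\<lambda>i. a ^ i) ` {1..?E} \<subseteq> {x. poly (kr ?B ?p) x = 0}" by auto
    have dist: "a ^ i \<noteq> a ^ j" if "i < j" "j \<le> ?E" for i j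
    proof
      assume e: "a ^ i = a ^ j"
      have "a ^ j = a ^ i * a ^ (j - i)" using that by (simp add: power_add[symmetric])
      then have "a ^ (j - i) = 1" using e a(2) by simp
      then show False using a(1)[of "j - i"] that by simp
    qed
    have "inj_on (\<lambda>i. a ^ i) {1..?E}"
    proof (rule inj_onI)
      fix i j assume "i \<in> {1..?E}" "j \<in> {1..?E}" "a ^ i = a ^ j"
      then show "i = j" using dist[of i j] dist[of j i] by (cases i j rule: linorder_cases) auto
    qed
    then have "?E \<le> card ((\<lambda>i. a ^ i) ` {1..?E})" by (simp add: card_image)
    also have "\<dots> \<le> card {x. poly (kr ?B ?p) x = 0}" by (rule card_mono[OF poly_roots_finite[OF k(1)] sub])
    also have "\<dots> \<le> degree (kr ?B ?p)" by (rule card_poly_roots_bound[OF k(1)])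
    finally show False using k(2) by simp
  qed
  then obtain i where i: "i \<in> {1..?E}" "poly (kr ?B ?p) (a ^ i) \<noteq> 0" by blast
  have "poly (kr ?B ?p) (a ^ i) = meval (point a R q mu ?B i) f"
  proof -
    have "(\<lambda>v. meval (\<lambda>u. (a ^ i) ^ (?B ^ u)) (theta n R q mu v)) = point a R q mu ?B i"
      by (auto simp: fun_eq_iff point_def ipev_gpoly theta_n[of n R q mu 0])
    then show ?thesis
      by (simp add: poly_kr hom_mev[OF meval_hom mcst_hom] mev_cst[OF comm_ring_hom_id])
  qed
  then show ?thesis using i by auto
qed

text \<open>In every characteristic, a root of \<open>t\<^sup>2\<^sup>M - t\<^sup>M + 1\<close> with \<open>M = 6\<^sup>e\<close> is an element whose order
  divides \<open>6\<^sup>e\<^sup>+\<^sup>1\<close> but not \<open>6\<^sup>e\<close>, hence a multiple of \<open>2\<^sup>e\<^sup>+\<^sup>1\<close> or \<open>3\<^sup>e\<^sup>+\<^sup>1\<close>.\<close>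

lemma root_of_large_order:
  fixes a :: "'k::field"
  assumes r: "a ^ (2 * 6 ^ e) - a ^ (6 ^ e) + 1 = 0"
  shows "a \<noteq> 0" "1 \<le> c \<Longrightarrow> c < 2 ^ e \<Longrightarrow> a ^ c \<noteq> 1"
proof -
  define b where "b = a ^ (6 ^ e)"
  have b: "b ^ 2 - b + 1 = 0" using r by (simp add: b_def power_mult[symmetric] mult.commute)
  show a0: "a \<noteq> 0"
  proof
    assume "a = 0"
    then have "b = 0" by (simp add: b_def)
    then show False using b by simp
  qed
  have "b ^ 3 + 1 = (b + 1) * (b ^ 2 - b + 1)" by (simp add: algebra_simps power2_eq_square power3_eq_cube)
  \<comment> \<open>b is a root of t^2 - t + 1, whence b^3 = -1 and b^6 = 1, while b = 1 would give
    1 = 0. This holds in every characteristic.\<close>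
  then have b3: "b ^ 3 = - 1" using b by (simp add: eq_neg_iff_add_eq_0)
  have "b ^ 6 = (b ^ 3) ^ 2" by (simp flip: power_mult)
  then have "b ^ 6 = 1" by (simp add: b3)
  moreover have "a ^ (6 ^ (e + 1)) = b ^ 6" unfolding b_def power_mult[symmetric] by (simp add: mult.commute)
  ultimately have b6: "a ^ (6 ^ (e + 1)) = 1" by simp
  show "a ^ c \<noteq> 1" if c: "1 \<le> c" "c < 2 ^ e"
  proof
    assume ac: "a ^ c = 1"
    \<comment> \<open>Both prime powers in g are at most c < 2^e <= 3^e, so their exponents are
      below e and g divides 6^e. Then b is a power of a^g = 1.\<close>
    define g where "g = gcd c (6 ^ (e + 1))"
    have "a ^ g = 1"
    proof -
      obtain x y where xy: "c * x = 6 ^ (e + 1) * y + g"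
        using bezout_nat[of c "6 ^ (e + 1)"] c unfolding g_def by auto
      have "a ^ (c * x) = 1" using ac by (simp add: power_mult)
      moreover have "a ^ (6 ^ (e + 1) * y + g) = a ^ g" using b6 by (simp add: power_add power_mult)
      ultimately show ?thesis by (simp only: xy)
    qed
    moreover have "g dvd 6 ^ e"
    proof -
      have "g dvd 2 ^ (e + 1) * 3 ^ (e + 1)"
        unfolding g_def by (simp flip: power_mult_distrib)
      then obtain g2 g3 where g: "g = g2 * g3" "g2 dvd 2 ^ (e + 1)" "g3 dvd 3 ^ (e + 1)"
        by (rule division_decomp[THEN exE]) blast
      obtain i j where ij: "g2 = 2 ^ i" "g3 = 3 ^ j"
        using g(2,3) divides_primepow_nat[of 2 g2 "e + 1"] divides_primepow_nat[of 3 g3 "e + 1"] by auto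
      have gc: "g \<le> c" unfolding g_def using c by (intro gcd_le1_nat) simp
      have "g2 \<le> g" "g3 \<le> g" using g(1) ij by simp_all
      then have le: "2 ^ i < (2::nat) ^ e" "3 ^ j < (2::nat) ^ e" using gc c unfolding ij by linarith+
      have "i < e" using power_less_imp_less_exp[OF _ le(1)] by simp
      moreover have "j < e"
      proof (rule ccontr)
        assume "\<not> j < e"
        then have "(3::nat) ^ e \<le> 3 ^ j" by (intro power_increasing) auto
        moreover have "(2::nat) ^ e \<le> 3 ^ e" by (rule power_mono) auto
        ultimately show False using le(2) by linarith
      qed
      ultimately have "g2 dvd 2 ^ e" "g3 dvd 3 ^ e" using ij by (auto intro: le_imp_power_dvd)
      then have "g dvd 2 ^ e * 3 ^ e" unfolding g(1) by (rule mult_dvd_mono)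
      then show ?thesis by (simp flip: power_mult_distrib)
    qed
    ultimately have "b = 1" unfolding b_def by (auto elim!: dvdE simp: power_mult)
    then show False using b by simp
  qed
qed

subsection \<open>Sums of products without the Sylvester-Gallai property\<close>

abbreviation dehom :: "nat \<Rightarrow> 'k::comm_ring_1 mp \<Rightarrow> 'k mp" where
  "dehom n \<equiv> msub (\<lambda>v. if v = n then 1 else mvar v)"

lemma hom_prod_list_map:
  assumes "comm_ring_hom h"
  shows "h (prod_list ps) = prod_list (map h ps)"
proof -
  interpret comm_ring_hom h by (rule assms)
  show ?thesis by (induction ps) (simp_all add: hom_mult)
qed

lemma evasive_mono: "evasive nn e B \<Longrightarrow> e' \<le> e \<Longrightarrow> evasive nn e' B"
  unfolding evasive_def by (meson le_trans)

lemma theta_secant_nonzero: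
  fixes Q :: "nat \<Rightarrow> 'k::field mp"
  assumes inf: "infinite (UNIV :: 'k set)" and r: "r > 0" "r ^ (m + 1) \<le> R" and q: "goodq n R q"
    and Q: "\<And>i. i < m \<Longrightarrow> whom (\<lambda>_. 1) r (Q i)" "\<And>i. i < m \<Longrightarrow> mvars (Q i) \<subseteq> {..<n + 1}"
    and Ps: "\<And>P. P \<in> set Ps \<Longrightarrow> whom (\<lambda>_. 1) r P" "\<And>P. P \<in> set Ps \<Longrightarrow> mvars P \<subseteq> {..<n + 1}"
    and x: "\<And>i. i < m \<Longrightarrow> meval x (Q i) = 0" "\<And>P. P \<in> set Ps \<Longrightarrow> meval x P \<noteq> 0"
    and f: "f = prod_list Ps + (\<Sum>i<m. A i * Q i)"
    and hom: "whom (\<lambda>_. 1) d f" "mvars f \<subseteq> {..<n + 1}"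
  shows "msub (theta n R q m) (dehom n f) \<noteq> 0"
proof -
  have ev: "evasive (n + 1) (r ^ (m + 1)) {curve n R q l t | l t. l \<noteq> (0 :: 'k)}"
    by (rule evasive_mono[OF curve_evasive[OF inf q] r(2)])
  obtain b where b: "\<forall>i\<le>m. b i \<in> {curve n R q l t | l t. l \<noteq> (0 :: 'k)}"
    and nz: "msub (\<lambda>v. if v \<in> {n + 1..<n + 1 + m} then mvar v else mcst (b m v)) (tau (n + 1) b m f) \<noteq> 0"
    using secant_nonvanishing[OF r(1) ev Q Ps x f] by blast
  show ?thesis by (rule theta_secant[OF inf _ hom nz]) (use b in blast)
qed

text \<open>With all variables but the first put to 0, the point lies on the curve itself, where a
  good \<open>q\<close> keeps the monomials of degree at most \<open>R\<close> apart. This serves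
  the factors that contain the gcd.\<close>

lemma theta_low_degree_nonzero:
  fixes P :: "'k::field mp"
  assumes q: "goodq n R q" and P: "P \<noteq> 0" "mvars P \<subseteq> {..<n}" "\<And>m. m \<in> keys P \<Longrightarrow> size m \<le> R"
  shows "msub (theta n R q mu) P \<noteq> 0"
proof -
  define im where "im m = replicate_mset (wdeg (wgt R q) m) (0::nat)" for m
  let ?s = "msub (\<lambda>v. if v = 0 then mvar 0 else 0) :: 'k mp \<Rightarrow> _"
  interpret s: comm_ring_hom ?s by (rule msub_hom)
  have th: "?s (theta n R q mu v) = mvar 0 ^ wgt R q v" for v
    unfolding theta_def
    by (simp add: s.hom_add s.hom_sum s.hom_mult s.hom_minus s.hom_power mev_var[OF mcst_hom])
  have eq: "?s (msub (theta n R q mu) P) = msub (\<lambda>v. mvar 0 ^ wgt R q v) P"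
    by (simp add: hom_mev[OF msub_hom mcst_hom] th mev_cst[OF mcst_hom])
  have im: "prod_mset (image_mset (\<lambda>v. mvar 0 ^ wgt R q v) m) = (mmon (im m) :: 'k mp)" for m
  proof (induction m)
    case empty
    then show ?case by (simp add: im_def single_one)
  next
    case (add v m)
    have "im (add_mset v m) = replicate_mset (wgt R q v) 0 + im m" by (simp add: im_def multiset_eq_iff)
    then show ?case using add by (simp add: mvar_power mmon_add)
  qed
  have "keys P \<noteq> {}" using P(1) by simp
  then obtain m0 where m0: "m0 \<in> keys P" by blast
  have inj: "m = m0" if "m \<in> keys P" "im m = im m0" for m
  proof -
    have "size (im m) = size (im m0)" using that by simp
    then have "wdeg (wgt R q) m = wdeg (wgt R q) m0" by (simp add: im_def)
    then have "krdeg (R + 1) m mod q = krdeg (R + 1) m0 mod q" using wdeg_wgt_cong by metis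
    moreover have "set_mset m \<subseteq> {..<n}" "set_mset m0 \<subseteq> {..<n}" using P(2) that m0 by (auto simp: mvars_def)
    ultimately show ?thesis using q P(3)[OF that(1)] P(3)[OF m0] unfolding goodq_def by blast
  qed
  have "lookup (msub (\<lambda>v. mvar 0 ^ wgt R q v) P) (im m0) = (\<Sum>m\<in>keys P. if im m = im m0 then lookup P m else 0)"
    by (simp add: mev_def im lookup_sum lookup_mcst_mult lookup_single when_def if_distrib cong: if_cong)
  also have "\<dots> = (\<Sum>m\<in>keys P. if m = m0 then lookup P m else 0)" by (rule sum.cong) (use inj in auto)
  also have "\<dots> = lookup P m0" using m0 by simp
  finally have "msub (\<lambda>v. mvar 0 ^ wgt R q v) P \<noteq> 0" using m0 by (auto simp: in_keys_iff)
  then show ?thesis using eq s.hom_zero by metis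
qed

text \<open>Modulo the linear forms that define the point \<open>x\<close>, a variable X_u is (x_u /
  x_v) X_v; powers of x_v avoid the division. This handles circuits with too many summands for the
  dimension: \<open>F\<close> becomes a multiple of a power of X_v.\<close>

lemma form_mod_linear_forms:
  fixes F :: "'k::field mp"
  assumes F: "whom (\<lambda>_. 1) d F" "mvars F \<subseteq> {..<N}"
  shows "mcst (x v ^ d) * F - mcst (meval x F) * mvar v ^ d
     \<in> idl (\<lambda>u. mcst (x v) * mvar u - mcst (x u) * mvar v) ({..<N} - {v})" (is "_ \<in> ?I")
proof -
  have mon: "mcst (x v ^ size m) * mmon m - mcst (prod_mset (image_mset x m)) * mvar v ^ size m \<in> ?I"
    if "set_mset m \<subseteq> {..<N}" for m
    using that
  proof (induction m)
    case (add u m)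
    let ?l = "mcst (x v) * mvar u - mcst (x u) * mvar v :: 'k mp"
    have l: "?l \<in> ?I"
    proof (cases "u = v")
      case False
      then show ?thesis using add.prems by (intro idl_gen[where g = "\<lambda>u. mcst (x v) * mvar u - mcst (x u) * mvar v"]) auto
    qed simp
    have c: "mcst (a * b) = mcst a * (mcst b :: 'k mp)" for a b by (simp add: mult_single)
    have m: "mmon (add_mset u m) = mvar u * (mmon m :: 'k mp)" by (simp add: mult_single)
    have "mcst (x v ^ size (add_mset u m)) * mmon (add_mset u m)
        - mcst (prod_mset (image_mset x (add_mset u m))) * mvar v ^ size (add_mset u m)
      = mcst (x v ^ size m) * mmon m * ?l
        + mcst (x u) * mvar v * (mcst (x v ^ size m) * mmon m - mcst (prod_mset (image_mset x m)) * mvar v ^ size m)"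
      unfolding m by (simp add: c algebra_simps)
    then show ?case using add l by (simp only:) (intro idl_add idl_mult; simp)
  qed simp
  have s: "size m = d" "set_mset m \<subseteq> {..<N}" if "m \<in> keys F" for m
    using F that unfolding whom_def wdeg_one by (auto simp: mvars_def)
  have "mcst (x v ^ d) * F - mcst (meval x F) * mvar v ^ d = (\<Sum>m\<in>keys F. mcst (lookup F m) *
      (mcst (x v ^ size m) * mmon m - mcst (prod_mset (image_mset x m)) * mvar v ^ size m))"
  proof -
    interpret c: comm_ring_hom "mcst :: 'k \<Rightarrow> 'k mp" by (rule mcst_hom)
    have "F = (\<Sum>m\<in>keys F. mcst (lookup F m) * mmon m)"
      by (subst mp_sum_monomials) (simp only: single_eq_cst_mult[symmetric])
    then have "mcst (x v ^ d) * F = mcst (x v ^ d) * (\<Sum>m\<in>keys F. mcst (lookup F m) * mmon m)" by (rule arg_cong)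
    then have a: "mcst (x v ^ d) * F = (\<Sum>m\<in>keys F. mcst (x v ^ d) * (mcst (lookup F m) * mmon m))"
      by (simp only: sum_distrib_left)
    have b: "mcst (meval x F) * mvar v ^ d = (\<Sum>m\<in>keys F. mcst (lookup F m) * mcst (prod_mset (image_mset x m)) * mvar v ^ d)"
      by (simp add: mev_def c.hom_sum sum_distrib_right mult_single)
    have c: "mcst (lookup F m) * (mcst (x v ^ size m) * mmon m - mcst (prod_mset (image_mset x m)) * mvar v ^ size m)
       = mcst (x v ^ d) * (mcst (lookup F m) * mmon m) - mcst (lookup F m) * mcst (prod_mset (image_mset x m)) * mvar v ^ d"
      if "m \<in> keys F" for m
      unfolding s[OF that] right_diff_distrib by (simp only: ac_simps)
    show ?thesis unfolding a b sum_subtractf[symmetric] by (rule sum.cong[OF refl]) (rule c[symmetric])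
  qed
  also have "\<dots> \<in> ?I" by (intro idl_sum idl_mult mon s)
  finally show ?thesis .
qed

text \<open>With at most n + 1 summands, each one except \<open>i0\<close> contributes a factor
  vanishing at \<open>x\<close>, and all factors are padded to degree \<open>r\<close> by the
  coordinate X_v, which is nonzero at \<open>x\<close>. With more summands, n linear forms through
  \<open>x\<close> take over, with degree 1 in place of \<open>r\<close>.\<close>

theorem theta_non_SG_homogeneous_nonzero:
  fixes H :: "nat \<Rightarrow> 'k::field mp list"
  assumes inf: "infinite (UNIV :: 'k set)" and r: "r \<ge> 1" and q: "goodq n (r ^ k) q"
    and k: "k' \<le> k" and i0: "i0 < k'"
    and H: "\<And>i P. i < k' \<Longrightarrow> P \<in> set (H i) \<Longrightarrow> mvars P \<subseteq> {..<n + 1} \<and> (\<exists>e\<le>r. whom (\<lambda>_. 1) e P)"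
    and hom: "\<And>i. i < k' \<Longrightarrow> whom (\<lambda>_. 1) d (prod_list (H i))"
    and x: "meval x (prod_list (H i0)) \<noteq> 0" "\<And>i. i < k' \<Longrightarrow> i \<noteq> i0 \<Longrightarrow> meval x (prod_list (H i)) = 0"
    and v: "v < n + 1" "x v \<noteq> 0"
  shows "msub (theta n (r ^ k) q (mu_of n k)) (dehom n (\<Sum>i<k'. prod_list (H i))) \<noteq> 0"
proof -
  define F where "F = (\<Sum>i<k'. prod_list (H i))"
  define mu where "mu = mu_of n k"
  let ?X = "mvar v :: 'k mp"
  interpret x: comm_ring_hom "meval x" by (rule meval_hom)
  interpret th: comm_ring_hom "msub (theta n (r ^ k) q mu) :: 'k mp \<Rightarrow> _" by (rule msub_hom)
  interpret dh: comm_ring_hom "dehom n :: 'k mp \<Rightarrow> _" by (rule msub_hom)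
  have Fhom: "whom (\<lambda>_. 1) d F" unfolding F_def by (rule whom_sum) (use hom in auto)
  have Hv: "mvars (prod_list (H i)) \<subseteq> {..<n + 1}" if "i < k'" for i
    by (rule mvars_prod_list) (use H that in blast)
  have Fv: "mvars F \<subseteq> {..<n + 1}" unfolding F_def by (rule mvars_sum) (use Hv in auto)
  have Xh: "whom (\<lambda>_. 1) e (?X ^ e)" for e
    using whom_power[OF whom_var[of "\<lambda>_. 1" v], of e] by simp
  have Xv: "mvars (?X ^ e) \<subseteq> {..<n + 1}" for e
    by (rule order_trans[OF mvars_power order_trans[OF mvars_single]]) (use v in auto)
  have Xx: "meval x (?X ^ e) = x v ^ e" for e
    by (simp add: x.hom_power mev_var[OF comm_ring_hom_id])
  have Fx: "meval x F = meval x (prod_list (H i0))"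
  proof -
    have "meval x F = (\<Sum>i<k'. if i = i0 then meval x (prod_list (H i0)) else 0)"
      unfolding F_def x.hom_sum by (rule sum.cong) (use x in auto)
    then show ?thesis using i0 by simp
  qed
  show ?thesis
  proof (cases "k' - 1 \<le> n")
    case True
    then have km: "k' - 1 \<le> mu" using k by (simp add: mu_def mu_of_def)
    have muk: "mu + 1 \<le> k" using k i0 by (simp add: mu_def mu_of_def)
    then have rR: "r ^ (mu + 1) \<le> r ^ k" using r by (intro power_increasing) auto
    define de where "de P = (SOME e. e \<le> r \<and> whom (\<lambda>_. 1) e P)" for P :: "'k mp"
    have de: "de P \<le> r" "whom (\<lambda>_. 1) (de P) P" if "i < k'" "P \<in> set (H i)" for i P
      using someI_ex[of "\<lambda>e. e \<le> r \<and> whom (\<lambda>_. 1) e P"] H[OF that] unfolding de_def by blast+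
    define up where "up P = P * ?X ^ (r - de P)" for P
    have up: "whom (\<lambda>_. 1) r (up P)" "mvars (up P) \<subseteq> {..<n + 1}" if "i < k'" "P \<in> set (H i)" for i P
    proof -
      show "whom (\<lambda>_. 1) r (up P)"
        using whom_mult[OF de(2)[OF that] Xh[of "r - de P"]] de(1)[OF that] by (simp add: up_def)
      show "mvars (up P) \<subseteq> {..<n + 1}"
        unfolding up_def by (rule order_trans[OF mvars_mult Un_least[OF _ Xv]]) (use H[OF that] in blast)
    qed
    have upx: "meval x (up P) = meval x P * x v ^ (r - de P)" for P
      by (simp add: up_def x.hom_mult Xx)
    \<comment> \<open>The sum is the padding of the factors of summand \<open>i0\<close>; the extra
      \<open>r\<close> makes X_v^N divisible by the padding of any single factor, so the other
      summands times X_v^N are multiples of padded forms.\<close>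
    define N where "N = (\<Sum>P\<leftarrow>H i0. r - de P) + r"
    define Ps where "Ps = ?X ^ r # map up (H i0)"
    have Ps: "prod_list Ps = ?X ^ N * prod_list (H i0)"
    proof -
      have "prod_list (map up L) = ?X ^ (\<Sum>P\<leftarrow>L. r - de P) * prod_list L" for L
        by (induction L) (simp_all add: up_def power_add ac_simps)
      then show ?thesis by (simp add: Ps_def N_def power_add ac_simps)
    qed
    define \<sigma> where "\<sigma> i = (if i < i0 then i else i + 1)" for i
    have \<sigma>: "\<sigma> i < k'" "\<sigma> i \<noteq> i0" if "i < k' - 1" for i using that i0 by (auto simp: \<sigma>_def)
    have "\<exists>P\<in>set (H (\<sigma> i)). meval x P = 0" if "i < k' - 1" for i
    proof -
      have "prod_list (map (meval x) (H (\<sigma> i))) = 0"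
        using x(2)[OF \<sigma>[OF that]] by (simp only: hom_prod_list_map[OF meval_hom])
      then show ?thesis unfolding prod_list_zero_iff by auto
    qed
    then obtain P where P: "\<And>i. i < k' - 1 \<Longrightarrow> P i \<in> set (H (\<sigma> i)) \<and> meval x (P i) = 0" by metis
    \<comment> \<open>Fewer than \<open>mu\<close> forms are filled up with 0, which is homogeneous
      of every degree and vanishes at \<open>x\<close>.\<close>
    define Q where "Q i = (if i < k' - 1 then up (P i) else 0)" for i
    have "\<exists>A. ?X ^ N * prod_list (H (\<sigma> i)) = A * Q i" if "i < k' - 1" for i
    proof -
      have "P i dvd prod_list (H (\<sigma> i))" using P[OF that] by (intro prod_list_dvd) simp
      moreover have "?X ^ (r - de (P i)) dvd ?X ^ N" by (rule le_imp_power_dvd) (simp add: N_def)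
      ultimately have "up (P i) dvd prod_list (H (\<sigma> i)) * ?X ^ N" unfolding up_def by (rule mult_dvd_mono)
      then show ?thesis using that by (auto simp: Q_def ac_simps elim!: dvdE)
    qed
    then obtain A where A: "\<And>i. i < k' - 1 \<Longrightarrow> ?X ^ N * prod_list (H (\<sigma> i)) = A i * Q i" by metis
    have split: "(\<Sum>i<k'. G i) = G i0 + (\<Sum>i<k' - 1. G (\<sigma> i))" for G :: "nat \<Rightarrow> 'k mp"
    proof -
      have "(\<Sum>i<k'. G i) = G i0 + (\<Sum>i\<in>{..<k'} - {i0}. G i)" by (rule sum.remove) (use i0 in auto)
      also have "(\<Sum>i\<in>{..<k'} - {i0}. G i) = (\<Sum>i<k' - 1. G (\<sigma> i))"
        by (rule sum.reindex_bij_witness[where i = \<sigma> and j = "\<lambda>i. if i < i0 then i else i - 1"])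
           (use i0 in \<open>auto simp: \<sigma>_def\<close>)
      finally show ?thesis .
    qed
    have f: "?X ^ N * F = prod_list Ps + (\<Sum>i<mu. A i * Q i)"
    proof -
      have "?X ^ N * F = prod_list Ps + (\<Sum>i<k' - 1. A i * Q i)"
        unfolding F_def split distrib_left sum_distrib_left Ps by (simp add: A)
      also have "(\<Sum>i<k' - 1. A i * Q i) = (\<Sum>i<mu. A i * Q i)"
        by (rule sum.mono_neutral_left) (use km in \<open>auto simp: Q_def\<close>)
      finally show ?thesis .
    qed
    have "msub (theta n (r ^ k) q mu) (dehom n (?X ^ N * F)) \<noteq> 0"
    proof (rule theta_secant_nonzero[OF inf _ rR q _ _ _ _ _ _ f])
      show "whom (\<lambda>_. 1) r (Q i)" "mvars (Q i) \<subseteq> {..<n + 1}" "meval x (Q i) = 0" if "i < mu" for i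
        using up[OF \<sigma>(1), of i "P i"] P[of i] by (auto simp: Q_def upx x.hom_zero)
      show "whom (\<lambda>_. 1) r P" "mvars P \<subseteq> {..<n + 1}" if "P \<in> set Ps" for P
        using that up[OF i0] Xh[of r] Xv[of r] by (auto simp: Ps_def)
      have "meval x P \<noteq> 0" if "P \<in> set (H i0)" for P
      proof -
        have "prod_list (map (meval x) (H i0)) \<noteq> 0" using x(1) by (simp only: hom_prod_list_map[OF meval_hom] not_False_eq_True)
        then show ?thesis using that unfolding prod_list_zero_iff by auto
      qed
      then show "meval x P \<noteq> 0" if "P \<in> set Ps" for P
        using that v by (auto simp: Ps_def upx Xx)
      show "whom (\<lambda>_. 1) (N + d) (?X ^ N * F)" by (rule whom_mult[OF Xh Fhom])
      show "mvars (?X ^ N * F) \<subseteq> {..<n + 1}" by (rule order_trans[OF mvars_mult Un_least[OF Xv Fv]])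
    qed (use r in simp)
    then show ?thesis unfolding F_def[symmetric] mu_def[symmetric] by (auto simp: dh.hom_mult th.hom_mult)
  next
    case False
    then have mu: "mu = n" using k by (simp add: mu_def mu_of_def)
    define c where "c = inverse (meval x F)"
    have c: "c * meval x F = 1" using Fx x(1) by (simp add: c_def)
    let ?Q = "\<lambda>u. mcst (x v) * mvar u - mcst (x u) * ?X"
    have "mcst (x v ^ d) * F - mcst (meval x F) * ?X ^ d \<in> idl ?Q ({..<n + 1} - {v})"
      by (rule form_mod_linear_forms[OF Fhom Fv])
    then have "mcst c * (mcst (x v ^ d) * F - mcst (meval x F) * ?X ^ d) \<in> idl ?Q ({..<n + 1} - {v})"
      by (rule idl_mult)
    then obtain h where h: "mcst c * (mcst (x v ^ d) * F - mcst (meval x F) * ?X ^ d) = (\<Sum>u\<in>{..<n + 1} - {v}. h u * ?Q u)"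
      unfolding idl_def by auto
    define \<sigma> where "\<sigma> i = (if i < v then i else i + 1)" for i
    have sum: "(\<Sum>u\<in>{..<n + 1} - {v}. h u * ?Q u) = (\<Sum>i<mu. h (\<sigma> i) * ?Q (\<sigma> i))"
      unfolding mu
      by (rule sum.reindex_bij_witness[where i = \<sigma> and j = "\<lambda>i. if i < v then i else i - 1"])
         (use v in \<open>auto simp: \<sigma>_def\<close>)
    have mm: "mcst c * (mcst (meval x F) * p) = p" for p :: "'k mp"
    proof -
      have "mcst c * mcst (meval x F) = (1 :: 'k mp)" by (simp add: mult_single c single_one)
      then show ?thesis by (simp only: mult.assoc[symmetric]) simp
    qed
    have f: "mcst c * (mcst (x v ^ d) * F) = prod_list (replicate d ?X) + (\<Sum>i<mu. h (\<sigma> i) * ?Q (\<sigma> i))"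
      using h unfolding right_diff_distrib[of "mcst c"] mm sum by (simp only: prod_list_replicate diff_eq_eq add.commute)
    have "msub (theta n (r ^ k) q mu) (dehom n (mcst c * (mcst (x v ^ d) * F))) \<noteq> 0"
    proof (rule theta_secant_nonzero[OF inf _ _ q _ _ _ _ _ _ f, where r = 1 and x = x and d = d])
      have whc: "whom (\<lambda>_. 1) e (mcst a * p)" if "whom (\<lambda>_. 1) e p" for e a and p :: "'k mp"
        using whom_mult[OF whom_cst[of _ a] that] by simp
      have mvc: "mvars (mcst a * p) \<subseteq> V" if "mvars p \<subseteq> V" for a V and p :: "'k mp"
        using mvars_mult[of "mcst a" p] mvars_single[of "{#}" a] that by auto
      show "whom (\<lambda>_. 1) 1 (?Q (\<sigma> i))" for i
        by (intro whom_diff whc) (simp_all add: whom_var[of "\<lambda>_. 1", simplified])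
      have mv: "mvars (mvar u :: 'k mp) \<subseteq> {..<n + 1}" if "u < n + 1" for u
        using mvars_single[of "{#u#}" "1 :: 'k"] that by auto
      show "mvars (?Q (\<sigma> i)) \<subseteq> {..<n + 1}" if "i < mu" for i
        using that mu v by (intro order_trans[OF mvars_diff Un_least] mvc mv) (auto simp: \<sigma>_def)
      show "meval x (?Q (\<sigma> i)) = 0" for i
        by (simp add: x.hom_minus x.hom_mult mev_var[OF comm_ring_hom_id] mev_cst[OF comm_ring_hom_id])
      show "whom (\<lambda>_. 1) 1 P" "mvars P \<subseteq> {..<n + 1}" "meval x P \<noteq> 0" if "P \<in> set (replicate d ?X)" for P
        using that whom_var[of "\<lambda>_. 1" v] mv[OF v(1)] v(2) by (auto simp: mev_var[OF comm_ring_hom_id])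
      show "whom (\<lambda>_. 1) d (mcst c * (mcst (x v ^ d) * F))" by (intro whc Fhom)
      show "mvars (mcst c * (mcst (x v ^ d) * F)) \<subseteq> {..<n + 1}" by (intro mvc Fv)
    qed (use r in simp_all)
    then show ?thesis unfolding F_def[symmetric] mu_def[symmetric] by (auto simp: dh.hom_mult th.hom_mult)
  qed
qed

text \<open>The degree of the common factor \<open>g\<close> is not bounded, but \<open>g\<close>
  divides the product of \<open>L\<close>, whose factors have degree at most \<open>r\<close>; the
  substitution kills none of them.\<close>

theorem theta_non_SG_nonzero:
  fixes H :: "nat \<Rightarrow> 'k::field mp list"
  assumes inf: "infinite (UNIV :: 'k set)" and r: "r \<ge> 1" and q: "goodq n (r ^ k) q"
    and k: "k' \<le> k" and i0: "i0 < k'"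
    and H: "\<And>i P. i < k' \<Longrightarrow> P \<in> set (H i) \<Longrightarrow> mvars P \<subseteq> {..<n + 1} \<and> (\<exists>e\<le>r. whom (\<lambda>_. 1) e P)"
    and hom: "\<And>i. i < k' \<Longrightarrow> whom (\<lambda>_. 1) d (prod_list (H i))"
    and x: "meval x (prod_list (H i0)) \<noteq> 0" "\<And>i. i < k' \<Longrightarrow> i \<noteq> i0 \<Longrightarrow> meval x (prod_list (H i)) = 0"
    and v: "v < n + 1" "x v \<noteq> 0"
    and L: "\<And>P. P \<in> set L \<Longrightarrow> mvars P \<subseteq> {..<n} \<and> (\<forall>m\<in>keys P. size m \<le> r)"
    and g: "g * u = prod_list L" "prod_list L \<noteq> 0"
    and f: "f = g * dehom n (\<Sum>i<k'. prod_list (H i))"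
  shows "msub (theta n (r ^ k) q (mu_of n k)) f \<noteq> 0"
proof -
  interpret th: comm_ring_hom "msub (theta n (r ^ k) q (mu_of n k)) :: 'k mp \<Rightarrow> _" by (rule msub_hom)
  have rk: "r \<le> r ^ k" using r k i0 by (simp add: self_le_power)
  have "msub (theta n (r ^ k) q (mu_of n k)) P \<noteq> 0" if "P \<in> set L" for P
  proof (rule theta_low_degree_nonzero[OF q])
    show "P \<noteq> 0" using g(2) that by (auto simp: prod_list_zero_iff)
    show "mvars P \<subseteq> {..<n}" using L that by blast
    show "size m \<le> r ^ k" if "m \<in> keys P" for m using L[OF \<open>P \<in> set L\<close>] that rk by (meson le_trans)
  qed
  then have "msub (theta n (r ^ k) q (mu_of n k)) (prod_list L) \<noteq> 0"
    unfolding hom_prod_list_map[OF msub_hom] prod_list_zero_iff by auto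
  then have g0: "msub (theta n (r ^ k) q (mu_of n k)) g \<noteq> 0" unfolding g(1)[symmetric] by (auto simp: th.hom_mult)
  have "msub (theta n (r ^ k) q (mu_of n k)) (dehom n (\<Sum>i<k'. prod_list (H i))) \<noteq> 0"
    by (rule theta_non_SG_homogeneous_nonzero[where H = H and d = d and x = x and v = v and ?k' = k' and ?i0.0 = i0])
       (use assms in blast)+
  then show ?thesis using g0 unfolding f th.hom_mult by simp
qed

section \<open>The algorithm\<close>

fun pstep :: "prog \<Rightarrow> memory \<Rightarrow> memory" where
  "pstep (Const i z) s = s(i := z)"
| "pstep (Add i a b) s = s(i := s a + s b)"
| "pstep (Sub i a b) s = s(i := s a - s b)"
| "pstep (Mul i a b) s = s(i := s a * s b)"
| "pstep (Div i a b) s = s(i := s a div s b)"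
| "pstep (Load i a) s = s(i := s (nat (s a)))"
| "pstep (Store a b) s = s(nat (s a) := s b)"
| "pstep _ s = s"

definition small :: "int \<Rightarrow> int \<Rightarrow> bool" where "small V z \<longleftrightarrow> \<bar>z\<bar> \<le> V"

fun psmall :: "int \<Rightarrow> prog \<Rightarrow> memory \<Rightarrow> bool" where
  "psmall V (Const i z) s \<longleftrightarrow> small V z"
| "psmall V (Add i a b) s \<longleftrightarrow> small V (s a) \<and> small V (s b)"
| "psmall V (Sub i a b) s \<longleftrightarrow> small V (s a) \<and> small V (s b)"
| "psmall V (Mul i a b) s \<longleftrightarrow> small V (s a) \<and> small V (s b)"
| "psmall V (Div i a b) s \<longleftrightarrow> small V (s a) \<and> small V (s b)"
| "psmall V (Load i a) s \<longleftrightarrow> small V (s a) \<and> small V (s (nat (s a)))"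
| "psmall V (Store a b) s \<longleftrightarrow> small V (s a) \<and> small V (s b)"
| "psmall V _ s \<longleftrightarrow> False"

fun seqs :: "prog list \<Rightarrow> prog" where
  "seqs [] = Const 0 0"
| "seqs [c] = c"
| "seqs (c # cs) = Seq c (seqs cs)"

primrec lrun :: "prog list \<Rightarrow> memory \<Rightarrow> memory" where
  "lrun [] s = s"
| "lrun (c # cs) s = lrun cs (pstep c s)"

primrec lsmall :: "int \<Rightarrow> prog list \<Rightarrow> memory \<Rightarrow> bool" where
  "lsmall V [] s \<longleftrightarrow> True"
| "lsmall V (c # cs) s \<longleftrightarrow> psmall V c s \<and> lsmall V cs (pstep c s)"

declare seqs.simps [simp del]

text \<open>The logarithm is given away: a bit length is bounded by the number itself plus 1, since
  the total time only has to be polynomial.\<close>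

lemma bits_le: "small (int V) z \<Longrightarrow> bits z \<le> V + 1"
proof -
  assume z: "small (int V) z"
  have "floorlog 2 x \<le> x" for x
    by (rule floorlog_leI) (simp_all add: less_exp)
  then have "bits z \<le> 1 + nat \<bar>z\<bar>" unfolding bits_def by (simp add: add_mono)
  then show ?thesis using z unfolding small_def by linarith
qed

locale machine =
  fixes bb :: blackbox and n U :: nat
  assumes U: "U \<ge> 64"
begin

definition V :: nat where "V = U ^ 60"

lemma V1: "V \<ge> 1" using U by (simp add: V_def)

text \<open>The unit 2 (V + 1) pays for reading two cells of absolute value at most V. So
  \<open>N\<close> counts instructions and loop tests, and for a query essentially the cells
  read.\<close>

definition runs :: "prog \<Rightarrow> memory \<Rightarrow> nat \<Rightarrow> memory \<Rightarrow> bool" where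
  "runs c s N s' \<longleftrightarrow> (\<exists>t. exec bb n c s t s' \<and> t \<le> N * (2 * (V + 1)))"

text \<open>Sizes of memory contents are tracked as exponents of \<open>U\<close> only, and every cell costs at most \<open>V + 1\<close>.\<close>

definition gr :: "nat \<Rightarrow> int \<Rightarrow> bool" where "gr j x \<longleftrightarrow> \<bar>x\<bar> \<le> int U ^ j"

lemma gr_mono: "gr i x \<Longrightarrow> i \<le> j \<Longrightarrow> gr j x"
  unfolding gr_def using U by (auto elim!: order_trans intro!: power_increasing)

lemma gr_add: "gr i x \<Longrightarrow> gr j y \<Longrightarrow> gr (Suc (i + j)) (x + y)"
proof -
  assume "gr i x" "gr j y"
  then have xy: "\<bar>x\<bar> \<le> int U ^ (i + j)" "\<bar>y\<bar> \<le> int U ^ (i + j)"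
    using gr_mono[of i x "i + j"] gr_mono[of j y "i + j"] by (simp_all add: gr_def)
  have "2 * int U ^ (i + j) \<le> int U * int U ^ (i + j)" using U by (intro mult_right_mono) auto
  then show ?thesis unfolding gr_def using xy by (simp add: abs_le_iff)
qed

lemma gr_uminus: "gr i x \<Longrightarrow> gr i (- x)" by (simp add: gr_def)

lemma gr_diff: "gr i x \<Longrightarrow> gr j y \<Longrightarrow> gr (Suc (i + j)) (x - y)"
  using gr_add[of i x j "- y"] by (simp add: gr_uminus)

lemma gr_mult: "gr i x \<Longrightarrow> gr j y \<Longrightarrow> gr (i + j) (x * y)"
  unfolding gr_def abs_mult power_add by (intro mult_mono) auto

lemma gr_div: "gr i x \<Longrightarrow> y \<ge> 0 \<Longrightarrow> x \<ge> 0 \<Longrightarrow> gr i (x div y)"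
proof -
  assume a: "gr i x" "y \<ge> 0" "x \<ge> 0"
  have "x div y \<le> x" using a by (cases "y = 0") (auto intro: zdiv_mono2[of x 1 y, simplified])
  moreover have "x div y \<ge> 0" using a by (simp add: div_int_pos_iff)
  ultimately show ?thesis using a by (simp add: gr_def)
qed

lemma gr_num: "\<bar>x\<bar> \<le> 64 \<Longrightarrow> gr 1 x" using U by (simp add: gr_def)

lemma gr_nat: "x \<le> U \<Longrightarrow> gr 1 (int x)" by (simp add: gr_def)

lemma gr_V: "gr i x \<Longrightarrow> i \<le> 60 \<Longrightarrow> small (int V) x"
  using gr_mono[of i x 60] by (simp add: gr_def V_def small_def)

lemma runs_prim:
  assumes "psmall (int V) c s"
  shows "runs c s 1 (pstep c s)"
proof -
  have b: "bits x + bits y \<le> 2 * Suc V" if "small (int V) (x)" "small (int V) (y)" for x y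
    using add_mono[OF bits_le[OF that(1)] bits_le[OF that(2)]] by simp
  have c: "bits x \<le> 2 * Suc V" if "small (int V) (x)" for x
    using bits_le[OF that] by simp
  show ?thesis using assms unfolding runs_def
    by (cases c) (use assms in \<open>auto intro!: exI conjI intro: exec.intros b c simp del: mult_Suc_right\<close>)
qed

lemma runs_Seq: "runs c s N s' \<Longrightarrow> runs c' s' N' s'' \<Longrightarrow> runs (Seq c c') s (N + N') s''"
  unfolding runs_def by (fastforce intro: exec.Seq simp: add_mult_distrib)

lemma runs_seqs: "cs \<noteq> [] \<Longrightarrow> lsmall (int V) cs s \<Longrightarrow> runs (seqs cs) s (length cs) (lrun cs s)"
proof (induction cs arbitrary: s rule: seqs.induct)
  case (2 c)
  then show ?case using runs_prim[of c s] by (simp add: seqs.simps)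
next
  case (3 c c' cs)
  have "runs (Seq c (seqs (c' # cs))) s (1 + length (c' # cs)) (lrun (c' # cs) (pstep c s))"
    by (rule runs_Seq[OF runs_prim 3(1)]) (use 3 in simp_all)
  then show ?case by (simp add: seqs.simps)
qed simp

lemma runs_mono: "runs c s N s' \<Longrightarrow> N \<le> N' \<Longrightarrow> runs c s N' s'"
  unfolding runs_def by (meson le_trans mult_le_mono1)

lemma ex_seqs:
  assumes "cs \<noteq> []" "lsmall (int V) cs s" "P (lrun cs s)" "length cs \<le> N"
  shows "\<exists>s'. runs (seqs cs) s N s' \<and> P s'"
  using runs_mono[OF runs_seqs[OF assms(1,2)] assms(4)] assms(3) by blast

lemma ex_Seq:
  assumes "\<exists>s'. runs c s N s' \<and> P s'" "\<And>s'. P s' \<Longrightarrow> \<exists>s''. runs c' s' N' s'' \<and> P' s''" "N + N' \<le> N''"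
  shows "\<exists>s''. runs (Seq c c') s N'' s'' \<and> P' s''"
  using assms(1,2) runs_mono[OF runs_Seq assms(3)] by blast

lemma runs_Cond:
  assumes "small (int V) (s i)" "s i > 0 \<Longrightarrow> runs c s N s'" "s i \<le> 0 \<Longrightarrow> runs c' s N s'"
  shows "runs (Cond i c c') s (N + 1) s'"
proof (cases "s i > 0")
  case True
  then obtain t where "exec bb n c s t s'" "t \<le> N * (2 * (V + 1))" using assms(2) unfolding runs_def by blast
  then show ?thesis unfolding runs_def using bits_le[OF assms(1)] True
    by (intro exI[of _ "bits (s i) + t"]) (auto intro: exec.CondTrue)
next
  case False
  then obtain t where "exec bb n c' s t s'" "t \<le> N * (2 * (V + 1))" using assms(3) unfolding runs_def by force
  then show ?thesis unfolding runs_def using bits_le[OF assms(1)] False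
    by (intro exI[of _ "bits (s i) + t"]) (auto intro: exec.CondFalse)
qed

text \<open>A loop whose number \<open>m\<close> of rounds is known beforehand; the index of the
  invariant is the number of rounds done.\<close>

lemma runs_While:
  assumes step: "\<And>j s. j < m \<Longrightarrow> I j s \<Longrightarrow> 0 < s x \<and> small (int V) (s x) \<and> (\<exists>s'. runs c s N s' \<and> I (Suc j) s')"
    and fin: "\<And>s. I m s \<Longrightarrow> s x = 0" and s: "I 0 s"
  shows "\<exists>s'. runs (While x c) s (m * (N + 1) + 1) s' \<and> I m s'"
proof -
  have "\<exists>s'. runs (While x c) s ((m - j) * (N + 1) + 1) s' \<and> I m s'" if "j \<le> m" "I j s" for j s
    using that
  proof (induction "m - j" arbitrary: j s)
    case 0
    then have "I m s" by simp
    moreover from fin[OF this] have "runs (While x c) s 1 s" unfolding runs_def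
      by (intro exI[of _ "bits (s x)"] conjI exec.WhileFalse) (auto simp: bits_def floorlog_def)
    ultimately show ?case using 0 by auto
  next
    case (Suc p)
    then have j: "j < m" by simp
    obtain s' where s': "0 < s x" "small (int V) (s x)" "runs c s N s'" "I (Suc j) s'" using step[OF j Suc(4)] by blast
    obtain s'' where s'': "runs (While x c) s' ((m - Suc j) * (N + 1) + 1) s''" "I m s''"
      using Suc(1)[of "Suc j" s'] Suc(2) j s' by force
    obtain t t' where t: "exec bb n c s t s'" "t \<le> N * (2 * (V + 1))"
      "exec bb n (While x c) s' t' s''" "t' \<le> ((m - Suc j) * (N + 1) + 1) * (2 * (V + 1))"
      using s' s'' unfolding runs_def by blast
    have "bits (s x) \<le> V + 1" by (rule bits_le) (rule s'(2))
    then have "bits (s x) + t + t' \<le> (1 + N + ((m - Suc j) * (N + 1) + 1)) * (2 * (V + 1))"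
      using t unfolding add_mult_distrib[of _ _ "2 * (V + 1)"] by (intro add_mono) auto
    also have "1 + N + ((m - Suc j) * (N + 1) + 1) = (m - j) * (N + 1) + 1"
      using j by (simp add: Suc_diff_Suc[symmetric] del: Suc_diff_Suc)
    finally have "runs (While x c) s ((m - j) * (N + 1) + 1) s''"
      unfolding runs_def using t s' j by (intro exI[of _ "bits (s x) + t + t'"] conjI exec.WhileTrue) auto
    then show ?case using s'' by blast
  qed
  from this[of 0 s] s show ?thesis by simp
qed

lemma power_loop:
  assumes s: "s a = x" "s b = y" "s c = int m" "s 5 = 1" and ne: "a \<noteq> b" "a \<noteq> c" "a \<noteq> 5" "c \<noteq> b" "c \<noteq> 5"
    and small: "small (int V) (y)" "small (int V) (int m)" "\<And>j. j \<le> m \<Longrightarrow> small (int V) (x * y ^ j)"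
  shows "\<exists>s'. runs (While c (seqs [Mul a a b, Sub c c 5])) s (m * 3 + 1) s' \<and> (\<forall>z. z \<notin> {a, c} \<longrightarrow> s' z = s z) \<and> s' a = x * y ^ m"
proof -
  define I where "I j s' \<longleftrightarrow> (\<forall>z. z \<notin> {a, c} \<longrightarrow> s' z = s z) \<and> s' a = x * y ^ j \<and> s' c = int (m - j)" for j s'
  have "\<exists>s'. runs (While c (seqs [Mul a a b, Sub c c 5])) s (m * (2 + 1) + 1) s' \<and> I m s'"
  proof (rule runs_While)
    fix j s' assume j: "j < m" and I: "I j s'"
    have v: "s' a = x * y ^ j" "s' b = y" "s' c = int (m - j)" "s' 5 = 1" using I s ne by (auto simp: I_def)
    have "runs (seqs [Mul a a b, Sub c c 5]) s' (length [Mul a a b, Sub c c 5]) (lrun [Mul a a b, Sub c c 5] s')"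
      by (rule runs_seqs) (use v small small(3)[of j] j ne V1 in \<open>auto simp: small_def\<close>)
    moreover have "I (Suc j) (lrun [Mul a a b, Sub c c 5] s')"
      using I v ne j by (auto simp: I_def of_nat_diff)
    moreover have "length [Mul a a b, Sub c c 5] = 2" by simp
    moreover have "0 < s' c" "small (int V) (s' c)" using v(3) j small(2) by (auto simp: small_def)
    ultimately show "0 < s' c \<and> small (int V) (s' c) \<and> (\<exists>s''. runs (seqs [Mul a a b, Sub c c 5]) s' 2 s'' \<and> I (Suc j) s'')"
      by metis
  qed (use s small in \<open>auto simp: I_def\<close>)
  then show ?thesis by (auto simp: I_def)
qed

end

locale parameters =
  fixes n d k r :: nat
  assumes pos: "n \<ge> 1" "d \<ge> 1" "k \<ge> 1" "r \<ge> 1"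
begin

abbreviation "R \<equiv> r ^ k"
abbreviation "S \<equiv> ssz n R"
abbreviation "mu \<equiv> mu_of n k"
abbreviation "Q \<equiv> qmax n R"
abbreviation "B \<equiv> kbase n d R"
abbreviation "E \<equiv> emax n d R mu"
text \<open>The least exponent with E < 2^e. A root of the modulus then has order above
  \<open>E\<close>, so its powers up to \<open>E\<close> are distinct.\<close>

abbreviation "e \<equiv> floorlog 2 E"
abbreviation "M \<equiv> (6::nat) ^ e"

text \<open>Dominates the inputs, the precomputed numbers apart from those derived from
  \<open>M\<close>, and the address 64 of the first query block.\<close>

definition "size_bound = E + n + d + k + r + 64"

lemma R1: "R \<ge> 1" using pos by simp

lemmas S_ge = ssz_ge[OF pos(1) R1]

lemma chain: "S \<le> Q" "Q \<le> B" "B \<le> E" "B ^ mu \<le> E" "3 \<le> Q" "B ^ (2 * mu) \<le> E" "Q < B"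
proof -
  have "S \<ge> 1" using S_ge by simp
  then have "S ^ 1 \<le> S ^ 4" by (intro power_increasing) auto
  then show "S \<le> Q" by (simp add: qmax_def)
  have "S ^ 4 \<ge> 1" using \<open>S \<ge> 1\<close> by simp
  then show "3 \<le> Q" by (simp add: qmax_def)
  have "1 * Q \<le> d * Q" using pos by (intro mult_le_mono1) auto
  then show "Q \<le> B" "Q < B" unfolding kbase_def by linarith+
  have B: "B \<ge> 1" by (simp add: kbase_def)
  have "B ^ 1 \<le> E" "B ^ mu \<le> E" "B ^ (2 * mu) \<le> E" unfolding emax_def using B by (intro power_increasing; simp)+
  then show "B \<le> E" "B ^ mu \<le> E" "B ^ (2 * mu) \<le> E" by simp_all
qed

lemma E_pos: "E \<ge> 1" using chain by linarith

lemma e: "E < 2 ^ e" "2 ^ (e - 1) \<le> E" "e \<ge> 1"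
  using floorlog_bounds[of E 2] floorlog_ge_SucI[of 2 0 E] E_pos by (auto simp: floorlog_def)

text \<open>6^e <= 8^e = (2^e)^3, and 2^e is at most 2 E. Hence the length of the modulus is
  polynomial in \<open>E\<close>.\<close>

lemma M_le: "M \<le> 8 * E ^ 3"
proof -
  have "M \<le> 8 ^ e" by (rule power_mono) auto
  also have "\<dots> = (2 ^ 3) ^ e" by simp
  also have "\<dots> = (2 ^ e) ^ 3" by (simp only: power_mult[symmetric] mult.commute)
  also have "\<dots> \<le> (2 * E) ^ 3"
  proof (rule power_mono)
    have "(2::nat) ^ e = 2 * 2 ^ (e - 1)" using e(3) by (cases e) auto
    then show "(2::nat) ^ e \<le> 2 * E" using e(2) by simp
  qed simp
  finally show ?thesis by (simp add: power_mult_distrib)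
qed

end

sublocale parameters \<subseteq> machine bb n size_bound for bb
  by unfold_locales (simp add: size_bound_def)

section \<open>Programs that compute the parameters\<close>

text \<open>The cells \<open>0, \<dots>, 3\<close> hold \<open>n\<close>, \<open>d\<close>, \<open>k\<close>, \<open>r\<close>; the cells \<open>5, \<dots>, 15\<close> hold \<open>1\<close>, \<open>R = r\<^sup>k\<close>, the number \<open>S\<close> of monomials, \<open>mu\<close>, \<open>Q\<close>,
  \<open>B\<close>, \<open>E\<close>, \<open>M\<close>, \<open>2 M\<close>, \<open>B\<close> to the power \<open>mu\<close>, and \<open>R + 1\<close>. The cells \<open>16, \<dots>, 19\<close> are the loop counters for \<open>q\<close>, \<open>i\<close>,
  the coordinate, and the terms of a coordinate; they count downwards. The queries are written to fresh blocks from cell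
  \<open>64\<close> on, all of which are initially \<open>0\<close>: cell \<open>20\<close> is the start of the block, \<open>27\<close> its size, \<open>21\<close> the cell of the
  constant coefficient of the current coordinate, \<open>22\<close> its weight, \<open>23\<close> and \<open>24\<close> are powers of \<open>B\<close>. Cell \<open>25\<close> counts the
  nonzero values, cell \<open>33\<close> stays \<open>0\<close> and cell \<open>34\<close> holds \<open>-1\<close>.\<close>

definition pre1 :: prog where
  "pre1 = Seq (seqs [Const 5 1, Const 6 1, Add 16 2 33]) (While 16 (seqs [Mul 6 6 3, Sub 16 16 5]))"

definition pre2 :: prog where
  "pre2 = Seq (seqs [Const 7 1, Add 16 0 33, Const 17 0])
     (While 16 (seqs [Add 17 17 5, Add 28 6 17, Mul 7 7 28, Div 7 7 17, Sub 16 16 5]))"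

definition pre3 :: prog where
  "pre3 = Seq (seqs [Sub 8 2 5, Sub 29 8 0]) (Cond 29 (seqs [Add 8 0 33]) (seqs [Add 8 8 33]))"

definition pre4 :: prog where
  "pre4 = Seq (seqs [Mul 28 7 7, Mul 28 28 28, Add 9 28 28, Add 9 9 5, Mul 10 1 9, Add 10 10 5, Const 14 1, Add 16 8 33])
     (While 16 (seqs [Mul 14 14 10, Sub 16 16 5]))"

definition pre5 :: prog where
  "pre5 = Seq (seqs [Mul 11 14 14, Mul 11 11 10, Const 12 1, Add 28 11 33, Const 29 6, Const 31 2])
     (While 28 (seqs [Div 28 28 31, Mul 12 12 29]))"

definition pre6 :: prog where
  "pre6 = seqs [Add 13 12 12, Mul 27 0 13, Add 27 27 13, Add 27 27 5, Add 15 6 5, Const 20 64, Const 34 (-1),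
     Const 25 0, Add 16 9 33]"

definition pre_program :: prog where
  "pre_program = Seq pre1 (Seq pre2 (Seq pre3 (Seq pre4 (Seq pre5 pre6))))"

context parameters
begin

lemma gr_params:
  "gr 1 (int n)" "gr 1 (int d)" "gr 1 (int k)" "gr 1 (int r)" "gr 1 (int R)" "gr 1 (int r ^ k)" "gr 1 (int S)" "gr 1 (int mu)"
  "gr 1 (int Q)" "gr 1 (int B)" "gr 1 (int E)" "gr 1 (int (B ^ mu))" "gr 1 (int B ^ mu)" "gr 1 (int B ^ (2 * mu))"
  "gr 4 (6 ^ e)" "gr 1 0" "gr 1 1" "gr 1 2" "gr 1 6" "gr 1 64" "gr 1 (-1)"
proof -
  have "R \<le> E" "S \<le> E" "Q \<le> E" "B \<le> E" "mu \<le> n" using S_ge chain by (auto simp: mu_of_def)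
  then have "n \<le> size_bound" "d \<le> size_bound" "k \<le> size_bound" "r \<le> size_bound" "R \<le> size_bound" "S \<le> size_bound"
    "mu \<le> size_bound" "Q \<le> size_bound" "B \<le> size_bound" "E \<le> size_bound" "B ^ mu \<le> size_bound"
    using chain unfolding size_bound_def by simp_all
  then show "gr 1 (int n)" "gr 1 (int d)" "gr 1 (int k)" "gr 1 (int r)" "gr 1 (int R)" "gr 1 (int S)" "gr 1 (int mu)"
    "gr 1 (int Q)" "gr 1 (int B)" "gr 1 (int E)" "gr 1 (int (B ^ mu))"
    by - (rule gr_nat, assumption)+
  then show "gr 1 (int r ^ k)" "gr 1 (int B ^ mu)" by simp_all
  have "gr 1 (int (B ^ (2 * mu)))" using chain by (intro gr_nat) (simp add: size_bound_def)
  then show "gr 1 (int B ^ (2 * mu))" by simp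
  show "gr 1 0" "gr 1 1" "gr 1 2" "gr 1 6" "gr 1 64" "gr 1 (-1)" by (intro gr_num; simp)+
  have "M \<le> size_bound * E ^ 3" by (rule order_trans[OF M_le mult_le_mono1]) (simp add: size_bound_def)
  also have "\<dots> \<le> size_bound * size_bound ^ 3" by (intro mult_le_mono2 power_mono) (simp_all add: size_bound_def)
  finally have "M \<le> size_bound ^ 4" by (simp add: power_eq_if)
  then have "int M \<le> int (size_bound ^ 4)" by linarith
  then show "gr 4 (6 ^ e)" by (simp add: gr_def)
qed

lemmas gr_rules = gr_params gr_add gr_diff gr_mult

text \<open>Alternating multiplications and divisions pass through binomial coefficients, so each
  division of the machine is exact.\<close>

lemma binomial_step: "((R + Suc j) choose Suc j) = ((R + j) choose j) * (R + Suc j) div Suc j"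
proof -
  have "Suc j * ((R + Suc j) choose Suc j) = (R + Suc j) * ((R + j) choose j)"
    using Suc_times_binomial_eq[of "R + j" j] by (simp add: mult.commute)
  then show ?thesis by (metis mult.commute nonzero_mult_div_cancel_left nat.distinct(1))
qed

lemma pre1:
  assumes s: "s 2 = int k" "s 3 = int r" "s 33 = 0"
  shows "\<exists>s'. runs bb pre1 s (10 * size_bound) s' \<and> (\<forall>x. x \<notin> {5, 6, 16} \<longrightarrow> s' x = s x) \<and> s' 5 = 1 \<and> s' 6 = int R"
  unfolding pre1_def
proof (rule ex_Seq[where P = "\<lambda>s'. s' = s(5 := 1, 6 := 1, 16 := int k)" and N = 3 and N' = "k * 3 + 1"])
  show "\<exists>s'. runs bb (seqs [Const 5 1, Const 6 1, Add 16 2 33]) s 3 s' \<and> s' = s(5 := 1, 6 := 1, 16 := int k)"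
    by (rule ex_seqs) (simp_all add: s, (intro conjI; (rule gr_V, (rule gr_rules)+, simp))?)
  fix s' assume s': "s' = s(5 := 1, 6 := 1, 16 := int k)"
  have "\<exists>s''. runs bb (While 16 (seqs [Mul 6 6 3, Sub 16 16 5])) s' (k * 3 + 1) s'' \<and> (\<forall>z. z \<notin> {6, 16} \<longrightarrow> s'' z = s' z) \<and> s'' 6 = 1 * int r ^ k"
  proof (rule power_loop)
    fix j assume "j \<le> k"
    then have "r ^ j \<le> R" using pos by (intro power_increasing) auto
    moreover have "R \<le> V" using gr_V[OF gr_params(6)] by (simp add: small_def)
    ultimately have "r ^ j \<le> V" by (rule order_trans)
    then show "small (int V) (1 * int r ^ j)" by (simp add: small_def)
  qed (simp_all add: s' s gr_V[OF gr_params(3)] gr_V[OF gr_params(4)])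
  then show "\<exists>s''. runs bb (While 16 (seqs [Mul 6 6 3, Sub 16 16 5])) s' (k * 3 + 1) s'' \<and>
      (\<forall>x. x \<notin> {5, 6, 16} \<longrightarrow> s'' x = s x) \<and> s'' 5 = 1 \<and> s'' 6 = int R"
    by (elim exE) (rule exI, auto simp: s')
qed (simp add: size_bound_def)

lemma pre2:
  assumes s: "s 0 = int n" "s 5 = 1" "s 6 = int R" "s 33 = 0"
  shows "\<exists>s'. runs bb pre2 s (10 * size_bound) s' \<and> (\<forall>x. x \<notin> {7, 16, 17, 28} \<longrightarrow> s' x = s x) \<and> s' 7 = int S"
  unfolding pre2_def
proof (rule ex_Seq[where P = "\<lambda>s'. s' = s(7 := 1, 16 := int n, 17 := 0)" and N = 3 and N' = "n * (5 + 1) + 1"])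
  show "\<exists>s'. runs bb (seqs [Const 7 1, Add 16 0 33, Const 17 0]) s 3 s' \<and> s' = s(7 := 1, 16 := int n, 17 := 0)"
    by (rule ex_seqs) (simp_all add: s, (intro conjI; (rule gr_V, (rule gr_rules)+, simp))?)
  let ?cs = "[Add 17 17 5, Add 28 6 17, Mul 7 7 28, Div 7 7 17, Sub 16 16 5]"
  fix s' assume s': "s' = s(7 := 1, 16 := int n, 17 := 0)"
  define I where "I j t \<longleftrightarrow> (\<forall>x. x \<notin> {7, 16, 17, 28} \<longrightarrow> t x = s x) \<and> t 7 = int ((R + j) choose j) \<and> t 16 = int (n - j) \<and> t 17 = int j"
    for j and t :: memory
  have "\<exists>s''. runs bb (While 16 (seqs ?cs)) s' (n * (5 + 1) + 1) s'' \<and> I n s''"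
  proof (rule runs_While)
    fix j t assume j: "j < n" and I: "I j t"
    have v: "t 5 = 1" "t 6 = int R" "t 7 = int ((R + j) choose j)" "t 16 = int (n - j)" "t 17 = int j" using I s by (auto simp: I_def)
    have "(R + j) choose j \<le> S"
    proof -
      have "(R + j) choose j = (R + j) choose R" using binomial_symmetric[of j "R + j"] by simp
      also have "\<dots> \<le> S" unfolding ssz_def by (rule binomial_mono_left) (use j in simp)
      finally show ?thesis .
    qed
    then have g1: "gr 1 (int ((R + j) choose j))" using gr_params(7) by (simp add: gr_def)
    have g2: "gr 1 (int j)" "gr 1 (int (n - j))" using gr_params(1) j by (simp_all add: gr_def)
    have g3: "gr 1 (int n - int j)" using g2(2) j by (simp add: of_nat_diff)
    have "\<exists>t'. runs bb (seqs ?cs) t 5 t' \<and> I (Suc j) t'"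
    proof (rule ex_seqs)
      show "lsmall (int V) ?cs t"
        by (simp add: v, intro conjI; (rule gr_V, (rule gr_rules g1 g2 g3)+, simp))
      have "int ((R + Suc j) choose Suc j) = int ((R + j) choose j) * (int R + (int j + 1)) div (int j + 1)"
        unfolding binomial_step by (simp only: of_nat_div of_nat_mult of_nat_add of_nat_Suc add.commute[of 1])
      then show "I (Suc j) (lrun ?cs t)"
        using I v j by (auto simp: I_def of_nat_diff)
    qed simp_all
    then show "0 < t 16 \<and> small (int V) (t 16) \<and>
       (\<exists>t'. runs bb (seqs ?cs) t 5 t' \<and> I (Suc j) t')"
      using v(4) j gr_V[OF g2(2)] by auto
  qed (auto simp: I_def s')
  then show "\<exists>s''. runs bb (While 16 (seqs ?cs)) s' (n * (5 + 1) + 1) s'' \<and>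
      (\<forall>x. x \<notin> {7, 16, 17, 28} \<longrightarrow> s'' x = s x) \<and> s'' 7 = int S"
    unfolding I_def ssz_def using binomial_symmetric[of n "R + n"] by (elim exE) (rule exI, auto simp: add.commute)
qed (simp add: size_bound_def)

lemma pre3:
  assumes s: "s 0 = int n" "s 2 = int k" "s 5 = 1" "s 33 = 0"
  shows "\<exists>s'. runs bb pre3 s (10 * size_bound) s' \<and> (\<forall>x. x \<notin> {8, 29} \<longrightarrow> s' x = s x) \<and> s' 8 = int mu"
  unfolding pre3_def
proof (rule ex_Seq[where P = "\<lambda>s'. s' = s(8 := int k - 1, 29 := int k - 1 - int n)" and N = 2 and N' = "1 + 1"])
  show "\<exists>s'. runs bb (seqs [Sub 8 2 5, Sub 29 8 0]) s 2 s' \<and> s' = s(8 := int k - 1, 29 := int k - 1 - int n)"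
    by (rule ex_seqs) (simp_all add: s, (intro conjI; (rule gr_V, (rule gr_rules)+, simp))?)
  fix s' assume s': "s' = s(8 := int k - 1, 29 := int k - 1 - int n)"
  have mu: "int mu = (if int k - 1 - int n > 0 then int n else int k - 1)" using pos by (auto simp: mu_of_def min_def)
  have "runs bb (Cond 29 (seqs [Add 8 0 33]) (seqs [Add 8 8 33])) s' (1 + 1) (s'(8 := int mu))"
  proof (rule runs_Cond)
    show "small (int V) (s' 29)" unfolding s' by (simp, rule gr_V, (rule gr_rules)+, simp)
    show "runs bb (seqs [Add 8 0 33]) s' 1 (s'(8 := int mu))" if "0 < s' 29"
      using runs_seqs[of "[Add 8 0 33]" s'] that gr_V[OF gr_params(1)] gr_V[OF gr_params(16)] by (simp add: s' s mu)
    have "small (int V) (int k - 1)" by (rule gr_V, (rule gr_rules)+, simp)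
    then show "runs bb (seqs [Add 8 8 33]) s' 1 (s'(8 := int mu))" if "s' 29 \<le> 0"
      using runs_seqs[of "[Add 8 8 33]" s'] that gr_V[OF gr_params(16)] by (simp add: s' s mu)
  qed
  then show "\<exists>s''. runs bb (Cond 29 (seqs [Add 8 0 33]) (seqs [Add 8 8 33])) s' (1 + 1) s'' \<and> (\<forall>x. x \<notin> {8, 29} \<longrightarrow> s'' x = s x) \<and> s'' 8 = int mu"
    by (rule_tac exI) (auto simp: s')
qed (simp add: size_bound_def)

lemma pre4:
  assumes s: "s 1 = int d" "s 5 = 1" "s 7 = int S" "s 8 = int mu" "s 33 = 0"
  shows "\<exists>s'. runs bb pre4 s (10 * size_bound) s' \<and> (\<forall>x. x \<notin> {9, 10, 14, 16, 28} \<longrightarrow> s' x = s x) \<and>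
    s' 9 = int Q \<and> s' 10 = int B \<and> s' 14 = int (B ^ mu)"
  unfolding pre4_def
proof (rule ex_Seq[where P = "\<lambda>s'. (\<forall>x. x \<notin> {9, 10, 14, 16, 28} \<longrightarrow> s' x = s x) \<and>
    s' 9 = int Q \<and> s' 10 = int B \<and> s' 14 = 1 \<and> s' 16 = int mu" and N = 8 and N' = "mu * 3 + 1"])
  let ?cs = "[Mul 28 7 7, Mul 28 28 28, Add 9 28 28, Add 9 9 5, Mul 10 1 9, Add 10 10 5, Const 14 1, Add 16 8 33]"
  show "\<exists>s'. runs bb (seqs ?cs) s 8 s' \<and> (\<forall>x. x \<notin> {9, 10, 14, 16, 28} \<longrightarrow> s' x = s x) \<and>
      s' 9 = int Q \<and> s' 10 = int B \<and> s' 14 = 1 \<and> s' 16 = int mu"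
  proof (rule ex_seqs)
    have qq: "int S * int S * (int S * int S) + int S * int S * (int S * int S) + 1 = int Q"
      by (simp add: qmax_def power4_eq_xxxx)
    have bq: "int d * int Q + 1 = int B" by (simp add: kbase_def)
    show "lsmall (int V) ?cs s"
      by (simp add: s s[simplified] qq bq, intro conjI; (rule gr_V, (rule gr_rules)+, simp))
    show "(\<forall>x. x \<notin> {9, 10, 14, 16, 28} \<longrightarrow> lrun ?cs s x = s x) \<and>
      lrun ?cs s 9 = int Q \<and> lrun ?cs s 10 = int B \<and> lrun ?cs s 14 = 1 \<and> lrun ?cs s 16 = int mu"
      by (simp add: s s[simplified] qmax_def kbase_def power4_eq_xxxx distrib_left mult.assoc)
  qed simp_all
  fix s' assume s': "(\<forall>x. x \<notin> {9, 10, 14, 16, 28} \<longrightarrow> s' x = s x) \<and> s' 9 = int Q \<and> s' 10 = int B \<and> s' 14 = 1 \<and> s' 16 = int mu"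
  have "\<exists>s''. runs bb (While 16 (seqs [Mul 14 14 10, Sub 16 16 5])) s' (mu * 3 + 1) s'' \<and> (\<forall>z. z \<notin> {14, 16} \<longrightarrow> s'' z = s' z) \<and> s'' 14 = 1 * int B ^ mu"
  proof (rule power_loop)
    fix j assume "j \<le> mu"
    then have "B ^ j \<le> B ^ mu" using chain by (intro power_increasing) auto
    moreover have "B ^ mu \<le> V" using gr_V[OF gr_params(13)] by (simp add: small_def)
    ultimately have "B ^ j \<le> V" by (rule order_trans)
    then show "small (int V) (1 * int B ^ j)" by (simp add: small_def)
  qed (use s' s in \<open>simp_all add: gr_V[OF gr_params(8)] gr_V[OF gr_params(10)]\<close>)
  then show "\<exists>s''. runs bb (While 16 (seqs [Mul 14 14 10, Sub 16 16 5])) s' (mu * 3 + 1) s'' \<and>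
      (\<forall>x. x \<notin> {9, 10, 14, 16, 28} \<longrightarrow> s'' x = s x) \<and> s'' 9 = int Q \<and> s'' 10 = int B \<and> s'' 14 = int (B ^ mu)"
    by (elim exE) (rule exI, use s' in auto)
qed (simp add: size_bound_def mu_of_def)

text \<open>\<open>e\<close> is the number of halvings that take \<open>E\<close> to 0, so one
  multiplication by 6 per round leaves M = 6^e.\<close>

lemma pre5:
  assumes s: "s 10 = int B" "s 14 = int (B ^ mu)" "s 33 = 0"
  shows "\<exists>s'. runs bb pre5 s (10 * size_bound) s' \<and> (\<forall>x. x \<notin> {11, 12, 28, 29, 31} \<longrightarrow> s' x = s x) \<and>
    s' 11 = int E \<and> s' 12 = int M"
  unfolding pre5_def
proof (rule ex_Seq[where P = "\<lambda>s'. s' = s(11 := int E, 12 := 1, 28 := int E, 29 := 6, 31 := 2)" and N = 6 and N' = "e * (2 + 1) + 1"])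
  have EE: "int E = int B ^ mu * int B ^ mu * int B" by (simp add: emax_def power_add mult_2)
  let ?cs = "[Mul 11 14 14, Mul 11 11 10, Const 12 1, Add 28 11 33, Const 29 6, Const 31 2]"
  show "\<exists>s'. runs bb (seqs ?cs) s 6 s' \<and> s' = s(11 := int E, 12 := 1, 28 := int E, 29 := 6, 31 := 2)"
    by (rule ex_seqs)
      (simp_all add: s EE, (intro conjI; (rule gr_V, (rule gr_rules)+, simp))?)
  fix s' assume s': "s' = s(11 := int E, 12 := 1, 28 := int E, 29 := 6, 31 := 2)"
  define I where "I j t \<longleftrightarrow> (\<forall>x. x \<notin> {12, 28} \<longrightarrow> t x = s' x) \<and> t 12 = 6 ^ j \<and> t 28 = int (E div 2 ^ j)"
    for j and t :: memory
  have "\<exists>s''. runs bb (While 28 (seqs [Div 28 28 31, Mul 12 12 29])) s' (e * (2 + 1) + 1) s'' \<and> I e s''"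
  proof (rule runs_While)
    fix j t assume j: "j < e" and I: "I j t"
    have v: "t 12 = 6 ^ j" "t 28 = int (E div 2 ^ j)" "t 29 = 6" "t 31 = 2" using I by (auto simp: I_def s')
    have "E div 2 ^ j \<le> E" by simp
    then have "int (E div 2 ^ j) \<le> int E" by linarith
    then have g1: "gr 1 (int (E div 2 ^ j))" using gr_params(11) by (simp only: gr_def abs_of_nat power_one_right)
    have "(6::int) ^ j \<le> 6 ^ e" using j by (intro power_increasing) auto
    moreover have "(6::int) ^ e \<le> int size_bound ^ 4" using gr_params(15) by (simp add: gr_def)
    ultimately have "(6::int) ^ j \<le> int size_bound ^ 4" by (rule order_trans)
    then have g2: "gr 4 (6 ^ j)" by (simp add: gr_def)
    have "\<exists>t'. runs bb (seqs [Div 28 28 31, Mul 12 12 29]) t 2 t' \<and> I (Suc j) t'"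
    proof (rule ex_seqs)
      show "lsmall (int V) [Div 28 28 31, Mul 12 12 29] t"
        by (simp add: v del: of_nat_div zdiv_int, intro conjI; (rule gr_V, (rule gr_rules g1 g2)+, simp))
      have "int (E div 2 ^ Suc j) = int (E div 2 ^ j) div 2" unfolding power_Suc2 div_mult2_eq by (simp only: of_nat_div of_nat_numeral)
      then show "I (Suc j) (lrun [Div 28 28 31, Mul 12 12 29] t)"
        using I v by (auto simp: I_def simp del: of_nat_div zdiv_int)
    qed simp_all
    moreover have "0 < t 28"
    proof -
      have "(2::nat) ^ j \<le> 2 ^ (e - 1)" using j by (intro power_increasing) auto
      then have "2 ^ j \<le> E" using e(2) by linarith
      then have "0 < E div 2 ^ j" by (simp add: div_greater_zero_iff)
      then show ?thesis using v(2) by linarith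
    qed
    ultimately show "0 < t 28 \<and> small (int V) (t 28) \<and> (\<exists>t'. runs bb (seqs [Div 28 28 31, Mul 12 12 29]) t 2 t' \<and> I (Suc j) t')"
      using gr_V[OF g1] v(2) by simp
  qed (use e(1) in \<open>auto simp: I_def s'\<close>)
  then show "\<exists>s''. runs bb (While 28 (seqs [Div 28 28 31, Mul 12 12 29])) s' (e * (2 + 1) + 1) s'' \<and>
      (\<forall>x. x \<notin> {11, 12, 28, 29, 31} \<longrightarrow> s'' x = s x) \<and> s'' 11 = int E \<and> s'' 12 = int M"
    unfolding I_def by (elim exE) (rule exI, auto simp: s')
next
  have "e \<le> E" by (rule floorlog_leI) (simp_all add: less_exp)
  then show "6 + (e * (2 + 1) + 1) \<le> 10 * size_bound" unfolding size_bound_def by simp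
qed

lemma pre_program:
  assumes s: "s 0 = int n" "s 1 = int d" "s 2 = int k" "s 3 = int r" "\<And>x. x \<ge> 5 \<Longrightarrow> s x = 0"
  shows "\<exists>s'. runs bb pre_program s (60 * size_bound) s' \<and>
    s' 0 = int n \<and> s' 5 = 1 \<and> s' 33 = 0 \<and> s' 8 = int mu \<and> s' 9 = int Q \<and> s' 10 = int B \<and> s' 11 = int E \<and>
    s' 12 = int M \<and> s' 13 = 2 * int M \<and> s' 14 = int (B ^ mu) \<and> s' 15 = int R + 1 \<and> s' 16 = int Q \<and> s' 20 = 64 \<and>
    s' 25 = 0 \<and> s' 27 = (int n + 1) * (2 * int M) + 1 \<and> s' 34 = -1 \<and> (\<forall>x\<ge>64. s' x = 0)"
proof -
  let ?cs = "[Add 13 12 12, Mul 27 0 13, Add 27 27 13, Add 27 27 5, Add 15 6 5, Const 20 64, Const 34 (-1),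
     Const 25 0, Add 16 9 33]"
  have z: "s 33 = 0" using s by simp
  obtain s1 where s1: "runs bb pre1 s (10 * size_bound) s1" "\<forall>x. x \<notin> {5, 6, 16} \<longrightarrow> s1 x = s x" "s1 5 = 1" "s1 6 = int R"
    using pre1[of s bb] s z by auto
  obtain s2 where s2: "runs bb pre2 s1 (10 * size_bound) s2" "\<forall>x. x \<notin> {7, 16, 17, 28} \<longrightarrow> s2 x = s1 x" "s2 7 = int S"
    using pre2[of s1 bb] s1 s z by auto
  obtain s3 where s3: "runs bb pre3 s2 (10 * size_bound) s3" "\<forall>x. x \<notin> {8, 29} \<longrightarrow> s3 x = s2 x" "s3 8 = int mu"
    using pre3[of s2 bb] s2 s1 s z by auto
  obtain s4 where s4: "runs bb pre4 s3 (10 * size_bound) s4" "\<forall>x. x \<notin> {9, 10, 14, 16, 28} \<longrightarrow> s4 x = s3 x"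
    "s4 9 = int Q" "s4 10 = int B" "s4 14 = int (B ^ mu)"
    using pre4[of s3 bb] s3 s2 s1 s z by auto
  obtain s5 where s5: "runs bb pre5 s4 (10 * size_bound) s5" "\<forall>x. x \<notin> {11, 12, 28, 29, 31} \<longrightarrow> s5 x = s4 x"
    "s5 11 = int E" "s5 12 = int M"
    using pre5[of s4 bb] s4 s3 s2 s1 s z by auto
  have v: "s5 0 = int n" "s5 5 = 1" "s5 6 = int R" "s5 8 = int mu" "s5 9 = int Q" "s5 10 = int B" "s5 14 = int (B ^ mu)" "s5 33 = 0" "s5 25 = 0"
    using s5 s4 s3 s2 s1 s z by simp_all
  have h: "s5 x = 0" if "x \<ge> 64" for x
    using s5(2) s4(2) s3(2) s2(2) s1(2) s(5)[of x] that by simp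
  have "\<exists>s'. runs bb pre6 s5 9 s' \<and> s' = lrun ?cs s5"
    unfolding pre6_def
    by (rule ex_seqs) (simp_all add: v s5(3,4), (intro conjI; (rule gr_V, (rule gr_rules)+, simp))?)
  then obtain s6 where s6: "runs bb pre6 s5 9 s6" "s6 = lrun ?cs s5" by blast
  have "runs bb pre_program s (10 * size_bound + (10 * size_bound + (10 * size_bound + (10 * size_bound + (10 * size_bound + 9))))) s6"
    unfolding pre_program_def
    by (rule runs_Seq[OF s1(1) runs_Seq[OF s2(1) runs_Seq[OF s3(1) runs_Seq[OF s4(1) runs_Seq[OF s5(1) s6(1)]]]]])
  then have "runs bb pre_program s (60 * size_bound) s6" by (rule runs_mono) (simp add: size_bound_def)
  then show ?thesis
    by (intro exI[of _ s6] conjI) (simp_all add: s6(2) v s5(3,4) h algebra_simps)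
qed

end

section \<open>Writing one coordinate of a query\<close>

definition inc_cell :: prog where
  "inc_cell = seqs [Load 32 30, Add 32 32 31, Store 30 32]"

text \<open>Adds the two monomials of the next summand of \<open>gpart\<close>. Since lists start
  with the highest coefficient, exponent x belongs to the cell x places below the one named in cell
  21.\<close>

definition term_program :: prog where
  "term_program =
    Seq (seqs [Mul 23 23 10, Mul 24 24 10, Mul 28 22 23, Add 28 28 24, Mul 28 28 17, Sub 30 21 28, Add 31 5 33])
   (Seq inc_cell
   (Seq (seqs [Add 28 22 24, Mul 28 28 17, Sub 30 21 28, Add 31 34 33])
   (Seq inc_cell (seqs [Sub 19 19 5]))))"

text \<open>The last instructions replace the weight w by (R + 1) w mod q, so that no high power of
  R + 1 is ever formed, and move cell 21 to the end of the next coordinate.\<close>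

definition coordinate_program :: prog where
  "coordinate_program =
    Seq (seqs [Mul 28 17 22, Sub 30 21 28, Add 31 5 33])
   (Seq inc_cell
   (Seq (seqs [Add 23 5 33, Add 24 14 33, Add 19 8 33])
   (Seq (While 19 term_program)
   (seqs [Mul 28 22 15, Div 29 28 16, Mul 29 29 16, Sub 22 28 29, Add 21 21 13, Sub 18 18 5]))))"

lemma gpart_0: "gpart R q mu B i v 0 = monom 1 (i * wgt R q v)"
  by (simp add: gpart_def)

lemma gpart_Suc: "gpart R q mu B i v (Suc l) = gpart R q mu B i v l + monom 1 (i * (B ^ (mu + Suc l) + wgt R q v * B ^ Suc l))
    + monom (- 1) (i * (B ^ (mu + Suc l) + wgt R q v))"
  by (simp add: gpart_def minus_monom[symmetric] del: minus_monom)

lemma coeff_gpart_bound: "\<bar>coeff (gpart R q mu B i v l) x\<bar> \<le> 1 + 2 * int l"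
proof (induction l)
  case 0
  show ?case by (simp add: gpart_0)
next
  case (Suc l)
  have b: "\<bar>a + b + c\<bar> \<le> 1 + 2 * int (Suc l)" if "\<bar>a\<bar> \<le> 1 + 2 * int l" "\<bar>b\<bar> \<le> 1" "\<bar>c\<bar> \<le> 1" for a b c :: int
    using that by simp
  show ?case unfolding gpart_Suc coeff_add by (rule b[OF Suc]) simp_all
qed

context parameters
begin

abbreviation "len \<equiv> 2 * M"

text \<open>E < 2^e gives E^2 < 4^e <= 6^e. The exponents in the query polynomials are at most E^2,
  so a coordinate fits into \<open>len\<close> cells.\<close>

lemma len_gt: "E * E < len" "len \<ge> 2"
proof -
  have "E * E < 2 ^ e * 2 ^ e" using e by (intro mult_strict_mono) auto
  also have "\<dots> = 4 ^ e" by (simp flip: power_mult_distrib)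
  also have "\<dots> \<le> M" by (rule power_mono) auto
  finally show "E * E < len" by simp
  show "len \<ge> 2" by simp
qed

text \<open>For l >= 1 the factors of i are at most 2 B^(2 mu), and B >= 3 leaves this below E =
  B^(2 mu + 1); i itself is at most \<open>E\<close>.\<close>

lemma exponent_le:
  assumes "i \<le> E" "q \<le> Q" "l \<le> mu" "q \<ge> 1"
  shows "i * wgt R q v < len" "l \<ge> 1 \<Longrightarrow> i * (B ^ (mu + l) + wgt R q v * B ^ l) < len"
    "l \<ge> 1 \<Longrightarrow> i * (B ^ (mu + l) + wgt R q v) < len"
proof -
  have w: "wgt R q v \<le> q" unfolding wgt_def using assms by (simp add: less_imp_le)
  have B3: "B \<ge> 3" using chain by simp
  have "wgt R q v \<le> E" using w assms chain by linarith
  then have "i * wgt R q v \<le> E * E" using assms by (intro mult_le_mono)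
  then show "i * wgt R q v < len" using len_gt by linarith
  assume l: "l \<ge> 1"
  have a: "B ^ (mu + l) \<le> B ^ (2 * mu)" using assms B3 by (intro power_increasing) auto
  have b: "wgt R q v * B ^ l \<le> B * B ^ (2 * mu - 1)"
  proof (rule mult_le_mono)
    show "wgt R q v \<le> B" using w assms chain by linarith
    show "B ^ l \<le> B ^ (2 * mu - 1)" using assms l B3 by (intro power_increasing) auto
  qed
  have c: "B * B ^ (2 * mu - 1) = B ^ (2 * mu)" using l assms by (simp flip: power_Suc)
  have "2 * B ^ (2 * mu) \<le> B * B ^ (2 * mu)" using B3 by (intro mult_le_mono1) auto
  then have d: "2 * B ^ (2 * mu) \<le> E" by (simp add: emax_def)
  have f: "B ^ (mu + l) + wgt R q v * B ^ l \<le> E" using a b c d by linarith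
  then have "i * (B ^ (mu + l) + wgt R q v * B ^ l) \<le> E * E" using assms by (intro mult_le_mono)
  then show "i * (B ^ (mu + l) + wgt R q v * B ^ l) < len" using len_gt by linarith
  have "wgt R q v * 1 \<le> wgt R q v * B ^ l" using B3 by (intro mult_le_mono2) simp
  then have "B ^ (mu + l) + wgt R q v \<le> E" using f by linarith
  then have "i * (B ^ (mu + l) + wgt R q v) \<le> E * E" using assms by (intro mult_le_mono)
  then show "i * (B ^ (mu + l) + wgt R q v) < len" using len_gt by linarith
qed

text \<open>The lower bound on \<open>a\<close> keeps the block, which ends at \<open>a\<close>, at
  addresses from 64 on and so away from the registers.\<close>

lemma inc_cell:
  assumes t: "t 30 = int (a - y)" "t 31 = \<delta>" and y: "y < len" and a: "a \<ge> len + 63"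
    and p: "\<And>x. x < len \<Longrightarrow> t (a - x) = coeff p x"
    and g: "gr 50 (int a)" "gr 1 \<delta>" "\<And>x. gr 6 (coeff p x)"
  shows "\<exists>t'. runs bb inc_cell t 3 t' \<and> (\<forall>x. x \<notin> {32} \<union> {a - len<..a} \<longrightarrow> t' x = t x) \<and>
     (\<forall>x<len. t' (a - x) = coeff (p + monom \<delta> y) x)"
  unfolding inc_cell_def
proof (rule ex_seqs)
  have ay: "a - y \<ge> 64" using y a by linarith
  then have ne: "a - y \<noteq> 32" "a - y \<noteq> 30" "a - y \<noteq> 31" by auto
  have st: "small (int V) (int (a - y))" using gr_V[OF g(1)] by (simp add: small_def)
  have tc: "t (a - y) = coeff p y" using p y by blast
  have sm: "small (int V) (coeff p y)" "small (int V) \<delta>" using gr_V[OF g(3)] gr_V[OF g(2)] by simp_all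
  have "small (int V) (coeff p y + \<delta>)" by (rule gr_V, rule gr_add[OF g(3) g(2)], simp)
  then show "lsmall (int V) [Load 32 30, Add 32 32 31, Store 30 32] t"
    using st sm by (simp add: t tc ne)
  have run: "lrun [Load 32 30, Add 32 32 31, Store 30 32] t = t(32 := coeff p y + \<delta>, a - y := coeff p y + \<delta>)"
    using ne by (simp add: t tc fun_eq_iff)
  have inj: "a - x = a - y \<longleftrightarrow> x = y" if "x < len" for x using that y a by auto
  show "(\<forall>x. x \<notin> {32} \<union> {a - len<..a} \<longrightarrow> lrun [Load 32 30, Add 32 32 31, Store 30 32] t x = t x) \<and>
     (\<forall>x<len. lrun [Load 32 30, Add 32 32 31, Store 30 32] t (a - x) = coeff (p + monom \<delta> y) x)"
    unfolding run
  proof (intro conjI allI impI)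
    fix x assume "x \<notin> {32} \<union> {a - len<..a}"
    then show "(t(32 := coeff p y + \<delta>, a - y := coeff p y + \<delta>)) x = t x" using y a by auto
  next
    fix x assume x: "x < len"
    then have "a - x \<noteq> 32" using a by auto
    then show "(t(32 := coeff p y + \<delta>, a - y := coeff p y + \<delta>)) (a - x) = coeff (p + monom \<delta> y) x"
      using inj[OF x] p[OF x] by (auto simp: coeff_monom)
  qed
qed simp_all

lemma term_program:
  assumes l: "Suc l \<le> mu" and i: "i \<le> E" and q: "1 \<le> q" "q \<le> Q" and a: "a \<ge> len + 63" "gr 50 (int a)"
    and s: "s 5 = 1" "s 33 = 0" "s 34 = -1" "s 10 = int B" "s 17 = int i" "s 21 = int a" "s 22 = int (wgt R q v)"
      "s 23 = int (B ^ l)" "s 24 = int (B ^ (mu + l))" "s 19 = int (mu - l)"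
    and p: "\<And>x. x < len \<Longrightarrow> s (a - x) = coeff (gpart R q mu B i v l) x"
  shows "\<exists>s'. runs bb term_program s 18 s' \<and> (\<forall>x. x \<notin> {19, 23, 24, 28, 30, 31, 32} \<union> {a - len<..a} \<longrightarrow> s' x = s x) \<and>
     (\<forall>x<len. s' (a - x) = coeff (gpart R q mu B i v (Suc l)) x) \<and>
     s' 23 = int (B ^ Suc l) \<and> s' 24 = int (B ^ (mu + Suc l)) \<and> s' 19 = int (mu - Suc l)"
proof -
  define w where "w = wgt R q v"
  define p1 where "p1 = gpart R q mu B i v l"
  define y1 where "y1 = i * (B ^ (mu + Suc l) + w * B ^ Suc l)"
  define y2 where "y2 = i * (B ^ (mu + Suc l) + w)"
  have y: "y1 < len" "y2 < len" using exponent_le[OF i q(2) l q(1), of v] by (simp_all add: y1_def y2_def w_def)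
  have B3: "B \<ge> 3" using chain by simp
  have "B ^ l \<le> E"
    by (rule order_trans[OF power_increasing chain(4)]) (use l B3 in auto)
  moreover have "B ^ (mu + l) \<le> E"
    by (rule order_trans[OF power_increasing chain(6)]) (use l B3 in auto)
  moreover have "w \<le> q" unfolding w_def wgt_def using q by (simp add: less_imp_le)
  moreover have "mu \<le> n" by (simp add: mu_of_def)
  ultimately have "B ^ l \<le> size_bound" "B ^ (mu + l) \<le> size_bound" "w \<le> size_bound" "i \<le> size_bound" "mu - l \<le> size_bound"
    using chain q i by (simp_all add: size_bound_def)
  then have "gr 1 (int (B ^ l))" "gr 1 (int (B ^ (mu + l)))" "gr 1 (int w)" "gr 1 (int i)" "gr 1 (int (mu - l))"
    by - (rule gr_nat, assumption)+
  then have gg: "gr 1 (int B ^ l)" "gr 1 (int B ^ (mu + l))" "gr 1 (int w)" "gr 1 (int i)" "gr 1 (int (mu - l))"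
    "gr 1 (int mu - int l)" using l by (simp_all add: of_nat_diff)
  have g3: "gr 4 (1 + 2 * int mu)"
    using gr_add[OF gr_params(17) gr_mult[OF gr_params(18) gr_params(8)]] by (simp add: numeral_eq_Suc)
  have gc: "gr 4 z" if "\<bar>z\<bar> \<le> 1 + 2 * int mu" for z
    using g3 that unfolding gr_def by linarith
  have c1: "\<bar>coeff p1 x\<bar> \<le> 1 + 2 * int mu" for x
  proof -
    have "\<bar>coeff p1 x\<bar> \<le> 1 + 2 * int l" unfolding p1_def by (rule coeff_gpart_bound)
    moreover have "1 + 2 * int l \<le> 1 + 2 * int mu" using l by simp
    ultimately show ?thesis by (rule order_trans)
  qed
  have c2: "gr 6 (coeff (p1 + monom 1 y1) x)" for x
  proof -
    have "\<bar>coeff (p1 + monom 1 y1) x\<bar> \<le> 1 + (1 + 2 * int mu)"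
      using c1[of x] by (simp add: coeff_monom abs_if split: if_splits)
    moreover have "gr 6 (1 + (1 + 2 * int mu))" using gr_add[OF gr_params(17) g3] by (simp add: numeral_eq_Suc)
    ultimately show ?thesis unfolding gr_def by linarith
  qed
  have low: "x \<notin> {a - len<..a}" if "x < 64" for x using a that by auto
  \<comment> \<open>\<open>K p\<close>: the block holds the polynomial p, the two powers of B are
    already advanced, cell 19 is still the old counter, and otherwise only scratch cells have
    changed.\<close>
  define K where "K p t \<longleftrightarrow> (\<forall>x. x \<notin> {19, 23, 24, 28, 30, 31, 32} \<union> {a - len<..a} \<longrightarrow> t x = s x) \<and>
     (\<forall>x<len. t (a - x) = coeff p x) \<and> t 23 = int (B ^ Suc l) \<and> t 24 = int (B ^ (mu + Suc l)) \<and> t 19 = int (mu - l)" for p and t :: memory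
  have Kv: "t 5 = 1" "t 33 = 0" "t 34 = -1" "t 10 = int B" "t 17 = int i" "t 21 = int a" "t 22 = int w" "t 23 = int B * int B ^ l"
     "t 24 = int B * int B ^ (mu + l)" "t 19 = int (mu - l)"
     if "K p t" for p t
    using that s low[of 5] low[of 33] low[of 34] low[of 10] low[of 17] low[of 21] low[of 22] unfolding K_def w_def by auto
  have hp: "a - x \<noteq> z" if "x < len" "z < 64" for x z using a that by auto
  have Kinc: "\<exists>t'. runs bb inc_cell t 3 t' \<and> K (p + monom \<delta> y) t'"
    if K: "K p t" and t: "t 30 = int (a - y)" "t 31 = \<delta>" "y < len" and g: "\<And>x. gr 6 (coeff p x)" "gr 1 \<delta>" for p t \<delta> y
  proof -
    obtain t' where t': "runs bb inc_cell t 3 t'" "\<forall>x. x \<notin> {32} \<union> {a - len<..a} \<longrightarrow> t' x = t x" "\<forall>x<len. t' (a - x) = coeff (p + monom \<delta> y) x"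
      using inc_cell[OF t a(1) _ a(2) g(2,1), of bb] K unfolding K_def by blast
    have "K (p + monom \<delta> y) t'"
      using K t' low[of 23] low[of 24] low[of 19] unfolding K_def by auto
    then show ?thesis using t' by blast
  qed
  have sub: "int a - int y = int (a - y)" if "y < len" for y using a that by (simp add: of_nat_diff)
  have st1: "\<exists>t. runs bb (seqs [Mul 23 23 10, Mul 24 24 10, Mul 28 22 23, Add 28 28 24, Mul 28 28 17, Sub 30 21 28, Add 31 5 33]) s 7 t \<and>
     (K p1 t \<and> t 30 = int (a - y1) \<and> t 31 = 1)"
  proof (rule ex_seqs)
    let ?cs = "[Mul 23 23 10, Mul 24 24 10, Mul 28 22 23, Add 28 28 24, Mul 28 28 17, Sub 30 21 28, Add 31 5 33]"
    show "lsmall (int V) ?cs s"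
      by (simp add: s w_def[symmetric], intro conjI; (rule gr_V, (rule gr_rules gg a(2))+, simp))
    have y1: "int y1 = (int w * (int B ^ l * int B) + int B ^ (mu + l) * int B) * int i"
      by (simp add: y1_def algebra_simps)
    show "K p1 (lrun ?cs s) \<and> lrun ?cs s 30 = int (a - y1) \<and> lrun ?cs s 31 = 1"
      unfolding K_def sub[OF y(1), symmetric] y1
      using p hp by (simp add: s w_def[symmetric] p1_def mult.commute)
  qed simp_all
  have st2: "\<exists>t. runs bb (seqs [Add 28 22 24, Mul 28 28 17, Sub 30 21 28, Add 31 34 33]) t' 4 t \<and>
     (K (p1 + monom 1 y1) t \<and> t 30 = int (a - y2) \<and> t 31 = -1)" if K: "K (p1 + monom 1 y1) t'" for t'
  proof (rule ex_seqs)
    let ?cs = "[Add 28 22 24, Mul 28 28 17, Sub 30 21 28, Add 31 34 33]"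
    show "lsmall (int V) ?cs t'"
      by (simp add: Kv[OF K], intro conjI; (rule gr_V, (rule gr_rules gg a(2))+, simp))
    have y2: "int y2 = (int w + int B * int B ^ (mu + l)) * int i"
      by (simp add: y2_def algebra_simps)
    show "K (p1 + monom 1 y1) (lrun ?cs t') \<and> lrun ?cs t' 30 = int (a - y2) \<and> lrun ?cs t' 31 = -1"
      unfolding sub[OF y(2), symmetric] y2
      using K hp by (simp add: Kv[OF K]) (simp add: K_def)
  qed simp_all
  have st3: "\<exists>s'. runs bb (seqs [Sub 19 19 5]) t 1 s' \<and> (\<forall>x. x \<notin> {19, 23, 24, 28, 30, 31, 32} \<union> {a - len<..a} \<longrightarrow> s' x = s x) \<and>
     (\<forall>x<len. s' (a - x) = coeff (gpart R q mu B i v (Suc l)) x) \<and>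
     s' 23 = int (B ^ Suc l) \<and> s' 24 = int (B ^ (mu + Suc l)) \<and> s' 19 = int (mu - Suc l)"
    if K: "K (p1 + monom 1 y1 + monom (-1) y2) t" for t
  proof (rule ex_seqs)
    show "lsmall (int V) [Sub 19 19 5] t"
      by (simp add: Kv[OF K], intro conjI; (rule gr_V, (rule gr_rules gg a(2))+, simp))
    have "gpart R q mu B i v (Suc l) = p1 + monom 1 y1 + monom (-1) y2"
      unfolding gpart_Suc p1_def y1_def y2_def w_def ..
    then show "(\<forall>x. x \<notin> {19, 23, 24, 28, 30, 31, 32} \<union> {a - len<..a} \<longrightarrow> lrun [Sub 19 19 5] t x = s x) \<and>
     (\<forall>x<len. lrun [Sub 19 19 5] t (a - x) = coeff (gpart R q mu B i v (Suc l)) x) \<and>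
     lrun [Sub 19 19 5] t 23 = int (B ^ Suc l) \<and> lrun [Sub 19 19 5] t 24 = int (B ^ (mu + Suc l)) \<and> lrun [Sub 19 19 5] t 19 = int (mu - Suc l)"
      using K hp l by (simp add: Kv[OF K] of_nat_diff) (simp add: K_def)
  qed simp_all
  have c1': "gr 6 (coeff p1 x)" for x by (rule gr_mono[OF gc[OF c1]]) simp
  show ?thesis unfolding term_program_def
    by (rule ex_Seq[OF st1, where N' = 11], elim conjE,
        rule ex_Seq[OF Kinc[OF _ _ _ y(1) c1' gr_params(17)], where N' = 8], assumption+,
        rule ex_Seq[OF st2, where N' = 4], assumption, elim conjE,
        rule ex_Seq[OF Kinc[OF _ _ _ y(2) c2 gr_params(21)], where N' = 1], assumption+, rule st3, assumption, simp_all)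
qed

lemma coordinate_program:
  assumes i: "i \<le> E" and q: "1 \<le> q" "q \<le> Q" and a: "a \<ge> len + 63" "gr 50 (int a)" and v: "v < n"
    and s: "s 5 = 1" "s 33 = 0" "s 34 = -1" "s 8 = int mu" "s 10 = int B" "s 13 = 2 * int M" "s 14 = int (B ^ mu)" "s 15 = int R + 1"
      "s 16 = int q" "s 17 = int i" "s 18 = int (n - v)" "s 21 = int a" "s 22 = int (wgt R q v)"
    and p: "\<And>x. x < len \<Longrightarrow> s (a - x) = 0"
  shows "\<exists>s'. runs bb coordinate_program s (mu * 19 + 16) s' \<and>
     (\<forall>x. x \<notin> {18, 19, 21, 22, 23, 24, 28, 29, 30, 31, 32} \<union> {a - len<..a} \<longrightarrow> s' x = s x) \<and>
     (\<forall>x<len. s' (a - x) = coeff (gpoly R q mu B i v) x) \<and>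
     s' 18 = int (n - Suc v) \<and> s' 21 = int (a + len) \<and> s' 22 = int (wgt R q (Suc v))"
proof -
  define w where "w = wgt R q v"
  have low: "x \<notin> {a - len<..a}" if "x < 64" for x using a that by auto
  have hp: "a - x \<noteq> z" if "x < len" "z < 64" for x z using a that by auto
  have "w < q" unfolding w_def wgt_def using q by simp
  then have "w \<le> size_bound" "i \<le> size_bound" "q \<le> size_bound" "n - v \<le> size_bound" using chain q i by (simp_all add: size_bound_def)
  then have "gr 1 (int w)" "gr 1 (int i)" "gr 1 (int q)" "gr 1 (int (n - v))" by - (rule gr_nat, assumption)+
  then have gg: "gr 1 (int w)" "gr 1 (int i)" "gr 1 (int q)" "gr 1 (int (n - v))" "gr 1 (int n - int v)"
    using v by (simp_all add: of_nat_diff)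
  have y: "i * w < len" unfolding w_def by (rule exponent_le[of i q 0]) (use i q in simp_all)
  have sub: "int a - int y = int (a - y)" if "y < len" for y using a that by (simp add: of_nat_diff)
  define K where "K l t \<longleftrightarrow> (\<forall>x. x \<notin> {19, 23, 24, 28, 30, 31, 32} \<union> {a - len<..a} \<longrightarrow> t x = s x) \<and>
     (\<forall>x<len. t (a - x) = coeff (gpart R q mu B i v l) x)" for l and t :: memory
  have Kfr: "t x = s x" if "K l t" "x < 64" "x \<notin> {19, 23, 24, 28, 30, 31, 32}" for l t x
    using that low[of x] unfolding K_def by blast
  have Kv: "t 5 = 1" "t 33 = 0" "t 34 = -1" "t 8 = int mu" "t 10 = int B" "t 13 = 2 * int M" "t 14 = int (B ^ mu)" "t 15 = int R + 1"
      "t 16 = int q" "t 17 = int i" "t 18 = int (n - v)" "t 21 = int a" "t 22 = int w" if "K l t" for l t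
    using Kfr[OF that] by (simp_all add: s w_def)
  have st1: "\<exists>t. runs bb (seqs [Mul 28 17 22, Sub 30 21 28, Add 31 5 33]) s 3 t \<and>
     t = s(28 := int (i * w), 30 := int (a - i * w), 31 := 1)"
  proof (rule ex_seqs)
    show "lsmall (int V) [Mul 28 17 22, Sub 30 21 28, Add 31 5 33] s"
      by (simp add: s w_def[symmetric], intro conjI; (rule gr_V, (rule gr_rules gg a(2))+, simp))
    show "lrun [Mul 28 17 22, Sub 30 21 28, Add 31 5 33] s = s(28 := int (i * w), 30 := int (a - i * w), 31 := 1)"
      unfolding sub[OF y, symmetric] by (simp add: s w_def[symmetric])
  qed simp_all
  have st2: "\<exists>t'. runs bb inc_cell t 3 t' \<and> K 0 t'" if t: "t = s(28 := int (i * w), 30 := int (a - i * w), 31 := 1)" for t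
  proof -
    have "\<exists>t'. runs bb inc_cell t 3 t' \<and> (\<forall>x. x \<notin> {32} \<union> {a - len<..a} \<longrightarrow> t' x = t x) \<and> (\<forall>x<len. t' (a - x) = coeff (0 + monom 1 (i * w)) x)"
    proof (rule inc_cell[OF _ _ y a(1) _ a(2)])
      show "t (a - x) = coeff 0 x" if "x < len" for x using p hp that by (simp add: t)
      show "gr 6 (coeff 0 x)" for x by (simp add: gr_def)
      show "gr 1 1" by (rule gr_params(17))
    qed (simp_all add: t)
    then obtain t' where t': "runs bb inc_cell t 3 t'" "\<And>x. x \<notin> {32} \<union> {a - len<..a} \<Longrightarrow> t' x = t x"
      "\<And>x. x < len \<Longrightarrow> t' (a - x) = coeff (0 + monom 1 (i * w)) x" by blast
    have "K 0 t'" unfolding K_def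
    proof (intro conjI allI impI)
      fix x assume x: "x \<notin> {19, 23, 24, 28, 30, 31, 32} \<union> {a - len<..a}"
      then have "t' x = t x" by (intro t'(2)) blast
      then show "t' x = s x" using x by (simp add: t)
    qed (use t'(3) in \<open>simp add: gpart_0 w_def\<close>)
    then show ?thesis using t'(1) by blast
  qed
  have st3: "\<exists>t'. runs bb (seqs [Add 23 5 33, Add 24 14 33, Add 19 8 33]) t 3 t' \<and>
     (K 0 t' \<and> t' 23 = 1 \<and> t' 24 = int (B ^ mu) \<and> t' 19 = int mu)" if K: "K 0 t" for t
    by (rule ex_seqs) (use K hp in \<open>simp_all add: Kv[OF K]\<close>, (intro conjI; (rule gr_V, (rule gr_rules gg a(2))+, simp))?, simp add: K_def)
  have st4: "\<exists>t'. runs bb (While 19 term_program) t (mu * (18 + 1) + 1) t' \<and>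
      (K mu t' \<and> t' 23 = int (B ^ mu) \<and> t' 24 = int (B ^ (mu + mu)) \<and> t' 19 = int (mu - mu))"
    if t: "K 0 t \<and> t 23 = 1 \<and> t 24 = int (B ^ mu) \<and> t 19 = int mu" for t
  proof (rule runs_While[where I = "\<lambda>l t. K l t \<and> t 23 = int (B ^ l) \<and> t 24 = int (B ^ (mu + l)) \<and> t 19 = int (mu - l)"])
    fix l t assume l: "l < mu" and I: "K l t \<and> t 23 = int (B ^ l) \<and> t 24 = int (B ^ (mu + l)) \<and> t 19 = int (mu - l)"
    have K: "K l t" using I by blast
    have "\<exists>t'. runs bb term_program t 18 t' \<and> (\<forall>x. x \<notin> {19, 23, 24, 28, 30, 31, 32} \<union> {a - len<..a} \<longrightarrow> t' x = t x) \<and>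
     (\<forall>x<len. t' (a - x) = coeff (gpart R q mu B i v (Suc l)) x) \<and>
     t' 23 = int (B ^ Suc l) \<and> t' 24 = int (B ^ (mu + Suc l)) \<and> t' 19 = int (mu - Suc l)"
      by (rule term_program[OF _ i q a]) (use l I Kv[OF K] K in \<open>auto simp: w_def K_def\<close>)
    moreover have "mu - l \<le> size_bound" by (simp add: size_bound_def mu_of_def)
    then have "small (int V) (int (mu - l))" by (rule gr_V[OF gr_nat]) simp
    ultimately show "0 < t 19 \<and> small (int V) (t 19) \<and> (\<exists>t'. runs bb term_program t 18 t' \<and>
      K (Suc l) t' \<and> t' 23 = int (B ^ Suc l) \<and> t' 24 = int (B ^ (mu + Suc l)) \<and> t' 19 = int (mu - Suc l))"
      using I l K unfolding K_def by auto
  qed (use t in auto)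
  have st5: "\<exists>s'. runs bb (seqs [Mul 28 22 15, Div 29 28 16, Mul 29 29 16, Sub 22 28 29, Add 21 21 13, Sub 18 18 5]) t 6 s' \<and>
     (\<forall>x. x \<notin> {18, 19, 21, 22, 23, 24, 28, 29, 30, 31, 32} \<union> {a - len<..a} \<longrightarrow> s' x = s x) \<and>
     (\<forall>x<len. s' (a - x) = coeff (gpoly R q mu B i v) x) \<and>
     s' 18 = int (n - Suc v) \<and> s' 21 = int (a + len) \<and> s' 22 = int (wgt R q (Suc v))" if K: "K mu t" for t
  proof (rule ex_seqs)
    let ?cs = "[Mul 28 22 15, Div 29 28 16, Mul 29 29 16, Sub 22 28 29, Add 21 21 13, Sub 18 18 5]"
    define z where "z = int w * (int R + 1) div int q"
    have gz: "gr 10 z" unfolding z_def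
      by (rule gr_mono[OF gr_div[OF gr_mult[OF gg(1) gr_add[OF gr_params(5,17)]]]]) simp_all
    show "lsmall (int V) ?cs t"
      by (simp add: Kv[OF K] z_def[symmetric, simplified], intro conjI; (rule gr_V, (rule gr_rules gg gz a(2))+, simp))
    have "wgt R q (Suc v) = (w * (R + 1)) mod q" unfolding w_def wgt_def power_Suc2 mod_mult_left_eq ..
    then have "int (wgt R q (Suc v)) = (int w * (int R + 1)) mod int q"
      by (simp only: of_nat_mod of_nat_mult of_nat_add of_nat_1)
    also have "\<dots> = int w * (int R + 1) - int w * (int R + 1) div int q * int q" by (simp add: minus_div_mult_eq_mod)
    finally have w: "int (wgt R q (Suc v)) = int w * (int R + 1) - int w * (int R + 1) div int q * int q" .
    show "(\<forall>x. x \<notin> {18, 19, 21, 22, 23, 24, 28, 29, 30, 31, 32} \<union> {a - len<..a} \<longrightarrow> lrun ?cs t x = s x) \<and>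
     (\<forall>x<len. lrun ?cs t (a - x) = coeff (gpoly R q mu B i v) x) \<and>
     lrun ?cs t 18 = int (n - Suc v) \<and> lrun ?cs t 21 = int (a + len) \<and> lrun ?cs t 22 = int (wgt R q (Suc v))"
      unfolding w using K hp v by (simp add: Kv[OF K] of_nat_diff) (simp add: K_def gpoly_def)
  qed simp_all
  show ?thesis unfolding coordinate_program_def
    by (rule ex_Seq[OF st1, where N' = "mu * 19 + 13"], rule ex_Seq[OF st2, where N' = "mu * 19 + 10"], assumption,
        rule ex_Seq[OF st3, where N' = "mu * 19 + 7"], assumption, rule ex_Seq[OF st4, where N' = 6], assumption,
        elim conjE, rule st5, assumption, simp_all)
qed

end

text \<open>The modulus has 1, -1, 1 at the offsets 0, M and 2 M of the block; the coordinates
  follow, and cell 21 starts at offset 4 M, the last cell of the first coordinate. The first weight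
  is computed as 1 mod q, because q may be 1.\<close>

definition query_program :: prog where
  "query_program =
    Seq (seqs [Add 30 20 33, Store 30 5, Add 30 20 12, Store 30 34, Add 30 30 12, Store 30 5, Add 35 20 33, Add 36 30 5,
          Add 21 30 13, Div 28 5 16, Mul 28 28 16, Sub 22 5 28, Add 18 0 33])
   (Seq (While 18 coordinate_program)
   (Seq (Query 26 35 13 36)
   (seqs [Add 25 25 26, Add 20 20 27, Sub 17 17 5])))"

text \<open>The leading coefficient comes first.\<close>

definition coeff_list :: "nat \<Rightarrow> int poly \<Rightarrow> int list" where
  "coeff_list m p = map (\<lambda>x. coeff p (m - 1 - x)) [0..<m]"

definition modulus_poly :: "nat \<Rightarrow> int poly" where
  "modulus_poly M = monom 1 (2 * M) - monom 1 M + 1"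

lemma (in machine) runs_Query:
  assumes s: "small (int V) (s h)" "small (int V) (s l)" "small (int V) (s g)"
    and m: "query_modulus s h l = hs" "query_coords n s l g = gs"
    and h: "\<And>z. z \<in> set hs \<Longrightarrow> small (int V) z" "length hs = m + 1"
    and g: "\<And>z. z \<in> set (concat gs) \<Longrightarrow> small (int V) z" "length (concat gs) = n * m"
  shows "runs (Query i h l g) s (m + n * m + 4) (s(i := of_bool (bb hs gs)))"
proof -
  have sum: "sum_list (map bits xs) \<le> length xs * (V + 1)" if "\<And>z. z \<in> set xs \<Longrightarrow> small (int V) z" for xs
    using that
  proof (induction xs)
    case (Cons z xs)
    then have "bits z + sum_list (map bits xs) \<le> (V + 1) + length xs * (V + 1)"
      by (intro add_mono bits_le) simp_all
    then show ?case by simp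
  qed simp
  have "bits (s h) + bits (s l) + bits (s g) + sum_list (map bits hs) + sum_list (map bits (concat gs))
      \<le> (V + 1) + (V + 1) + (V + 1) + (m + 1) * (V + 1) + (n * m) * (V + 1)"
    using sum[of hs] sum[of "concat gs"] bits_le[OF s(1)] bits_le[OF s(2)] bits_le[OF s(3)] h g
    by (intro add_mono) (simp_all del: set_concat length_concat map_concat)
  also have "\<dots> \<le> (m + n * m + 4) * (2 * (V + 1))"
    by (simp add: algebra_simps)
  finally show ?thesis unfolding runs_def
    using exec.Query[of bb n i h l g s] unfolding m by blast
qed

section \<open>Correctness of one query and of the loops over exponents and moduli\<close>

context parameters
begin

abbreviation "block_size \<equiv> (n + 1) * len + 1"

definition scalars :: "nat \<Rightarrow> memory \<Rightarrow> bool" where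
  "scalars P t \<longleftrightarrow> t 0 = int n \<and> t 5 = 1 \<and> t 33 = 0 \<and> t 34 = -1 \<and> t 8 = int mu \<and> t 10 = int B \<and> t 11 = int E \<and>
    t 12 = int M \<and> t 13 = 2 * int M \<and> t 14 = int (B ^ mu) \<and> t 15 = int R + 1 \<and> t 27 = int block_size \<and> t 20 = int P \<and>
    (\<forall>x\<ge>P. t x = 0)"

definition answer :: "blackbox \<Rightarrow> nat \<Rightarrow> nat \<Rightarrow> bool" where
  "answer bb q i \<longleftrightarrow> bb (coeff_list (len + 1) (modulus_poly M)) (map (\<lambda>v. coeff_list len (gpoly R q mu B i v)) [0..<n])"

lemma query_program:
  assumes P: "P \<ge> 64" "gr 20 (int P)" and s: "scalars P s" "s 16 = int q" "s 17 = int i" "s 25 = int c" and c: "gr 5 (int c)"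
    and q: "1 \<le> q" "q \<le> Q" and i: "1 \<le> i" "i \<le> E"
  shows "\<exists>s'. runs bb query_program s (n * (mu * 19 + 17) + (len + n * len) + 21) s' \<and>
    scalars (P + block_size) s' \<and> s' 16 = int q \<and> s' 17 = int (i - 1) \<and> s' 25 = int (c + of_bool (answer bb q i))"
proof -
  let ?cs = "[Add 30 20 33, Store 30 5, Add 30 20 12, Store 30 34, Add 30 30 12, Store 30 5, Add 35 20 33, Add 36 30 5,
          Add 21 30 13, Div 28 5 16, Mul 28 28 16, Sub 22 5 28, Add 18 0 33]"
  have iM: "int M = 6 ^ e" by simp
  have sv: "s 0 = int n" "s 5 = 1" "s 33 = 0" "s 34 = -1" "s 8 = int mu" "s 10 = int B" "s 11 = int E"
    "s 12 = 6 ^ e" "s 13 = 2 * 6 ^ e" "s 14 = int (B ^ mu)" "s 15 = int R + 1" "s 27 = int block_size" "s 20 = int P"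
    "\<And>x. x \<ge> P \<Longrightarrow> s x = 0"
    using s(1) by (simp_all add: scalars_def)
  have nn: "nat (int P + 6 ^ e) = P + M" "nat (2 * 6 ^ e + int P) = P + 2 * M"
  proof -
    have "nat (int (P + M)) = P + M" "nat (int (P + 2 * M)) = P + 2 * M" by (rule nat_int)+
    then show "nat (int P + 6 ^ e) = P + M" "nat (2 * 6 ^ e + int P) = P + 2 * M" by (simp_all add: add.commute)
  qed
  have hz: "P \<noteq> z" "P + x \<noteq> z" "z \<noteq> P" "z \<noteq> P + x" if "z < 64" for x z using that P by auto
  have "q \<le> size_bound" "i \<le> size_bound" using chain q i by (simp_all add: size_bound_def)
  then have gg: "gr 1 (int q)" "gr 1 (int i)" by - (rule gr_nat, assumption)+
  have g1q: "gr 1 (1 div int q)" by (rule gr_div[OF gr_params(17)]) simp_all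
  define t1 where "t1 = lrun ?cs s"
  have st1: "runs bb (seqs ?cs) s 13 t1"
  proof -
    have "runs bb (seqs ?cs) s (length ?cs) t1" unfolding t1_def
      by (rule runs_seqs) (simp_all add: sv(1-13) s nn hz, (intro conjI; (rule gr_V, (rule gr_rules gg g1q P(2))+, simp))?)
    moreover have "length ?cs = 13" by simp
    ultimately show ?thesis by metis
  qed
  have t1r: "t1 18 = int n" "t1 21 = int (P + 2 * len)" "t1 22 = int (wgt R q 0)" "t1 35 = int P" "t1 36 = int (P + len + 1)"
  proof -
    have "1 - 1 div int q * int q = int (wgt R q 0)"
      unfolding wgt_def power_0 of_nat_mod of_nat_1 by (rule minus_div_mult_eq_mod)
    then show "t1 18 = int n" "t1 21 = int (P + 2 * len)" "t1 22 = int (wgt R q 0)" "t1 35 = int P" "t1 36 = int (P + len + 1)"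
      by (simp_all add: t1_def sv(1-13) s nn hz)
  qed
  have t1o: "t1 x = s x" if "x < 64" "x \<notin> {18, 21, 22, 28, 30, 35, 36}" for x
    using that by (simp add: t1_def sv(1-13) s nn hz)
  have t1h: "t1 (P + x) = (if x = M then -1 else if x = 0 \<or> x = len then 1 else 0)" for x
    using sv(14)[of "P + x"] P by (auto simp: t1_def sv(1-13) s nn hz)
  define W :: "nat set" where "W = {18, 19, 21, 22, 23, 24, 28, 29, 30, 31, 32}"
  have W: "x \<notin> W" if "x \<ge> 64" for x using that by (auto simp: W_def)
  \<comment> \<open>Besides the registers in \<open>W\<close>, only the window of the coordinates
    written so far has changed, so the cells of the next one are still 0.\<close>
  define I where "I v t \<longleftrightarrow>
     (\<forall>x. x \<notin> W \<union> {P + len<..P + len + v * len} \<longrightarrow> t x = t1 x) \<and>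
     (\<forall>u<v. \<forall>x<len. t (P + 2 * len + u * len - x) = coeff (gpoly R q mu B i u) x) \<and>
     t 18 = int (n - v) \<and> t 21 = int (P + 2 * len + v * len) \<and> t 22 = int (wgt R q v)" for v and t :: memory
  have Ifr: "t x = s x" if "I v t" "x < 64" "x \<notin> W" "x \<noteq> 35" "x \<noteq> 36" for v t x
  proof -
    have "x \<notin> W \<union> {P + len<..P + len + v * len}" using that P by auto
    then have "t x = t1 x" using that(1) unfolding I_def by blast
    then show ?thesis using t1o[of x] that by (simp add: W_def)
  qed
  have ga: "gr 50 (int (P + 2 * len + v * len))" if "v \<le> n" for v
  proof -
    have "gr 1 (int v)" using gr_params(1) that by (simp add: gr_def)
    then have "gr 35 (int P + 2 * (2 * 6 ^ e) + int v * (2 * 6 ^ e))"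
      using gr_add[OF gr_add[OF P(2) gr_mult[OF gr_params(18) gr_mult[OF gr_params(18) gr_params(15)]]]
        gr_mult[OF _ gr_mult[OF gr_params(18) gr_params(15)]], of 1 "int v"]
      by (rule_tac gr_mono) (assumption | simp)+
    then show ?thesis by (rule_tac gr_mono[of 35]) simp_all
  qed
  have st2: "\<exists>t. runs bb (While 18 coordinate_program) t1 (n * ((mu * 19 + 16) + 1) + 1) t \<and> I n t"
  proof (rule runs_While)
    fix v t assume v: "v < n" and I: "I v t"
    define a where "a = P + 2 * len + v * len"
    have al: "a - len = P + len + v * len" "a \<ge> len + 63" using P by (simp_all add: a_def)
    have cell: "t (a - x) = 0" if "x < len" for x
    proof -
      have "a - x > P + len + v * len" using that by (simp add: a_def)
      then have "a - x \<notin> W \<union> {P + len<..P + len + v * len}" using P W[of "a - x"] by auto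
      then have "t (a - x) = t1 (a - x)" using I unfolding I_def by blast
      moreover obtain y where y: "a - x = P + y" "y > len"
      proof
        have "P + len < a - x" using \<open>a - x > P + len + v * len\<close> by (meson le_add1 le_less_trans)
        then show "a - x = P + (a - x - P)" "a - x - P > len" by linarith+
      qed
      ultimately show ?thesis using t1h[of y] by simp
    qed
    have tv: "t 5 = 1" "t 33 = 0" "t 34 = -1" "t 8 = int mu" "t 10 = int B" "t 13 = 2 * int M" "t 14 = int (B ^ mu)" "t 15 = int R + 1"
      "t 16 = int q" "t 17 = int i"
      using Ifr[OF I] by (simp_all add: sv(1-13) s W_def)
    have tI: "t 18 = int (n - v)" "t 21 = int a" "t 22 = int (wgt R q v)" using I[unfolded I_def, THEN conjunct2, THEN conjunct2] unfolding a_def by simp_all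
    have ga': "gr 50 (int a)" unfolding a_def by (rule ga) (use v in simp)
    have "\<exists>t'. runs bb coordinate_program t (mu * 19 + 16) t' \<and>
     (\<forall>x. x \<notin> W \<union> {a - len<..a} \<longrightarrow> t' x = t x) \<and>
     (\<forall>x<len. t' (a - x) = coeff (gpoly R q mu B i v) x) \<and>
     t' 18 = int (n - Suc v) \<and> t' 21 = int (a + len) \<and> t' 22 = int (wgt R q (Suc v))"
      unfolding W_def by (rule coordinate_program[OF i(2) q al(2) ga' v tv(1-10) tI]) (rule cell)
    then obtain t' where t': "runs bb coordinate_program t (mu * 19 + 16) t'"
     "\<forall>x. x \<notin> W \<union> {a - len<..a} \<longrightarrow> t' x = t x"
     "\<forall>x<len. t' (a - x) = coeff (gpoly R q mu B i v) x"
     "t' 18 = int (n - Suc v)" "t' 21 = int (a + len)" "t' 22 = int (wgt R q (Suc v))"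
      by (elim exE conjE) (rule that; assumption)
    have "I (Suc v) t'" unfolding I_def
    proof (intro conjI allI impI)
      fix x assume x: "x \<notin> W \<union> {P + len<..P + len + Suc v * len}"
      have "{a - len<..a} \<subseteq> {P + len<..P + len + Suc v * len}" "{P + len<..P + len + v * len} \<subseteq> {P + len<..P + len + Suc v * len}"
        by (auto simp: al(1)) (simp_all add: a_def)
      then have "x \<notin> W \<union> {a - len<..a}" "x \<notin> W \<union> {P + len<..P + len + v * len}" using x by blast+
      then have "t' x = t x" "t x = t1 x" using t'(2) I unfolding I_def by blast+
      then show "t' x = t1 x" by simp
    next
      fix u x assume ux: "u < Suc v" "x < len"
      show "t' (P + 2 * len + u * len - x) = coeff (gpoly R q mu B i u) x"
      proof (cases "u = v")
        case True
        then show ?thesis using t'(3) ux(2) by (simp add: a_def)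
      next
        case False
        then have "u < v" using ux by simp
        then have "Suc u * len \<le> v * len" by (intro mult_le_mono1) simp
        then have "P + 2 * len + u * len - x \<le> a - len" "P + 2 * len + u * len - x \<ge> 64" using P ux by (simp_all add: al(1))
        then have "t' (P + 2 * len + u * len - x) = t (P + 2 * len + u * len - x)" using W[of "P + 2 * len + u * len - x"] by (intro t'(2)[rule_format]) auto
        moreover have "t (P + 2 * len + u * len - x) = coeff (gpoly R q mu B i u) x" using I ux \<open>u < v\<close> unfolding I_def by blast
        ultimately show ?thesis by simp
      qed
    qed (use t' in \<open>simp_all add: a_def\<close>)
    moreover have "small (int V) (t 18)" "0 < t 18"
    proof -
      have "n - v \<le> size_bound" by (simp add: size_bound_def)
      then show "small (int V) (t 18)" using I gr_V[OF gr_nat] unfolding I_def by simp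
      show "0 < t 18" using I v unfolding I_def by simp
    qed
    ultimately show "0 < t 18 \<and> small (int V) (t 18) \<and> (\<exists>t'. runs bb coordinate_program t (mu * 19 + 16) t' \<and> I (Suc v) t')"
      using t'(1) by blast
  next
    show "I 0 t1" unfolding I_def using t1r by simp
  qed (simp add: I_def)
  then obtain t2 where t2: "runs bb (While 18 coordinate_program) t1 (n * ((mu * 19 + 16) + 1) + 1) t2" "I n t2" by blast
  have t2v: "t2 13 = int len" "t2 35 = int P" "t2 36 = int (P + len + 1)" "t2 27 = int block_size" "t2 20 = int P"
    "t2 5 = 1" "t2 25 = int c" "t2 17 = int i"
  proof -
    have "35 \<notin> W \<union> {P + len<..P + len + n * len}" "36 \<notin> W \<union> {P + len<..P + len + n * len}" using P by (auto simp: W_def)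
    then have "t2 35 = t1 35" "t2 36 = t1 36" using t2(2) unfolding I_def by blast+
    then show "t2 35 = int P" "t2 36 = int (P + len + 1)" using t1r by simp_all
  qed (use Ifr[OF t2(2)] in \<open>simp_all add: sv(1-13) s W_def\<close>)
  have hs: "query_modulus t2 35 13 = coeff_list (len + 1) (modulus_poly M)"
  proof -
    have "t2 (P + x) = coeff (modulus_poly M) (len - x)" if "x \<le> len" for x
    proof -
      have "P + x \<notin> W \<union> {P + len<..P + len + n * len}" using that P W[of "P + x"] by auto
      then have "t2 (P + x) = t1 (P + x)" using t2(2) unfolding I_def by blast
      also have "\<dots> = coeff (modulus_poly M) (len - x)"
      proof -
        have M1: "M \<ge> 1" by simp
        have "len - x = len \<longleftrightarrow> x = 0" "len - x = M \<longleftrightarrow> x = M" "len - x = 0 \<longleftrightarrow> x = len" using that M1 by linarith+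
        then show ?thesis unfolding t1h modulus_poly_def using M1 by (auto simp: coeff_monom coeff_1)
      qed
      finally show ?thesis .
    qed
    then show ?thesis
      unfolding query_modulus_def block_def coeff_list_def t2v nat_int by (intro map_cong) auto
  qed
  have gs: "query_coords n t2 13 36 = map (\<lambda>v. coeff_list len (gpoly R q mu B i v)) [0..<n]"
  proof -
    have "t2 (P + len + 1 + v * len + x) = coeff (gpoly R q mu B i v) (len - 1 - x)" if "x < len" "v < n" for x v
    proof -
      have "P + len + 1 + v * len + x = P + 2 * len + v * len - (len - 1 - x)" using that by simp
      moreover have "t2 (P + 2 * len + v * len - (len - 1 - x)) = coeff (gpoly R q mu B i v) (len - 1 - x)"
      proof -
        have "len - 1 - x < len" using that by simp
        then show ?thesis using t2(2) that unfolding I_def by blast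
      qed
      ultimately show ?thesis by simp
    qed
    moreover have "nat (t2 13) = len" "nat (t2 36) = P + len + 1" unfolding t2v by (rule nat_int)+
    ultimately show ?thesis
      unfolding query_coords_def block_def coeff_list_def by (intro map_cong) auto
  qed
  have st3: "runs bb (Query 26 35 13 36) t2 (len + n * len + 4) (t2(26 := of_bool (answer bb q i)))"
    unfolding answer_def
  proof (rule runs_Query[OF _ _ _ hs gs])
    have "gr 50 (int (P + 2 * len + 0 * len))" by (rule ga) simp
    then have g: "small (int V) (int (P + 2 * len))" by (simp add: gr_V)
    then have "P + 2 * len \<le> V" unfolding small_def by (simp only: abs_of_nat of_nat_le_iff)
    then have "P \<le> V" "P + len + 1 \<le> V" "len \<le> V" using len_gt(2) by linarith+
    then show "small (int V) (t2 35)" "small (int V) (t2 13)" "small (int V) (t2 36)"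
      unfolding t2v small_def by (simp_all only: abs_of_nat of_nat_le_iff)
    have one: "small (int V) z" if "\<bar>z\<bar> \<le> 1" for z using V1 that by (auto simp: small_def)
    show "small (int V) z" if "z \<in> set (coeff_list (len + 1) (modulus_poly M))" for z
      by (rule one) (use that in \<open>auto simp: coeff_list_def modulus_poly_def coeff_monom coeff_1 split: if_splits\<close>)
    show "length (coeff_list (len + 1) (modulus_poly M)) = len + 1" by (simp add: coeff_list_def)
    have g3: "gr 4 (1 + 2 * int mu)"
      using gr_add[OF gr_params(17) gr_mult[OF gr_params(18) gr_params(8)]] by (simp add: numeral_eq_Suc)
    show "small (int V) z" if "z \<in> set (concat (map (\<lambda>v. coeff_list len (gpoly R q mu B i v)) [0..<n]))" for z
    proof -
      note z = that
      obtain v x where "z = coeff (gpoly R q mu B i v) x" using z by (auto simp: coeff_list_def)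
      then have "\<bar>z\<bar> \<le> 1 + 2 * int mu" unfolding gpoly_def by (simp only: coeff_gpart_bound)
      then show ?thesis using gr_V[OF g3] by (simp add: small_def)
    qed
    show "length (concat (map (\<lambda>v. coeff_list len (gpoly R q mu B i v)) [0..<n])) = n * len"
      by (simp add: coeff_list_def length_concat o_def sum_list_triv)
  qed
  define t3 where "t3 = t2(26 := of_bool (answer bb q i))"
  define bs where "bs = block_size"
  have t3v: "t3 5 = 1" "t3 25 = int c" "t3 26 = of_bool (answer bb q i)" "t3 27 = int bs" "t3 20 = int P" "t3 17 = int i"
    unfolding t3_def bs_def by (simp_all only: t2v fun_upd_apply) simp_all
  have "\<exists>t. runs bb (seqs [Add 25 25 26, Add 20 20 27, Sub 17 17 5]) t3 3 t \<and> t = lrun [Add 25 25 26, Add 20 20 27, Sub 17 17 5] t3"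
  proof (rule ex_seqs)
    have b: "gr 1 (of_bool (answer bb q i))" by (cases "answer bb q i") (simp_all add: gr_params[simplified])
    have "gr 15 ((int n + 1) * (2 * 6 ^ e) + 1)"
      by (rule gr_mono, (rule gr_rules)+, simp)
    then have bs: "gr 15 (int bs)" by (simp add: bs_def algebra_simps)
    show "lsmall (int V) [Add 25 25 26, Add 20 20 27, Sub 17 17 5] t3"
      by (simp add: t3v, intro conjI impI; (rule gr_V, (rule gr_rules gg c b bs P(2))+, simp))
  qed simp_all
  then obtain t4 where t4: "runs bb (seqs [Add 25 25 26, Add 20 20 27, Sub 17 17 5]) t3 3 t4"
    "t4 = lrun [Add 25 25 26, Add 20 20 27, Sub 17 17 5] t3" by blast
  have "runs bb query_program s (13 + (n * ((mu * 19 + 16) + 1) + 1 + (len + n * len + 4 + 3))) t4"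
    unfolding query_program_def by (rule runs_Seq[OF st1 runs_Seq[OF t2(1) runs_Seq[OF st3[folded t3_def] t4(1)]]])
  then have r: "runs bb query_program s (n * (mu * 19 + 17) + (len + n * len) + 21) t4" by (rule runs_mono) simp
  have t4o: "t4 x = t2 x" if "x \<notin> {17, 20, 25, 26}" for x using that by (simp add: t4(2) t3_def)
  have t4v: "t4 17 = int (i - 1)" "t4 20 = int (P + block_size)" "t4 25 = int (c + of_bool (answer bb q i))"
    using i unfolding bs_def[symmetric] by (simp_all add: t4(2) t3v of_nat_diff)
  have "t4 x = 0" if "x \<ge> P + block_size" for x
  proof -
    have bs: "block_size = len + n * len + 1" by simp
    have "x \<notin> W \<union> {P + len<..P + len + n * len}" using that P W[of x] unfolding bs by auto
    then have "t2 x = t1 x" using t2(2) unfolding I_def by blast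
    also have "\<dots> = 0" using t1h[of "x - P"] that unfolding bs by auto
    finally show ?thesis using t4o[of x] that P by simp
  qed
  then have "scalars (P + block_size) t4"
    unfolding scalars_def using t4v(2) t4o Ifr[OF t2(2)] by (simp add: sv(1-13) W_def)
  moreover have "t4 16 = int q" using t4o[of 16] Ifr[OF t2(2), of 16] s by (simp add: W_def)
  ultimately show ?thesis using r t4v by blast
qed

end

definition modulus_program :: prog where
  "modulus_program = Seq (seqs [Add 17 11 33]) (Seq (While 17 query_program) (seqs [Sub 16 16 5]))"

definition pit_program :: prog where
  "pit_program = Seq pre_program (Seq (While 16 modulus_program) (seqs [Add 0 25 33]))"

context parameters
begin

definition query_time :: nat where "query_time = n * (mu * 19 + 17) + (len + n * len) + 21"

text \<open>After \<open>m\<close> queries; \<open>Z\<close> says that all values so far were zero.\<close>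

definition progress :: "nat \<Rightarrow> nat \<Rightarrow> bool \<Rightarrow> memory \<Rightarrow> bool" where
  "progress m q Z t \<longleftrightarrow> scalars (64 + m * block_size) t \<and> t 16 = int q \<and>
     (\<exists>c. t 25 = int c \<and> c \<le> m \<and> (c = 0 \<longleftrightarrow> Z))"

lemma scalars_upd:
  assumes s: "scalars P t" and z: "z \<in> {16, 17}" and P: "P \<ge> 64"
  shows "scalars P (t(z := x))"
proof -
  have u: "(t(z := x)) y = t y" if "y \<notin> {16, 17}" for y using z that by auto
  have "(t(z := x)) y = t y" if "y \<ge> P" for y using P that by (intro u) auto
  then show ?thesis using s unfolding scalars_def by (simp add: u del: fun_upd_apply)
qed

lemma query_step:
  assumes s: "progress m q Z s" "s 17 = int i" and m: "m \<le> Q * E" and q: "1 \<le> q" "q \<le> Q" and i: "1 \<le> i" "i \<le> E"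
  shows "\<exists>s'. runs bb query_program s query_time s' \<and> progress (Suc m) q (Z \<and> \<not> answer bb q i) s' \<and> s' 17 = int (i - 1)"
proof -
  obtain c where c: "s 25 = int c" "c \<le> m" "c = 0 \<longleftrightarrow> Z" using s unfolding progress_def by blast
  have "m \<le> size_bound * size_bound"
    by (rule order_trans[OF m mult_le_mono]) (use chain in \<open>auto simp: size_bound_def\<close>)
  then have "int m \<le> int (size_bound * size_bound)" by linarith
  then have gm: "gr 2 (int m)" by (simp add: gr_def power2_eq_square)
  have "int c \<le> int m" using c by simp
  then have gc: "gr 5 (int c)" using gr_mono[OF gm, of 5] by (simp add: gr_def)
  have gn: "gr 3 (int n + 1)" using gr_add[OF gr_params(1) gr_params(17)] by (simp add: numeral_eq_Suc)
  have "gr 10 ((int n + 1) * (2 * 6 ^ e) + 1)"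
    by (rule gr_mono, rule gr_add[OF gr_mult[OF gn gr_mult[OF gr_params(18) gr_params(15)]] gr_params(17)], simp)
  then have bs: "gr 10 (int block_size)" by (simp add: algebra_simps)
  have "gr 20 (64 + int m * int block_size)"
    by (rule gr_mono[OF gr_add[OF gr_params(20) gr_mult[OF gm bs]]]) simp
  then have P: "gr 20 (int (64 + m * block_size))" by (simp only: of_nat_add of_nat_mult of_nat_numeral)
  have P64: "64 + m * block_size \<ge> 64" by simp
  have sc: "scalars (64 + m * block_size) s" "s 16 = int q" using s unfolding progress_def by blast+
  obtain s' where s': "runs bb query_program s query_time s'" "scalars (64 + m * block_size + block_size) s'" "s' 16 = int q"
      "s' 17 = int (i - 1)" "s' 25 = int (c + of_bool (answer bb q i))"
    using query_program[OF P64 P sc s(2) c(1) gc q i, of bb, folded query_time_def] by (elim exE conjE) (rule that; assumption)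
  have "64 + m * block_size + block_size = 64 + Suc m * block_size" by simp
  then have "scalars (64 + Suc m * block_size) s'" using s'(2) by (simp only:)
  moreover have "\<exists>c'. s' 25 = int c' \<and> c' \<le> Suc m \<and> (c' = 0 \<longleftrightarrow> Z \<and> \<not> answer bb q i)"
    by (rule exI[of _ "c + of_bool (answer bb q i)"]) (use s'(5) c in auto)
  ultimately show ?thesis using s' unfolding progress_def by blast
qed

lemma modulus_program:
  assumes s: "progress ((Q - q) * E) q Z s" and q: "1 \<le> q" "q \<le> Q"
  shows "\<exists>s'. runs bb modulus_program s (E * (query_time + 1) + 3) s' \<and>
    progress ((Q - (q - 1)) * E) (q - 1) (Z \<and> (\<forall>i\<in>{1..E}. \<not> answer bb q i)) s'"
proof -
  have sc: "scalars (64 + (Q - q) * E * block_size) s" using s unfolding progress_def by blast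
  have st1: "\<exists>t. runs bb (seqs [Add 17 11 33]) s 1 t \<and> (progress ((Q - q) * E) q Z t \<and> t 17 = int E)"
  proof (rule ex_seqs)
    have v: "s 11 = int E" "s 33 = 0" using sc by (simp_all add: scalars_def)
    show "lsmall (int V) [Add 17 11 33] s" by (simp add: v, intro conjI; (rule gr_V, (rule gr_rules)+, simp))
    have "lrun [Add 17 11 33] s = s(17 := int E)" by (simp add: v)
    moreover have "scalars (64 + (Q - q) * E * block_size) (s(17 := int E))" by (rule scalars_upd[OF sc]) simp_all
    ultimately show "progress ((Q - q) * E) q Z (lrun [Add 17 11 33] s) \<and> lrun [Add 17 11 33] s 17 = int E"
      using s unfolding progress_def by (simp del: lrun.simps)
  qed simp_all
  have st2: "\<exists>t'. runs bb (While 17 query_program) t (E * (query_time + 1) + 1) t' \<and>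
      (progress ((Q - q) * E + E) q (Z \<and> (\<forall>i\<in>{E - E<..E}. \<not> answer bb q i)) t' \<and> t' 17 = int (E - E))"
    if t: "progress ((Q - q) * E) q Z t \<and> t 17 = int E" for t
  proof (rule runs_While[where I = "\<lambda>j t. progress ((Q - q) * E + j) q (Z \<and> (\<forall>i\<in>{E - j<..E}. \<not> answer bb q i)) t \<and> t 17 = int (E - j)"])
    fix j t assume j: "j < E"
      and I: "progress ((Q - q) * E + j) q (Z \<and> (\<forall>i\<in>{E - j<..E}. \<not> answer bb q i)) t \<and> t 17 = int (E - j)"
    have m: "(Q - q) * E + j \<le> Q * E"
    proof -
      have "(Q - q) * E + E = (Q - q + 1) * E" by simp
      also have "\<dots> \<le> Q * E" by (rule mult_le_mono1) (use q in linarith)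
      finally show ?thesis using j by linarith
    qed
    have ij: "1 \<le> E - j" "E - j \<le> E" using j by simp_all
    have set: "{E - Suc j<..E} = insert (E - j) {E - j<..E}" using j by auto
    have run: "\<exists>s'. runs bb query_program t query_time s' \<and>
      progress (Suc ((Q - q) * E + j)) q ((Z \<and> (\<forall>i\<in>{E - j<..E}. \<not> answer bb q i)) \<and> \<not> answer bb q (E - j)) s' \<and> s' 17 = int (E - j - 1)"
      by (rule query_step[OF _ _ m q ij]) (use I in blast)+
    have Z: "((Z \<and> (\<forall>i\<in>{E - j<..E}. \<not> answer bb q i)) \<and> \<not> answer bb q (E - j)) = (Z \<and> (\<forall>i\<in>{E - Suc j<..E}. \<not> answer bb q i))"
      unfolding set by blast
    have "E - j \<le> size_bound" by (simp add: size_bound_def)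
    then have sm: "small (int V) (int (E - j))" by (rule gr_V[OF gr_nat]) simp
    have idx: "E - j - 1 = E - Suc j" "Suc ((Q - q) * E + j) = (Q - q) * E + Suc j" by simp_all
    have t17: "t 17 = int (E - j)" using I by blast
    show "0 < t 17 \<and> small (int V) (t 17) \<and> (\<exists>s'. runs bb query_program t query_time s' \<and>
        progress ((Q - q) * E + Suc j) q (Z \<and> (\<forall>i\<in>{E - Suc j<..E}. \<not> answer bb q i)) s' \<and> s' 17 = int (E - Suc j))"
      using run[unfolded Z idx] sm ij(1) unfolding t17 by simp
  qed (use t in auto)
  have st3: "\<exists>s'. runs bb (seqs [Sub 16 16 5]) t 1 s' \<and>
      progress ((Q - (q - 1)) * E) (q - 1) (Z \<and> (\<forall>i\<in>{1..E}. \<not> answer bb q i)) s'"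
    if t: "progress ((Q - q) * E + E) q (Z \<and> (\<forall>i\<in>{E - E<..E}. \<not> answer bb q i)) t \<and> t 17 = int (E - E)" for t
  proof (rule ex_seqs)
    have mq: "(Q - q) * E + E = (Q - (q - 1)) * E" 
    proof -
      have "Q - (q - 1) = Suc (Q - q)" using q by simp
      then show ?thesis by simp
    qed
    have rng: "{E - E<..E} = {1..E}" by auto
    have sct: "scalars (64 + (Q - (q - 1)) * E * block_size) t" using t unfolding progress_def mq by blast
    have v: "t 5 = 1" "t 16 = int q" using t by (simp_all add: scalars_def progress_def)
    have "q \<le> size_bound" using q chain by (simp add: size_bound_def)
    then have gq: "gr 1 (int q)" by (rule gr_nat)
    show "lsmall (int V) [Sub 16 16 5] t" by (simp add: v, intro conjI; (rule gr_V, (rule gr_rules gq)+, simp))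
    have "lrun [Sub 16 16 5] t = t(16 := int (q - 1))" using q by (simp add: v of_nat_diff)
    moreover have "scalars (64 + (Q - (q - 1)) * E * block_size) (t(16 := int (q - 1)))" by (rule scalars_upd[OF sct]) simp_all
    ultimately show "progress ((Q - (q - 1)) * E) (q - 1) (Z \<and> (\<forall>i\<in>{1..E}. \<not> answer bb q i)) (lrun [Sub 16 16 5] t)"
      using t unfolding progress_def mq rng by (simp del: lrun.simps)
  qed simp_all
  show ?thesis unfolding modulus_program_def
    by (rule ex_Seq[OF st1, where N' = "E * (query_time + 1) + 2"], rule ex_Seq[OF st2, where N' = 1], assumption, rule st3, assumption) simp_all
qed

lemma query_time_le: "query_time \<le> size_bound ^ 6"
proof -
  define U where "U = size_bound"
  have u: "mu \<le> U" "n \<le> U" "64 \<le> U" "1 \<le> U" by (simp_all add: U_def size_bound_def mu_of_def)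
  have "int M \<le> int U ^ 4" using gr_params(15) by (simp add: gr_def U_def)
  then have M: "M \<le> U ^ 4" by (simp only: of_nat_power[symmetric] of_nat_le_iff)
  have "n * (mu * 19 + 17) \<le> U * (U * 19 + 17 * U)" using u by (intro mult_le_mono add_mono) auto
  also have "\<dots> = 36 * U ^ 2" by (simp add: power2_eq_square algebra_simps)
  also have "\<dots> \<le> 36 * U ^ 5" using u by (intro mult_le_mono2 power_increasing) auto
  finally have 1: "n * (mu * 19 + 17) \<le> 36 * U ^ 5" .
  have "len \<le> 2 * U ^ 5" using M power_increasing[of 4 5 U] u by linarith
  moreover have "n * len \<le> U * (2 * U ^ 4)" using u M by (intro mult_le_mono) auto
  then have "n * len \<le> 2 * U ^ 5" by (simp add: power_eq_if)
  moreover have "21 \<le> 21 * U ^ 5" using u by simp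
  ultimately have "query_time \<le> 61 * U ^ 5" using 1 unfolding query_time_def by linarith
  also have "\<dots> \<le> U * U ^ 5" using u by (intro mult_le_mono1) simp
  finally show ?thesis by (simp add: U_def[symmetric] power_eq_if)
qed

text \<open>With U = \<open>size_bound\<close>, the Q E queries of at most U^6 units each and the
  preparation take at most U^10 units, and a unit 2 (V + 1) is at most U^61 as V = U^60.\<close>

lemma pit_program:
  assumes s: "s 0 = int n" "s 1 = int d" "s 2 = int k" "s 3 = int r" "\<And>x. x \<ge> 5 \<Longrightarrow> s x = 0"
  shows "\<exists>t s'. exec bb n pit_program s t s' \<and> t \<le> size_bound ^ 72 \<and>
    (s' 0 = 0 \<longleftrightarrow> (\<forall>q\<in>{1..Q}. \<forall>i\<in>{1..E}. \<not> answer bb q i))"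
proof -
  have st1: "\<exists>t. runs bb pre_program s (60 * size_bound) t \<and> progress 0 Q True t"
  proof (rule exE[OF pre_program[of s bb, OF s(1-4)]], rule s(5), assumption, elim conjE)
    fix t assume r: "runs bb pre_program s (60 * size_bound) t"
      and v: "t 0 = int n" "t 5 = 1" "t 33 = 0" "t 8 = int mu" "t 9 = int Q" "t 10 = int B" "t 11 = int E"
        "t 12 = int M" "t 13 = 2 * int M" "t 14 = int (B ^ mu)" "t 15 = int R + 1" "t 16 = int Q" "t 20 = 64"
        "t 25 = 0" "t 27 = (int n + 1) * (2 * int M) + 1" "t 34 = -1" "\<forall>x\<ge>64. t x = 0"
    have "progress 0 Q True t" unfolding progress_def scalars_def using v by (auto simp: algebra_simps)
    then show ?thesis using r by blast
  qed
  have st2: "\<exists>t'. runs bb (While 16 modulus_program) t (Q * ((E * (query_time + 1) + 3) + 1) + 1) t' \<and>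
      progress (Q * E) (Q - Q) (\<forall>q\<in>{Q - Q<..Q}. \<forall>i\<in>{1..E}. \<not> answer bb q i) t'" if t: "progress 0 Q True t" for t
  proof (rule runs_While[where I = "\<lambda>j t. progress (j * E) (Q - j) (\<forall>q\<in>{Q - j<..Q}. \<forall>i\<in>{1..E}. \<not> answer bb q i) t"])
    fix j t assume j: "j < Q" and I: "progress (j * E) (Q - j) (\<forall>q\<in>{Q - j<..Q}. \<forall>i\<in>{1..E}. \<not> answer bb q i) t"
    have qj: "1 \<le> Q - j" "Q - j \<le> Q" "Q - (Q - j) = j" "Q - (Q - j - 1) = Suc j" "Q - j - 1 = Q - Suc j" using j by simp_all
    have set: "{Q - Suc j<..Q} = insert (Q - j) {Q - j<..Q}" using j by auto
    have "\<exists>s'. runs bb modulus_program t (E * (query_time + 1) + 3) s' \<and>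
      progress ((Q - (Q - j - 1)) * E) (Q - j - 1) ((\<forall>q\<in>{Q - j<..Q}. \<forall>i\<in>{1..E}. \<not> answer bb q i) \<and> (\<forall>i\<in>{1..E}. \<not> answer bb (Q - j) i)) s'"
      by (rule modulus_program[OF _ qj(1,2)]) (use I in \<open>simp only: qj(3)\<close>)
    moreover have "((\<forall>q\<in>{Q - j<..Q}. \<forall>i\<in>{1..E}. \<not> answer bb q i) \<and> (\<forall>i\<in>{1..E}. \<not> answer bb (Q - j) i)) =
        (\<forall>q\<in>{Q - Suc j<..Q}. \<forall>i\<in>{1..E}. \<not> answer bb q i)" unfolding set by blast
    moreover have "Q - j \<le> size_bound" using chain by (simp add: size_bound_def)
    then have "small (int V) (int (Q - j))" by (rule gr_V[OF gr_nat]) simp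
    moreover have "t 16 = int (Q - j)" using I by (simp add: progress_def)
    ultimately show "0 < t 16 \<and> small (int V) (t 16) \<and> (\<exists>s'. runs bb modulus_program t (E * (query_time + 1) + 3) s' \<and>
        progress (Suc j * E) (Q - Suc j) (\<forall>q\<in>{Q - Suc j<..Q}. \<forall>i\<in>{1..E}. \<not> answer bb q i) s')"
      using qj(1) by (simp only: qj(4,5)) simp
  qed (use t in \<open>auto simp: progress_def\<close>)
  have st3: "\<exists>s'. runs bb (seqs [Add 0 25 33]) t 1 s' \<and> (s' 0 = 0 \<longleftrightarrow> (\<forall>q\<in>{1..Q}. \<forall>i\<in>{1..E}. \<not> answer bb q i))"
    if t: "progress (Q * E) (Q - Q) (\<forall>q\<in>{Q - Q<..Q}. \<forall>i\<in>{1..E}. \<not> answer bb q i) t" for t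
  proof (rule ex_seqs)
    obtain c where c: "t 25 = int c" "c \<le> Q * E" "c = 0 \<longleftrightarrow> (\<forall>q\<in>{Q - Q<..Q}. \<forall>i\<in>{1..E}. \<not> answer bb q i)"
      using t unfolding progress_def by blast
    have v: "t 33 = 0" using t by (simp add: progress_def scalars_def)
    have "int c \<le> int (Q * E)" using c(2) by (simp only: of_nat_le_iff)
    then have gc: "gr 2 (int c)" using gr_mult[OF gr_params(9) gr_params(11)] by (simp add: gr_def numeral_eq_Suc abs_mult)
    show "lsmall (int V) [Add 0 25 33] t" by (simp add: v c(1), intro conjI; (rule gr_V, (rule gr_params gc)+, simp))
    have "{Q - Q<..Q} = {1..Q}" by auto
    then show "(lrun [Add 0 25 33] t 0 = 0) = (\<forall>q\<in>{1..Q}. \<forall>i\<in>{1..E}. \<not> answer bb q i)" using c v by simp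
  qed simp_all
  define N where "N = 60 * size_bound + (Q * ((E * (query_time + 1) + 3) + 1) + 2)"
  have "\<exists>s'. runs bb pit_program s N s' \<and> (s' 0 = 0 \<longleftrightarrow> (\<forall>q\<in>{1..Q}. \<forall>i\<in>{1..E}. \<not> answer bb q i))"
    unfolding pit_program_def N_def
    by (rule ex_Seq[OF st1, where N' = "Q * ((E * (query_time + 1) + 3) + 1) + 2"], rule ex_Seq[OF st2, where N' = 1], assumption, rule st3, assumption) simp_all
  then obtain s' t where s': "exec bb n pit_program s t s'" "t \<le> N * (2 * (V + 1))"
    "s' 0 = 0 \<longleftrightarrow> (\<forall>q\<in>{1..Q}. \<forall>i\<in>{1..E}. \<not> answer bb q i)" unfolding runs_def by blast
  have "N * (2 * (V + 1)) \<le> size_bound ^ 72"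
  proof -
    define U where "U = size_bound"
    have u: "Q \<le> U" "E \<le> U" "64 \<le> U" "1 \<le> U" using chain by (simp_all add: U_def size_bound_def)
    have p: "U ^ i \<le> U ^ j" if "i \<le> j" for i j using u that by (intro power_increasing) auto
    have "E * (query_time + 1) \<le> U * (U ^ 6 + 1)" using u query_time_le by (intro mult_le_mono add_mono) (auto simp: U_def)
    also have "\<dots> \<le> 2 * U ^ 7" using p[of 1 7] by (simp add: distrib_left power_eq_if)
    finally have "Q * ((E * (query_time + 1) + 3) + 1) \<le> U * (2 * U ^ 7 + 4)" using u by (intro mult_le_mono) auto
    also have "\<dots> \<le> 6 * U ^ 8" using p[of 1 8] by (simp add: distrib_left power_eq_if)
    finally have "N \<le> 60 * U ^ 8 + 6 * U ^ 8 + 2 * U ^ 8" unfolding N_def using p[of 1 8] p[of 0 8] by (simp add: U_def)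
    also have "\<dots> \<le> U ^ 2 * U ^ 8"
    proof -
      have "64 * 64 \<le> U * U" using u by (intro mult_le_mono)
      then have "68 * U ^ 8 \<le> U ^ 2 * U ^ 8" by (intro mult_le_mono1) (simp add: power2_eq_square)
      then show ?thesis by simp
    qed
    finally have N: "N \<le> U ^ 10" by (simp add: power_add[symmetric])
    have "V = U ^ 60" by (simp add: V_def U_def)
    then have "2 * (V + 1) \<le> 4 * U ^ 60" using p[of 0 60] by simp
    also have "\<dots> \<le> U * U ^ 60" using u by (intro mult_le_mono1) simp
    finally have "2 * (V + 1) \<le> U * U ^ 60" .
    then have "N * (2 * (V + 1)) \<le> U ^ 10 * (U * U ^ 60)" by (rule mult_le_mono[OF N])
    also have "\<dots> = U ^ 71" by (simp only: power_Suc[symmetric] power_add[symmetric]) simp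
    also have "\<dots> \<le> U ^ 72" by (rule p) simp
    finally show ?thesis by (simp add: U_def)
  qed
  then show ?thesis using s' by (meson order_trans)
qed

end

section \<open>Bounds\<close>

text \<open>One term of Vandermonde's sum.\<close>

lemma binomial_mult_le: "(a choose b) * (c choose d) \<le> (a + c) choose (b + d)"
proof -
  have "(a choose b) * (c choose (b + d - b)) \<le> (\<Sum>k\<le>b + d. (a choose k) * (c choose (b + d - k)))"
    by (rule member_le_sum) simp_all
  then show ?thesis by (simp add: vandermonde)
qed

lemma binomial_power_le: "(a choose b) ^ k \<le> (k * a) choose (k * b)"
proof (induction k)
  case (Suc k)
  have "(a choose b) * (a choose b) ^ k \<le> (a choose b) * ((k * a) choose (k * b))" using Suc by simp
  also have "\<dots> \<le> (a + k * a) choose (b + k * b)" by (rule binomial_mult_le)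
  finally show ?case by simp
qed simp

lemma le_binomial: "1 \<le> j \<Longrightarrow> j < N \<Longrightarrow> N \<le> N choose j"
proof (induction N arbitrary: j)
  case (Suc N)
  obtain i where i: "j = Suc i" using Suc.prems(1) by (cases j) auto
  show ?case
  proof (cases "j = N")
    case True
    then show ?thesis using i by simp
  next
    case False
    then have "N \<le> N choose j" using Suc by simp
    moreover have "1 \<le> N choose i" using Suc.prems i by (simp add: Suc_le_eq)
    ultimately show ?thesis using i by simp
  qed
qed simp

context parameters
begin

text \<open>Let T be the bound. S^k is at most its first binomial coefficient, and d^mu is at most
  mu^mu times the second, where mu^mu <= S^mu because mu <= n <= S. So B <= 4 d S^4 gives B^mu <=
  T^8 and B <= 4 T^5, hence E <= 4 T^21. The four inputs and the 64 raise the factor to 72.\<close>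

lemma size_bound_le: "size_bound \<le> 72 * PIT_bound n d k r ^ 21"
proof -
  define T where "T = PIT_bound n d k r"
  define C1 where "C1 = (k * (n + 1 + R)) choose (k * R)"
  define C2 where "C2 = (k - 1 + d) choose (k - 1)"
  have T: "T = d * C1 * C2" by (simp add: T_def PIT_bound_def C1_def C2_def)
  have C: "C1 \<ge> 1" "C2 \<ge> 1" by (simp_all add: C1_def C2_def Suc_le_eq distrib_left)
  have "1 * 1 \<le> d * C1" "1 * 1 \<le> d * C2" "1 * 1 \<le> C1 * C2" using pos C by (intro mult_le_mono; simp)+
  then have CT: "d \<le> T" "C1 \<le> T" "C2 \<le> T"
    unfolding T using mult_le_mono2[of 1 "C1 * C2" d] mult_le_mono2[of 1 "d * C2" C1] mult_le_mono2[of 1 "d * C1" C2]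
    by (simp_all add: ac_simps)
  have T1: "T \<ge> 1" using CT C by linarith
  have R: "R \<ge> 1" by (rule R1)
  have "1 \<le> k * R" "k * R < k * (n + 1 + R)" using pos R by (simp_all add: distrib_left)
  then have N: "k * (n + 1 + R) \<le> C1" unfolding C1_def by (rule le_binomial)
  have "n + 1 + R \<le> k * (n + 1 + R)" "k \<le> k * (n + 1 + R)" using pos by (cases k; simp)+
  then have "n + 1 + R \<le> C1" "k \<le> C1" using N by (meson order_trans)+
  moreover have "r \<le> R" using pos by (simp add: self_le_power)
  ultimately have le: "n \<le> T" "k \<le> T" "r \<le> T" using CT by simp_all
  have S1: "S \<ge> 2" "n + 1 \<le> S"
    using S_ge(1) R le_binomial[of R "n + R"] pos unfolding ssz_def by linarith+
  have "S ^ k \<le> (k * (n + R)) choose (k * R)" unfolding ssz_def by (rule binomial_power_le)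
  also have "\<dots> \<le> C1" unfolding C1_def by (intro binomial_mono_left mult_le_mono2) simp
  finally have Sk: "S ^ k \<le> T" using CT by linarith
  have mk: "mu \<le> k" "mu \<le> n" by (auto simp: mu_of_def)
  have p: "x ^ mu \<le> T" if "x \<le> S" for x
  proof -
    have "x ^ mu \<le> S ^ mu" using that by (rule power_mono) simp
    also have "\<dots> \<le> S ^ k" using mk S1 by (intro power_increasing) auto
    finally show ?thesis using Sk by linarith
  qed
  have dm: "d ^ mu \<le> T * T"
  proof -
    have "d ^ m \<le> m ^ m * ((m + d) choose m)" for m
    proof (cases "m = 0")
      case False
      have "real d / real m \<le> real (m + d) / real m" by (simp add: divide_right_mono)
      then have "(real d / real m) ^ m \<le> (real (m + d) / real m) ^ m" by (intro power_mono) simp_all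
      also have "\<dots> \<le> real ((m + d) choose m)" by (rule binomial_ge_n_over_k_pow_k) simp
      finally have "real d ^ m \<le> real ((m + d) choose m) * real m ^ m" using False by (simp add: power_divide field_simps)
      then have "real (d ^ m) \<le> real (m ^ m * ((m + d) choose m))" by (simp add: mult.commute)
      then show ?thesis by (simp only: of_nat_le_iff)
    qed simp
    then have "d ^ mu \<le> mu ^ mu * ((mu + d) choose mu)" .
    also have "(mu + d) choose mu = (mu + d) choose d" using binomial_symmetric[of mu "mu + d"] by simp
    also have "\<dots> \<le> (k - 1 + d) choose d" by (rule binomial_mono_left) (simp add: mu_of_def)
    also have "\<dots> = C2" unfolding C2_def using binomial_symmetric[of d "k - 1 + d"] by simp
    also have "mu ^ mu * C2 \<le> T * T" using mk S1 CT by (intro mult_le_mono p) auto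
    finally show ?thesis by simp
  qed
  have B: "B \<le> 2 * 2 * d * S ^ 4"
  proof -
    have "d * 1 \<le> d * S ^ 4" using S1 by (intro mult_le_mono2) simp
    then have "d + 1 \<le> 2 * (d * S ^ 4)" using pos(2) by linarith
    moreover have "B = 2 * (d * S ^ 4) + d + 1" by (simp add: kbase_def qmax_def distrib_left)
    ultimately show ?thesis by simp
  qed
  have "B ^ mu \<le> (2 * 2 * d * S ^ 4) ^ mu" using B by (rule power_mono) simp
  also have "\<dots> = 2 ^ mu * 2 ^ mu * d ^ mu * (S ^ mu) ^ 4" by (simp only: power_mult_distrib power_mult[symmetric] mult.commute)
  also have "\<dots> \<le> T * T * (T * T) * T ^ 4" using S1 by (intro mult_le_mono p dm power_mono) auto
  finally have Bm: "B ^ mu \<le> T ^ 8" by (simp add: power_eq_if)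
  have "S \<le> T" using Sk self_le_power[of S k] S1 pos by linarith
  then have "2 * 2 * d * S ^ 4 \<le> 2 * 2 * T * T ^ 4" using CT by (intro mult_le_mono power_mono) auto
  then have B4: "B \<le> 4 * T ^ 5" using B by (simp add: power_eq_if)
  have "E = B ^ mu * B ^ mu * B" by (simp add: emax_def mult_2 power_add)
  also have "\<dots> \<le> T ^ 8 * T ^ 8 * (4 * T ^ 5)" using Bm B4 by (intro mult_le_mono)
  also have "\<dots> = 4 * T ^ 21" by (simp add: power_add[symmetric])
  finally have E: "E \<le> 4 * T ^ 21" .
  have "T ^ 1 \<le> T ^ 21" "1 \<le> T ^ 21" using T1 power_increasing[of 1 21 T] one_le_power[OF T1] by simp_all
  then have "size_bound \<le> 72 * T ^ 21" using E le CT unfolding size_bound_def by simp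
  then show ?thesis by (simp add: T_def)
qed

end

text \<open>The constant may depend on \<open>k\<close>. With Y the base of the claimed power, d
  contributes Y, the first binomial coefficient (3 k)^k Y^(k + 4) and the second k^k Y, in total k^k
  (3 k)^k Y^(k + 6).\<close>

lemma PIT_bound_polynomial:
  assumes "k \<ge> 1"
  shows "\<exists>c. \<forall>n\<ge>1. \<forall>d\<ge>1. \<forall>r\<ge>1. PIT_bound n d k r \<le> c * (d ^ k * n ^ (r ^ k) * r ^ (k\<^sup>2 * r ^ k)) ^ c"
proof (rule exI[of _ "k ^ k * (3 * k) ^ k + k + 6"], intro allI impI)
  fix n d r :: nat assume pos: "n \<ge> 1" "d \<ge> 1" "r \<ge> 1"
  define R where "R = r ^ k"
  define Y where "Y = d ^ k * n ^ R * r ^ (k\<^sup>2 * R)"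
  have R1: "R \<ge> 1" using pos by (simp add: R_def)
  have one: "d ^ k \<ge> 1" "n ^ R \<ge> 1" "r ^ (k\<^sup>2 * R) \<ge> 1" using pos by simp_all
  have "1 * 1 \<le> d ^ k * n ^ R" "1 * 1 \<le> d ^ k * r ^ (k\<^sup>2 * R)" "1 * 1 \<le> n ^ R * r ^ (k\<^sup>2 * R)"
    using one by (intro mult_le_mono; simp)+
  then have Y: "d ^ k \<le> Y" "n ^ R \<le> Y" "r ^ (k\<^sup>2 * R) \<le> Y"
    unfolding Y_def
    using mult_le_mono2[of 1 "n ^ R * r ^ (k\<^sup>2 * R)" "d ^ k"] mult_le_mono2[of 1 "d ^ k * r ^ (k\<^sup>2 * R)" "n ^ R"]
      mult_le_mono2[of 1 "d ^ k * n ^ R" "r ^ (k\<^sup>2 * R)"] by (simp_all add: ac_simps)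
  have Y1: "Y \<ge> 1" using Y one by linarith
  have choose: "a choose b \<le> a ^ b" if "b \<le> a" for a b using that by (rule binomial_le_pow)
  have C2: "(k - 1 + d) choose (k - 1) \<le> k ^ k * Y"
  proof -
    have "(k - 1 + d) choose (k - 1) \<le> (k - 1 + d) ^ (k - 1)" by (rule choose) simp
    also have "\<dots> \<le> (k - 1 + d) ^ k" using pos by (intro power_increasing) auto
    also have "\<dots> \<le> (k * d) ^ k"
    proof (rule power_mono)
      obtain a b where "k = Suc a" "d = Suc b" using assms pos by (metis Suc_le_D One_nat_def)
      then show "k - 1 + d \<le> k * d" by simp
    qed simp
    also have "\<dots> \<le> k ^ k * Y" unfolding power_mult_distrib using Y by simp
    finally show ?thesis .
  qed
  have d: "d \<le> Y" using Y self_le_power[of d k] assms pos by linarith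
  \<comment> \<open>For r = 1 the power is the constant (3 k)^k. For r >= 2 the base 3 k is at most
    2^(3 k), and 2^(3 k^2 R) is absorbed by the cube of r^(k^2 R).\<close>
  have k3: "(3 * k) ^ (k * R) \<le> (3 * k) ^ k * Y ^ 3"
  proof (cases "r = 1")
    case True
    have "(3 * k) ^ k * 1 \<le> (3 * k) ^ k * Y ^ 3" using Y1 by (intro mult_le_mono2) simp
    then show ?thesis using True by (simp add: R_def)
  next
    case False
    have "3 * k \<le> 2 ^ (3 * k)"
    proof -
      have "2 * k + k \<le> 2 ^ k * 4" using less_exp[of k] by linarith
      also have "2 ^ k * 4 \<le> (2 ^ k * 2 ^ (2 * k) :: nat)" using assms power_increasing[of 2 "2 * k" "2 :: nat"] by simp
      finally show ?thesis by (simp add: power_add[symmetric])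
    qed
    then have "(3 * k) ^ (k * R) \<le> (2 ^ (3 * k)) ^ (k * R)" by (rule power_mono) simp
    also have "\<dots> = (2 ^ (k\<^sup>2 * R)) ^ 3" by (simp add: power_mult[symmetric] power2_eq_square ac_simps)
    also have "\<dots> \<le> (r ^ (k\<^sup>2 * R)) ^ 3" using False pos by (intro power_mono) auto
    also have "\<dots> \<le> Y ^ 3" using Y by (intro power_mono) auto
    also have "\<dots> \<le> (3 * k) ^ k * Y ^ 3" using assms by simp
    finally show ?thesis .
  qed
  have C1: "(k * (n + 1 + R)) choose (k * R) \<le> (3 * k) ^ k * Y ^ 3 * (Y ^ k * Y)"
  proof -
    have "(k * (n + 1 + R)) choose (k * R) \<le> (k * (n + 1 + R)) ^ (k * R)" by (rule choose) (simp add: distrib_left)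
    also have "\<dots> \<le> (k * (3 * n * R)) ^ (k * R)"
    proof (intro power_mono mult_le_mono2)
      obtain a b where "n = Suc a" "R = Suc b" using R1 pos by (metis Suc_le_D One_nat_def)
      then show "n + 1 + R \<le> 3 * n * R" by (simp add: distrib_right)
    qed simp
    also have "\<dots> = (3 * k) ^ (k * R) * (n ^ R) ^ k * r ^ (k\<^sup>2 * R)"
      by (simp add: power_mult_distrib R_def power_mult[symmetric] power2_eq_square ac_simps)
    also have "\<dots> \<le> (3 * k) ^ k * Y ^ 3 * Y ^ k * Y" using Y by (intro mult_le_mono k3 power_mono) auto
    finally show ?thesis by (simp add: ac_simps)
  qed
  have "PIT_bound n d k r \<le> Y * ((3 * k) ^ k * Y ^ 3 * (Y ^ k * Y)) * (k ^ k * Y)"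
    unfolding PIT_bound_def R_def[symmetric] by (intro mult_le_mono d C1 C2)
  also have "\<dots> = k ^ k * (3 * k) ^ k * Y ^ (k + 6)" by (simp add: power_add power_eq_if ac_simps)
  also have "\<dots> \<le> (k ^ k * (3 * k) ^ k + k + 6) * Y ^ (k ^ k * (3 * k) ^ k + k + 6)"
    using Y1 by (intro mult_le_mono power_increasing) auto
  finally show "PIT_bound n d k r \<le> (k ^ k * (3 * k) ^ k + k + 6) * (d ^ k * n ^ (r ^ k) * r ^ (k\<^sup>2 * r ^ k)) ^ (k ^ k * (3 * k) ^ k + k + 6)"
    by (simp add: Y_def R_def)
qed

section \<open>From ring records to type classes\<close>

lemma lookup_single_mult:
  "lookup (Poly_Mapping.single k c * q) m = (if k \<subseteq># m then c * lookup (q :: 'k::comm_ring_1 mp) (m - k) else 0)"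
proof (induction q rule: mp_induct)
  case (single l b)
  have "k + l = m \<longleftrightarrow> k \<subseteq># m \<and> l = m - k" by (auto simp: subset_mset.add_diff_inverse)
  then show ?case by (auto simp: mult_single lookup_single when_def)
qed (simp_all add: distrib_left lookup_add)

lemma finite_submultisets: "finite {a. a \<subseteq># (m :: 'b multiset)}"
proof (rule finite_subset)
  show "{a. a \<subseteq># m} \<subseteq> {a. set_mset a \<subseteq> set_mset m \<and> size a \<le> size m}"
    by (auto dest: mset_subset_eqD size_mset_mono)
  show "finite {a. set_mset a \<subseteq> set_mset m \<and> size a \<le> size m}" by (rule finite_multisets_le) simp
qed

lemma lookup_mult_sum: "lookup (p * q) m = (\<Sum>a\<in>{a. a \<subseteq># m}. lookup p a * lookup (q :: 'k::comm_ring_1 mp) (m - a))"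
proof (induction p rule: mp_induct)
  case (single k c)
  have "(\<Sum>a\<in>{a. a \<subseteq># m}. lookup (Poly_Mapping.single k c) a * lookup q (m - a)) =
      (\<Sum>a\<in>{a. a \<subseteq># m}. if a = k then c * lookup q (m - k) else 0)"
    by (rule sum.cong) (auto simp: lookup_single when_def)
  then show ?case using finite_submultisets[of m] by (simp add: lookup_single_mult)
qed (simp_all add: distrib_right lookup_add sum.distrib)

definition mdeg :: "'k::comm_ring_1 mp \<Rightarrow> nat" where
  "mdeg p = Max (insert 0 (size ` keys p))"

definition hmg :: "nat \<Rightarrow> 'k::comm_ring_1 mp \<Rightarrow> 'k mp" where
  "hmg n p = (\<Sum>m\<in>keys p. Poly_Mapping.single (m + replicate_mset (mdeg p - size m) n) (lookup p m))"

lemma size_le_mdeg: "m \<in> keys p \<Longrightarrow> size m \<le> mdeg p"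
  unfolding mdeg_def by (rule Max_ge) auto

lemma whom_hmg: "whom (\<lambda>_. 1) (mdeg p) (hmg n p)"
  unfolding hmg_def
proof (rule whom_sum)
  fix m assume "m \<in> keys p"
  then show "whom (\<lambda>_. 1) (mdeg p) (Poly_Mapping.single (m + replicate_mset (mdeg p - size m) n) (lookup p m))"
    using whom_single[of "\<lambda>_. 1" "m + replicate_mset (mdeg p - size m) n" "lookup p m"] size_le_mdeg[of m p]
    unfolding wdeg_one by simp
qed

lemma mvars_hmg: "mvars p \<subseteq> {..<n} \<Longrightarrow> mvars (hmg n p) \<subseteq> {..<n + 1}"
  unfolding hmg_def
  by (intro mvars_sum order_trans[OF mvars_single]) (auto simp: mvars_def split: if_splits)

lemma dehom_hmg: "mvars (p :: 'a::comm_ring_1 mp) \<subseteq> {..<n} \<Longrightarrow> dehom n (hmg n p) = p"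
proof -
  assume p: "mvars p \<subseteq> {..<n}"
  interpret d: comm_ring_hom "dehom n :: 'a mp \<Rightarrow> _" by (rule msub_hom)
  have "dehom n (Poly_Mapping.single (m + replicate_mset j n) c) = Poly_Mapping.single m c" if "m \<in> keys p" for m j and c :: 'a
  proof -
    have "image_mset (\<lambda>v. if v = n then 1 else mvar v) m = image_mset (mvar :: _ \<Rightarrow> 'a mp) m"
      by (rule image_mset_cong) (use p that in \<open>auto simp: mvars_def\<close>)
    then have 1: "prod_mset (image_mset (\<lambda>v. if v = n then 1 else mvar v) m) = (mmon m :: 'a mp)"
      by (simp only: mmon_prod[symmetric])
    have "prod_mset (image_mset (\<lambda>v. if v = n then 1 else mvar v) (m + replicate_mset j n)) = (mmon m :: 'a mp)"
      by (simp only: image_mset_union prod_mset.union 1) simp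
    then show ?thesis by (simp only: mev_single[OF mcst_hom] single_eq_cst_mult[of m c])
  qed
  then have "dehom n (hmg n p) = (\<Sum>m\<in>keys p. Poly_Mapping.single m (lookup p m))"
    unfolding hmg_def d.hom_sum by (rule sum.cong[OF refl])
  then show ?thesis by (simp only: mp_sum_monomials[symmetric])
qed

lemma lookup_hmg:
  assumes p: "mvars p \<subseteq> {..<n}"
  shows "lookup (hmg n p) m = (if size m = mdeg p then lookup p (filter_mset (\<lambda>i. i \<noteq> n) m) else 0)"
proof -
  have "l + replicate_mset (mdeg p - size l) n = m \<longleftrightarrow> size m = mdeg p \<and> l = filter_mset (\<lambda>i. i \<noteq> n) m" if l: "l \<in> keys p" for l
  proof
    have nl: "n \<notin># l" using p l by (auto simp: mvars_def)
    show "size m = mdeg p \<and> l = filter_mset (\<lambda>i. i \<noteq> n) m" if "l + replicate_mset (mdeg p - size l) n = m"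
      unfolding that[symmetric] using size_le_mdeg[OF l] nl by (auto simp: multiset_eq_iff not_in_iff)
    show "l + replicate_mset (mdeg p - size l) n = m" if "size m = mdeg p \<and> l = filter_mset (\<lambda>i. i \<noteq> n) m"
    proof -
      have m: "m = filter_mset (\<lambda>i. i \<noteq> n) m + filter_mset (\<lambda>i. \<not> i \<noteq> n) m" by (rule multiset_partition)
      have "filter_mset (\<lambda>i. \<not> i \<noteq> n) m = replicate_mset (count m n) n" by (simp add: filter_eq_replicate_mset)
      moreover have "count m n = mdeg p - size l"
        using arg_cong[OF m, of size, unfolded size_union calculation size_replicate_mset] that by simp
      ultimately show ?thesis using m that by simp
    qed
  qed
  then have "lookup (hmg n p) m = (\<Sum>l\<in>keys p. if l = filter_mset (\<lambda>i. i \<noteq> n) m then if size m = mdeg p then lookup p l else 0 else 0)"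
    unfolding hmg_def lookup_sum lookup_single when_def by (intro sum.cong) auto
  then show ?thesis by (simp add: in_keys_iff)
qed

text \<open>The bridge between the two worlds: a type-class field in bijection with the carrier of
  the record \<open>F\<close>. Polynomials over \<open>F\<close> are the images under
  \<open>rep\<close>, and the notions used for circuits are translated one by one.\<close>

locale represented = field F for F :: "'a ring" (structure) +
  fixes \<iota> :: "'k::field \<Rightarrow> 'a"
  assumes bij: "bij_betw \<iota> UNIV (carrier F)"
    and add: "\<iota> (x + y) = \<iota> x \<oplus> \<iota> y" and mult: "\<iota> (x * y) = \<iota> x \<otimes> \<iota> y" and one: "\<iota> 1 = \<one>"
begin

lemma in_carrier [simp]: "\<iota> x \<in> carrier F" using bij by (auto simp: bij_betw_def)

lemma eq_iff: "\<iota> x = \<iota> y \<longleftrightarrow> x = y" using bij by (auto simp: bij_betw_def inj_on_def)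

lemma exists: "a \<in> carrier F \<Longrightarrow> \<exists>x. a = \<iota> x" using bij by (auto simp: bij_betw_def)

lemma zero: "\<iota> 0 = \<zero>"
proof -
  have "\<iota> 0 \<oplus> \<iota> 0 = \<iota> 0" by (simp add: add[symmetric])
  then show ?thesis by (metis in_carrier add.l_cancel_one)
qed

lemma eq_zero: "\<iota> x = \<zero> \<longleftrightarrow> x = 0" using eq_iff[of x 0] by (simp add: zero)

lemma sum: "finite A \<Longrightarrow> (\<Oplus>i\<in>A. \<iota> (f i)) = \<iota> (\<Sum>i\<in>A. f i)"
  by (induction A rule: finite_induct) (simp_all add: zero add)

lemma prod: "finite A \<Longrightarrow> (\<Otimes>i\<in>A. \<iota> (f i)) = \<iota> (\<Prod>i\<in>A. f i)"
  by (induction A rule: finite_induct) (simp_all add: one mult)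

lemma pow: "\<iota> x [^] (n::nat) = \<iota> (x ^ n)"
  by (induction n) (simp_all add: one mult mult.commute[of x] m_comm)

lemma nat_mult_one: "[(n::nat)] \<cdot> \<one> = \<iota> (of_nat n)"
  by (induction n) (simp_all add: zero add one a_comm)

lemma int_mult_one: "[(z::int)] \<cdot> \<one> = \<iota> (of_int z)"
proof (cases z)
  case (nonneg n)
  then show ?thesis by (simp add: add_pow_int_ge nat_mult_one)
next
  case (neg n)
  have "\<iota> (of_int z) \<oplus> \<iota> (of_nat (Suc n)) = \<zero>"
    unfolding add[symmetric] zero[symmetric] eq_iff by (simp add: neg)
  then have "\<iota> (of_int z) = \<ominus> \<iota> (of_nat (Suc n))" by (simp add: add.inv_equality)
  then show ?thesis unfolding neg by (simp add: add_pow_int_lt nat_mult_one nat_add_distrib del: of_nat_Suc)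
qed

definition rep :: "'k mp \<Rightarrow> 'a mpoly" where "rep p = (\<lambda>m. \<iota> (lookup p m))"

lemma rep_eq_iff: "rep p = rep q \<longleftrightarrow> p = q"
  by (auto simp: rep_def fun_eq_iff eq_iff poly_mapping_eq_iff)

lemma rep_const: "indexed_const (\<iota> c) = rep (mcst c)"
  by (auto simp: indexed_const_def rep_def fun_eq_iff lookup_single when_def zero)

lemma rep_zero: "indexed_const \<zero> = rep 0" by (simp add: zero[symmetric] rep_const)
lemma rep_one: "indexed_const \<one> = rep 1" by (simp add: one[symmetric] rep_const single_one)

lemma rep_add: "indexed_padd (rep p) (rep q) = rep (p + q)"
  by (simp add: indexed_padd_def rep_def fun_eq_iff lookup_add add)

lemma rep_pmult: "indexed_pmult (rep p) i = rep (mvar i * p)"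
  by (auto simp: indexed_pmult_def rep_def fun_eq_iff lookup_single_mult zero)

lemma rep_var: "indexed_var i = rep (mvar i)"
  by (simp add: indexed_var_def rep_one rep_pmult)

lemma rep_mult: "mpoly_mult F (rep p) (rep q) = rep (p * q)"
  unfolding mpoly_mult_def
proof
  fix m
  show "(\<Oplus>a\<in>{a. a \<subseteq># m}. rep p a \<otimes> rep q (m - a)) = rep (p * q) m"
    unfolding rep_def mult[symmetric] lookup_mult_sum by (rule sum[OF finite_submultisets])
qed

lemma carrier_mpoly: "carrier (mpoly_ring F n) = rep ` {p. mvars p \<subseteq> {..<n}}"
proof
  have "P \<in> rep ` {p. mvars p \<subseteq> {..<n}}" if "P \<in> indexed_pset {..<n} (carrier F)" for P
    using that
  proof induction
    case (indexed_const k)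
    then obtain c where "k = \<iota> c" using exists by blast
    moreover have "mvars (mcst c) \<subseteq> {..<n}" using mvars_single[of "{#}" c] by auto
    ultimately show ?case by (auto simp: rep_const)
  next
    case (indexed_padd P Q)
    then show ?case using mvars_add by (fastforce simp: rep_add)
  next
    case (indexed_pmult P i)
    then obtain p where p: "P = rep p" "mvars p \<subseteq> {..<n}" by blast
    have "mvars (mvar i * p) \<subseteq> {..<n}"
      by (rule order_trans[OF mvars_mult Un_least[OF order_trans[OF mvars_single] p(2)]]) (use indexed_pmult in auto)
    then show ?case by (auto simp: p rep_pmult)
  qed
  then show "carrier (mpoly_ring F n) \<subseteq> rep ` {p. mvars p \<subseteq> {..<n}}" by (auto simp: mpoly_ring_def)
  have mon: "rep (Poly_Mapping.single m c) \<in> indexed_pset {..<n} (carrier F)" if "set_mset m \<subseteq> {..<n}" for m c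
    using that
  proof (induction m)
    case empty
    show ?case unfolding rep_const[symmetric] by (intro indexed_pset.indexed_const in_carrier)
  next
    case (add i m)
    have "Poly_Mapping.single (add_mset i m) c = mvar i * Poly_Mapping.single m c" by (simp add: mult_single)
    then show ?case using indexed_pset.indexed_pmult[of "rep (Poly_Mapping.single m c)" "{..<n}" "carrier F" i] add by (simp add: rep_pmult)
  qed
  have "rep (\<Sum>m\<in>A. Poly_Mapping.single m (f m)) \<in> indexed_pset {..<n} (carrier F)"
    if "finite A" "\<And>m. m \<in> A \<Longrightarrow> set_mset m \<subseteq> {..<n}" for A f
    using that
  proof (induction A rule: finite_induct)
    case empty
    show ?case using indexed_pset.indexed_const[of "\<iota> 0" "carrier F" "{..<n}"] by (simp add: rep_const)
  next
    case (insert m A)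
    then show ?case using indexed_pset.indexed_padd[OF mon[of m "f m"], of "rep (\<Sum>m\<in>A. Poly_Mapping.single m (f m))"]
      by (simp add: rep_add)
  qed
  from this[of "keys p" "lookup p" for p] show "rep ` {p. mvars p \<subseteq> {..<n}} \<subseteq> carrier (mpoly_ring F n)"
    by (auto simp: mpoly_ring_def mvars_def mp_sum_monomials[symmetric])
qed

lemma mpoly_ops:
  "rep p \<otimes>\<^bsub>mpoly_ring F n\<^esub> rep q = rep (p * q)" "rep p \<oplus>\<^bsub>mpoly_ring F n\<^esub> rep q = rep (p + q)"
  "\<one>\<^bsub>mpoly_ring F n\<^esub> = rep 1" "\<zero>\<^bsub>mpoly_ring F n\<^esub> = rep 0"
  by (simp_all add: mpoly_ring_def rep_mult rep_add rep_one rep_zero)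

lemma mvars_closed: "mvars (1 :: 'k mp) \<subseteq> {..<n}" "mvars (0 :: 'k mp) \<subseteq> {..<n}"
  using mvars_single[of "{#}" "1 :: 'k"] by (auto simp: single_one mvars_def)

lemma monoids: "comm_monoid (mpoly_ring F n)" "abelian_monoid (mpoly_ring F n)"
  by (rule comm_monoidI abelian_monoidI;
      use mvars_closed mvars_mult mvars_add in \<open>fastforce simp: carrier_mpoly mpoly_ops ac_simps\<close>)+

lemma mpoly_finprod:
  "finite A \<Longrightarrow> (\<And>i. i \<in> A \<Longrightarrow> mvars (f i) \<subseteq> {..<n}) \<Longrightarrow> (\<Otimes>\<^bsub>mpoly_ring F n\<^esub>i\<in>A. rep (f i)) = rep (\<Prod>i\<in>A. f i)"
proof (induction A rule: finite_induct)
  case (insert i A)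
  then show ?case using comm_monoid.finprod_insert[OF monoids(1), of A i "\<lambda>i. rep (f i)" n]
    by (auto simp: carrier_mpoly mpoly_ops)
qed (simp add: comm_monoid.finprod_empty[OF monoids(1)] mpoly_ops)

lemma mpoly_finsum:
  "finite A \<Longrightarrow> (\<And>i. i \<in> A \<Longrightarrow> mvars (f i) \<subseteq> {..<n}) \<Longrightarrow> (\<Oplus>\<^bsub>mpoly_ring F n\<^esub>i\<in>A. rep (f i)) = rep (\<Sum>i\<in>A. f i)"
proof (induction A rule: finite_induct)
  case (insert i A)
  then show ?case using abelian_monoid.finsum_insert[OF monoids(2), of A i "\<lambda>i. rep (f i)" n]
    by (auto simp: carrier_mpoly mpoly_ops)
qed (simp add: abelian_monoid.finsum_empty[OF monoids(2)] mpoly_ops)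

lemma support_rep: "mpoly_support F (rep p) = keys p"
  by (auto simp: mpoly_support_def rep_def eq_zero in_keys_iff)

lemma degree_rep: "mpoly_degree F (rep p) = mdeg p"
  by (simp add: mpoly_degree_def support_rep mdeg_def)

lemma homogenize_rep: "mvars p \<subseteq> {..<n} \<Longrightarrow> homogenize F n (rep p) = rep (hmg n p)"
  unfolding homogenize_def degree_rep by (auto simp: lookup_hmg rep_def zero fun_eq_iff)

lemma homogeneous_rep: "homogeneous_of_degree F e (rep p) \<longleftrightarrow> whom (\<lambda>_. 1) e p"
  unfolding homogeneous_of_degree_def support_rep whom_def wdeg_one ..

lemma eval_rep:
  assumes "\<And>i. i \<in> mvars p \<Longrightarrow> y i = \<iota> (x i)"
  shows "mpoly_eval F (rep p) y = \<iota> (meval x p)"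
proof -
  have "rep p m \<otimes> (\<Otimes>i\<in>set_mset m. y i [^] count m i) = \<iota> (lookup p m * prod_mset (image_mset x m))" if "m \<in> keys p" for m
  proof -
    have "(\<Otimes>i\<in>set_mset m. y i [^] count m i) = (\<Otimes>i\<in>set_mset m. \<iota> (x i ^ count m i))"
    proof (rule finprod_cong')
      fix i assume "i \<in> set_mset m"
      then have "y i = \<iota> (x i)" using that by (intro assms) (auto simp: mvars_def)
      then show "y i [^] count m i = \<iota> (x i ^ count m i)" by (simp only: pow)
    qed auto
    also have "\<dots> = \<iota> (prod_mset (image_mset x m))"
      by (simp add: prod image_prod_mset_multiplicity)
    finally show ?thesis by (simp add: rep_def mult)
  qed
  then have "mpoly_eval F (rep p) y = (\<Oplus>m\<in>keys p. \<iota> (lookup p m * prod_mset (image_mset x m)))"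
    unfolding mpoly_eval_def support_rep by (intro finsum_cong') auto
  then show ?thesis by (simp add: sum mev_def)
qed

lemma eval_list: "eval (map \<iota> l) (\<iota> x) = \<iota> (poly (Poly (rev l)) x)"
  by (induction l) (simp_all add: zero pow mult[symmetric] add[symmetric] Poly_snoc poly_monom add.commute)

lemma int_poly_eval_coeff_list:
  assumes "\<And>x. x \<ge> m \<Longrightarrow> Polynomial.coeff p x = 0"
  shows "int_poly_eval F (coeff_list m p) (\<iota> a) = \<iota> (ipev a p)"
proof -
  have "Poly (rev (map of_int (coeff_list m p))) = (map_poly of_int p :: 'k poly)"
    by (rule poly_eqI)
       (use assms in \<open>auto simp: nth_default_def coeff_list_def rev_nth coeff_map_poly not_less\<close>)
  moreover have "map (\<lambda>z. [z] \<cdot> \<one>) (coeff_list m p) = map \<iota> (map of_int (coeff_list m p))" by (simp add: int_mult_one)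
  ultimately show ?thesis unfolding int_poly_eval_def ipev_def by (simp only: eval_list)
qed

end

locale represented_closed = represented F \<iota> + algebraically_closed F for F :: "'a ring" (structure) and \<iota> :: "'k::field \<Rightarrow> 'a"
begin

lemma poly_root:
  assumes "Polynomial.degree (p :: 'k poly) > 0"
  shows "\<exists>x. poly p x = 0"
proof -
  define L where "L = map \<iota> (rev (coeffs p))"
  have p0: "p \<noteq> 0" using assms by auto
  have "polynomial (carrier F) L"
    using p0 by (auto simp: polynomial_def L_def hd_map hd_rev last_coeffs_eq_coeff_degree eq_zero)
  then have L: "L \<in> carrier (poly_ring F)" by (simp add: univ_poly_carrier)
  have "length L - 1 = Polynomial.degree p" by (simp add: L_def degree_eq_length_coeffs)
  then have "roots L \<noteq> {#}" using roots_over_carrier[OF L] assms unfolding splitted_def by auto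
  then obtain x where "is_root L x" using roots_mem_iff_is_root[OF L] by blast
  then have x: "x \<in> carrier F" "eval L x = \<zero>" by (auto simp: is_root_def)
  then obtain y where y: "x = \<iota> y" using exists by blast
  have "poly (Poly (rev (rev (coeffs p)))) y = 0" using x(2) unfolding y L_def eval_list eq_zero .
  then show ?thesis by auto
qed

text \<open>Over a finite field the product of all X - a, plus 1, has no root.\<close>

lemma infinite_field: "infinite (UNIV :: 'k set)"
proof
  assume fin: "finite (UNIV :: 'k set)"
  define p where "p = (\<Prod>a\<in>UNIV. [:- a, 1:] :: 'k poly)"
  have "Polynomial.degree p = card (UNIV :: 'k set)"
    unfolding p_def by (subst degree_prod_eq_sum_degree) auto
  then have "Polynomial.degree p > 0" using fin by (simp add: card_gt_0_iff)
  then have "Polynomial.degree (p + 1) > 0" by (simp add: degree_add_eq_left)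
  then obtain x where "poly (p + 1) x = 0" using poly_root by blast
  moreover have "poly p x = 0" unfolding p_def poly_prod using fin by (auto intro: prod_zero)
  ultimately show False by simp
qed

lemma circuit_rep:
  assumes "sps_circuit F n k r C"
  shows "\<exists>D. C = map (map rep) D \<and> length D \<le> k \<and> (\<forall>i<length D. \<forall>P\<in>set (D ! i). mvars P \<subseteq> {..<n} \<and> mdeg P \<le> r)"
proof -
  define q where "q P = (SOME p. P = rep p \<and> mvars p \<subseteq> {..<n} \<and> mdeg p \<le> r)" for P
  have q: "P = rep (q P) \<and> mvars (q P) \<subseteq> {..<n} \<and> mdeg (q P) \<le> r" if "Qs \<in> set C" "P \<in> set Qs" for P Qs
  proof -
    have "P \<in> carrier (mpoly_ring F n)" "mpoly_degree F P \<le> r" using assms that by (auto simp: sps_circuit_def)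
    then have "\<exists>p. P = rep p \<and> mvars p \<subseteq> {..<n} \<and> mdeg p \<le> r" by (auto simp: carrier_mpoly degree_rep)
    then show ?thesis unfolding q_def by (rule someI_ex)
  qed
  have "C = map (map rep) (map (map q) C)"
    by (simp add: map_idI[symmetric] o_def) (rule map_idI[symmetric], rule map_idI, use q in metis)
  moreover have "length (map (map q) C) \<le> k" using assms by (simp add: sps_circuit_def)
  ultimately show ?thesis using q by (intro exI[of _ "map (map q) C"] conjI) (auto dest: nth_mem)
qed

lemma prod_list_nth: "(\<Prod>j<length xs. xs ! j) = prod_list (xs :: 'b::comm_monoid_mult list)"
  by (induction xs) (simp_all add: prod.lessThan_Suc_shift del: prod.lessThan_Suc)

lemma summand_rep:
  assumes "i < length D" "\<And>P. P \<in> set (D ! i) \<Longrightarrow> mvars P \<subseteq> {..<n}"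
  shows "summand F n (map (map rep) D) i = rep (prod_list (D ! i))" "mvars (prod_list (D ! i)) \<subseteq> {..<n}"
proof -
  have "summand F n (map (map rep) D) i = (\<Otimes>\<^bsub>mpoly_ring F n\<^esub>j\<in>{..<length (D ! i)}. rep (D ! i ! j))"
    unfolding summand_def using assms(1)
    by (simp, intro comm_monoid.finprod_cong'[OF monoids(1)]) (use assms in \<open>auto simp: carrier_mpoly\<close>)
  also have "\<dots> = rep (\<Prod>j<length (D ! i). D ! i ! j)"
    by (rule mpoly_finprod) (use assms in \<open>auto dest: nth_mem\<close>)
  finally show "summand F n (map (map rep) D) i = rep (prod_list (D ! i))"
    by (simp only: prod_list_nth)
  show "mvars (prod_list (D ! i)) \<subseteq> {..<n}" by (rule mvars_prod_list) (rule assms(2))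
qed

lemma circuit_poly_rep:
  assumes "\<And>i P. i < length D \<Longrightarrow> P \<in> set (D ! i) \<Longrightarrow> mvars P \<subseteq> {..<n}"
  shows "circuit_poly F n (map (map rep) D) = rep (\<Sum>i<length D. prod_list (D ! i))"
proof -
  have "circuit_poly F n (map (map rep) D) = (\<Oplus>\<^bsub>mpoly_ring F n\<^esub>i\<in>{..<length D}. rep (prod_list (D ! i)))"
    unfolding circuit_poly_def
    by (simp, intro abelian_monoid.finsum_cong'[OF monoids(2)])
       (use summand_rep[OF _ assms] in \<open>auto simp: carrier_mpoly\<close>)
  also have "\<dots> = rep (\<Sum>i<length D. prod_list (D ! i))"
    by (rule mpoly_finsum) (use summand_rep(2)[OF _ assms] in auto)
  finally show ?thesis .
qed

text \<open>The bound \<open>d\<close> concerns the given circuit \<open>C\<close>, the non-SG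
  property an equivalent circuit \<open>C'\<close>. They meet in the polynomial \<open>p\<close>:
  its degree comes from \<open>C\<close>, its factorization into gcd and simple part from
  \<open>C'\<close>.\<close>

lemma non_SG_theta_nonzero:
  assumes r: "r \<ge> 1" and f: "f \<in> non_SG_polys F n d k r"
  shows "\<exists>p. f = rep p \<and> mvars p \<subseteq> {..<n} \<and> (\<forall>m\<in>keys p. size m \<le> d) \<and>
    (\<forall>q. goodq n (r ^ k) q \<longrightarrow> msub (theta n (r ^ k) q (mu_of n k)) p \<noteq> 0)"
proof -
  obtain C C' S where C: "f = circuit_poly F n C" "sps_circuit F n k r C" "circuit_degree F n C \<le> d"
    and C': "sps_circuit F n k r C'" "circuit_poly F n C' = f"
    and S: "simple_part F n k r C' S" "non_SG_homogeneous F (n + 1) (homogenize_circuit F n S)"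
    using f unfolding non_SG_polys_def non_SG_def non_SG_minimal_def non_SG_simple_def by auto
  obtain g0 where g0: "g0 \<in> carrier (mpoly_ring F n)" "g0 \<noteq> \<zero>\<^bsub>mpoly_ring F n\<^esub>"
      "\<And>i. i < length C' \<Longrightarrow> summand F n C' i = g0 \<otimes>\<^bsub>mpoly_ring F n\<^esub> summand F n S i"
    and Sc: "sps_circuit F n k r S" "length S = length C'"
    using S(1) unfolding simple_part_def circuit_gcd_def is_gcd_def by blast
  obtain D where D: "C = map (map rep) D" "\<forall>i<length D. \<forall>P\<in>set (D ! i). mvars P \<subseteq> {..<n} \<and> mdeg P \<le> r"
    using circuit_rep[OF C(2)] by blast
  obtain D' where D': "C' = map (map rep) D'" "length D' \<le> k" "\<forall>i<length D'. \<forall>P\<in>set (D' ! i). mvars P \<subseteq> {..<n} \<and> mdeg P \<le> r"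
    using circuit_rep[OF C'(1)] by blast
  obtain T where T: "S = map (map rep) T" "\<forall>i<length T. \<forall>P\<in>set (T ! i). mvars P \<subseteq> {..<n} \<and> mdeg P \<le> r"
    using circuit_rep[OF Sc(1)] by blast
  have len: "length T = length D'" using Sc(2) by (simp add: T(1) D'(1))
  obtain g where g: "g0 = rep g" "mvars g \<subseteq> {..<n}" using g0(1) by (auto simp: carrier_mpoly)
  have gn: "g \<noteq> 0" using g0(2) unfolding mpoly_ops g(1) rep_eq_iff .
  define p where "p = (\<Sum>i<length D. prod_list (D ! i))"
  have fp: "f = rep p" unfolding p_def C(1) D(1) by (rule circuit_poly_rep) (use D(2) in blast)
  have pv: "mvars p \<subseteq> {..<n}" unfolding p_def by (rule mvars_sum, rule mvars_prod_list) (use D(2) in auto)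
  have deg: "size m \<le> d" if mp: "m \<in> keys p" for m
  proof -
    obtain i where i: "i < length D" "m \<in> keys (prod_list (D ! i))"
      using mp keys_sum[of "\<lambda>i. prod_list (D ! i)" "{..<length D}"] unfolding p_def by auto
    have "size m \<le> mdeg (prod_list (D ! i))" by (rule size_le_mdeg[OF i(2)])
    also have "\<dots> = mpoly_degree F (summand F n C i)"
      unfolding D(1) using summand_rep(1)[OF i(1), of n] D(2) i(1) by (simp add: degree_rep)
    also have "\<dots> \<le> circuit_degree F n C"
      unfolding circuit_degree_def by (rule Max_ge) (use i(1) D(1) in auto)
    finally show ?thesis using C(3) by linarith
  qed
  define N where "N i = circuit_degree F n S - mpoly_degree F (summand F n S i)" for i
  \<comment> \<open>The homogenized simple part over the type class. The padding variable has degree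
    1 <= r, so all factors still have degree at most \<open>r\<close>.\<close>
  define H where "H = map (\<lambda>i. map (hmg n) (T ! i) @ replicate (N i) (mvar n)) [0..<length T]"
  have lH: "length H = length T" by (simp add: H_def)
  have Hi: "H ! i = map (hmg n) (T ! i) @ replicate (N i) (mvar n)" if "i < length T" for i
    using that by (simp add: H_def)
  have hT: "homogenize_circuit F n S = map (map rep) H"
  proof -
    have "length S = length T" "\<And>i. i < length T \<Longrightarrow> S ! i = map rep (T ! i)" by (simp_all add: T(1))
    then show ?thesis unfolding homogenize_circuit_def H_def map_map N_def[symmetric]
      by (intro map_cong) (use T(2) in \<open>auto simp: rep_var homogenize_rep\<close>)
  qed
  have HP: "mvars P \<subseteq> {..<n + 1} \<and> (\<exists>e\<le>r. whom (\<lambda>_. 1) e P)" if iP: "i < length T" "P \<in> set (H ! i)" for i P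
  proof -
    consider P' where "P' \<in> set (T ! i)" "P = hmg n P'" | "P = mvar n" using iP by (auto simp: Hi)
    then show ?thesis
    proof cases
      case 1
      then show ?thesis using T(2) iP(1) mvars_hmg[of P' n] whom_hmg[of P' n] by blast
    next
      case 2
      then show ?thesis using mvars_single[of "{#n#}" "1 :: 'k"] whom_var[of "\<lambda>_. 1" n] r by auto
    qed
  qed
  have sH: "summand F (n + 1) (homogenize_circuit F n S) i = rep (prod_list (H ! i))"
    "mvars (prod_list (H ! i)) \<subseteq> {..<n + 1}" if "i < length T" for i
    unfolding hT by (rule summand_rep; use HP that lH in auto)+
  have lhS: "length (homogenize_circuit F n S) = length T" by (simp add: hT lH)
  obtain e where "\<forall>i<length T. homogeneous_of_degree F e (summand F (n + 1) (homogenize_circuit F n S) i)"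
    using S(2) unfolding non_SG_homogeneous_def homogeneous_circuit_def lhS by blast
  then have e: "whom (\<lambda>_. 1) e (prod_list (H ! i))" if "i < length T" for i
    using that sH(1)[OF that] homogeneous_rep by metis
  obtain i0 L y where i0: "i0 < length T" and L: "L \<in> proj_space F (n + 1)"
    and y: "y \<in> L" "mpoly_eval F (rep (prod_list (H ! i0))) y \<noteq> \<zero>"
      "\<And>j. j < length T \<Longrightarrow> j \<noteq> i0 \<Longrightarrow> mpoly_eval F (rep (prod_list (H ! j))) y = \<zero>"
  proof -
    obtain i0 L where i0: "i0 < length T" "L \<in> proj_space F (n + 1)"
      "\<And>j. j < length T \<Longrightarrow> j \<noteq> i0 \<Longrightarrow> L \<in> proj_zeros F (n + 1) (summand F (n + 1) (homogenize_circuit F n S) j)"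
      "L \<notin> proj_zeros F (n + 1) (summand F (n + 1) (homogenize_circuit F n S) i0)"
      using S(2) unfolding non_SG_homogeneous_def lhS by blast
    then obtain y where "y \<in> L" "mpoly_eval F (rep (prod_list (H ! i0))) y \<noteq> \<zero>"
      unfolding proj_zeros_def sH(1)[OF i0(1)] by blast
    moreover have "mpoly_eval F (rep (prod_list (H ! j))) y = \<zero>" if "j < length T" "j \<noteq> i0" for j
      using i0(3)[OF that] \<open>y \<in> L\<close> unfolding proj_zeros_def sH(1)[OF that(1)] by blast
    ultimately show ?thesis using that i0 by blast
  qed
  obtain z where zL: "L = proj_point F (n + 1) z" and "z \<in> {x \<in> {..<n + 1} \<rightarrow>\<^sub>E carrier F. \<exists>i<n + 1. x i \<noteq> \<zero>}"
    using L unfolding proj_space_def by (rule imageE)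
  then obtain v where z: "z \<in> {..<n + 1} \<rightarrow>\<^sub>E carrier F" "v < n + 1" "z v \<noteq> \<zero>" by blast
  obtain c where c: "c \<in> carrier F" "c \<noteq> \<zero>" and yz: "y = (\<lambda>i\<in>{..<n + 1}. c \<otimes> z i)"
    using y(1) unfolding zL proj_point_def by blast
  have "\<exists>t. y i = \<iota> t" if "i < n + 1" for i
    using that z(1) c(1) by (intro exists) (auto simp: yz)
  then obtain x where x: "\<And>i. i < n + 1 \<Longrightarrow> y i = \<iota> (x i)" by metis
  have "z v \<in> carrier F" using z by blast
  moreover have "y v = c \<otimes> z v" using z(2) by (simp add: yz)
  ultimately have "y v \<noteq> \<zero>" using z(3) c integral by metis
  then have xv: "x v \<noteq> 0" using x[OF z(2)] by (auto simp: zero)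
  have ev: "mpoly_eval F (rep (prod_list (H ! i))) y = \<iota> (meval x (prod_list (H ! i)))" if "i < length T" for i
    by (rule eval_rep) (use sH(2)[OF that] x in auto)
  have x0: "meval x (prod_list (H ! i0)) \<noteq> 0" using y(2) unfolding ev[OF i0] eq_zero .
  have xj: "meval x (prod_list (H ! j)) = 0" if "j < length T" "j \<noteq> i0" for j
    using y(3)[OF that] unfolding ev[OF that(1)] eq_zero .
  have dH: "dehom n (prod_list (H ! i)) = prod_list (T ! i)" if "i < length T" for i
  proof -
    interpret dh: comm_ring_hom "dehom n :: 'k mp \<Rightarrow> _" by (rule msub_hom)
    have "map (dehom n) (map (hmg n) (T ! i)) = T ! i"
      unfolding map_map by (rule map_idI) (use T(2) that in \<open>auto simp: dehom_hmg\<close>)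
    then show ?thesis
      by (simp add: Hi[OF that] hom_prod_list_map[OF msub_hom] dh.hom_mult dh.hom_power mev_var[OF mcst_hom] del: map_map)
  qed
  have factor: "prod_list (D' ! i) = g * prod_list (T ! i)" if "i < length T" for i
  proof -
    have "summand F n C' i = rep (prod_list (D' ! i))"
      unfolding D'(1) by (rule summand_rep) (use that len D'(3) in auto)
    moreover have "summand F n S i = rep (prod_list (T ! i))"
      unfolding T(1) by (rule summand_rep) (use that T(2) in auto)
    ultimately have "rep (prod_list (D' ! i)) = rep (g * prod_list (T ! i))"
      using g0(3)[of i] that len unfolding g(1) by (simp add: D'(1) mpoly_ops)
    then show ?thesis by (simp only: rep_eq_iff)
  qed
  have pg: "p = g * dehom n (\<Sum>i<length T. prod_list (H ! i))"
  proof -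
    interpret dh: comm_ring_hom "dehom n :: 'k mp \<Rightarrow> _" by (rule msub_hom)
    have "rep p = circuit_poly F n C'" using C'(2) fp by simp
    also have "\<dots> = rep (\<Sum>i<length D'. prod_list (D' ! i))"
      unfolding D'(1) by (rule circuit_poly_rep) (use D'(3) in blast)
    finally have "p = (\<Sum>i<length T. prod_list (D' ! i))" unfolding rep_eq_iff len .
    then show ?thesis by (simp add: factor dh.hom_sum dH sum_distrib_left)
  qed
  \<comment> \<open>A zero factor would make the summand \<open>i0\<close> vanish at
    \<open>x\<close>. Hence the gcd divides a nonzero product of factors, namely the summand
    \<open>i0\<close> of \<open>C'\<close>.\<close>
  have T0: "prod_list (T ! i0) \<noteq> 0"
  proof
    assume "prod_list (T ! i0) = 0"
    then have "0 \<in> set (H ! i0)" using i0 by (force simp: prod_list_zero_iff Hi hmg_def)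
    then have "prod_list (H ! i0) = 0" by (simp add: prod_list_zero_iff)
    moreover have "meval x 0 = 0" by (simp add: mev_def)
    ultimately show False using x0 by metis
  qed
  have "msub (theta n (r ^ k) q (mu_of n k)) p \<noteq> 0" if q: "goodq n (r ^ k) q" for q
  proof (rule theta_non_SG_nonzero[OF infinite_field r q _ i0 HP e x0 xj z(2) xv _ factor[OF i0, symmetric] _ pg])
    show "length T \<le> k" using D'(2) len by simp
    show "mvars P \<subseteq> {..<n} \<and> (\<forall>m\<in>keys P. size m \<le> r)" if "P \<in> set (D' ! i0)" for P
    proof -
      have "mvars P \<subseteq> {..<n}" "mdeg P \<le> r" using D'(3) i0 len that by auto
      then show ?thesis using size_le_mdeg le_trans by blast
    qed
    show "prod_list (D' ! i0) \<noteq> 0" unfolding factor[OF i0] using gn T0 by simp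
  qed
  then show ?thesis using fp pv deg by blast
qed

end

lemma (in parameters) coeff_gpoly_zero:
  assumes "1 \<le> q" "q \<le> Q" "i \<le> E" "x \<ge> len"
  shows "coeff (gpoly R q mu B i v) x = 0"
proof -
  have "i * wgt R q v \<noteq> x" using exponent_le(1)[of i q 0 v] assms by simp
  moreover have "coeff (monom 1 (i * (B ^ (mu + j) + wgt R q v * B ^ j)) - monom 1 (i * (B ^ (mu + j) + wgt R q v)) :: int poly) x = 0"
    if "j \<in> {1..mu}" for j
    using exponent_le(2,3)[of i q j v] assms that by (simp add: coeff_monom)
  ultimately show ?thesis unfolding gpoly_def gpart_def coeff_add coeff_sum by (simp add: coeff_monom)
qed

text \<open>The hitting property as a predicate on field records, because the argument by
  contradiction below has to name a record that violates it.\<close>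

definition all_hit :: "'a ring \<Rightarrow> bool" where
  "all_hit F \<longleftrightarrow> (\<forall>n d k r \<rho> f. parameters n d k r \<and> root_choice F \<rho> \<and> f \<in> non_SG_polys F n d k r \<longrightarrow>
     (\<exists>q\<in>{1..qmax n (r ^ k)}. \<exists>i\<in>{1..emax n d (r ^ k) (mu_of n k)}. parameters.answer n d k r (black_box F \<rho> f) q i))"

text \<open>The black box may use any root of the modulus; since every root has order above
  \<open>E\<close>, the choice does not matter.\<close>

lemma (in represented_closed) all_hit: "all_hit F"
  unfolding all_hit_def
proof (intro allI impI, elim conjE)
  fix n d k r \<rho> f
  assume par: "parameters n d k r" and \<rho>: "root_choice F \<rho>" and f: "f \<in> non_SG_polys F n d k r"
  interpret P: parameters n d k r by (rule par)
  obtain p where p: "f = rep p" "mvars p \<subseteq> {..<n}" "\<And>m. m \<in> keys p \<Longrightarrow> size m \<le> d"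
      "\<And>q. goodq n P.R q \<Longrightarrow> msub (theta n P.R q P.mu) p \<noteq> 0"
    using non_SG_theta_nonzero[OF P.pos(4) f] by blast
  obtain q where q: "1 \<le> q" "q \<le> P.Q" "goodq n P.R q"
    using good_modulus[OF P.pos(1) P.R1] unfolding qmax_def by blast
  define h where "h = coeff_list (P.len + 1) (modulus_poly P.M)"
  have M: "P.M > 0" by simp
  have hc: "Polynomial.coeff (modulus_poly P.M) x = 0" if "x \<ge> P.len + 1" for x
    using that M by (simp add: modulus_poly_def coeff_monom coeff_1)
  have ev: "int_poly_eval F h (\<iota> a) = \<iota> (ipev a (modulus_poly P.M))" for a
    unfolding h_def by (rule int_poly_eval_coeff_list) (rule hc)
  \<comment> \<open>The modulus has leading coefficient 1 and so keeps the degree \<open>len\<close>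
    in every characteristic; hence it has a root, and \<rho> must return one.\<close>
  have "Polynomial.coeff (map_poly of_int (modulus_poly P.M) :: 'k poly) P.len \<noteq> 0"
    using M by (simp add: coeff_map_poly modulus_poly_def coeff_monom coeff_1)
  then have "P.len \<le> Polynomial.degree (map_poly of_int (modulus_poly P.M) :: 'k poly)" by (rule le_degree)
  then obtain b where b: "ipev b (modulus_poly P.M) = (0 :: 'k)"
    using poly_root[of "map_poly of_int (modulus_poly P.M)"] M unfolding ipev_def by auto
  have "int_poly_eval F h (\<iota> b) = \<zero>" unfolding ev b zero ..
  then have rh: "\<rho> h \<in> carrier F" "int_poly_eval F h (\<rho> h) = \<zero>"
    using \<rho> in_carrier unfolding root_choice_def by blast+
  then obtain a where a: "\<rho> h = \<iota> a" using exists by blast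
  have "ipev a (modulus_poly P.M) = 0"
    using rh(2) unfolding a ev eq_zero .
  moreover have "ipev a (modulus_poly P.M) = a ^ (2 * 6 ^ P.e) - a ^ (6 ^ P.e) + 1"
  proof -
    interpret e: comm_ring_hom "ipev a" by (rule ipev_hom)
    show ?thesis by (simp add: modulus_poly_def e.hom_add e.hom_minus ipev_monom)
  qed
  ultimately have ra: "a ^ (2 * 6 ^ P.e) - a ^ (6 ^ P.e) + 1 = 0" by simp
  have "\<exists>i. 1 \<le> i \<and> i \<le> P.E \<and> meval (point a P.R q P.mu P.B i) p \<noteq> 0"
  proof (rule hitting_exponent[OF p(4)[OF q(3)] p(3) q(1,2) P.pos(2)])
    show "a ^ c \<noteq> 1" if "1 \<le> c" "c \<le> P.E" for c
      by (rule root_of_large_order(2)[OF ra that(1)]) (use that P.e(1) in linarith)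
    show "a \<noteq> 0" by (rule root_of_large_order(1)[OF ra])
  qed
  then obtain i where i: "1 \<le> i" "i \<le> P.E" "meval (point a P.R q P.mu P.B i) p \<noteq> 0" by blast
  have "mpoly_eval F f (\<lambda>j. int_poly_eval F (map (\<lambda>v. coeff_list P.len (gpoly P.R q P.mu P.B i v)) [0..<n] ! j) (\<rho> h))
     = \<iota> (meval (point a P.R q P.mu P.B i) p)"
    unfolding p(1)
  proof (rule eval_rep)
    fix v assume "v \<in> mvars p"
    then have v: "v < n" using p(2) by auto
    have "int_poly_eval F (coeff_list P.len (gpoly P.R q P.mu P.B i v)) (\<iota> a) = \<iota> (ipev a (gpoly P.R q P.mu P.B i v))"
      by (rule int_poly_eval_coeff_list) (rule P.coeff_gpoly_zero[OF q(1,2) i(2)])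
    then show "int_poly_eval F (map (\<lambda>v. coeff_list P.len (gpoly P.R q P.mu P.B i v)) [0..<n] ! v) (\<rho> h) = \<iota> (point a P.R q P.mu P.B i v)"
      using v by (simp add: a point_def)
  qed
  then have "P.answer (black_box F \<rho> f) q i"
    unfolding P.answer_def black_box_def h_def[symmetric] using i(3) by (simp add: eq_zero)
  then show "\<exists>q\<in>{1..P.Q}. \<exists>i\<in>{1..P.E}. P.answer (black_box F \<rho> f) q i"
    by (intro bexI[of _ q] bexI[of _ i]) (use q i in simp_all)
qed

text \<open>The algebra above is about type classes, and a field on a subset of a type is not a type. To argue by
  contradiction it suffices to turn a single counterexample into a type; the field with two elements
  only makes the type definition total.\<close>

definition chosen_field :: "('a + int) ring" where
  "chosen_field = (if \<exists>F :: 'a ring. algebraically_closed F \<and> \<not> all_hit F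
     then image_ring Inl (SOME F :: 'a ring. algebraically_closed F \<and> \<not> all_hit F) else image_ring Inr (residue_ring 2))"

lemma field_chosen: "field (chosen_field :: ('a + int) ring)"
proof (cases "\<exists>F :: 'a ring. algebraically_closed F \<and> \<not> all_hit F")
  case True
  define F where "F = (SOME F :: 'a ring. algebraically_closed F \<and> \<not> all_hit F)"
  have "algebraically_closed F" using someI_ex[OF True] unfolding F_def by blast
  then interpret algebraically_closed F .
  show ?thesis using True inj_imp_image_ring_is_field[of Inl] by (simp add: chosen_field_def F_def[symmetric])
next
  case False
  interpret residues_prime 2 "residue_ring (int 2)" by unfold_locales simp_all
  show ?thesis using False inj_imp_image_ring_is_field[of Inr] by (auto simp: chosen_field_def)
qed

typedef 'a chosen = "carrier (chosen_field :: ('a + int) ring)"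
proof -
  interpret C: field "chosen_field :: ('a + int) ring" by (rule field_chosen)
  show ?thesis by (rule exI[of _ "\<one>\<^bsub>chosen_field\<^esub>"]) simp
qed

instantiation chosen :: (type) field
begin

definition "0 = Abs_chosen \<zero>\<^bsub>chosen_field\<^esub>"
definition "1 = Abs_chosen \<one>\<^bsub>chosen_field\<^esub>"
definition "x + y = Abs_chosen (Rep_chosen x \<oplus>\<^bsub>chosen_field\<^esub> Rep_chosen y)"
definition "x * y = Abs_chosen (Rep_chosen x \<otimes>\<^bsub>chosen_field\<^esub> Rep_chosen y)"
definition "- x = Abs_chosen (\<ominus>\<^bsub>chosen_field\<^esub> Rep_chosen x)"
definition "x - y = x + - (y :: 'a chosen)"
definition "inverse x = (if x = 0 then 0 else Abs_chosen (inv\<^bsub>chosen_field\<^esub> Rep_chosen x))"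
definition "x div y = x * inverse (y :: 'a chosen)"

instance
proof -
  interpret C: field "chosen_field :: ('a + int) ring" by (rule field_chosen)
  have [simp]: "Rep_chosen (x :: 'a chosen) \<in> carrier chosen_field" for x by (rule Rep_chosen)
  have R [simp]: "Rep_chosen (0 :: 'a chosen) = \<zero>\<^bsub>chosen_field\<^esub>" "Rep_chosen (1 :: 'a chosen) = \<one>\<^bsub>chosen_field\<^esub>"
    "Rep_chosen (x + y) = Rep_chosen x \<oplus>\<^bsub>chosen_field\<^esub> Rep_chosen y"
    "Rep_chosen (x * y) = Rep_chosen x \<otimes>\<^bsub>chosen_field\<^esub> Rep_chosen y"
    "Rep_chosen (- x) = \<ominus>\<^bsub>chosen_field\<^esub> Rep_chosen x" for x y :: "'a chosen"
    by (simp_all add: zero_chosen_def one_chosen_def plus_chosen_def times_chosen_def uminus_chosen_def Abs_chosen_inverse)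
  have unit: "Rep_chosen x \<in> Units chosen_field" if "x \<noteq> 0" for x :: "'a chosen"
    using that Rep_chosen_inject[of x 0] by (simp add: C.field_Units)
  show "OFCLASS('a chosen, field_class)"
  proof (intro_classes, unfold minus_chosen_def divide_chosen_def)
    show "inverse x * x = 1" if "x \<noteq> 0" for x :: "'a chosen"
      using that unit[OF that] by (simp add: inverse_chosen_def Rep_chosen_inject[symmetric] Abs_chosen_inverse C.Units_closed)
    show "inverse (0 :: 'a chosen) = 0" by (simp add: inverse_chosen_def)
    fix x y z :: "'a chosen"
    show "x * y * z = x * (y * z)" "x + y + z = x + (y + z)" "(x + y) * z = x * z + y * z"
      by (simp_all add: Rep_chosen_inject[symmetric] C.m_assoc C.a_assoc C.l_distr)
    show "x * y = y * x" unfolding Rep_chosen_inject[symmetric] R by (rule C.m_comm) simp_all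
    show "x + y = y + x" unfolding Rep_chosen_inject[symmetric] R by (rule C.a_comm) simp_all
    show "1 * x = x" "0 + x = x" "- x + x = 0" "(0 :: 'a chosen) \<noteq> 1"
      by (simp_all add: Rep_chosen_inject[symmetric] C.l_neg)
  qed simp_all
qed

end

lemma all_hit_if_algebraically_closed:
  assumes "algebraically_closed (F :: 'a ring)"
  shows "all_hit F"
proof (rule ccontr)
  assume "\<not> all_hit F"
  then have ex: "\<exists>F :: 'a ring. algebraically_closed F \<and> \<not> all_hit F" using assms by blast
  define G where "G = (SOME F :: 'a ring. algebraically_closed F \<and> \<not> all_hit F)"
  have G: "algebraically_closed G" "\<not> all_hit G" using someI_ex[OF ex] unfolding G_def by blast+
  interpret G: algebraically_closed G by (rule G(1))
  have ch: "chosen_field = image_ring Inl G" using ex by (simp add: chosen_field_def G_def)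
  have iso: "Inl \<in> Ring.ring_hom G chosen_field"
    using inj_imp_image_ring_iso[of Inl G] unfolding ch ring_iso_def by auto
  have carr: "carrier chosen_field = Inl ` carrier G" unfolding ch by (rule image_ring_carrier)
  \<comment> \<open>The chosen field is the counterexample \<open>G\<close> itself up to the
    injection \<open>Inl\<close>; removing the injection represents \<open>G\<close> over a
    type.\<close>
  define h where "h x = projl (Rep_chosen x)" for x :: "'a chosen"
  have h: "Rep_chosen x = Inl (h x)" "h x \<in> carrier G" for x
    using Rep_chosen[of x] unfolding carr h_def by auto
  have Rep: "Rep_chosen (x + y) = Rep_chosen x \<oplus>\<^bsub>chosen_field\<^esub> Rep_chosen y"
    "Rep_chosen (x * y) = Rep_chosen x \<otimes>\<^bsub>chosen_field\<^esub> Rep_chosen y" "Rep_chosen (1 :: 'a chosen) = \<one>\<^bsub>chosen_field\<^esub>"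
    for x y :: "'a chosen"
  proof -
    interpret C: field "chosen_field :: ('a + int) ring" by (rule field_chosen)
    show "Rep_chosen (x + y) = Rep_chosen x \<oplus>\<^bsub>chosen_field\<^esub> Rep_chosen y"
      "Rep_chosen (x * y) = Rep_chosen x \<otimes>\<^bsub>chosen_field\<^esub> Rep_chosen y" "Rep_chosen (1 :: 'a chosen) = \<one>\<^bsub>chosen_field\<^esub>"
      by (simp_all add: one_chosen_def plus_chosen_def times_chosen_def Abs_chosen_inverse Rep_chosen)
  qed
  interpret rc: represented_closed G h
  proof
    have inj: "x = y" if "h x = h y" for x y using that h(1) Rep_chosen_inject by metis
    have "\<exists>x. a = h x" if "a \<in> carrier G" for a
    proof -
      have "Inl a \<in> carrier chosen_field" unfolding carr using that by (rule imageI)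
      then have "h (Abs_chosen (Inl a)) = a" by (simp add: h_def Abs_chosen_inverse)
      then show ?thesis by metis
    qed
    then show "bij_betw h UNIV (carrier G)" unfolding bij_betw_def using h(2) inj by (auto intro: injI)
    show "h (x + y) = h x \<oplus>\<^bsub>G\<^esub> h y" for x y
      using Rep(1)[of x y] ring_hom_add[OF iso h(2)[of x] h(2)[of y]] unfolding h(1) by (metis sum.inject(1))
    show "h (x * y) = h x \<otimes>\<^bsub>G\<^esub> h y" for x y
      using Rep(2)[of x y] ring_hom_mult[OF iso h(2)[of x] h(2)[of y]] unfolding h(1) by (metis sum.inject(1))
    show "h 1 = \<one>\<^bsub>G\<^esub>" using Rep(3) ring_hom_one[OF iso] unfolding h(1) by (metis sum.inject(1))
  qed
  show False using rc.all_hit G(2) by blast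
qed

text \<open>1512 = 21 * 72: the exponent of \<open>size_bound_le\<close> times that of
  \<open>pit_program\<close>. For the zero polynomial every query answers zero, whichever roots are
  used.\<close>

lemma non_SG_PIT:
  fixes F :: "'a ring"
  assumes F: "algebraically_closed F" and par: "parameters n d k r"
  shows "black_box_PIT pit_program F n d k r (non_SG_polys F n d k r) (72 ^ 72 * PIT_bound n d k r ^ 1512)"
  unfolding black_box_PIT_def
proof (intro allI impI, elim conjE)
  interpret P: parameters n d k r by (rule par)
  interpret F: algebraically_closed F by (rule F)
  fix \<rho> f assume \<rho>: "root_choice F \<rho>" and f: "f \<in> insert \<zero>\<^bsub>mpoly_ring F n\<^esub> (non_SG_polys F n d k r)"
  define s where "s = initial_memory n d k r (field_char F)"
  have "s 0 = int n" "s 1 = int d" "s 2 = int k" "s 3 = int r" "\<And>x. x \<ge> 5 \<Longrightarrow> s x = 0"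
    by (simp_all add: s_def initial_memory_def)
  from P.pit_program[OF this, of "black_box F \<rho> f"]
  obtain t s' where e: "exec (black_box F \<rho> f) n pit_program s t s'" "t \<le> P.size_bound ^ 72"
    "s' 0 = 0 \<longleftrightarrow> (\<forall>q\<in>{1..P.Q}. \<forall>i\<in>{1..P.E}. \<not> P.answer (black_box F \<rho> f) q i)" by blast
  have "P.size_bound ^ 72 \<le> (72 * PIT_bound n d k r ^ 21) ^ 72" by (rule power_mono[OF P.size_bound_le]) simp
  also have "\<dots> = 72 ^ 72 * PIT_bound n d k r ^ 1512" unfolding power_mult_distrib power_mult[symmetric] by simp
  finally have t: "t \<le> 72 ^ 72 * PIT_bound n d k r ^ 1512" using e(2) by linarith
  have "(\<forall>q\<in>{1..P.Q}. \<forall>i\<in>{1..P.E}. \<not> P.answer (black_box F \<rho> f) q i) \<longleftrightarrow> f = \<zero>\<^bsub>mpoly_ring F n\<^esub>"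
  proof
    assume "f = \<zero>\<^bsub>mpoly_ring F n\<^esub>"
    then have "mpoly_support F f = {}"
      by (auto simp: mpoly_ring_def F.indexed_const_def mpoly_support_def)
    then show "\<forall>q\<in>{1..P.Q}. \<forall>i\<in>{1..P.E}. \<not> P.answer (black_box F \<rho> f) q i"
      by (simp add: P.answer_def black_box_def mpoly_eval_def)
  next
    assume "\<forall>q\<in>{1..P.Q}. \<forall>i\<in>{1..P.E}. \<not> P.answer (black_box F \<rho> f) q i"
    then show "f = \<zero>\<^bsub>mpoly_ring F n\<^esub>"
      using all_hit_if_algebraically_closed[OF F] f par \<rho> unfolding all_hit_def by blast
  qed
  then show "\<exists>t s. exec (black_box F \<rho> f) n pit_program (initial_memory n d k r (field_char F)) t s \<and>
      t \<le> 72 ^ 72 * PIT_bound n d k r ^ 1512 \<and> (s 0 = 0) = (f = \<zero>\<^bsub>mpoly_ring F n\<^esub>)"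
    using e t unfolding s_def by blast
qed

theorem theorem1p13:
  shows "(\<exists>M c. \<forall>(F :: 'a ring) n d k r.
            algebraically_closed F \<and> n \<ge> 1 \<and> d \<ge> 1 \<and> k \<ge> 1 \<and> r \<ge> 1 \<longrightarrow>
            black_box_PIT M F n d k r (non_SG_polys F n d k r)
              (c * (PIT_bound n d k r + floorlog 2 (field_char F)) ^ c))
       \<and> (\<forall>k\<ge>1. \<exists>c. \<forall>n\<ge>1. \<forall>d\<ge>1. \<forall>r\<ge>1.
            PIT_bound n d k r \<le> c * (d ^ k * n ^ (r ^ k) * r ^ (k\<^sup>2 * r ^ k)) ^ c)"
proof
  \<comment> \<open>One number serves both as factor and as exponent; it is kept abstract so that
    72^72 is never evaluated.\<close>
  obtain c :: nat where c: "72 ^ 72 \<le> c" "1512 \<le> c" by (meson linear order_trans)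
  have "black_box_PIT pit_program F n d k r (non_SG_polys F n d k r) (c * (PIT_bound n d k r + floorlog 2 (field_char F)) ^ c)"
    if F: "algebraically_closed F" and pos: "n \<ge> 1" "d \<ge> 1" "k \<ge> 1" "r \<ge> 1" for F :: "'a ring" and n d k r
  proof -
    have par: "parameters n d k r" by unfold_locales (rule pos)+
    have "k * r ^ k \<le> k * (n + 1 + r ^ k)" by (rule mult_le_mono2) simp
    then have "PIT_bound n d k r \<ge> 1" using pos by (simp add: PIT_bound_def Suc_le_eq)
    then have "PIT_bound n d k r ^ 1512 \<le> (PIT_bound n d k r + floorlog 2 (field_char F)) ^ c"
      by (intro order_trans[OF power_increasing[OF c(2)] power_mono]) auto
    then have "72 ^ 72 * PIT_bound n d k r ^ 1512 \<le> c * (PIT_bound n d k r + floorlog 2 (field_char F)) ^ c"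
      by (rule mult_le_mono[OF c(1)])
    then show ?thesis using non_SG_PIT[OF F par] unfolding black_box_PIT_def by (meson le_trans)
  qed
  then show "\<exists>M c. \<forall>(F :: 'a ring) n d k r.
            algebraically_closed F \<and> n \<ge> 1 \<and> d \<ge> 1 \<and> k \<ge> 1 \<and> r \<ge> 1 \<longrightarrow>
            black_box_PIT M F n d k r (non_SG_polys F n d k r)
              (c * (PIT_bound n d k r + floorlog 2 (field_char F)) ^ c)" by blast
  show "\<forall>k\<ge>1. \<exists>c. \<forall>n\<ge>1. \<forall>d\<ge>1. \<forall>r\<ge>1.
            PIT_bound n d k r \<le> c * (d ^ k * n ^ (r ^ k) * r ^ (k\<^sup>2 * r ^ k)) ^ c"
    using PIT_bound_polynomial by blast
qed

end
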